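(* Let $n,d$ be positive integers and let $k$ be a field of characteristic $0$. For every $b(s)\in B(n,d)$, the set $S(b(s),k)$ is a constructible subset of the projective space $\mathbb{P}(n,d;k)$.
   Context: For a field $K$ of characteristic $0$, let $R_n(K)=K[x_1,\dots,x_n]$ and let $A_n(K)=K\langle x_1,\dots,x_n,\partial_1,\dots,\partial_n\rangle$ be the $n$-th Weyl algebra. For a nonzero $g\in R_n(K)$, the set of polynomials $b(s)\in K[s]$ for which there is $Q\in A_n(K)[s]$ with $b(s)g^s=Q\cdot g^{s+1}$ is a nonzero ideal of $K[s]$; its monic generator is the Bernstein-Sato polynomial $b_g(s)$. It is known that $b_g(s)\in\mathbb{Q}[s]$, and that $b_{cg}(s)=b_g(s)$ for every nonzero $c\in K$. $B(n,d)$ denotes the set of Bernstein-Sato polynomials of all nonzero polynomials of degree at most $d$ in $n$ variables with coefficients in $K$, as $K$ varies over all fields of characteristic $0$; it is a known result of Lyubeznik that $B(n,d)$ is finite. Let $N$ be the number of monomials in $n$ variables of degree at most $d$, let $C=k[\bar a]$ be the polynomial ring in the $N$ indeterminates $\bar a=\{a_\alpha : |\alpha|\le d\}$ with its standard grading, and let $\mathbb{P}(n,d;k)\cong\mathbb{P}^{N-1}_k$ be the projective space with homogeneous coordinate ring $C$. Points $P$ of $\mathbb{P}(n,d;k)$ are homogeneous primes of $C$ (other than the irrelevant ideal). For such $P$, let $k(P)$ be the fraction field of $C/P$ and let $\sigma_P:C\to k(P)$ be the natural map, extended coefficientwise to $C[x_1,\dots,x_n]\to k(P)[x_1,\dots,x_n]$.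 Let $f=\sum_{|\alpha|\le d}a_\alpha x^\alpha\in C[x_1,\dots,x_n]$ be the generic polynomial of degree at most $d$. $S(b(s),k)$ is the set of all points $P\in\mathbb{P}(n,d;k)$ such that $b_{\sigma_P(f)}(s)=b(s)$. A subset is constructible if it is a finite union of locally closed sets (differences of two closed sets), in the Zariski topology. *)

theory Defs
  imports
    "HOL-Algebra.Indexed_Polynomials"
    "HOL-Algebra.UnivPoly"
    "HOL-Algebra.QuotRing"
    "HOL-Computational_Algebra.Polynomial"
begin

hide_const (open) Polynomial.monom Polynomial.coeff Polynomial.degree Polynomial.order

section \<open>Multivariate polynomial rings\<close>

text \<open>
  The monomial with exponents \<open>\<alpha>\<close> is the multiset in which \<open>i\<close> occurs \<open>\<alpha> i\<close> times, as in
  \<^theory>\<open>HOL-Algebra.Indexed_Polynomials\<close>; \<open>|\<alpha>|\<close> is the \<^const>\<open>size\<close> of the multiset. That theory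
  provides the set of polynomials but no ring structure. In the product, \<open>u\<close> ranges over the
  divisors of the monomial \<open>m\<close>.
\<close>

definition mpoly_ring :: "('a, 'm) ring_scheme \<Rightarrow> 'v set \<Rightarrow> ('v multiset \<Rightarrow> 'a) ring" where
  "mpoly_ring R I =
    \<lparr>carrier = ring.indexed_pset R I (carrier R),
     monoid.mult = (\<lambda>p q m. \<Oplus>\<^bsub>R\<^esub>u \<in> {u. u \<subseteq># m}. p u \<otimes>\<^bsub>R\<^esub> q (m - u)),
     one = ring.indexed_const R \<one>\<^bsub>R\<^esub>,
     zero = ring.indexed_const R \<zero>\<^bsub>R\<^esub>,
     add = (\<lambda>p q m. p m \<oplus>\<^bsub>R\<^esub> q m)\<rparr>"

definition mpoly_degree_le :: "('a, 'm) ring_scheme \<Rightarrow> nat \<Rightarrow> ('v multiset \<Rightarrow> 'a) \<Rightarrow> bool" where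
  "mpoly_degree_le R d p \<longleftrightarrow> (\<forall>m. p m \<noteq> \<zero>\<^bsub>R\<^esub> \<longrightarrow> size m \<le> d)"

definition homogeneous_part ::
    "('a, 'm) ring_scheme \<Rightarrow> nat \<Rightarrow> ('v multiset \<Rightarrow> 'a) \<Rightarrow> ('v multiset \<Rightarrow> 'a)" where
  "homogeneous_part R e p = (\<lambda>m. if size m = e then p m else \<zero>\<^bsub>R\<^esub>)"

definition partial_diff ::
    "('a, 'm) ring_scheme \<Rightarrow> 'v \<Rightarrow> ('v multiset \<Rightarrow> 'a) \<Rightarrow> ('v multiset \<Rightarrow> 'a)" where
  "partial_diff R i p = (\<lambda>m. [Suc (count m i)] \<cdot>\<^bsub>R\<^esub> p (add_mset i m))"

section \<open>Localization and fields of fractions\<close>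

text \<open>The fraction \<open>a / b\<close>, with denominators in the multiplicative set \<open>S\<close>.\<close>

definition fraction :: "('a, 'm) ring_scheme \<Rightarrow> 'a set \<Rightarrow> 'a \<Rightarrow> 'a \<Rightarrow> ('a \<times> 'a) set" where
  "fraction R S a b =
    {(c, e). c \<in> carrier R \<and> e \<in> S \<and>
       (\<exists>t\<in>S. t \<otimes>\<^bsub>R\<^esub> (a \<otimes>\<^bsub>R\<^esub> e) = t \<otimes>\<^bsub>R\<^esub> (c \<otimes>\<^bsub>R\<^esub> b))}"

text \<open>The unions below, as in \<^const>\<open>rcoset_mult\<close>, are unions of one and the same class.\<close>

definition localization :: "('a, 'm) ring_scheme \<Rightarrow> 'a set \<Rightarrow> ('a \<times> 'a) set ring" where
  "localization R S =
    \<lparr>carrier = {fraction R S a b | a b. a \<in> carrier R \<and> b \<in> S},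
     monoid.mult = (\<lambda>A B. \<Union>(a, b)\<in>A. \<Union>(c, e)\<in>B. fraction R S (a \<otimes>\<^bsub>R\<^esub> c) (b \<otimes>\<^bsub>R\<^esub> e)),
     one = fraction R S \<one>\<^bsub>R\<^esub> \<one>\<^bsub>R\<^esub>,
     zero = fraction R S \<zero>\<^bsub>R\<^esub> \<one>\<^bsub>R\<^esub>,
     add = (\<lambda>A B. \<Union>(a, b)\<in>A. \<Union>(c, e)\<in>B.
              fraction R S (a \<otimes>\<^bsub>R\<^esub> e \<oplus>\<^bsub>R\<^esub> c \<otimes>\<^bsub>R\<^esub> b) (b \<otimes>\<^bsub>R\<^esub> e))\<rparr>"

definition fraction_field :: "('a, 'm) ring_scheme \<Rightarrow> ('a \<times> 'a) set ring" where
  "fraction_field R = localization R (carrier R - {\<zero>\<^bsub>R\<^esub>})"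

text \<open>The extension of a derivation \<open>\<delta>\<close> of \<open>R\<close> by the quotient rule.\<close>

definition localized_derivation ::
    "('a, 'm) ring_scheme \<Rightarrow> 'a set \<Rightarrow> ('a \<Rightarrow> 'a) \<Rightarrow> ('a \<times> 'a) set \<Rightarrow> ('a \<times> 'a) set" where
  "localized_derivation R S \<delta> A =
    (\<Union>(a, b)\<in>A. fraction R S (b \<otimes>\<^bsub>R\<^esub> \<delta> a \<ominus>\<^bsub>R\<^esub> a \<otimes>\<^bsub>R\<^esub> \<delta> b) (b \<otimes>\<^bsub>R\<^esub> b))"

section \<open>The Weyl algebra\<close>

definition free_algebra :: "('a, 'm) ring_scheme \<Rightarrow> 'l set \<Rightarrow> ('l list \<Rightarrow> 'a) ring" where
  "free_algebra R L =
    \<lparr>carrier = {p. range p \<subseteq> carrier R \<and> finite {w. p w \<noteq> \<zero>\<^bsub>R\<^esub>} \<and>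
                   {w. p w \<noteq> \<zero>\<^bsub>R\<^esub>} \<subseteq> lists L},
     monoid.mult = (\<lambda>p q w. \<Oplus>\<^bsub>R\<^esub>i \<in> {..length w}. p (take i w) \<otimes>\<^bsub>R\<^esub> q (drop i w)),
     one = (\<lambda>w. if w = [] then \<one>\<^bsub>R\<^esub> else \<zero>\<^bsub>R\<^esub>),
     zero = (\<lambda>_. \<zero>\<^bsub>R\<^esub>),
     add = (\<lambda>p q w. p w \<oplus>\<^bsub>R\<^esub> q w)\<rparr>"

definition free_word :: "('a, 'm) ring_scheme \<Rightarrow> 'l list \<Rightarrow> ('l list \<Rightarrow> 'a)" where
  "free_word R v = (\<lambda>w. if w = v then \<one>\<^bsub>R\<^esub> else \<zero>\<^bsub>R\<^esub>)"

datatype weyl_letter = Var nat | Diff nat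

definition weyl_letters :: "nat \<Rightarrow> weyl_letter set" where
  "weyl_letters n = Var ` {..<n} \<union> Diff ` {..<n}"

definition weyl_relations ::
    "('a, 'm) ring_scheme \<Rightarrow> nat \<Rightarrow> (weyl_letter list \<Rightarrow> 'a) set" where
  "weyl_relations K n =
    (let F = free_algebra K (weyl_letters n); W = free_word K in
       {W [Var i, Var j] \<ominus>\<^bsub>F\<^esub> W [Var j, Var i] | i j. i < n \<and> j < n}
     \<union> {W [Diff i, Diff j] \<ominus>\<^bsub>F\<^esub> W [Diff j, Diff i] | i j. i < n \<and> j < n}
     \<union> {(W [Diff i, Var j] \<ominus>\<^bsub>F\<^esub> W [Var j, Diff i]) \<ominus>\<^bsub>F\<^esub> (if i = j then \<one>\<^bsub>F\<^esub> else \<zero>\<^bsub>F\<^esub>)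
          | i j. i < n \<and> j < n})"

definition weyl_algebra ::
    "('a, 'm) ring_scheme \<Rightarrow> nat \<Rightarrow> (weyl_letter list \<Rightarrow> 'a) set ring" where
  "weyl_algebra K n =
    (let F = free_algebra K (weyl_letters n) in F Quot (Idl\<^bsub>F\<^esub> (weyl_relations K n)))"

section \<open>The module generated by \<open>g\<^sup>s\<close>\<close>

abbreviation poly_ring :: "('a, 'm) ring_scheme \<Rightarrow> nat \<Rightarrow> (nat multiset \<Rightarrow> 'a) ring" where
  "poly_ring K n \<equiv> mpoly_ring K {..<n}"

definition powers :: "('a, 'm) ring_scheme \<Rightarrow> 'a \<Rightarrow> 'a set" where
  "powers R g = range (\<lambda>e::nat. g [^]\<^bsub>R\<^esub> e)"

type_synonym 'a inverted_poly = "((nat multiset \<Rightarrow> 'a) \<times> (nat multiset \<Rightarrow> 'a)) set"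

text \<open>\<open>R\<^sub>n(K)[1/g]\<close>\<close>

definition inverted_ring ::
    "('a, 'm) ring_scheme \<Rightarrow> nat \<Rightarrow> (nat multiset \<Rightarrow> 'a) \<Rightarrow> 'a inverted_poly ring" where
  "inverted_ring K n g = localization (poly_ring K n) (powers (poly_ring K n) g)"

definition inverted_frac ::
    "('a, 'm) ring_scheme \<Rightarrow> nat \<Rightarrow> (nat multiset \<Rightarrow> 'a) \<Rightarrow>
     (nat multiset \<Rightarrow> 'a) \<Rightarrow> (nat multiset \<Rightarrow> 'a) \<Rightarrow> 'a inverted_poly" where
  "inverted_frac K n g = fraction (poly_ring K n) (powers (poly_ring K n) g)"

definition inverted_poly ::
    "('a, 'm) ring_scheme \<Rightarrow> nat \<Rightarrow> (nat multiset \<Rightarrow> 'a) \<Rightarrow>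
     (nat multiset \<Rightarrow> 'a) \<Rightarrow> 'a inverted_poly" where
  "inverted_poly K n g h = inverted_frac K n g h \<one>\<^bsub>poly_ring K n\<^esub>"

text \<open>
  The free module \<open>R\<^sub>n(K)[1/g, s] g\<^sup>s\<close> of rank one is identified with its coefficient ring
  \<open>R\<^sub>n(K)[1/g][s]\<close>: the element \<open>u\<close> below stands for \<open>u g\<^sup>s\<close>. In particular \<open>g\<^sup>s\<^sup>+\<^sup>1\<close> is
  represented by \<open>g\<close>, and \<open>\<partial>\<^sub>i (u g\<^sup>s) = (\<partial>\<^sub>i u + s (\<partial>\<^sub>i g / g) u) g\<^sup>s\<close>.
\<close>

abbreviation gs_module ::
    "('a, 'm) ring_scheme \<Rightarrow> nat \<Rightarrow> (nat multiset \<Rightarrow> 'a) \<Rightarrow>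
     ('a inverted_poly, nat \<Rightarrow> 'a inverted_poly) up_ring" where
  "gs_module K n g \<equiv> UP (inverted_ring K n g)"

definition gs_monom ::
    "('a, 'm) ring_scheme \<Rightarrow> nat \<Rightarrow> (nat multiset \<Rightarrow> 'a) \<Rightarrow>
     (nat multiset \<Rightarrow> 'a) \<Rightarrow> nat \<Rightarrow> (nat \<Rightarrow> 'a inverted_poly)" where
  "gs_monom K n g h j = monom (gs_module K n g) (inverted_poly K n g h) j"

fun letter_act ::
    "('a, 'm) ring_scheme \<Rightarrow> nat \<Rightarrow> (nat multiset \<Rightarrow> 'a) \<Rightarrow> weyl_letter \<Rightarrow>
     (nat \<Rightarrow> 'a inverted_poly) \<Rightarrow> (nat \<Rightarrow> 'a inverted_poly)" where
  "letter_act K n g (Var i) u =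
     gs_monom K n g (ring.indexed_var K i) 0 \<otimes>\<^bsub>gs_module K n g\<^esub> u"
| "letter_act K n g (Diff i) u =
     (\<lambda>j. localized_derivation (poly_ring K n) (powers (poly_ring K n) g) (partial_diff K i) (u j))
     \<oplus>\<^bsub>gs_module K n g\<^esub>
     (monom (gs_module K n g) (inverted_frac K n g (partial_diff K i g) g) 1
        \<otimes>\<^bsub>gs_module K n g\<^esub> u)"

definition free_act ::
    "('a, 'm) ring_scheme \<Rightarrow> nat \<Rightarrow> (nat multiset \<Rightarrow> 'a) \<Rightarrow> (weyl_letter list \<Rightarrow> 'a) \<Rightarrow>
     (nat \<Rightarrow> 'a inverted_poly) \<Rightarrow> (nat \<Rightarrow> 'a inverted_poly)" where
  "free_act K n g p u =
    (\<Oplus>\<^bsub>gs_module K n g\<^esub>w \<in> {w. p w \<noteq> \<zero>\<^bsub>K\<^esub>}.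
       gs_monom K n g (ring.indexed_const K (p w)) 0
         \<otimes>\<^bsub>gs_module K n g\<^esub> foldr (letter_act K n g) w u)"

text \<open>All representatives of a residue class \<open>A\<close> act in the same way.\<close>

definition weyl_act ::
    "('a, 'm) ring_scheme \<Rightarrow> nat \<Rightarrow> (nat multiset \<Rightarrow> 'a) \<Rightarrow> (weyl_letter list \<Rightarrow> 'a) set \<Rightarrow>
     (nat \<Rightarrow> 'a inverted_poly) \<Rightarrow> (nat \<Rightarrow> 'a inverted_poly)" where
  "weyl_act K n g A u = the_elem ((\<lambda>p. free_act K n g p u) ` A)"

definition weyl_s_act ::
    "('a, 'm) ring_scheme \<Rightarrow> nat \<Rightarrow> (nat multiset \<Rightarrow> 'a) \<Rightarrow>
     (nat \<Rightarrow> (weyl_letter list \<Rightarrow> 'a) set) \<Rightarrow>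
     (nat \<Rightarrow> 'a inverted_poly) \<Rightarrow> (nat \<Rightarrow> 'a inverted_poly)" where
  "weyl_s_act K n g Q u =
    (\<Oplus>\<^bsub>gs_module K n g\<^esub>j \<in> {..deg (weyl_algebra K n) Q}.
       gs_monom K n g \<one>\<^bsub>poly_ring K n\<^esub> j
         \<otimes>\<^bsub>gs_module K n g\<^esub> weyl_act K n g (coeff (UP (weyl_algebra K n)) Q j) u)"

section \<open>Bernstein-Sato polynomials\<close>

text \<open>The \<open>b\<close> for which \<open>b(s) g\<^sup>s = Q \<cdot> g\<^sup>s\<^sup>+\<^sup>1\<close> for some \<open>Q\<close> in \<open>A\<^sub>n(K)[s]\<close>.\<close>

definition bernstein_ideal ::
    "('a, 'm) ring_scheme \<Rightarrow> nat \<Rightarrow> (nat multiset \<Rightarrow> 'a) \<Rightarrow> (nat \<Rightarrow> 'a) set" where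
  "bernstein_ideal K n g =
    {b \<in> carrier (UP K). \<exists>Q \<in> carrier (UP (weyl_algebra K n)).
       (\<lambda>j. inverted_poly K n g (ring.indexed_const K (coeff (UP K) b j)))
         = weyl_s_act K n g Q (gs_monom K n g g 0)}"

definition is_bernstein_sato ::
    "('a, 'm) ring_scheme \<Rightarrow> nat \<Rightarrow> (nat multiset \<Rightarrow> 'a) \<Rightarrow> (nat \<Rightarrow> 'a) \<Rightarrow> bool" where
  "is_bernstein_sato K n g b \<longleftrightarrow>
     b \<in> carrier (UP K) \<and> coeff (UP K) b (deg K b) = \<one>\<^bsub>K\<^esub> \<and>
     bernstein_ideal K n g = PIdl\<^bsub>UP K\<^esub> b"

definition char_zero :: "('a, 'm) ring_scheme \<Rightarrow> bool" where
  "char_zero K \<longleftrightarrow> (\<forall>m::nat. m > 0 \<longrightarrow> [m] \<cdot>\<^bsub>K\<^esub> \<one>\<^bsub>K\<^esub> \<noteq> \<zero>\<^bsub>K\<^esub>)"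

definition rat_embed :: "('a, 'm) ring_scheme \<Rightarrow> rat \<Rightarrow> 'a" where
  "rat_embed K r =
    (case quotient_of r of (p, q) \<Rightarrow> ([p] \<cdot>\<^bsub>K\<^esub> \<one>\<^bsub>K\<^esub>) \<otimes>\<^bsub>K\<^esub> inv\<^bsub>K\<^esub> ([q] \<cdot>\<^bsub>K\<^esub> \<one>\<^bsub>K\<^esub>))"

definition rat_poly_embed :: "('a, 'm) ring_scheme \<Rightarrow> rat poly \<Rightarrow> (nat \<Rightarrow> 'a)" where
  "rat_poly_embed K b = (\<lambda>j. rat_embed K (Polynomial.coeff b j))"

text \<open>
  Bernstein-Sato polynomials have rational coefficients, and are compared over different fields
  as rational polynomials. HOL cannot quantify over all fields in a set comprehension, so this is
  the part of \<open>B(n,d)\<close> arising from the fields carried by subsets of the type \<open>'c\<close>; a statement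
  about its members with \<open>'c\<close> a free type variable covers all fields.
\<close>

definition bernstein_sato_set :: "'c itself \<Rightarrow> nat \<Rightarrow> nat \<Rightarrow> rat poly set" where
  "bernstein_sato_set _ n d =
    {b. \<exists>(K :: 'c ring) g. field K \<and> char_zero K \<and>
          g \<in> carrier (poly_ring K n) \<and> g \<noteq> \<zero>\<^bsub>poly_ring K n\<^esub> \<and> mpoly_degree_le K d g \<and>
          is_bernstein_sato K n g (rat_poly_embed K b)}"

section \<open>The projective space of polynomials of degree at most \<open>d\<close>\<close>

definition exponents :: "nat \<Rightarrow> nat \<Rightarrow> nat multiset set" where
  "exponents n d = {\<alpha>. set_mset \<alpha> \<subseteq> {..<n} \<and> size \<alpha> \<le> d}"

text \<open>The ring \<open>C\<close>, whose indeterminates \<open>a\<^sub>\<alpha>\<close> are indexed by the exponents \<open>\<alpha>\<close>.\<close>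

definition coeff_ring ::
    "('a, 'm) ring_scheme \<Rightarrow> nat \<Rightarrow> nat \<Rightarrow> (nat multiset multiset \<Rightarrow> 'a) ring" where
  "coeff_ring k n d = mpoly_ring k (exponents n d)"

definition homogeneous_ideal ::
    "('a, 'm) ring_scheme \<Rightarrow> 'v set \<Rightarrow> ('v multiset \<Rightarrow> 'a) set \<Rightarrow> bool" where
  "homogeneous_ideal k I J \<longleftrightarrow>
     ideal J (mpoly_ring k I) \<and> (\<forall>p\<in>J. \<forall>e. homogeneous_part k e p \<in> J)"

definition irrelevant_ideal ::
    "('a, 'm) ring_scheme \<Rightarrow> 'v set \<Rightarrow> ('v multiset \<Rightarrow> 'a) set" where
  "irrelevant_ideal k I = Idl\<^bsub>mpoly_ring k I\<^esub> (ring.indexed_var k ` I)"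

definition proj_space ::
    "('a, 'm) ring_scheme \<Rightarrow> nat \<Rightarrow> nat \<Rightarrow> (nat multiset multiset \<Rightarrow> 'a) set set" where
  "proj_space k n d =
    {P. primeideal P (coeff_ring k n d) \<and> homogeneous_ideal k (exponents n d) P \<and>
        P \<noteq> irrelevant_ideal k (exponents n d)}"

definition zariski_closed ::
    "('a, 'm) ring_scheme \<Rightarrow> nat \<Rightarrow> nat \<Rightarrow> (nat multiset multiset \<Rightarrow> 'a) set set \<Rightarrow> bool" where
  "zariski_closed k n d Z \<longleftrightarrow>
    (\<exists>J. homogeneous_ideal k (exponents n d) J \<and> Z = {P \<in> proj_space k n d. J \<subseteq> P})"

definition zariski_constructible ::
    "('a, 'm) ring_scheme \<Rightarrow> nat \<Rightarrow> nat \<Rightarrow> (nat multiset multiset \<Rightarrow> 'a) set set \<Rightarrow> bool" where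
  "zariski_constructible k n d T \<longleftrightarrow>
    (\<exists>\<L>. finite \<L> \<and> T = \<Union>\<L> \<and>
       (\<forall>L\<in>\<L>. \<exists>Z Z'. zariski_closed k n d Z \<and> zariski_closed k n d Z' \<and> L = Z - Z'))"

definition residue_field ::
    "('a, 'm) ring_scheme \<Rightarrow> nat \<Rightarrow> nat \<Rightarrow> (nat multiset multiset \<Rightarrow> 'a) set \<Rightarrow>
     ((nat multiset multiset \<Rightarrow> 'a) set \<times> (nat multiset multiset \<Rightarrow> 'a) set) set ring" where
  "residue_field k n d P = fraction_field (coeff_ring k n d Quot P)"

definition residue_map ::
    "('a, 'm) ring_scheme \<Rightarrow> nat \<Rightarrow> nat \<Rightarrow> (nat multiset multiset \<Rightarrow> 'a) set \<Rightarrow>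
     (nat multiset multiset \<Rightarrow> 'a) \<Rightarrow>
     ((nat multiset multiset \<Rightarrow> 'a) set \<times> (nat multiset multiset \<Rightarrow> 'a) set) set" where
  "residue_map k n d P c =
    (let C = coeff_ring k n d; Q = C Quot P
     in fraction Q (carrier Q - {\<zero>\<^bsub>Q\<^esub>}) (P +>\<^bsub>C\<^esub> c) \<one>\<^bsub>Q\<^esub>)"

text \<open>\<open>f = \<Sum> a\<^sub>\<alpha> x\<^sup>\<alpha>\<close>, an element of \<open>C[x\<^sub>1, \<dots>, x\<^sub>n]\<close>.\<close>

definition generic_poly ::
    "('a, 'm) ring_scheme \<Rightarrow> nat \<Rightarrow> nat \<Rightarrow> nat multiset \<Rightarrow> (nat multiset multiset \<Rightarrow> 'a)" where
  "generic_poly k n d =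
    (\<lambda>\<alpha>. if \<alpha> \<in> exponents n d then ring.indexed_var k \<alpha> else \<zero>\<^bsub>coeff_ring k n d\<^esub>)"

definition bernstein_sato_stratum ::
    "('a, 'm) ring_scheme \<Rightarrow> nat \<Rightarrow> nat \<Rightarrow> rat poly \<Rightarrow> (nat multiset multiset \<Rightarrow> 'a) set set" where
  "bernstein_sato_stratum k n d b =
    {P \<in> proj_space k n d.
       is_bernstein_sato (residue_field k n d P) n
         (\<lambda>\<alpha>. residue_map k n d P (generic_poly k n d \<alpha>))
         (rat_poly_embed (residue_field k n d P) b)}"

end

theory Submission
  imports Defs "HOL-Library.Poly_Mapping" "HOL-Library.Multiset_Order"
begin

text \<open>
  A subset of a noetherian space is constructible as soon as, on every irreducible closed set with
  generic point \<open>P\<close>, it either contains or misses a nonempty open subset. So the point is that the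
  Bernstein-Sato polynomial is generically constant: for each point \<open>P\<close> of the projective space
  there is \<open>h \<notin> P\<close> such that \<open>b\<close> is the Bernstein-Sato polynomial at \<open>P\<close> if and only if it is the
  one at \<open>Q\<close>, for every point \<open>Q\<close> with \<open>P \<subseteq> Q\<close> and \<open>h \<notin> Q\<close>. This is
  \<open>stratum_generically_constant\<close>, and \<open>stratum_closed_inter\<close> is the noetherian induction.

  Generic constancy is elimination theory over a ring of coefficients. Let \<open>R\<close> be a commutative ring
  and \<open>g\<close> a polynomial over it. The powers \<open>g\<^sup>s\<close> are replaced by the delta function of the graph of
  \<open>g\<close>, following Malgrange: the module \<open>R[x][\<tau>]\<close> with generator \<open>\<delta>(t - g)\<close>, where \<open>\<tau>\<close> stands for
  \<open>\<partial>\<^sub>t\<close>, where \<open>\<partial>\<^sub>i\<close> acts as \<open>\<partial>\<^sub>i - (\<partial>\<^sub>i g) \<tau>\<close> and where \<open>s\<close> acts as \<open>- \<partial>\<^sub>t t\<close>. Unlike \<open>R[x][1/g, s] g\<^sup>s\<close> this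
  module has no denominators, so that it is the same free module for all residue rings of \<open>R\<close>.
  The Bernstein ideal consists of the \<open>b(s)\<close> with \<open>b(s) \<delta> \<in> D[s] g \<delta>\<close>. It is found by two eliminations:
  the operators free of \<open>\<tau>\<close> among all operators that annihilate \<open>\<delta>\<close>
  (\<open>annihilator_specializes\<close>), and the polynomials in \<open>s\<close> among the operators that take \<open>\<delta>\<close> into
  \<open>D[s] g \<delta>\<close> (\<open>bs_ideal_specializes\<close>). Both are instances of one statement, the lemma
  \<open>elimination\<close> of the locale \<open>shift_closed_module\<close>. Modulo a prime ideal \<open>p\<close> of \<open>R\<close>, the leading monomials of a left ideal
  of operators are generated by finitely many of them (Dickson's lemma). Let \<open>h\<close> be the product of
  the corresponding leading coefficients. Division by these finitely many operators is then
  possible modulo each prime ideal \<open>q \<supseteq> p\<close> that does not contain \<open>h\<close>, so that the result of the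
  elimination over \<open>q\<close> comes from the one over \<open>p\<close>. Comparing degrees then gives
  \<open>bs_generator_generically_constant\<close>.

  This part is done for type classes, whereas the rings of the statement are records. The two meet
  in a ring type \<open>uring\<close> that maps onto every commutative ring on a given type. Polynomial rings, the
  Weyl algebra and the module of \<open>g\<^sup>s\<close> over a record ring become images of typed objects. The map
  \<open>\<tau>\<^sup>k \<mapsto> (-1)\<^sup>k s (s - 1) \<dots> (s - k + 1) g\<^sup>-\<^sup>k\<close> embeds the module of the delta function into the module
  of \<open>g\<^sup>s\<close> (\<open>Psi_kernel\<close>), and it identifies the two notions of Bernstein ideal
  (\<open>bernstein_ideal_iff\<close>, \<open>is_bernstein_sato_iff\<close>).
\<close>

abbreviation lookup :: "('k \<Rightarrow>\<^sub>0 'r::zero) \<Rightarrow> 'k \<Rightarrow> 'r" where "lookup \<equiv> Poly_Mapping.lookup"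
abbreviation keys :: "('k \<Rightarrow>\<^sub>0 'r::zero) \<Rightarrow> 'k set" where "keys \<equiv> Poly_Mapping.keys"
abbreviation single :: "'k \<Rightarrow> 'r \<Rightarrow> ('k \<Rightarrow>\<^sub>0 'r::zero)" where "single \<equiv> Poly_Mapping.single"

section \<open>Monomial elimination modulo prime ideals\<close>

definition prime_ideal_set :: "'r::comm_ring_1 set \<Rightarrow> bool" where
  "prime_ideal_set p \<longleftrightarrow> 0 \<in> p \<and> 1 \<notin> p \<and> (\<forall>a\<in>p. \<forall>b\<in>p. a + b \<in> p) \<and>
     (\<forall>a. \<forall>b\<in>p. a * b \<in> p) \<and> (\<forall>a b. a * b \<in> p \<longrightarrow> a \<in> p \<or> b \<in> p)"

lemma prime_ideal_setD:
  fixes p :: "'r::comm_ring_1 set"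
  assumes "prime_ideal_set p"
  shows "0 \<in> p" "1 \<notin> p" "\<And>a b. a \<in> p \<Longrightarrow> b \<in> p \<Longrightarrow> a + b \<in> p"
    "\<And>a b. b \<in> p \<Longrightarrow> a * b \<in> p" "\<And>a b. a \<in> p \<Longrightarrow> a * b \<in> p"
    "\<And>a b. a \<notin> p \<Longrightarrow> b \<notin> p \<Longrightarrow> a * b \<notin> p"
    "\<And>a. a \<in> p \<Longrightarrow> - a \<in> p" "\<And>a b. a \<in> p \<Longrightarrow> b \<in> p \<Longrightarrow> a - b \<in> p"
proof -
  have m: "\<And>a b. b \<in> p \<Longrightarrow> a * b \<in> p" and a: "\<And>a b. a \<in> p \<Longrightarrow> b \<in> p \<Longrightarrow> a + b \<in> p"
    and z: "0 \<in> p" and o: "1 \<notin> p" and pr: "\<And>a b. a * b \<in> p \<Longrightarrow> a \<in> p \<or> b \<in> p"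
    using assms unfolding prime_ideal_set_def by auto
  have n: "\<And>a. a \<in> p \<Longrightarrow> - a \<in> p" using m[of _ "-1"] by simp
  show "0 \<in> p" "1 \<notin> p" by (fact z, fact o)
  show "\<And>a b. a \<in> p \<Longrightarrow> b \<in> p \<Longrightarrow> a + b \<in> p" by (fact a)
  show "\<And>a b. b \<in> p \<Longrightarrow> a * b \<in> p" by (fact m)
  show "\<And>a b. a \<in> p \<Longrightarrow> a * b \<in> p" using m by (metis mult.commute)
  show "\<And>a b. a \<notin> p \<Longrightarrow> b \<notin> p \<Longrightarrow> a * b \<notin> p" using pr by blast
  show "\<And>a. a \<in> p \<Longrightarrow> - a \<in> p" by (fact n)
  show "\<And>a b. a \<in> p \<Longrightarrow> b \<in> p \<Longrightarrow> a - b \<in> p" using a n by (metis diff_conv_add_uminus)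
qed

lemma prime_ideal_set_sum:
  assumes "prime_ideal_set p" "\<And>i. i \<in> A \<Longrightarrow> f i \<in> p"
  shows "sum f A \<in> p"
  using assms(2)
  by (induction A rule: infinite_finite_induct) (auto simp: prime_ideal_setD(1,3)[OF assms(1)])

lemma prime_ideal_set_prod:
  assumes "prime_ideal_set p" "\<And>i. i \<in> A \<Longrightarrow> f i \<notin> p"
  shows "prod f A \<notin> p"
  using assms(2)
  by (induction A rule: infinite_finite_induct) (auto simp: prime_ideal_setD[OF assms(1)])

definition scal :: "'r \<Rightarrow> ('k::monoid_add \<Rightarrow>\<^sub>0 'r) \<Rightarrow> ('k \<Rightarrow>\<^sub>0 'r::comm_ring_1)" where
  "scal a f = single 0 a * f"

lemma lookup_scal [simp]: "lookup (scal a f) m = a * lookup f m"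
  unfolding scal_def mult_map_scale_conv_mult[symmetric]
  by (simp add: Poly_Mapping.map.rep_eq when_def)

definition coeffs_in :: "'r set \<Rightarrow> ('k \<Rightarrow>\<^sub>0 'r::zero) set" where
  "coeffs_in p = {f. \<forall>m. lookup f m \<in> p}"

lemma coeffs_in_closed:
  fixes f f' :: "'k::monoid_add \<Rightarrow>\<^sub>0 'r::comm_ring_1"
  assumes "prime_ideal_set p" "f \<in> coeffs_in p"
  shows "f' \<in> coeffs_in p \<Longrightarrow> f + f' \<in> coeffs_in p"
    "f' \<in> coeffs_in p \<Longrightarrow> f - f' \<in> coeffs_in p" "scal a f \<in> coeffs_in p"
    "a \<in> p \<Longrightarrow> scal a f' \<in> coeffs_in p"
  using assms
  by (auto simp: coeffs_in_def lookup_scal lookup_add lookup_minus prime_ideal_setD[OF assms(1)])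

subsection \<open>Dickson's lemma\<close>

text \<open>
  One variable at a time: a sequence of natural numbers has a monotone subsequence, and a
  decreasing one is eventually constant.
\<close>

lemma dickson_sequence:
  fixes f :: "nat \<Rightarrow> 'v multiset"
  assumes "finite V"
  shows "\<exists>r::nat \<Rightarrow> nat. strict_mono r \<and> (\<forall>i j. i < j \<longrightarrow> (\<forall>v\<in>V. count (f (r i)) v \<le> count (f (r j)) v))"
  using assms
proof (induction V rule: finite_induct)
  case empty
  show ?case by (rule exI[of _ id]) (auto simp: strict_mono_def)
next
  case (insert v V)
  then obtain r :: "nat \<Rightarrow> nat" where r: "strict_mono r"
      "\<forall>i j. i < j \<longrightarrow> (\<forall>v\<in>V. count (f (r i)) v \<le> count (f (r j)) v)"
    by blast
  obtain r' where r': "strict_mono r'" "monoseq (\<lambda>i. count (f (r (r' i))) v)"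
    using seq_monosub[of "\<lambda>i. count (f (r i)) v"] by auto
  have "\<exists>N. \<forall>i\<ge>N. \<forall>j\<ge>i. count (f (r (r' i))) v \<le> count (f (r (r' j))) v"
  proof (cases "\<forall>m. \<forall>n\<ge>m. count (f (r (r' m))) v \<le> count (f (r (r' n))) v")
    case True then show ?thesis by blast
  next
    case False
    then have dec: "\<And>m n. m \<le> n \<Longrightarrow> count (f (r (r' n))) v \<le> count (f (r (r' m))) v"
      using r'(2) unfolding monoseq_def by blast
    obtain N where "\<And>i. count (f (r (r' N))) v \<le> count (f (r (r' i))) v"
      using ex_has_least_nat[of "\<lambda>_. True" 0 "\<lambda>i. count (f (r (r' i))) v"] by auto
    then have "\<forall>i\<ge>N. \<forall>j\<ge>i. count (f (r (r' i))) v \<le> count (f (r (r' j))) v"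
      using dec by (meson order_trans)
    then show ?thesis by blast
  qed
  then obtain N where N: "\<And>i j. N \<le> i \<Longrightarrow> i \<le> j \<Longrightarrow> count (f (r (r' i))) v \<le> count (f (r (r' j))) v"
    by blast
  have sm: "strict_mono (\<lambda>i. r (r' (i + N)))"
    using r(1) r'(1) unfolding strict_mono_def by simp
  show ?case
  proof (rule exI[of _ "\<lambda>i. r (r' (i + N))"], intro conjI sm allI impI ballI)
    fix i j :: nat and w assume ij: "i < j" and w: "w \<in> insert v V"
    have lt: "r' (i + N) < r' (j + N)" using r'(1) ij by (simp add: strict_mono_def)
    show "count (f (r (r' (i + N)))) w \<le> count (f (r (r' (j + N)))) w"
      using w r(2) lt N[of "i + N" "j + N"] ij by auto
  qed
qed

lemma dickson:
  fixes A :: "'v multiset set"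
  assumes "finite V" and A: "\<And>m. m \<in> A \<Longrightarrow> set_mset m \<subseteq> V"
  obtains B where "finite B" "B \<subseteq> A" "\<And>a. a \<in> A \<Longrightarrow> \<exists>b\<in>B. b \<subseteq># a"
proof
  \<comment> \<open>The minimal elements of \<open>A\<close>; an infinite sequence of them would contain two comparable ones.\<close>
  define B where "B = {b\<in>A. \<forall>a\<in>A. \<not> a \<subset># b}"
  show "B \<subseteq> A" by (auto simp: B_def)
  show "\<exists>b\<in>B. b \<subseteq># a" if "a \<in> A" for a
    using that
  proof (induction a rule: measure_induct_rule[of size])
    case (less a)
    show ?case
    proof (cases "a \<in> B")
      case True then show ?thesis by blast
    next
      case False
      then obtain a' where a': "a' \<in> A" "a' \<subset># a" using less.prems by (auto simp: B_def)
      then show ?thesis using less.IH[of a'] mset_subset_size[of a' a] by (meson subset_mset.less_imp_le subset_mset.order_trans)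
    qed
  qed
  show "finite B"
  proof (rule ccontr)
    assume "infinite B"
    then obtain f :: "nat \<Rightarrow> 'v multiset" where f: "inj f" "range f \<subseteq> B"
      using infinite_countable_subset by blast
    obtain r :: "nat \<Rightarrow> nat" where r: "strict_mono r"
      "\<forall>i j. i < j \<longrightarrow> (\<forall>v\<in>V. count (f (r i)) v \<le> count (f (r j)) v)"
      using dickson_sequence[OF assms(1)] by blast
    have inB: "f i \<in> B" for i using f(2) by blast
    have c: "count (f (r 0)) v \<le> count (f (r 1)) v" for v
    proof (cases "v \<in> V")
      case False
      then have "v \<notin># f (r 0)" using A inB \<open>B \<subseteq> A\<close> by blast
      then show ?thesis by (simp add: not_in_iff)
    qed (use r in auto)
    then have "f (r 0) \<subseteq># f (r 1)" by (simp add: subseteq_mset_def)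
    moreover have "f (r 0) \<noteq> f (r 1)"
      using f(1) r(1) by (metis inj_eq strict_mono_eq zero_neq_one)
    ultimately have "f (r 0) \<subset># f (r 1)" by (simp add: subset_mset.less_le)
    then show False using inB \<open>B \<subseteq> A\<close> by (auto simp: B_def)
  qed
qed

subsection \<open>Leading monomials modulo a prime ideal\<close>

text \<open>
  The leading monomial of the image of \<open>f\<close> over the domain of residues modulo \<open>p\<close>.
\<close>

definition lead_monom :: "'r set \<Rightarrow> ('k::linorder \<Rightarrow>\<^sub>0 'r::zero) \<Rightarrow> 'k \<Rightarrow> bool" where
  "lead_monom p f m \<longleftrightarrow> lookup f m \<notin> p \<and> (\<forall>m'>m. lookup f m' \<in> p)"

lemma lead_monom_exists:
  fixes f :: "'k::linorder \<Rightarrow>\<^sub>0 'r::comm_ring_1"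
  assumes "prime_ideal_set p" "f \<notin> coeffs_in p"
  obtains m where "lead_monom p f m"
proof -
  define A where "A = {m. lookup f m \<notin> p}"
  have "A \<subseteq> keys f" using prime_ideal_setD(1)[OF assms(1)] by (auto simp: A_def in_keys_iff)
  then have fin: "finite A" by (rule finite_subset) simp
  have ne: "A \<noteq> {}" using assms(2) by (auto simp: A_def coeffs_in_def)
  have "lead_monom p f (Max A)"
    unfolding lead_monom_def
  proof (intro conjI allI impI)
    show "lookup f (Max A) \<notin> p" using Max_in[OF fin ne] by (simp add: A_def)
    fix m' assume "m' > Max A"
    then show "lookup f m' \<in> p" using Max_ge[OF fin, of m'] by (fastforce simp: A_def)
  qed
  then show thesis by (rule that)
qed

text \<open>
  Suppose that, up to a factor \<open>u\<close> that is invertible at \<open>q\<close>, \<open>f\<close> is modulo \<open>q\<close> an element \<open>l\<close> of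
  \<open>L\<close>, and that modulo \<open>q\<close> it has no monomials outside the initial segment \<open>Init\<close>. Then \<open>l\<close> can be
  chosen without monomials outside \<open>Init\<close>. As \<open>h\<close> is the same for all \<open>q\<close>, this says that elimination
  commutes with specialization on an open set.
\<close>

definition eliminates :: "'r::comm_ring_1 set \<Rightarrow> ('k::{linorder,monoid_add} \<Rightarrow>\<^sub>0 'r) set \<Rightarrow> 'r \<Rightarrow> bool" where
  "eliminates p L h \<longleftrightarrow> h \<notin> p \<and> (\<forall>q Init f u l. prime_ideal_set q \<longrightarrow> p \<subseteq> q \<longrightarrow> h \<notin> q \<longrightarrow>
     (\<forall>m m'. m \<in> Init \<longrightarrow> m' \<le> m \<longrightarrow> m' \<in> Init) \<longrightarrow>
     u \<notin> q \<longrightarrow> l \<in> L \<longrightarrow> scal u f - l \<in> coeffs_in q \<longrightarrow>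
     (\<forall>m. m \<notin> Init \<longrightarrow> lookup f m \<in> q) \<longrightarrow>
     (\<exists>u' l'. u' \<notin> q \<and> l' \<in> L \<and> (\<forall>m. m \<notin> Init \<longrightarrow> lookup l' m = 0) \<and>
        scal u' f - l' \<in> coeffs_in q))"

lemma eliminatesD:
  assumes "eliminates p L h" "prime_ideal_set q" "p \<subseteq> q" "h \<notin> q"
    "\<And>m m'. m \<in> Init \<Longrightarrow> m' \<le> m \<Longrightarrow> m' \<in> Init" "\<And>m. m \<notin> Init \<Longrightarrow> lookup f m \<in> q"
    "u \<notin> q" "l \<in> L" "scal u f - l \<in> coeffs_in q"
  obtains u' l' where "u' \<notin> q" "l' \<in> L" "\<And>m. m \<notin> Init \<Longrightarrow> lookup l' m = 0"
    "scal u' f - l' \<in> coeffs_in q"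
  using assms(1)[unfolded eliminates_def, THEN conjunct2, rule_format, of q Init u l f] assms(2-) that
  by metis

text \<open>
  Abstraction of a left ideal \<open>L\<close> in a ring of operators whose leading monomials multiply as in a
  commutative ring, \<open>shift v\<close> being left multiplication by the generator \<open>v\<close>. Everything is
  considered modulo \<open>p\<close>, whence the requirement that \<open>L\<close> contains all elements with coefficients
  in \<open>p\<close>.
\<close>

locale shift_closed_module =
  fixes p :: "'r::comm_ring_1 set" and L :: "('v::wellorder multiset \<Rightarrow>\<^sub>0 'r) set"
    and V :: "'v set" and shift :: "'v \<Rightarrow> ('v multiset \<Rightarrow>\<^sub>0 'r) \<Rightarrow> ('v multiset \<Rightarrow>\<^sub>0 'r)"
  assumes prime: "prime_ideal_set p"
    and add_closed: "f \<in> L \<Longrightarrow> f' \<in> L \<Longrightarrow> f + f' \<in> L"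
    and scal_closed: "f \<in> L \<Longrightarrow> scal a f \<in> L"
    and contains_coeffs_in: "coeffs_in p \<subseteq> L"
    and finite_vars: "finite V"
    and lead_vars: "f \<in> L \<Longrightarrow> lead_monom p f m \<Longrightarrow> set_mset m \<subseteq> V"
    and shift_closed: "f \<in> L \<Longrightarrow> v \<in> V \<Longrightarrow> shift v f \<in> L"
    and shift_lead: "f \<in> L \<Longrightarrow> v \<in> V \<Longrightarrow> lead_monom p f m \<Longrightarrow> lead_monom p (shift v f) (add_mset v m)"
    and shift_coeff: "f \<in> L \<Longrightarrow> v \<in> V \<Longrightarrow> lead_monom p f m \<Longrightarrow>
      lookup (shift v f) (add_mset v m) - lookup f m \<in> p"
begin

text \<open>
  By Dickson's lemma finitely many elements have leading monomials that generate all others, and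
  shifting changes the leading coefficient only by an element of \<open>p\<close>. So the product of the
  finitely many leading coefficients serves for every leading monomial.
\<close>

lemma uniform_leading_coeff:
  "\<exists>h. h \<notin> p \<and> (\<forall>f m. f \<in> L \<longrightarrow> lead_monom p f m \<longrightarrow>
     (\<exists>e\<in>L. lead_monom p e m \<and> h - lookup e m \<in> p))"
proof -
  note pr = prime_ideal_setD[OF prime]
  define A where "A = {m. \<exists>f\<in>L. lead_monom p f m}"
  have "set_mset m \<subseteq> V" if "m \<in> A" for m using lead_vars that by (auto simp: A_def)
  from dickson[OF finite_vars this]
  obtain B where B: "finite B" "B \<subseteq> A" "\<And>a. a \<in> A \<Longrightarrow> \<exists>b\<in>B. b \<subseteq># a" by metis
  have "\<forall>b\<in>B. \<exists>f. f \<in> L \<and> lead_monom p f b" using B(2) by (auto simp: A_def)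
  then obtain F where F: "\<And>b. b \<in> B \<Longrightarrow> F b \<in> L" "\<And>b. b \<in> B \<Longrightarrow> lead_monom p (F b) b"
    by metis
  define h where "h = (\<Prod>b\<in>B. lookup (F b) b)"
  have h: "h \<notin> p"
    unfolding h_def by (rule prime_ideal_set_prod[OF prime]) (use F in \<open>auto simp: lead_monom_def\<close>)
  have up: "\<exists>e\<in>L. lead_monom p e (b + c) \<and> lookup e (b + c) - lookup f b \<in> p"
    if "f \<in> L" "lead_monom p f b" "set_mset c \<subseteq> V" for f b c
    using that
  proof (induction c)
    case empty then show ?case using pr(1) by auto
  next
    case (add v c)
    then obtain e where e: "e \<in> L" "lead_monom p e (b + c)" "lookup e (b + c) - lookup f b \<in> p" by auto
    have v: "v \<in> V" using add.prems by simp
    have "lookup (shift v e) (add_mset v (b + c)) - lookup e (b + c) + (lookup e (b + c) - lookup f b) \<in> p"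
      by (rule pr(3)[OF shift_coeff[OF e(1) v e(2)] e(3)])
    then have c: "lookup (shift v e) (add_mset v (b + c)) - lookup f b \<in> p" by simp
    show ?case
      using shift_closed[OF e(1) v] shift_lead[OF e(1) v e(2)] c
      by (intro bexI[of _ "shift v e"]) auto
  qed
  have "\<exists>e\<in>L. lead_monom p e m \<and> h - lookup e m \<in> p" if f: "f \<in> L" "lead_monom p f m" for f m
  proof -
    have mA: "m \<in> A" using f by (auto simp: A_def)
    then obtain b where b: "b \<in> B" "b \<subseteq># m" using B(3) by blast
    have "set_mset (m - b) \<subseteq> V" using lead_vars[OF f] by (meson in_diffD subset_iff)
    from up[OF F(1)[OF b(1)] F(2)[OF b(1)] this] b(2)
    obtain e where e: "e \<in> L" "lead_monom p e m" "lookup e m - lookup (F b) b \<in> p" by auto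
    define c where "c = (\<Prod>b\<in>B - {b}. lookup (F b) b)"
    have hc: "h = c * lookup (F b) b"
      unfolding h_def c_def using prod.remove[OF B(1) b(1)] by (simp add: mult.commute)
    have "- (c * (lookup e m - lookup (F b) b)) \<in> p" by (intro pr(7) pr(4) e(3))
    then have he: "h - lookup (scal c e) m \<in> p" by (simp add: hc algebra_simps)
    have "lookup (scal c e) m \<notin> p" using pr(3)[OF he] h by fastforce
    moreover have "\<forall>m'>m. lookup (scal c e) m' \<in> p"
      using e(2) pr(4) by (auto simp: lead_monom_def)
    ultimately show ?thesis using scal_closed[OF e(1), of c] he
      by (intro bexI[of _ "scal c e"]) (auto simp: lead_monom_def)
  qed
  with h show ?thesis by blast
qed

text \<open>
  The elements of \<open>L\<close> with leading coefficient \<open>h\<close> reduce any other element, also modulo a larger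
  prime ideal \<open>q\<close> that avoids \<open>h\<close>. So a congruence modulo \<open>q\<close> can be moved into any initial
  segment of the monomials.
\<close>

lemma elimination: "\<exists>h. eliminates p L h"
proof -
  note pr = prime_ideal_setD[OF prime]
  obtain h where h: "h \<notin> p" "\<And>f m. f \<in> L \<Longrightarrow> lead_monom p f m \<Longrightarrow>
     \<exists>e\<in>L. lead_monom p e m \<and> h - lookup e m \<in> p"
    using uniform_leading_coeff by blast
  have goal: "\<exists>u' l'. u' \<notin> q \<and> l' \<in> L \<and> (\<forall>m. m \<notin> Init \<longrightarrow> lookup l' m = 0) \<and>
        scal u' f - l' \<in> coeffs_in q"
    if q: "prime_ideal_set q" "p \<subseteq> q" "h \<notin> q" and
      Init: "\<And>m m'. m \<in> Init \<Longrightarrow> m' \<le> m \<Longrightarrow> m' \<in> Init" and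
      f: "\<And>m. m \<notin> Init \<Longrightarrow> lookup f m \<in> q" and
      ul: "u \<notin> q" "l \<in> L" "scal u f - l \<in> coeffs_in q" for q Init f u l
  proof -
    note qr = prime_ideal_setD[OF q(1)]
    have zero: "0 \<in> L" using contains_coeffs_in pr(1) by (auto simp: coeffs_in_def)
    have trivial: "?thesis" if "scal u f \<in> coeffs_in q" "u \<notin> q" for u
      using that zero by (intro exI[of _ u] exI[of _ 0]) auto
    have main: ?thesis if "u \<notin> q" "l \<in> L" "scal u f - l \<in> coeffs_in q" "lead_monom p l m" for u l m
      using that
    proof (induction m arbitrary: u l rule: less_induct)
      case (less m)
      show ?case
      proof (cases "m \<in> Init")
        case True
        \<comment> \<open>All monomials of \<open>l\<close> outside \<open>Init\<close> are above \<open>m\<close>, so their coefficients are in \<open>p\<close> and they can be removed without leaving \<open>L\<close>.\<close>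
        define r where "r = (\<Sum>m\<in>keys l - Init. single m (lookup l m))"
        have lr: "lookup r m' = (if m' \<in> Init then 0 else lookup l m')" for m'
        proof -
          have "lookup r m' = (\<Sum>m\<in>keys l - Init. if m = m' then lookup l m else 0)"
            unfolding r_def lookup_sum lookup_single when_def ..
          also have "\<dots> = (if m' \<in> keys l - Init then lookup l m' else 0)"
            by (rule sum.delta) simp
          finally show ?thesis by (simp add: in_keys_iff)
        qed
        have rp: "r \<in> coeffs_in p"
          unfolding coeffs_in_def
        proof (clarify)
          fix m'
          show "lookup r m' \<in> p"
          proof (cases "m' \<in> Init")
            case False
            then have "m' > m" using Init[OF True, of m'] by (meson leI)
            then show ?thesis using less.prems(4) lr by (auto simp: lead_monom_def pr)
          qed (simp add: lr pr)
        qed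
        have "l + scal (-1) r \<in> L"
          using contains_coeffs_in rp add_closed scal_closed less.prems(2) by blast
        moreover have "lookup (l + scal (-1) r) m' = (if m' \<in> Init then lookup l m' else 0)" for m'
          unfolding lookup_add lookup_scal by (simp add: lr)
        moreover have "scal u f - (l + scal (-1) r) \<in> coeffs_in q"
          unfolding coeffs_in_def
        proof (clarify)
          fix m'
          have "lookup (scal u f - l) m' + lookup r m' \<in> q"
            using less.prems(3) rp q(2) by (intro qr(3)) (auto simp: coeffs_in_def)
          then show "lookup (scal u f - (l + scal (-1) r)) m' \<in> q"
            by (simp add: lookup_add lookup_minus lookup_scal algebra_simps)
        qed
        ultimately show ?thesis using less.prems(1)
          by (intro exI[of _ u] exI[of _ "l + scal (-1) r"]) simp
      next
        case False
        obtain e where e: "e \<in> L" "lead_monom p e m" "h - lookup e m \<in> p"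
          using h(2)[OF less.prems(2,4)] by blast
        define a where "a = lookup l m"
        have aq: "a \<in> q"
        proof -
          have "u * lookup f m - a \<in> q"
            using less.prems(3) by (auto simp: coeffs_in_def a_def lookup_minus lookup_scal)
          moreover have "u * lookup f m \<in> q" using f[OF False] by (rule qr(4))
          ultimately have "u * lookup f m - (u * lookup f m - a) \<in> q" by (rule qr(8)[rotated])
          then show ?thesis by simp
        qed
        \<comment> \<open>One step of the division: the leading term of \<open>l\<close> cancels modulo \<open>p\<close>, and modulo \<open>q\<close> nothing is lost, because the coefficient \<open>a\<close> of the multiple of \<open>e\<close> is in \<open>q\<close>.\<close>
        define l2 where "l2 = scal h l + scal (- a) e"
        have l2L: "l2 \<in> L" unfolding l2_def using add_closed scal_closed less.prems(2) e(1) by blast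
        have l2c: "lookup l2 m' = h * lookup l m' - a * lookup e m'" for m'
          unfolding l2_def lookup_add lookup_scal by simp
        have l2q: "scal (h * u) f - l2 \<in> coeffs_in q"
          unfolding coeffs_in_def
        proof (clarify)
          fix m'
          have "h * lookup (scal u f - l) m' + a * lookup e m' \<in> q"
            using less.prems(3) aq by (intro qr(3) qr(5) qr(4)) (auto simp: coeffs_in_def)
          then show "lookup (scal (h * u) f - l2) m' \<in> q"
            by (simp add: l2c lookup_minus lookup_scal algebra_simps)
        qed
        have hu: "h * u \<notin> q" by (rule qr(6)[OF q(3) less.prems(1)])
        show ?thesis
        proof (cases "l2 \<in> coeffs_in p")
          case True
          have "scal (h * u) f \<in> coeffs_in q"
            unfolding coeffs_in_def
          proof (clarify)
            fix m'
            have "lookup (scal (h * u) f - l2) m' + lookup l2 m' \<in> q"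
              using l2q True q(2) by (intro qr(3)) (auto simp: coeffs_in_def)
            then show "lookup (scal (h * u) f) m' \<in> q" by (simp add: lookup_minus)
          qed
          then show ?thesis using trivial hu by blast
        next
          case F: False
          obtain m2 where m2: "lead_monom p l2 m2" by (rule lead_monom_exists[OF prime F])
          have "lookup l2 m' \<in> p" if "m' \<ge> m" for m'
          proof (cases "m' = m")
            case True
            have "a * (h - lookup e m) \<in> p" by (intro pr(4) e(3))
            then show ?thesis by (simp add: True l2c a_def algebra_simps)
          next
            case False
            then have "m' > m" using that by simp
            then show ?thesis using less.prems(4) e(2) by (auto simp: l2c lead_monom_def pr)
          qed
          then have "m2 < m" using m2 unfolding lead_monom_def by (meson leI)
          from less.IH[OF this hu l2L l2q m2] show ?thesis .
        qed
      qed
    qed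
    show ?thesis
    proof (cases "l \<in> coeffs_in p")
      case True
      have "scal u f \<in> coeffs_in q"
        unfolding coeffs_in_def
      proof (clarify)
        fix m'
        have "lookup (scal u f - l) m' + lookup l m' \<in> q"
          using ul True q(2) by (intro qr(3)) (auto simp: coeffs_in_def)
        then show "lookup (scal u f) m' \<in> q" by (simp add: lookup_minus)
      qed
      then show ?thesis using trivial ul(1) by blast
    next
      case False
      then obtain m where "lead_monom p l m" using lead_monom_exists[OF prime] by blast
      then show ?thesis using main ul by blast
    qed
  qed
  show ?thesis
    unfolding eliminates_def
  proof (rule exI[of _ h], intro conjI allI impI h(1))
    fix q Init f u l
    assume a: "prime_ideal_set q" "p \<subseteq> q" "h \<notin> q" "\<forall>m m'. m \<in> Init \<longrightarrow> m' \<le> m \<longrightarrow> m' \<in> Init"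
      "u \<notin> q" "l \<in> L" "scal u f - l \<in> coeffs_in q" "\<forall>m. m \<notin> Init \<longrightarrow> lookup f m \<in> q"
    show "\<exists>u' l'. u' \<notin> q \<and> l' \<in> L \<and> (\<forall>m. m \<notin> Init \<longrightarrow> lookup l' m = 0) \<and>
        scal u' f - l' \<in> coeffs_in q"
      by (rule goal[OF a(1-3) _ _ a(5-7)]) (use a(4,8) in blast)+
  qed
qed

end

abbreviation pcoeff :: "'r::zero poly \<Rightarrow> nat \<Rightarrow> 'r" where "pcoeff \<equiv> Polynomial.coeff"

type_synonym 'r mpoly = "nat multiset \<Rightarrow>\<^sub>0 'r"

section \<open>Differential operators on polynomials\<close>

subsection \<open>Polynomials as finitely supported functions\<close>

lemma poly_mapping_sum_single:
  fixes f :: "'k \<Rightarrow>\<^sub>0 'r::comm_monoid_add"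
  shows "f = (\<Sum>m\<in>keys f. single m (lookup f m))"
proof (rule poly_mapping_eqI)
  fix k
  have "lookup (\<Sum>m\<in>keys f. single m (lookup f m)) k = (\<Sum>m\<in>keys f. if m = k then lookup f m else 0)"
    by (simp add: lookup_sum lookup_single when_def)
  also have "\<dots> = (if k \<in> keys f then lookup f k else 0)" by (rule sum.delta) simp
  finally show "lookup f k = lookup (\<Sum>m\<in>keys f. single m (lookup f m)) k" by (simp add: in_keys_iff)
qed

text \<open>
  Reduces an additive identity to monomials.
\<close>

lemma poly_mapping_additive_induct [case_names zero single add]:
  fixes f :: "'k \<Rightarrow>\<^sub>0 'r::comm_monoid_add"
  assumes "P 0" "\<And>m c. P (single m c)" "\<And>f g. P f \<Longrightarrow> P g \<Longrightarrow> P (f + g)"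
  shows "P f"
proof -
  have "P (\<Sum>m\<in>A. single m (lookup f m))" if "finite A" for A
    using that by (induction A rule: finite_induct) (auto intro: assms)
  from this[of "keys f"] show ?thesis using poly_mapping_sum_single[of f] by simp
qed

lemma lookup_single_mult:
  fixes f :: "'v multiset \<Rightarrow>\<^sub>0 'r::comm_ring_1"
  shows "lookup (single m c * f) k = (if m \<subseteq># k then c * lookup f (k - m) else 0)"
proof (induction f rule: poly_mapping_additive_induct)
  case (single m' c')
  have "m + m' = k \<longleftrightarrow> m \<subseteq># k \<and> m' = k - m" by (auto simp: subset_mset.le_iff_add)
  then show ?case by (auto simp: mult_single lookup_single when_def)
qed (auto simp: lookup_add algebra_simps)

subsection \<open>Partial derivatives\<close>

lift_definition pderiv_at :: "'v \<Rightarrow> ('v multiset \<Rightarrow>\<^sub>0 'r::comm_ring_1) \<Rightarrow> ('v multiset \<Rightarrow>\<^sub>0 'r)"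
  is "\<lambda>i p m. of_nat (Suc (count m i)) * p (add_mset i m)"
proof -
  fix i :: 'v and p :: "'v multiset \<Rightarrow> 'r"
  assume "finite {m. p m \<noteq> 0}"
  moreover have "{m. of_nat (Suc (count m i)) * p (add_mset i m) \<noteq> 0} \<subseteq> (\<lambda>m. m - {#i#}) ` {m. p m \<noteq> 0}"
  proof
    fix m assume "m \<in> {m. of_nat (Suc (count m i)) * p (add_mset i m) \<noteq> 0}"
    then have "p (add_mset i m) \<noteq> 0" by auto
    then show "m \<in> (\<lambda>m. m - {#i#}) ` {m. p m \<noteq> 0}"
      by (intro image_eqI[of _ _ "add_mset i m"]) auto
  qed
  ultimately show "finite {m. of_nat (Suc (count m i)) * p (add_mset i m) \<noteq> 0}"
    by (meson finite_imageI finite_subset)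
qed

lemma lookup_pderiv_at: "lookup (pderiv_at i p) m = of_nat (Suc (count m i)) * lookup p (add_mset i m)"
  by (simp add: pderiv_at.rep_eq)

lemma pderiv_at_add: "pderiv_at i (p + q) = pderiv_at i p + pderiv_at i q"
  by (rule poly_mapping_eqI) (simp add: lookup_pderiv_at lookup_add algebra_simps)

lemma pderiv_at_zero [simp]: "pderiv_at i 0 = 0"
  by (rule poly_mapping_eqI) (simp add: lookup_pderiv_at)

lemma pderiv_at_diff: "pderiv_at i (p - q) = pderiv_at i p - pderiv_at i q"
  by (rule poly_mapping_eqI) (simp add: lookup_pderiv_at lookup_minus algebra_simps)

lemma pderiv_at_single: "pderiv_at i (single m c) = single (m - {#i#}) (of_nat (count m i) * c)"
proof (rule poly_mapping_eqI)
  fix k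
  show "lookup (pderiv_at i (single m c)) k = lookup (single (m - {#i#}) (of_nat (count m i) * c)) k"
  proof (cases "i \<in># m")
    case True
    then obtain m' where m: "m = add_mset i m'" by (meson mset_add)
    show ?thesis by (auto simp: lookup_pderiv_at lookup_single when_def m)
  next
    case False
    then have "m \<noteq> add_mset i k" "count m i = 0" by (auto simp: not_in_iff)
    then show ?thesis by (auto simp: lookup_pderiv_at lookup_single when_def)
  qed
qed

lemma pderiv_at_const [simp]: "pderiv_at i (single 0 c) = 0"
  by (simp add: pderiv_at_single)

lemma pderiv_at_mult: "pderiv_at i (p * q) = pderiv_at i p * q + p * pderiv_at i q"
proof (induction p rule: poly_mapping_additive_induct)
  case (single m c)
  show ?case
  proof (induction q rule: poly_mapping_additive_induct)
    case (single m' c')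
    have 1: "single (m - {#i#} + m') (of_nat (count m i) * c * c') =
        single (m + m' - {#i#}) (of_nat (count m i) * c * c')"
    proof (cases "i \<in># m")
      case True
      then obtain m2 where "m = add_mset i m2" by (meson mset_add)
      then show ?thesis by simp
    next
      case False
      then have "count m i = 0" by (simp add: not_in_iff)
      then show ?thesis by simp
    qed
    have 2: "single (m + (m' - {#i#})) (c * (of_nat (count m' i) * c')) =
        single (m + m' - {#i#}) (c * (of_nat (count m' i) * c'))"
    proof (cases "i \<in># m'")
      case True
      then obtain m2 where "m' = add_mset i m2" by (meson mset_add)
      then show ?thesis by simp
    next
      case False
      then have "count m' i = 0" by (simp add: not_in_iff)
      then show ?thesis by simp
    qed
    show ?case
      unfolding pderiv_at_single mult_single 1 2 by (simp add: single_add[symmetric] algebra_simps)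
  qed (simp_all add: pderiv_at_add algebra_simps)
qed (simp_all add: pderiv_at_add algebra_simps)

lemma pderiv_at_commute: "pderiv_at i (pderiv_at j p) = pderiv_at j (pderiv_at i p)"
  by (rule poly_mapping_eqI) (auto simp: lookup_pderiv_at add_mset_commute algebra_simps)

subsection \<open>The module generated by the delta function\<close>

text \<open>
  A polynomial in \<open>\<tau>\<close> over \<open>R[x]\<close> stands for \<open>\<Sum> a\<^sub>k \<partial>\<^sub>t\<^sup>k \<delta>(t - g)\<close>. The operators below are the actions of
  \<open>x\<^sub>i\<close>, \<open>\<partial>\<^sub>i\<close>, \<open>\<partial>\<^sub>t\<close> and \<open>s = - \<partial>\<^sub>t t\<close>, by the rules \<open>t \<delta> = g \<delta>\<close> and \<open>\<partial>\<^sub>i \<delta> = - (\<partial>\<^sub>i g) \<partial>\<^sub>t \<delta>\<close>. The operator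
  \<open>euler\<close> is \<open>\<tau> d/d\<tau>\<close>.
\<close>

definition var_op :: "nat \<Rightarrow> 'r::comm_ring_1 mpoly poly \<Rightarrow> 'r mpoly poly" where
  "var_op i z = smult (single {#i#} 1) z"

definition euler :: "'r::comm_ring_1 mpoly poly \<Rightarrow> 'r mpoly poly" where
  "euler z = Abs_poly (\<lambda>k. of_nat k * pcoeff z k)"

lemma coeff_euler [simp]: "pcoeff (euler z) k = of_nat k * pcoeff z k"
proof -
  have "\<forall>\<^sub>\<infinity> k. of_nat k * pcoeff z k = 0"
    using MOST_coeff_eq_0[of z] by (rule eventually_mono) simp
  then show ?thesis unfolding euler_def by (simp add: Abs_poly_inverse)
qed

definition diff_op :: "'r::comm_ring_1 mpoly \<Rightarrow> nat \<Rightarrow> 'r mpoly poly \<Rightarrow> 'r mpoly poly" where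
  "diff_op g i z = map_poly (pderiv_at i) z - pCons 0 (smult (pderiv_at i g) z)"

definition tau_op :: "'r::comm_ring_1 mpoly poly \<Rightarrow> 'r mpoly poly" where
  "tau_op z = pCons 0 z"

definition s_op :: "'r::comm_ring_1 mpoly \<Rightarrow> 'r mpoly poly \<Rightarrow> 'r mpoly poly" where
  "s_op g z = euler z - pCons 0 (smult g z)"

abbreviation cmult :: "'r \<Rightarrow> 'r::comm_ring_1 mpoly poly \<Rightarrow> 'r mpoly poly" where
  "cmult c \<equiv> smult (single 0 c)"

lemma coeff_var_op: "pcoeff (var_op i z) k = single {#i#} 1 * pcoeff z k"
  by (simp add: var_op_def)

lemma coeff_diff_op: "pcoeff (diff_op g i z) k =
    pderiv_at i (pcoeff z k) - (if k = 0 then 0 else pderiv_at i g * pcoeff z (k - 1))"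
  by (cases k) (simp_all add: diff_op_def coeff_map_poly)

lemma coeff_tau_op: "pcoeff (tau_op z) k = (if k = 0 then 0 else pcoeff z (k - 1))"
  by (cases k) (simp_all add: tau_op_def)

lemma coeff_s_op: "pcoeff (s_op g z) k =
    of_nat k * pcoeff z k - (if k = 0 then 0 else g * pcoeff z (k - 1))"
  by (cases k) (simp_all add: s_op_def)

lemmas coeff_ops = coeff_var_op coeff_diff_op coeff_tau_op coeff_s_op

lemma ops_add:
  "var_op i (y + z) = var_op i y + var_op i z"
  "diff_op g i (y + z) = diff_op g i y + diff_op g i z"
  "tau_op (y + z) = tau_op y + tau_op z"
  "s_op g (y + z) = s_op g y + s_op g z"
  by (rule poly_eqI; simp add: coeff_ops pderiv_at_add algebra_simps)+

lemma ops_zero [simp]: "var_op i 0 = 0" "diff_op g i 0 = 0" "tau_op 0 = 0" "s_op g 0 = 0"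
  by (rule poly_eqI; simp add: coeff_ops)+

lemma ops_cmult:
  "var_op i (cmult c z) = cmult c (var_op i z)"
  "diff_op g i (cmult c z) = cmult c (diff_op g i z)"
  "tau_op (cmult c z) = cmult c (tau_op z)"
  "s_op g (cmult c z) = cmult c (s_op g z)"
  by (rule poly_eqI; simp add: coeff_ops pderiv_at_mult algebra_simps)+

lemma ops_diff:
  "var_op i (y - z) = var_op i y - var_op i z"
  "diff_op g i (y - z) = diff_op g i y - diff_op g i z"
  "tau_op (y - z) = tau_op y - tau_op z"
  "s_op g (y - z) = s_op g y - s_op g z"
  by (rule poly_eqI; simp add: coeff_ops pderiv_at_diff algebra_simps)+

lemma diff_op_smult: "diff_op g i (smult a z) = smult a (diff_op g i z) + smult (pderiv_at i a) z"
  by (rule poly_eqI) (simp add: coeff_ops pderiv_at_mult algebra_simps)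

lemma tau_op_smult: "tau_op (smult a z) = smult a (tau_op z)"
  by (rule poly_eqI) (simp add: coeff_ops)

lemma s_op_smult: "s_op g (smult a z) = smult a (s_op g z)"
  by (rule poly_eqI) (simp add: coeff_ops algebra_simps)

lemma diff_op_commute: "diff_op g i (diff_op g j z) = diff_op g j (diff_op g i z)"
proof (rule poly_eqI)
  fix k
  show "pcoeff (diff_op g i (diff_op g j z)) k = pcoeff (diff_op g j (diff_op g i z)) k"
    by (simp add: coeff_ops pderiv_at_diff pderiv_at_mult pderiv_at_commute[of i j] algebra_simps)
qed

lemma tau_op_diff_op: "tau_op (diff_op g i z) = diff_op g i (tau_op z)"
  by (rule poly_eqI) (auto simp add: coeff_ops)

lemma s_op_diff_op: "s_op g (diff_op g i z) = diff_op g i (s_op g z)"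
proof (rule poly_eqI)
  fix k
  have "pderiv_at i (of_nat j :: 'a mpoly) = 0" for j
    by (simp flip: single_of_nat)
  then show "pcoeff (s_op g (diff_op g i z)) k = pcoeff (diff_op g i (s_op g z)) k"
    by (cases k) (auto simp add: coeff_ops pderiv_at_diff pderiv_at_add pderiv_at_mult algebra_simps)
qed

lemma s_op_tau_op: "s_op g (tau_op z) = tau_op (s_op g z) + tau_op z"
proof (rule poly_eqI)
  fix k
  show "pcoeff (s_op g (tau_op z)) k = pcoeff (tau_op (s_op g z) + tau_op z) k"
    by (cases k) (auto simp add: coeff_ops algebra_simps)
qed

declare single_of_nat [simp del]

locale delta_module =
  fixes n :: nat and g :: "'r::comm_ring_1 mpoly"
begin

subsection \<open>Normally ordered differential operators\<close>

text \<open>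
  A multiset of natural numbers encodes a normally ordered monomial in the operators: \<open>0\<close> encodes \<open>s\<close>,
  \<open>2 i + 1\<close> encodes \<open>x\<^sub>i\<close>, \<open>2 i + 2\<close> encodes \<open>\<partial>\<^sub>i\<close> and \<open>2 n + 1\<close> encodes \<open>\<tau>\<close>. In the order of multisets the monomials
  free of \<open>\<tau>\<close> form an initial segment, since \<open>\<tau>\<close> has the largest code, and so do the powers
  \<open>1, s, \<dots>, s\<^sup>j\<^sup>-\<^sup>1\<close>, since \<open>s\<close> has the smallest one. These are the two initial segments into which the
  elimination takes place.
\<close>

definition xpart :: "nat multiset \<Rightarrow> nat multiset" where
  "xpart m = image_mset (\<lambda>v. v div 2) (filter_mset (\<lambda>v. odd v \<and> v < 2 * n + 1) m)"

definition dpart :: "nat multiset \<Rightarrow> nat multiset" where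
  "dpart m = image_mset (\<lambda>v. v div 2 - 1) (filter_mset (\<lambda>v. even v \<and> 0 < v \<and> v < 2 * n + 1) m)"

definition dfold :: "'r mpoly poly \<Rightarrow> nat multiset \<Rightarrow> 'r mpoly poly" where
  "dfold z b = fold_mset (diff_op g) z b"

text \<open>
  The monomial acts as \<open>x\<^sup>a \<partial>\<^sup>b \<tau>\<^sup>c s\<^sup>e\<close>.
\<close>

definition act :: "'r mpoly poly \<Rightarrow> nat multiset \<Rightarrow> 'r mpoly poly" where
  "act z m = smult (single (xpart m) 1)
     (dfold ((tau_op ^^ count m (2 * n + 1)) ((s_op g ^^ count m 0) z)) (dpart m))"

lemma dfold_add_mset: "dfold z (add_mset i b) = diff_op g i (dfold z b)"
proof -
  interpret comp_fun_commute "diff_op g" by standard (auto simp: fun_eq_iff diff_op_commute)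
  show ?thesis by (simp add: dfold_def)
qed

lemma dfold_empty [simp]: "dfold z {#} = z" by (simp add: dfold_def)

lemma dfold_tau_op: "dfold (tau_op z) b = tau_op (dfold z b)"
  by (induction b) (auto simp: dfold_add_mset tau_op_diff_op)

lemma dfold_s_op: "dfold (s_op g z) b = s_op g (dfold z b)"
  by (induction b) (auto simp: dfold_add_mset s_op_diff_op)

lemma dfold_add: "dfold (y + z) b = dfold y b + dfold z b"
  by (induction b) (auto simp: dfold_add_mset ops_add)

lemma dfold_cmult: "dfold (cmult c z) b = cmult c (dfold z b)"
  by (induction b) (auto simp: dfold_add_mset ops_cmult)

lemma xpart_simps:
  "i < n \<Longrightarrow> xpart (add_mset (2 * i + 1) m) = add_mset i (xpart m)"
  "i < n \<Longrightarrow> xpart (add_mset (2 * i + 2) m) = xpart m"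
  "xpart (add_mset 0 m) = xpart m" "xpart (add_mset (2 * n + 1) m) = xpart m"
  by (auto simp: xpart_def)

lemma dpart_simps:
  "i < n \<Longrightarrow> dpart (add_mset (2 * i + 1) m) = dpart m"
  "i < n \<Longrightarrow> dpart (add_mset (2 * i + 2) m) = add_mset i (dpart m)"
  "dpart (add_mset 0 m) = dpart m" "dpart (add_mset (2 * n + 1) m) = dpart m"
  by (auto simp: dpart_def)

lemma count_xpart: "i < n \<Longrightarrow> count (xpart m) i = count m (2 * i + 1)"
proof (induction m)
  case (add v m)
  then show ?case
    by (cases "odd v \<and> v < 2 * n + 1") (auto simp: xpart_def elim!: oddE)
qed (simp add: xpart_def)

lemma act_var: "i < n \<Longrightarrow> act z (add_mset (2 * i + 1) m) = var_op i (act z m)"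
proof -
  assume i: "i < n"
  have ne: "2 * i + 1 \<noteq> 2 * n + 1" "2 * i + 1 \<noteq> 0" using i by auto
  show ?thesis using ne
    unfolding act_def xpart_simps(1)[OF i] dpart_simps(1)[OF i] var_op_def by (simp add: mult_single)
qed

text \<open>
  The commutator of \<open>\<partial>\<^sub>i\<close> with the power of \<open>x\<^sub>i\<close> on its right.
\<close>

lemma act_diff:
  assumes i: "i < n"
  shows "diff_op g i (act z m) =
    act z (add_mset (2 * i + 2) m) + cmult (of_nat (count m (2 * i + 1))) (act z (m - {#2 * i + 1#}))"
proof -
  let ?w = "\<lambda>m. dfold ((tau_op ^^ count m (2 * n + 1)) ((s_op g ^^ count m 0) z)) (dpart m)"
  have ne: "2 * i + 2 \<noteq> 2 * n + 1" "2 * i + 2 \<noteq> 0" by presburger+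
  have 1: "act z (add_mset (2 * i + 2) m) = smult (single (xpart m) 1) (diff_op g i (?w m))"
    using ne unfolding act_def xpart_simps(2)[OF i] dpart_simps(2)[OF i] dfold_add_mset by simp
  have 2: "smult (single (xpart m - {#i#}) (of_nat (count m (2 * i + 1)))) (?w m) =
     cmult (of_nat (count m (2 * i + 1))) (act z (m - {#2 * i + 1#}))"
  proof (cases "2 * i + 1 \<in># m")
    case True
    then obtain m' where m: "m = add_mset (2 * i + 1) m'" by (meson mset_add)
    have ne: "2 * i + 1 \<noteq> 2 * n + 1" "2 * i + 1 \<noteq> 0" using i by auto
    have w: "?w m = ?w m'" using ne unfolding m dpart_simps(1)[OF i] by simp
    have x: "xpart m - {#i#} = xpart m'" unfolding m xpart_simps(1)[OF i] by simp
    have "act z (m - {#2 * i + 1#}) = smult (single (xpart m') 1) (?w m')"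
      unfolding m by (simp add: act_def)
    then show ?thesis unfolding w x by (simp add: mult_single)
  next
    case False
    then have "count m (2 * i + 1) = 0" by (simp add: not_in_iff)
    then show ?thesis by simp
  qed
  show ?thesis
    unfolding act_def[of z m] diff_op_smult pderiv_at_single count_xpart[OF i] mult_1_right 2 1 ..
qed

lemma act_tau: "act z (add_mset (2 * n + 1) m) = tau_op (act z m)"
  by (simp add: act_def xpart_simps[simplified] dpart_simps[simplified] dfold_tau_op tau_op_smult)

lemma s_op_tau_power: "s_op g ((tau_op ^^ k) w) = (tau_op ^^ k) (s_op g w) + cmult (of_nat k) ((tau_op ^^ k) w)"
proof (induction k)
  case (Suc k)
  have "s_op g ((tau_op ^^ Suc k) w) = tau_op (s_op g ((tau_op ^^ k) w)) + tau_op ((tau_op ^^ k) w)"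
    by (simp add: s_op_tau_op)
  also have "\<dots> = (tau_op ^^ Suc k) (s_op g w) + cmult (of_nat (Suc k)) ((tau_op ^^ Suc k) w)"
    by (simp add: Suc.IH ops_add ops_cmult single_add smult_add_left algebra_simps)
  finally show ?case .
qed simp

text \<open>
  The commutator of \<open>s\<close> with the power of \<open>\<tau>\<close> on its right.
\<close>

lemma act_s: "s_op g (act z m) = act z (add_mset 0 m) + cmult (of_nat (count m (2 * n + 1))) (act z m)"
proof -
  let ?b = "dpart m" and ?k = "count m (2 * n + 1)" and ?w = "(s_op g ^^ count m 0) z"
  let ?x = "single (xpart m) 1 :: 'r mpoly"
  have "s_op g (act z m) = smult ?x (dfold (s_op g ((tau_op ^^ ?k) ?w)) ?b)"
    by (simp add: act_def s_op_smult dfold_s_op)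
  also have "\<dots> = smult ?x (dfold ((tau_op ^^ ?k) (s_op g ?w)) ?b) +
      cmult (of_nat ?k) (smult ?x (dfold ((tau_op ^^ ?k) ?w) ?b))"
    by (simp add: s_op_tau_power dfold_add dfold_cmult smult_add_right mult.commute)
  also have "smult ?x (dfold ((tau_op ^^ ?k) (s_op g ?w)) ?b) = act z (add_mset 0 m)"
    by (simp add: act_def xpart_simps dpart_simps)
  finally show ?thesis by (simp add: act_def)
qed

definition ev :: "'r mpoly poly \<Rightarrow> (nat multiset \<Rightarrow>\<^sub>0 'r) \<Rightarrow> 'r mpoly poly" where
  "ev z f = (\<Sum>m\<in>keys f. cmult (lookup f m) (act z m))"

lemma ev_superset:
  assumes "finite A" "keys f \<subseteq> A"
  shows "ev z f = (\<Sum>m\<in>A. cmult (lookup f m) (act z m))"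
  unfolding ev_def by (rule sum.mono_neutral_left) (use assms in \<open>auto simp: in_keys_iff\<close>)

lemma ev_zero [simp]: "ev z 0 = 0" by (simp add: ev_def)

lemma ev_single [simp]: "ev z (single m c) = cmult c (act z m)"
  by (subst ev_superset[of "{m}"]) auto

lemma ev_add: "ev z (f + f') = ev z f + ev z f'"
proof -
  let ?A = "keys f \<union> keys f'"
  have "keys (f + f') \<subseteq> ?A" by (rule keys_add)
  then show ?thesis
    by (simp add: ev_superset[of ?A] lookup_add single_add smult_add_left sum.distrib)
qed

lemma ev_sum: "ev z (sum F A) = (\<Sum>i\<in>A. ev z (F i))"
  by (induction A rule: infinite_finite_induct) (auto simp: ev_add)

lemma ev_scal: "ev z (scal c f) = cmult c (ev z f)"
proof (induction f rule: poly_mapping_additive_induct)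
  case (single m a)
  have "scal c (single m a) = single m (c * a)" by (simp add: scal_def mult_single)
  then show ?case by (simp add: mult_single)
next
  case (add f f')
  have "scal c (f + f') = scal c f + scal c f'" by (simp add: scal_def algebra_simps)
  then show ?case by (simp add: add ev_add smult_add_right)
qed (simp add: scal_def)

lemma ev_diff: "ev z (f - f') = ev z f - ev z f'"
  using ev_add[of z "f - f'" f'] by simp

subsection \<open>Left multiplication by the generators\<close>

definition gen_op :: "nat \<Rightarrow> 'r mpoly poly \<Rightarrow> 'r mpoly poly" where
  "gen_op v z = (if v = 0 then s_op g z else if v = 2 * n + 1 then tau_op z
     else if odd v then var_op (v div 2) z else diff_op g (v div 2 - 1) z)"

text \<open>
  Left multiplication by a generator, rewritten in normal order.
\<close>

definition shift :: "nat \<Rightarrow> (nat multiset \<Rightarrow>\<^sub>0 'r) \<Rightarrow> (nat multiset \<Rightarrow>\<^sub>0 'r)" where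
  "shift v f = single {#v#} 1 * f +
     (if v = 0 then single {#2 * n + 1#} 1 * pderiv_at (2 * n + 1) f
      else if even v then pderiv_at (v - 1) f else 0)"

lemma gen_op_linear: "gen_op v (y + z) = gen_op v y + gen_op v z" "gen_op v 0 = 0"
  "gen_op v (cmult c z) = cmult c (gen_op v z)" "gen_op v (y - z) = gen_op v y - gen_op v z"
  by (simp_all add: gen_op_def ops_add ops_cmult ops_diff)

lemma shift_add: "shift v (f + f') = shift v f + shift v f'"
  by (simp add: shift_def pderiv_at_add algebra_simps)

lemma ev_shift:
  assumes v: "v \<le> 2 * n + 1"
  shows "ev z (shift v f) = gen_op v (ev z f)"
proof (induction f rule: poly_mapping_additive_induct)
  case zero
  show ?case by (simp add: shift_def gen_op_linear)
next
  case (add f f')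
  then show ?case by (simp add: shift_add ev_add gen_op_linear)
next
  case (single m c)
  consider "v = 0" | "v = 2 * n + 1" | i where "v = 2 * i + 1" "i < n" | i where "v = 2 * i + 2" "i < n"
  proof (cases "even v")
    case True
    then show thesis using v that by (cases "v = 0") (auto elim!: evenE intro!: that(4)[of "v div 2 - 1"])
  next
    case False
    then obtain b where "v = 2 * b + 1" by (elim oddE)
    then show thesis using v that(2) that(3)[of b] by (cases "b = n") auto
  qed
  then show ?case
  proof cases
    case 1
    have "single {#2 * n + 1#} 1 * single (m - {#2 * n + 1#}) (of_nat (count m (2 * n + 1)) * c)
        = single m (of_nat (count m (2 * n + 1)) * c)"
      by (cases "2 * n + 1 \<in># m") (simp_all add: mult_single not_in_iff)
    then have "shift v (single m c) = single (add_mset 0 m) c + single m (of_nat (count m (2 * n + 1)) * c)"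
      using 1 by (simp add: shift_def pderiv_at_single mult_single)
    then show ?thesis using 1
      by (simp add: gen_op_def ops_cmult act_s ev_add smult_add_right mult_single mult.commute)
  next
    case 2
    then have "shift v (single m c) = single (add_mset v m) c"
      by (simp add: shift_def mult_single)
    then show ?thesis using 2 act_tau[of z m] by (simp add: gen_op_def ops_cmult)
  next
    case 3
    then have "shift v (single m c) = single (add_mset v m) c"
      by (simp add: shift_def mult_single)
    then show ?thesis using 3 act_var[of i z m] by (simp add: gen_op_def ops_cmult)
  next
    case 4
    then have "shift v (single m c) = single (add_mset v m) c +
        single (m - {#2 * i + 1#}) (of_nat (count m (2 * i + 1)) * c)"
      by (simp add: shift_def pderiv_at_single mult_single)
    moreover have "gen_op v w = diff_op g i w" for w
    proof -
      have "2 * i + 2 \<noteq> 2 * n + 1" by presburger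
      then show ?thesis using 4 by (simp add: gen_op_def)
    qed
    ultimately show ?thesis using 4 act_diff[of i z m]
      by (simp add: ops_cmult ev_add smult_add_right mult_single mult.commute)
  qed
qed

text \<open>
  The corrections that come from normal ordering move a coefficient from a monomial \<open>k'\<close> only to
  divisors \<open>k\<close> of \<open>k'\<close>. So they do not affect leading terms.
\<close>

lemma lookup_shift:
  "\<exists>c k'. k \<subseteq># k' \<and> lookup (shift v f) k = (if v \<in># k then lookup f (k - {#v#}) else 0) + c * lookup f k'"
proof -
  have s: "lookup (single {#v#} 1 * f) k = (if v \<in># k then lookup f (k - {#v#}) else 0)"
    by (simp add: lookup_single_mult)
  consider "v = 0" | "v \<noteq> 0" "even v" | "odd v" by (cases "v = 0") auto
  then show ?thesis
  proof cases
    case 1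
    show ?thesis
    proof (cases "2 * n + 1 \<in># k")
      case True
      then show ?thesis using 1 s
        by (intro exI[of _ "of_nat (Suc (count (k - {#2 * n + 1#}) (2 * n + 1)))"] exI[of _ k])
          (simp add: shift_def lookup_add lookup_single_mult lookup_pderiv_at)
    next
      case False
      then show ?thesis using 1 s
        by (intro exI[of _ 0] exI[of _ k]) (simp add: shift_def lookup_add lookup_single_mult)
    qed
  next
    case 2
    then show ?thesis using s
      by (intro exI[of _ "of_nat (Suc (count k (v - 1)))"] exI[of _ "add_mset (v - 1) k"])
         (simp add: shift_def lookup_add lookup_pderiv_at)
  next
    case 3
    then show ?thesis using s
      by (intro exI[of _ 0] exI[of _ k]) (auto simp add: shift_def lookup_add)
  qed
qed

lemma shift_lead:
  assumes p: "prime_ideal_set p" and f: "lead_monom p f m"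
  shows "lookup (shift v f) (add_mset v m) - lookup f m \<in> p"
    and "lead_monom p (shift v f) (add_mset v m)"
proof -
  note pr = prime_ideal_setD[OF p]
  have congr: "lookup (shift v f) k - (if v \<in># k then lookup f (k - {#v#}) else 0) \<in> p"
    if k: "k \<ge> add_mset v m" for k
  proof -
    obtain c k' where k': "k \<subseteq># k'"
        "lookup (shift v f) k = (if v \<in># k then lookup f (k - {#v#}) else 0) + c * lookup f k'"
      using lookup_shift by blast
    have "m < add_mset v m" by (rule le_multiset_right_total)
    also have "\<dots> \<le> k" by (fact k)
    also have "k \<le> k'" using k'(1) by (rule subset_eq_imp_le_multiset)
    finally have "lookup f k' \<in> p" using f by (auto simp: lead_monom_def)
    then have "c * lookup f k' \<in> p" by (rule pr(4))
    then show ?thesis using k'(2) by simp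
  qed
  show 1: "lookup (shift v f) (add_mset v m) - lookup f m \<in> p" using congr[of "add_mset v m"] by simp
  have "lookup (shift v f) (add_mset v m) \<notin> p"
    using pr(8)[OF _ 1, of "lookup (shift v f) (add_mset v m)"] f by (auto simp: lead_monom_def)
  moreover have "lookup (shift v f) k \<in> p" if k: "k > add_mset v m" for k
  proof -
    have "(if v \<in># k then lookup f (k - {#v#}) else 0) \<in> p"
    proof (cases "v \<in># k")
      case True
      then obtain k' where k': "k = add_mset v k'" by (meson mset_add)
      have "m < k'"
      proof (rule ccontr)
        assume "\<not> m < k'"
        then have "add_mset v k' \<le> add_mset v m" by (intro add_mset_le_right_le) simp
        then show False using k k' by simp
      qed
      then show ?thesis using f k' by (auto simp: lead_monom_def)
    qed (simp add: pr(1))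
    from pr(3)[OF congr[of k] this] k show ?thesis by simp
  qed
  ultimately show "lead_monom p (shift v f) (add_mset v m)" by (auto simp: lead_monom_def)
qed

subsection \<open>Vanishing modulo a prime ideal\<close>

text \<open>
  The polynomials that vanish in \<open>(R/q)[x\<^sub>1, \<dots>, x\<^sub>n]\<close>, the variables other than \<open>x\<^sub>1, \<dots>, x\<^sub>n\<close> being sent to
  \<open>0\<close>.
\<close>

definition kerM :: "'r set \<Rightarrow> 'r mpoly set" where
  "kerM q = {f. \<forall>a. set_mset a \<subseteq> {..<n} \<longrightarrow> lookup f a \<in> q}"

definition kerN :: "'r set \<Rightarrow> 'r mpoly poly set" where
  "kerN q = {z. \<forall>k. pcoeff z k \<in> kerM q}"

lemma kerM_closed:
  assumes q: "prime_ideal_set q"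
  shows "0 \<in> kerM q" "a \<in> kerM q \<Longrightarrow> b \<in> kerM q \<Longrightarrow> a + b \<in> kerM q"
    "a \<in> kerM q \<Longrightarrow> b \<in> kerM q \<Longrightarrow> a - b \<in> kerM q" "b \<in> kerM q \<Longrightarrow> a * b \<in> kerM q"
    "b \<in> kerM q \<Longrightarrow> i < n \<Longrightarrow> pderiv_at i b \<in> kerM q"
    "c \<in> q \<Longrightarrow> single m c \<in> kerM q"
proof -
  note qr = prime_ideal_setD[OF q]
  show "0 \<in> kerM q" "a \<in> kerM q \<Longrightarrow> b \<in> kerM q \<Longrightarrow> a + b \<in> kerM q"
    "a \<in> kerM q \<Longrightarrow> b \<in> kerM q \<Longrightarrow> a - b \<in> kerM q"
    "b \<in> kerM q \<Longrightarrow> i < n \<Longrightarrow> pderiv_at i b \<in> kerM q" "c \<in> q \<Longrightarrow> single m c \<in> kerM q"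
    by (auto simp: kerM_def lookup_add lookup_minus lookup_pderiv_at lookup_single when_def qr)
  show "a * b \<in> kerM q" if b: "b \<in> kerM q"
  proof (induction a rule: poly_mapping_additive_induct)
    case (single m c)
    show ?case
      unfolding kerM_def
    proof (clarify)
      fix k :: "nat multiset" assume "set_mset k \<subseteq> {..<n}"
      then have "set_mset (k - m) \<subseteq> {..<n}" by (meson in_diffD subset_iff)
      then have "lookup b (k - m) \<in> q" using b by (auto simp: kerM_def)
      then show "lookup (single m c * b) k \<in> q"
        by (simp add: lookup_single_mult qr(1) qr(4))
    qed
  qed (auto simp: kerM_def lookup_add algebra_simps qr)
qed

lemma kerN_closed:
  assumes q: "prime_ideal_set q"
  shows "0 \<in> kerN q" "y \<in> kerN q \<Longrightarrow> z \<in> kerN q \<Longrightarrow> y + z \<in> kerN q"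
    "y \<in> kerN q \<Longrightarrow> z \<in> kerN q \<Longrightarrow> y - z \<in> kerN q" "z \<in> kerN q \<Longrightarrow> smult a z \<in> kerN q"
    "c \<in> q \<Longrightarrow> cmult c w \<in> kerN q"
    "z \<in> kerN q \<Longrightarrow> v \<le> 2 * n + 1 \<Longrightarrow> gen_op v z \<in> kerN q"
proof -
  note kr = kerM_closed[OF q]
  show "0 \<in> kerN q" "y \<in> kerN q \<Longrightarrow> z \<in> kerN q \<Longrightarrow> y + z \<in> kerN q"
    "y \<in> kerN q \<Longrightarrow> z \<in> kerN q \<Longrightarrow> y - z \<in> kerN q" "z \<in> kerN q \<Longrightarrow> smult a z \<in> kerN q"
    by (simp_all add: kerN_def kr)
  show "cmult c w \<in> kerN q" if "c \<in> q"
  proof -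
    have "pcoeff w k * single 0 c \<in> kerM q" for k by (rule kr(4)[OF kr(6)[OF that]])
    then show ?thesis by (simp add: kerN_def mult.commute)
  qed
  show "gen_op v z \<in> kerN q" if z: "z \<in> kerN q" and v: "v \<le> 2 * n + 1"
  proof -
    have zk: "pcoeff z k \<in> kerM q" for k using z by (simp add: kerN_def)
    have "pderiv_at (v div 2 - 1) (pcoeff z k) \<in> kerM q" if "v \<noteq> 0" "even v" for k
      by (rule kr(5)[OF zk]) (use v that in presburger)
    then show ?thesis
      unfolding kerN_def gen_op_def by (auto simp: coeff_ops kr zk)
  qed
qed

lemma ev_coeffs_in:
  assumes q: "prime_ideal_set q" and f: "f \<in> coeffs_in q"
  shows "ev z f \<in> kerN q"
proof -
  have "(\<Sum>m\<in>A. cmult (lookup f m) (act z m)) \<in> kerN q" if "finite A" for A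
    using that f by (induction A rule: finite_induct)
      (auto intro: kerN_closed[OF q] simp: coeffs_in_def)
  then show ?thesis by (simp add: ev_def)
qed

definition supported_mod :: "'r set \<Rightarrow> nat set \<Rightarrow> (nat multiset \<Rightarrow>\<^sub>0 'r) set" where
  "supported_mod p V = {f. \<forall>m. \<not> set_mset m \<subseteq> V \<longrightarrow> lookup f m \<in> p}"

lemma supported_mod_closed:
  assumes p: "prime_ideal_set p"
  shows "f \<in> supported_mod p V \<Longrightarrow> f' \<in> supported_mod p V \<Longrightarrow> f + f' \<in> supported_mod p V"
    "f \<in> supported_mod p V \<Longrightarrow> f' \<in> supported_mod p V \<Longrightarrow> f - f' \<in> supported_mod p V"
    "f \<in> supported_mod p V \<Longrightarrow> scal a f \<in> supported_mod p V"
    "f \<in> coeffs_in p \<Longrightarrow> f \<in> supported_mod p V"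
    "f \<in> supported_mod p V \<Longrightarrow> lead_monom p f m \<Longrightarrow> set_mset m \<subseteq> V"
  using prime_ideal_setD[OF p]
  by (auto simp: supported_mod_def lookup_add lookup_minus coeffs_in_def lead_monom_def)

lemma supported_mod_shift:
  assumes z: "0 \<in> p" and a: "\<And>a b. a \<in> p \<Longrightarrow> b \<in> p \<Longrightarrow> a + b \<in> p"
    and m: "\<And>a b. b \<in> p \<Longrightarrow> a * b \<in> p"
    and f: "f \<in> supported_mod p V" and v: "v \<in> V"
  shows "shift v f \<in> supported_mod p V"
  unfolding supported_mod_def
proof (intro CollectI allI impI)
  fix m assume "\<not> set_mset m \<subseteq> V"
  then obtain x where x: "x \<in># m" "x \<notin> V" by blast
  obtain c k' where k': "m \<subseteq># k'"
      "lookup (shift v f) m = (if v \<in># m then lookup f (m - {#v#}) else 0) + c * lookup f k'"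
    using lookup_shift by blast
  have "\<not> set_mset k' \<subseteq> V" using k'(1) x by (meson mset_subset_eqD subsetD)
  then have 1: "c * lookup f k' \<in> p" using f by (auto simp: supported_mod_def intro!: m)
  have "x \<in># m - {#v#}" using x v by (cases "x = v") (auto simp: in_diff_count)
  then have "\<not> set_mset (m - {#v#}) \<subseteq> V" using x by blast
  then have "lookup f (m - {#v#}) \<in> p" using f by (auto simp: supported_mod_def)
  then show "lookup (shift v f) m \<in> p" using 1 by (simp add: k'(2) a z)
qed

subsection \<open>Eliminating the variable tau\<close>

text \<open>
  The operators, with \<open>\<tau>\<close>, that annihilate the delta function modulo \<open>p\<close>.
\<close>

definition ann_ideal :: "'r set \<Rightarrow> (nat multiset \<Rightarrow>\<^sub>0 'r) set" where
  "ann_ideal p = {f \<in> supported_mod p {..2 * n + 1}. ev 1 f \<in> kerN p}"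

lemma ann_ideal_module:
  assumes p: "prime_ideal_set p"
  shows "shift_closed_module p (ann_ideal p) {..2 * n + 1} shift"
proof
  note sm = supported_mod_closed[OF p] and kr = kerN_closed[OF p]
  note pr = prime_ideal_setD(1,3,4)[OF p]
  show "prime_ideal_set p" by (fact p)
  show "f + f' \<in> ann_ideal p" if "f \<in> ann_ideal p" "f' \<in> ann_ideal p" for f f'
    using that by (auto simp: ann_ideal_def ev_add sm kr)
  show "scal a f \<in> ann_ideal p" if "f \<in> ann_ideal p" for f a
    using that by (auto simp: ann_ideal_def ev_scal sm kr)
  show "coeffs_in p \<subseteq> ann_ideal p" by (auto simp: ann_ideal_def sm ev_coeffs_in[OF p])
  show "set_mset m \<subseteq> {..2 * n + 1}" if "f \<in> ann_ideal p" "lead_monom p f m" for f m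
    using that sm(5) unfolding ann_ideal_def by blast
  show "shift v f \<in> ann_ideal p" if "f \<in> ann_ideal p" "v \<in> {..2 * n + 1}" for f v
    using that by (auto simp: ann_ideal_def ev_shift kr intro: supported_mod_shift pr)
  show "lead_monom p (shift v f) (add_mset v m)" if "lead_monom p f m" for f v m
    using shift_lead(2)[OF p that] .
  show "lookup (shift v f) (add_mset v m) - lookup f m \<in> p" if "lead_monom p f m" for f v m
    using shift_lead(1)[OF p that] .
qed simp

definition section_monom :: "nat multiset \<Rightarrow> nat \<Rightarrow> nat multiset" where
  "section_monom a k = image_mset (\<lambda>i. 2 * i + 1) a + replicate_mset k (2 * n + 1)"

text \<open>
  Every element \<open>\<Sum> a\<^sub>k(x) \<tau>\<^sup>k\<close> of the module is obtained from the delta function by the operator with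
  the same name. Its coefficients are those of the element, so that it vanishes modulo \<open>q\<close> together
  with the element.
\<close>

definition section_map :: "'r mpoly poly \<Rightarrow> (nat multiset \<Rightarrow>\<^sub>0 'r)" where
  "section_map z = (\<Sum>k\<le>Polynomial.degree z. \<Sum>a\<in>{a \<in> keys (pcoeff z k). set_mset a \<subseteq> {..<n}}.
     single (section_monom a k) (lookup (pcoeff z k) a))"

lemma act_section_monom:
  assumes "set_mset a \<subseteq> {..<n}"
  shows "act 1 (section_monom a k) = Polynomial.monom (single a 1) k"
proof -
  have x: "xpart (section_monom a k) = a"
    using assms by (induction a) (auto simp: xpart_def section_monom_def)
  have d: "dpart (section_monom a k) = {#}"
    by (induction a) (auto simp: dpart_def section_monom_def)
  have t: "count (section_monom a k) (2 * n + 1) = k"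
    using assms by (induction a) (auto simp: section_monom_def)
  have s: "count (section_monom a k) 0 = 0"
    by (auto simp: section_monom_def not_in_iff[symmetric])
  have "(tau_op ^^ k) 1 = Polynomial.monom (1 :: 'r mpoly) k"
    by (induction k) (auto simp: tau_op_def monom_Suc)
  then show ?thesis unfolding act_def x d t s by (simp add: smult_monom)
qed

lemma section_map_supported:
  assumes m: "\<not> set_mset m \<subseteq> {..2 * n + 1}"
  shows "lookup (section_map z) m = 0"
proof -
  have "section_monom a k \<noteq> m" if "set_mset a \<subseteq> {..<n}" for a k
  proof
    assume e: "section_monom a k = m"
    have "i \<le> n" if "i \<in># a" for i using \<open>set_mset a \<subseteq> {..<n}\<close> that by force
    then show False using m by (auto simp: e[symmetric] section_monom_def split: if_splits)
  qed
  then show ?thesis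
    by (auto simp: section_map_def lookup_sum lookup_single when_def intro!: sum.neutral)
qed

lemma section_map_coeffs_in:
  assumes q: "prime_ideal_set q" and z: "z \<in> kerN q"
  shows "section_map z \<in> coeffs_in q"
  using z unfolding coeffs_in_def section_map_def
  by (auto simp: lookup_sum lookup_single when_def kerN_def kerM_def prime_ideal_setD(1)[OF q]
      intro!: prime_ideal_set_sum[OF q])

lemma ev_section_map:
  assumes q: "prime_ideal_set q"
  shows "z - ev 1 (section_map z) \<in> kerN q"
proof -
  let ?K = "\<lambda>k. {a \<in> keys (pcoeff z k). set_mset a \<subseteq> {..<n}}"
  have "ev 1 (section_map z) = (\<Sum>k\<le>Polynomial.degree z. \<Sum>a\<in>?K k.
      Polynomial.monom (single a (lookup (pcoeff z k) a)) k)"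
    unfolding section_map_def ev_sum
    by (intro sum.cong refl) (simp add: act_section_monom smult_monom mult_single)
  also have "\<dots> = (\<Sum>k\<le>Polynomial.degree z. Polynomial.monom (\<Sum>a\<in>?K k. single a (lookup (pcoeff z k) a)) k)"
    by (simp add: monom_sum)
  finally have e: "pcoeff (ev 1 (section_map z)) j =
      (if j \<le> Polynomial.degree z then \<Sum>a\<in>?K j. single a (lookup (pcoeff z j) a) else 0)" for j
    by (simp add: Polynomial.coeff_sum)
  have l: "lookup (\<Sum>a\<in>?K j. single a (lookup (pcoeff z j) a)) b = lookup (pcoeff z j) b"
    if b: "set_mset b \<subseteq> {..<n}" for b j
  proof -
    have "lookup (\<Sum>a\<in>?K j. single a (lookup (pcoeff z j) a)) b =
        (\<Sum>a\<in>?K j. if a = b then lookup (pcoeff z j) a else 0)"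
      by (simp add: lookup_sum lookup_single when_def)
    also have "\<dots> = (if b \<in> ?K j then lookup (pcoeff z j) b else 0)" by (rule sum.delta) simp
    finally show ?thesis using b by (auto simp: in_keys_iff)
  qed
  show ?thesis
    unfolding kerN_def kerM_def
    by (auto simp: e l lookup_minus prime_ideal_setD(1)[OF q] coeff_eq_0)
qed

lemma multiset_initial_segment:
  fixes m m' :: "nat multiset"
  assumes "m' \<le> m" "\<forall>x\<in>#m. x < c"
  shows "\<forall>x\<in>#m'. x < c"
proof (cases "m' = m")
  case False
  then have "m' < m" using assms(1) by simp
  then obtain A B where "A \<subseteq># m" "m' = (m - A) + B" "\<forall>k. k \<in># B \<longrightarrow> (\<exists>a. a \<in># A \<and> k < a)"
    unfolding less_multiset\<^sub>D\<^sub>M by blast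
  then show ?thesis using assms(2)
    by (metis in_diffD mset_subset_eqD order.strict_trans union_iff)
qed (use assms in simp)

text \<open>
  If \<open>f\<close> is free of \<open>\<tau>\<close> and annihilates \<open>\<delta>\<close> modulo \<open>q\<close>, subtract the operator of \<open>section_map\<close> with
  the same effect on \<open>\<delta>\<close>. The difference annihilates \<open>\<delta>\<close> over \<open>R\<close> and is congruent to \<open>f\<close>
  modulo \<open>q\<close>, but it contains \<open>\<tau>\<close>. Eliminating \<open>\<tau>\<close> again gives a lift of \<open>f\<close> to the annihilator of
  \<open>\<delta>\<close> that is free of \<open>\<tau>\<close>.
\<close>

lemma annihilator_specializes:
  assumes p: "prime_ideal_set p"
  shows "\<exists>h. h \<notin> p \<and> (\<forall>q f. prime_ideal_set q \<longrightarrow> p \<subseteq> q \<longrightarrow> h \<notin> q \<longrightarrow>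
     f \<in> supported_mod q {..2 * n} \<longrightarrow> ev 1 f \<in> kerN q \<longrightarrow>
     (\<exists>u l. u \<notin> q \<and> l \<in> ann_ideal p \<and> (\<forall>m. \<not> set_mset m \<subseteq> {..2 * n} \<longrightarrow> lookup l m = 0) \<and>
        scal u f - l \<in> coeffs_in q))"
proof -
  interpret shift_closed_module p "ann_ideal p" "{..2 * n + 1}" shift
    by (rule ann_ideal_module[OF p])
  let ?Init = "{m :: nat multiset. set_mset m \<subseteq> {..2 * n}}"
  have Init: "m' \<in> ?Init" if "m \<in> ?Init" "m' \<le> m" for m m'
    using that multiset_initial_segment[of m' m "2 * n + 1"] by (auto simp: less_Suc_eq_le subset_iff)
  obtain h where el: "eliminates p (ann_ideal p) h" using elimination by blast
  then have h: "h \<notin> p" by (simp add: eliminates_def)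
  show ?thesis
  proof (rule exI[of _ h], intro conjI allI impI h)
    fix q f
    assume q: "prime_ideal_set q" "p \<subseteq> q" "h \<notin> q"
      and f: "f \<in> supported_mod q {..2 * n}" "ev 1 f \<in> kerN q"
    \<comment> \<open>\<open>f\<close> without the monomials that are not free of \<open>\<tau>\<close>, whose coefficients are in \<open>q\<close>\<close>
    define f0 where "f0 = (\<Sum>m\<in>keys f \<inter> {m. set_mset m \<subseteq> {..2 * n}}. single m (lookup f m))"
    have lf0: "lookup f0 m = (if set_mset m \<subseteq> {..2 * n} then lookup f m else 0)" for m
    proof -
      have "lookup f0 m = (\<Sum>k\<in>keys f \<inter> {m. set_mset m \<subseteq> {..2 * n}}. if k = m then lookup f k else 0)"
        by (simp add: f0_def lookup_sum lookup_single when_def)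
      also have "\<dots> = (if m \<in> keys f \<inter> {m. set_mset m \<subseteq> {..2 * n}} then lookup f m else 0)"
        by (rule sum.delta) simp
      finally show ?thesis by (auto simp: in_keys_iff)
    qed
    have ff0: "f - f0 \<in> coeffs_in q"
      using f(1) prime_ideal_setD(1)[OF q(1)] by (auto simp: coeffs_in_def supported_mod_def lookup_minus lf0)
    have "ev 1 f - ev 1 (f - f0) \<in> kerN q"
      by (intro kerN_closed(3)[OF q(1)] f(2) ev_coeffs_in[OF q(1)] ff0)
    then have f0: "ev 1 f0 \<in> kerN q" by (simp add: ev_diff)
    define l where "l = f0 - section_map (ev 1 f0)"
    have "ev 1 l \<in> kerN p"
      using ev_section_map[OF p, of "ev 1 f0"] by (simp add: l_def ev_diff)
    moreover have "lookup l m = 0" if "\<not> set_mset m \<subseteq> {..2 * n + 1}" for m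
    proof -
      have "\<not> set_mset m \<subseteq> {..2 * n}" using that by force
      then show ?thesis using section_map_supported[of m "ev 1 f0"] that
        by (auto simp: l_def lookup_minus lf0)
    qed
    ultimately have l: "l \<in> ann_ideal p"
      using prime_ideal_setD(1)[OF p] by (auto simp: ann_ideal_def supported_mod_def)
    have "(f - f0) + section_map (ev 1 f0) \<in> coeffs_in q"
      by (intro coeffs_in_closed(1)[OF q(1)] ff0 section_map_coeffs_in[OF q(1) f0])
    then have "scal 1 f - l \<in> coeffs_in q" by (simp add: l_def scal_def algebra_simps)
    have fI: "lookup f m \<in> q" if "m \<notin> ?Init" for m using f(1) that by (simp add: supported_mod_def)
    obtain u' l' where "u' \<notin> q" "l' \<in> ann_ideal p" "\<And>m. m \<notin> ?Init \<Longrightarrow> lookup l' m = 0"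
        "scal u' f - l' \<in> coeffs_in q"
      by (rule eliminatesD[OF el q Init fI prime_ideal_setD(2)[OF q(1)] l
            \<open>scal 1 f - l \<in> coeffs_in q\<close>]) blast+
    then show "\<exists>u l. u \<notin> q \<and> l \<in> ann_ideal p \<and> (\<forall>m. \<not> set_mset m \<subseteq> {..2 * n} \<longrightarrow> lookup l m = 0) \<and>
        scal u f - l \<in> coeffs_in q"
      by (intro exI[of _ u'] exI[of _ l']) simp
  qed
qed

subsection \<open>The submodule generated by \<open>g\<close>\<close>

text \<open>
  \<open>D[s] g \<delta>\<close>, which corresponds to \<open>D[s] g\<^sup>s\<^sup>+\<^sup>1\<close>. The generators with code at most \<open>2 n\<close> are all but \<open>\<tau>\<close>.
\<close>

inductive_set dmod :: "'r mpoly poly set" where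
  base: "[:g:] \<in> dmod"
| add: "y \<in> dmod \<Longrightarrow> z \<in> dmod \<Longrightarrow> y + z \<in> dmod"
| cmult: "y \<in> dmod \<Longrightarrow> cmult c y \<in> dmod"
| gen: "y \<in> dmod \<Longrightarrow> v \<le> 2 * n \<Longrightarrow> gen_op v y \<in> dmod"

lemma dmod_zero: "0 \<in> dmod"
  using dmod.cmult[OF dmod.base, of 0] by simp

lemma dmod_ev:
  assumes g: "keys g \<subseteq> {a. set_mset a \<subseteq> {..<n}}" and y: "y \<in> dmod"
  shows "\<exists>f \<in> supported_mod {0} {..2 * n}. ev 1 f = y"
  using y
proof (induction rule: dmod.induct)
  case base
  define f where "f = (\<Sum>a\<in>keys g. single (section_monom a 0) (lookup g a))"
  have "ev 1 f = (\<Sum>a\<in>keys g. [:single a (lookup g a):])"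
    unfolding f_def ev_sum
    by (intro sum.cong refl) (use g in \<open>simp add: act_section_monom subset_iff mult_single monom_0\<close>)
  also have "\<dots> = [:\<Sum>a\<in>keys g. single a (lookup g a):]"
  proof -
    have "(\<Sum>a\<in>A. [:F a:]) = [:\<Sum>a\<in>A. F a:]" for A and F :: "nat multiset \<Rightarrow> 'r mpoly"
      by (induction A rule: infinite_finite_induct) auto
    then show ?thesis .
  qed
  finally have "ev 1 f = [:g:]" by (simp flip: poly_mapping_sum_single)
  moreover have "f \<in> supported_mod {0} {..2 * n}"
  proof -
    have "set_mset (section_monom a 0) \<subseteq> {..2 * n}" if "a \<in> keys g" for a
      using g that by (force simp: section_monom_def)
    then have ne: "section_monom a 0 \<noteq> m" if "\<not> set_mset m \<subseteq> {..2 * n}" "a \<in> keys g" for a m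
      using that by blast
    show ?thesis
      unfolding supported_mod_def
    proof (intro CollectI allI impI)
      fix m :: "nat multiset" assume m: "\<not> set_mset m \<subseteq> {..2 * n}"
      have "lookup f m = (\<Sum>a\<in>keys g. if section_monom a 0 = m then lookup g a else 0)"
        by (simp add: f_def lookup_sum lookup_single when_def)
      also have "\<dots> = 0" by (intro sum.neutral ballI) (simp add: ne[OF m])
      finally show "lookup f m \<in> {0}" by simp
    qed
  qed
  ultimately show ?case by blast
next
  case (add y z)
  then obtain f f' where "f \<in> supported_mod {0} {..2 * n}" "ev 1 f = y"
    "f' \<in> supported_mod {0} {..2 * n}" "ev 1 f' = z" by blast
  then show ?case by (intro bexI[of _ "f + f'"]) (auto simp: ev_add supported_mod_def lookup_add)
next
  case (cmult y c)
  then obtain f where "f \<in> supported_mod {0} {..2 * n}" "ev 1 f = y" by blast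
  then show ?case by (intro bexI[of _ "scal c f"]) (auto simp: ev_scal supported_mod_def)
next
  case (gen y v)
  then obtain f where "f \<in> supported_mod {0} {..2 * n}" "ev 1 f = y" by blast
  then show ?case using gen by (intro bexI[of _ "shift v f"] supported_mod_shift) (auto simp: ev_shift)
qed

text \<open>
  The operators free of \<open>\<tau>\<close> that take \<open>\<delta>\<close> into \<open>D[s] g \<delta>\<close> modulo \<open>p\<close>. It is the sum of \<open>D[s] g\<close> and the
  annihilator of \<open>\<delta>\<close> in \<open>D[s]\<close>.
\<close>

definition bs_module :: "'r set \<Rightarrow> (nat multiset \<Rightarrow>\<^sub>0 'r) set" where
  "bs_module p = {f \<in> supported_mod p {..2 * n}. \<exists>y\<in>dmod. ev 1 f - y \<in> kerN p}"

lemma bs_module_closed: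
  assumes p: "prime_ideal_set p"
  shows "f \<in> bs_module p \<Longrightarrow> f' \<in> bs_module p \<Longrightarrow> f + f' \<in> bs_module p"
    "f \<in> bs_module p \<Longrightarrow> scal a f \<in> bs_module p"
    "f \<in> coeffs_in p \<Longrightarrow> f \<in> bs_module p"
    "f \<in> bs_module p \<Longrightarrow> v \<le> 2 * n \<Longrightarrow> shift v f \<in> bs_module p"
proof -
  note sm = supported_mod_closed[OF p] and kr = kerN_closed[OF p] and pr = prime_ideal_setD(1,3,4)[OF p]
  show "f + f' \<in> bs_module p" if f: "f \<in> bs_module p" "f' \<in> bs_module p"
  proof -
    obtain y y' where "y \<in> dmod" "y' \<in> dmod" "ev 1 f - y \<in> kerN p" "ev 1 f' - y' \<in> kerN p"
      using f by (auto simp: bs_module_def)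
    then have "y + y' \<in> dmod" "(ev 1 f - y) + (ev 1 f' - y') \<in> kerN p" by (auto intro: dmod.add kr)
    then have "y + y' \<in> dmod" "ev 1 (f + f') - (y + y') \<in> kerN p" by (simp_all add: ev_add algebra_simps)
    then show ?thesis using f by (auto simp: bs_module_def sm)
  qed
  show "scal a f \<in> bs_module p" if f: "f \<in> bs_module p"
  proof -
    obtain y where "y \<in> dmod" "ev 1 f - y \<in> kerN p" using f by (auto simp: bs_module_def)
    then have "cmult a y \<in> dmod" "cmult a (ev 1 f - y) \<in> kerN p" by (auto intro: dmod.cmult kr)
    then have "cmult a y \<in> dmod" "ev 1 (scal a f) - cmult a y \<in> kerN p"
      by (simp_all add: ev_scal smult_diff_right)
    then show ?thesis using f by (auto simp: bs_module_def sm)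
  qed
  show "f \<in> bs_module p" if "f \<in> coeffs_in p"
    using ev_coeffs_in[OF p that, of 1] sm(4)[OF that] dmod_zero
    unfolding bs_module_def by (auto intro: bexI[of _ 0])
  show "shift v f \<in> bs_module p" if f: "f \<in> bs_module p" and v: "v \<le> 2 * n"
  proof -
    obtain y where "y \<in> dmod" "ev 1 f - y \<in> kerN p" using f by (auto simp: bs_module_def)
    then have "gen_op v y \<in> dmod" "gen_op v (ev 1 f - y) \<in> kerN p"
      using v by (auto intro: dmod.gen kr)
    then have "gen_op v y \<in> dmod" "ev 1 (shift v f) - gen_op v y \<in> kerN p"
      using v by (simp_all add: ev_shift gen_op_linear)
    moreover have "shift v f \<in> supported_mod p {..2 * n}"
      using f v by (intro supported_mod_shift pr) (auto simp: bs_module_def)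
    ultimately show ?thesis by (auto simp: bs_module_def)
  qed
qed

lemma bs_module_module:
  assumes p: "prime_ideal_set p"
  shows "shift_closed_module p (bs_module p) {..2 * n} shift"
proof
  show "prime_ideal_set p" by (fact p)
  show "set_mset m \<subseteq> {..2 * n}" if "f \<in> bs_module p" "lead_monom p f m" for f m
    using that supported_mod_closed(5)[OF p] unfolding bs_module_def by blast
  show "lead_monom p (shift v f) (add_mset v m)" if "lead_monom p f m" for f v m
    using shift_lead(2)[OF p that] .
  show "lookup (shift v f) (add_mset v m) - lookup f m \<in> p" if "lead_monom p f m" for f v m
    using shift_lead(1)[OF p that] .
qed (auto simp: bs_module_closed[OF p])

text \<open>
  The part in \<open>D[s] g\<close> of an element over \<open>q\<close> lifts to \<open>R\<close> as it is, and the rest annihilates \<open>\<delta>\<close>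
  modulo \<open>q\<close> and lifts by \<open>annihilator_specializes\<close>. A second elimination brings the lift into
  \<open>Init\<close>.
\<close>

lemma bs_module_specializes:
  assumes p: "prime_ideal_set p"
    and g: "keys g \<subseteq> {a. set_mset a \<subseteq> {..<n}}"
  shows "\<exists>h. h \<notin> p \<and> (\<forall>q f Init. prime_ideal_set q \<longrightarrow> p \<subseteq> q \<longrightarrow> h \<notin> q \<longrightarrow>
     (\<forall>m m'. m \<in> Init \<longrightarrow> m' \<le> m \<longrightarrow> m' \<in> Init) \<longrightarrow>
     f \<in> bs_module q \<longrightarrow> (\<forall>m. m \<notin> Init \<longrightarrow> lookup f m \<in> q) \<longrightarrow>
     (\<exists>u l. u \<notin> q \<and> l \<in> bs_module p \<and> (\<forall>m. m \<notin> Init \<longrightarrow> lookup l m = 0) \<and>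
        scal u f - l \<in> coeffs_in q))"
proof -
  interpret shift_closed_module p "bs_module p" "{..2 * n}" shift
    by (rule bs_module_module[OF p])
  obtain h1 where el: "eliminates p (bs_module p) h1" using elimination by blast
  then have h1: "h1 \<notin> p" by (simp add: eliminates_def)
  obtain h2 where h2: "h2 \<notin> p" and ann: "\<And>q f. prime_ideal_set q \<Longrightarrow> p \<subseteq> q \<Longrightarrow> h2 \<notin> q \<Longrightarrow>
     f \<in> supported_mod q {..2 * n} \<Longrightarrow> ev 1 f \<in> kerN q \<Longrightarrow>
     \<exists>u l. u \<notin> q \<and> l \<in> ann_ideal p \<and> (\<forall>m. \<not> set_mset m \<subseteq> {..2 * n} \<longrightarrow> lookup l m = 0) \<and>
        scal u f - l \<in> coeffs_in q"
    using annihilator_specializes[OF p] by (elim exE conjE) (rule that, auto)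
  show ?thesis
  proof (rule exI[of _ "h1 * h2"], intro conjI allI impI)
    show "h1 * h2 \<notin> p" using prime_ideal_setD(6)[OF p h1 h2] .
    fix q f Init
    assume q: "prime_ideal_set q" "p \<subseteq> q" "h1 * h2 \<notin> q"
      and Init: "\<forall>m m'. m \<in> Init \<longrightarrow> m' \<le> m \<longrightarrow> m' \<in> Init"
      and f: "f \<in> bs_module q" "\<forall>m. m \<notin> Init \<longrightarrow> lookup f m \<in> q"
    note qr = prime_ideal_setD[OF q(1)]
    have hq: "h1 \<notin> q" "h2 \<notin> q" using q(3) qr(4)[of h2 h1] qr(5)[of h1 h2] by auto
    obtain y where y: "y \<in> dmod" "ev 1 f - y \<in> kerN q" using f(1) by (auto simp: bs_module_def)
    obtain y' where y': "y' \<in> supported_mod {0} {..2 * n}" "ev 1 y' = y" using dmod_ev[OF g y(1)] by blast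
    have "f - y' \<in> supported_mod q {..2 * n}"
      using f(1) y'(1) by (auto simp: supported_mod_def bs_module_def lookup_minus)
    moreover have "ev 1 (f - y') \<in> kerN q" using y(2) by (simp add: ev_diff y'(2))
    ultimately obtain u l where ul: "u \<notin> q" "l \<in> ann_ideal p"
        "\<forall>m. \<not> set_mset m \<subseteq> {..2 * n} \<longrightarrow> lookup l m = 0" "scal u (f - y') - l \<in> coeffs_in q"
      using ann[OF q(1,2) hq(2)] by blast
    have "ev 1 (l + scal u y') - cmult u y \<in> kerN p"
      using ul(2) by (simp add: ev_add ev_scal y'(2) ann_ideal_def)
    moreover have "l + scal u y' \<in> supported_mod p {..2 * n}"
      using ul(3) y'(1) prime_ideal_setD(1)[OF p] by (auto simp: supported_mod_def lookup_add)
    ultimately have l: "l + scal u y' \<in> bs_module p"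
      using dmod.cmult[OF y(1)] by (auto simp: bs_module_def)
    have c: "scal u f - (l + scal u y') \<in> coeffs_in q"
      using ul(4) by (simp add: scal_def algebra_simps)
    obtain u' l' where "u' \<notin> q" "l' \<in> bs_module p" "\<And>m. m \<notin> Init \<Longrightarrow> lookup l' m = 0"
        "scal u' f - l' \<in> coeffs_in q"
      by (rule eliminatesD[OF el q(1,2) hq(1) _ _ ul(1) l c, of Init]) (use Init f(2) in blast)+
    then show "\<exists>u l. u \<notin> q \<and> l \<in> bs_module p \<and> (\<forall>m. m \<notin> Init \<longrightarrow> lookup l m = 0) \<and>
        scal u f - l \<in> coeffs_in q"
      by (intro exI[of _ u'] exI[of _ l']) simp
  qed
qed

subsection \<open>Polynomials in \<open>s\<close>\<close>

definition spoly :: "'r poly \<Rightarrow> (nat multiset \<Rightarrow>\<^sub>0 'r)" where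
  "spoly c = (\<Sum>k\<le>Polynomial.degree c. single (replicate_mset k 0) (pcoeff c k))"

lemma replicate_mset_eq_iff: "replicate_mset j x = replicate_mset k x \<longleftrightarrow> j = k"
  by (metis size_replicate_mset)

lemma lookup_spoly: "lookup (spoly c) (replicate_mset k 0) = pcoeff c k"
proof -
  have "lookup (spoly c) (replicate_mset k 0) = (\<Sum>j\<le>Polynomial.degree c. if j = k then pcoeff c j else 0)"
    unfolding spoly_def lookup_sum lookup_single when_def replicate_mset_eq_iff ..
  also have "\<dots> = (if k \<in> {..Polynomial.degree c} then pcoeff c k else 0)" by (rule sum.delta) simp
  finally show ?thesis by (auto simp: coeff_eq_0)
qed

lemma lookup_spoly_other: "(\<And>k. m \<noteq> replicate_mset k 0) \<Longrightarrow> lookup (spoly c) m = 0"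
  unfolding spoly_def lookup_sum lookup_single when_def by (intro sum.neutral ballI) auto

lemma eq_spolyI:
  assumes "\<And>k. lookup f (replicate_mset k 0) = pcoeff c k"
    "\<And>m. (\<And>k. m \<noteq> replicate_mset k 0) \<Longrightarrow> lookup f m = 0"
  shows "f = spoly c"
proof (rule poly_mapping_eqI)
  fix m show "lookup f m = lookup (spoly c) m"
    using assms lookup_spoly lookup_spoly_other by (metis (full_types))
qed

lemma spoly_add: "spoly (b + c) = spoly b + spoly c"
  by (rule eq_spolyI[symmetric]) (simp_all add: lookup_add lookup_spoly lookup_spoly_other)

lemma spoly_smult: "spoly (smult a c) = scal a (spoly c)"
  by (rule eq_spolyI[symmetric]) (simp_all add: lookup_spoly lookup_spoly_other)

lemma spoly_pCons_0: "spoly (pCons 0 c) = single {#0#} 1 * spoly c"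
proof (rule eq_spolyI[symmetric])
  fix k show "lookup (single {#0#} 1 * spoly c) (replicate_mset k 0) = pcoeff (pCons 0 c) k"
    by (cases k) (auto simp: lookup_single_mult lookup_spoly coeff_pCons)
next
  fix m :: "nat multiset" assume m: "\<And>k. m \<noteq> replicate_mset k 0"
  have "lookup (spoly c) (m - {#0#}) = 0" if "0 \<in># m"
  proof (rule lookup_spoly_other, rule notI)
    fix k assume "m - {#0#} = replicate_mset k 0"
    then have "m = replicate_mset (Suc k) 0" using that by (metis insert_DiffM replicate_mset_Suc)
    with m show False by blast
  qed
  then show "lookup (single {#0#} 1 * spoly c) m = 0" by (simp add: lookup_single_mult)
qed

lemma ev_spoly: "ev z (spoly c) = (\<Sum>k\<le>Polynomial.degree c. cmult (pcoeff c k) ((s_op g ^^ k) z))"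
proof -
  have "xpart (replicate_mset k 0) = {#}" "dpart (replicate_mset k 0) = {#}" for k
    by (induction k) (auto simp: xpart_def dpart_def)
  then have "act z (replicate_mset k 0) = (s_op g ^^ k) z" for k
    by (simp add: act_def)
  then show ?thesis by (simp add: spoly_def ev_sum)
qed

lemma spoly_supported: "prime_ideal_set p \<Longrightarrow> spoly c \<in> supported_mod p {..2 * n}"
  unfolding supported_mod_def
proof (intro CollectI allI impI)
  fix m :: "nat multiset" assume p: "prime_ideal_set p" and m: "\<not> set_mset m \<subseteq> {..2 * n}"
  have "m \<noteq> replicate_mset k 0" for k using m by (auto split: if_splits)
  then show "lookup (spoly c) m \<in> p" by (simp add: lookup_spoly_other prime_ideal_setD(1)[OF p])
qed

text \<open>
  Up to denominators this is the Bernstein ideal of the image of \<open>g\<close> over the field of fractions of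
  the residue domain at \<open>q\<close>.
\<close>

definition bs_ideal :: "'r set \<Rightarrow> 'r poly set" where
  "bs_ideal q = {c. \<exists>y\<in>dmod. ev 1 (spoly c) - y \<in> kerN q}"

lemma bs_ideal_iff: "prime_ideal_set q \<Longrightarrow> c \<in> bs_ideal q \<longleftrightarrow> spoly c \<in> bs_module q"
  by (auto simp: bs_ideal_def bs_module_def spoly_supported)

lemma bs_ideal_closed:
  assumes q: "prime_ideal_set q"
  shows "b \<in> bs_ideal q \<Longrightarrow> c \<in> bs_ideal q \<Longrightarrow> b + c \<in> bs_ideal q"
    "c \<in> bs_ideal q \<Longrightarrow> smult a c \<in> bs_ideal q"
    "(\<And>k. pcoeff c k \<in> q) \<Longrightarrow> c \<in> bs_ideal q"
    "b \<in> bs_ideal q \<Longrightarrow> c \<in> bs_ideal q \<Longrightarrow> b - c \<in> bs_ideal q"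
    "c \<in> bs_ideal q \<Longrightarrow> pCons 0 c \<in> bs_ideal q"
    "c \<in> bs_ideal q \<Longrightarrow> d * c \<in> bs_ideal q"
proof -
  note cl = bs_module_closed[OF q]
  show add: "b + c \<in> bs_ideal q" if "b \<in> bs_ideal q" "c \<in> bs_ideal q" for b c
    using that by (simp add: bs_ideal_iff[OF q] spoly_add cl)
  show sm: "smult a c \<in> bs_ideal q" if "c \<in> bs_ideal q" for a c
    using that by (simp add: bs_ideal_iff[OF q] spoly_smult cl)
  show zero: "c \<in> bs_ideal q" if "\<And>k. pcoeff c k \<in> q" for c
  proof -
    have "lookup (spoly c) m \<in> q" for m
      using that lookup_spoly[of c] lookup_spoly_other[of m c] prime_ideal_setD(1)[OF q] by metis
    then show ?thesis by (auto simp: bs_ideal_iff[OF q] coeffs_in_def intro: cl)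
  qed
  show "b - c \<in> bs_ideal q" if "b \<in> bs_ideal q" "c \<in> bs_ideal q"
    using add[OF that(1) sm[OF that(2), of "-1"]] by simp
  show s: "pCons 0 c \<in> bs_ideal q" if "c \<in> bs_ideal q" for c
  proof -
    have f: "spoly c \<in> bs_module q" using that by (simp add: bs_ideal_iff[OF q])
    have "lookup (pderiv_at (2 * n + 1) (spoly c)) m = 0" for m
    proof -
      have "add_mset (2 * n + 1) m \<noteq> replicate_mset k 0" for k
        by (metis add_is_0 in_replicate_mset one_neq_zero union_single_eq_member)
      then show ?thesis by (simp add: lookup_pderiv_at lookup_spoly_other)
    qed
    then have "pderiv_at (2 * n + 1) (spoly c) = 0" by (intro poly_mapping_eqI) simp
    then have "shift 0 (spoly c) = spoly (pCons 0 c)" by (simp add: shift_def spoly_pCons_0)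
    then show ?thesis using cl(4)[OF f, of 0] by (simp add: bs_ideal_iff[OF q])
  qed
  show "d * c \<in> bs_ideal q" if "c \<in> bs_ideal q"
    by (induction d) (auto simp: prime_ideal_setD(1)[OF q] intro: zero add sm s that)
qed

lemma bs_ideal_mono:
  assumes "p \<subseteq> q"
  shows "bs_ideal p \<subseteq> bs_ideal q"
proof -
  have "kerN p \<subseteq> kerN q" using assms by (auto simp: kerN_def kerM_def)
  then show ?thesis by (auto simp: bs_ideal_def)
qed

text \<open>
  The initial segment consists of the powers of \<open>s\<close> below \<open>s\<^sup>j\<close>, so that \<open>j\<close> bounds the degree of the
  lift \<open>c'\<close>.
\<close>

lemma bs_ideal_specializes:
  assumes p: "prime_ideal_set p"
    and g: "keys g \<subseteq> {a. set_mset a \<subseteq> {..<n}}"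
  shows "\<exists>h. h \<notin> p \<and> (\<forall>q c j. prime_ideal_set q \<longrightarrow> p \<subseteq> q \<longrightarrow> h \<notin> q \<longrightarrow>
     c \<in> bs_ideal q \<longrightarrow> (\<forall>k\<ge>j. pcoeff c k \<in> q) \<longrightarrow>
     (\<exists>u c'. u \<notin> q \<and> c' \<in> bs_ideal p \<and> (\<forall>k\<ge>j. pcoeff c' k = 0) \<and>
        (\<forall>k. u * pcoeff c k - pcoeff c' k \<in> q)))"
proof -
  obtain h where h: "h \<notin> p" and sp: "\<And>q f Init. prime_ideal_set q \<Longrightarrow> p \<subseteq> q \<Longrightarrow> h \<notin> q \<Longrightarrow>
     (\<forall>m m'. m \<in> Init \<longrightarrow> m' \<le> m \<longrightarrow> m' \<in> Init) \<Longrightarrow>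
     f \<in> bs_module q \<Longrightarrow> (\<forall>m. m \<notin> Init \<longrightarrow> lookup f m \<in> q) \<Longrightarrow>
     (\<exists>u l. u \<notin> q \<and> l \<in> bs_module p \<and> (\<forall>m. m \<notin> Init \<longrightarrow> lookup l m = 0) \<and>
        scal u f - l \<in> coeffs_in q)"
    using bs_module_specializes[OF p g] by (elim exE conjE) (rule that, auto)
  show ?thesis
  proof (rule exI[of _ h], intro conjI allI impI h)
    fix q c j
    assume q: "prime_ideal_set q" "p \<subseteq> q" "h \<notin> q"
      and c: "c \<in> bs_ideal q" "\<forall>k\<ge>j. pcoeff c k \<in> q"
    define Init where "Init = {replicate_mset k (0::nat) | k. k < j}"
    have Init: "m' \<in> Init" if m: "m \<in> Init" "m' \<le> m" for m m'
    proof -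
      obtain k where k: "m = replicate_mset k 0" "k < j" using m(1) by (auto simp: Init_def)
      have "\<forall>x\<in>#m'. x < 1" by (rule multiset_initial_segment[OF m(2)]) (simp add: k)
      then have "m' = replicate_mset (size m') 0"
        by (intro set_mset_subset_singletonD) auto
      then obtain k' where k': "m' = replicate_mset k' 0" by blast
      have "k' \<le> k"
      proof (rule ccontr)
        assume "\<not> k' \<le> k"
        then have "m \<subset># m'" unfolding k k'
          by (metis count_replicate_mset nle_le replicate_mset_eq_iff subset_mset.less_le replicate_mset_msubseteq_iff)
        then show False using m(2) subset_imp_less_mset by fastforce
      qed
      then show ?thesis using k' k(2) by (auto simp: Init_def)
    qed
    have out: "\<forall>m. m \<notin> Init \<longrightarrow> lookup (spoly c) m \<in> q"
    proof (intro allI impI)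
      fix m assume m: "m \<notin> Init"
      show "lookup (spoly c) m \<in> q"
      proof (cases "\<exists>k. m = replicate_mset k 0")
        case True
        then obtain k where "m = replicate_mset k 0" by blast
        then show ?thesis using m c(2) by (auto simp: lookup_spoly Init_def)
      qed (simp add: lookup_spoly_other prime_ideal_setD(1)[OF q(1)])
    qed
    have "spoly c \<in> bs_module q" using c(1) by (simp add: bs_ideal_iff[OF q(1)])
    then obtain u l where ul: "u \<notin> q" "l \<in> bs_module p" "\<forall>m. m \<notin> Init \<longrightarrow> lookup l m = 0"
        "scal u (spoly c) - l \<in> coeffs_in q"
      using sp[OF q _ _ out] Init by blast
    define c' where "c' = (\<Sum>k<j. Polynomial.monom (lookup l (replicate_mset k 0)) k)"
    have cc': "pcoeff c' k = (if k < j then lookup l (replicate_mset k 0) else 0)" for k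
      by (simp add: c'_def Polynomial.coeff_sum)
    have l: "l = spoly c'"
    proof (rule eq_spolyI)
      fix k
      have "replicate_mset k 0 \<in> Init \<longleftrightarrow> k < j" by (auto simp: Init_def replicate_mset_eq_iff)
      then show "lookup l (replicate_mset k 0) = pcoeff c' k" using ul(3) by (auto simp: cc')
    next
      fix m :: "nat multiset" assume "\<And>k. m \<noteq> replicate_mset k 0"
      then have "m \<notin> Init" by (auto simp: Init_def)
      then show "lookup l m = 0" using ul(3) by blast
    qed
    have "u * pcoeff c k - pcoeff c' k \<in> q" for k
    proof -
      have "lookup (scal u (spoly c) - l) (replicate_mset k 0) \<in> q" using ul(4) by (auto simp: coeffs_in_def)
      then show ?thesis by (simp add: l lookup_minus lookup_spoly)
    qed
    then show "\<exists>u c'. u \<notin> q \<and> c' \<in> bs_ideal p \<and> (\<forall>k\<ge>j. pcoeff c' k = 0) \<and>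
        (\<forall>k. u * pcoeff c k - pcoeff c' k \<in> q)"
      using ul(1,2) unfolding l by (intro exI[of _ u] exI[of _ c']) (auto simp: bs_ideal_iff[OF p] cc')
  qed
qed

subsection \<open>The generator of the Bernstein ideal is generically constant\<close>

text \<open>
  Over the field of fractions of the residue domain at \<open>q\<close>, the polynomial \<open>b\<close> is in the Bernstein
  ideal and no nonzero element of the ideal has smaller degree.
\<close>

definition bs_generator :: "'r set \<Rightarrow> 'r poly \<Rightarrow> bool" where
  "bs_generator q b \<longleftrightarrow> (\<exists>u. u \<notin> q \<and> smult u b \<in> bs_ideal q) \<and>
     (\<forall>c\<in>bs_ideal q. (\<forall>k\<ge>Polynomial.degree b. pcoeff c k \<in> q) \<longrightarrow> (\<forall>k. pcoeff c k \<in> q))"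

text \<open>
  The bound on degrees in \<open>bs_ideal_specializes\<close> shows that no new elements of degree less than a
  given bound arise over \<open>q\<close>. This settles minimality. For membership there are three cases over
  \<open>p\<close>. Either a multiple of \<open>b\<close> is in the ideal, which then remains true. Or some \<open>c\<close> of the same degree
  \<open>r\<close> as \<open>b\<close> is in the ideal but \<open>b\<close> is not: then, if \<open>b\<close> were in the ideal over \<open>q\<close>, so would be a
  nonzero combination of \<open>b\<close> and \<open>c\<close> of smaller degree. Or there is no element of degree \<open>r\<close>, and
  then there is none over \<open>q\<close>, where \<open>b\<close> still has degree \<open>r\<close> because its leading coefficient is not
  in \<open>q\<close>.
\<close>

theorem bs_generator_generically_constant:
  assumes p: "prime_ideal_set p"
    and g: "keys g \<subseteq> {a. set_mset a \<subseteq> {..<n}}"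
  shows "\<exists>h. h \<notin> p \<and> (\<forall>q. prime_ideal_set q \<longrightarrow> p \<subseteq> q \<longrightarrow> h \<notin> q \<longrightarrow> lead_coeff b \<notin> q \<longrightarrow>
     (bs_generator q b \<longleftrightarrow> bs_generator p b))"
proof (cases "\<exists>c\<in>bs_ideal p. (\<forall>k\<ge>Polynomial.degree b. pcoeff c k \<in> p) \<and> (\<exists>k. pcoeff c k \<notin> p)")
  case True
  then obtain c k where c: "c \<in> bs_ideal p" "\<forall>k\<ge>Polynomial.degree b. pcoeff c k \<in> p" "pcoeff c k \<notin> p"
    by blast
  have "\<not> bs_generator q b" if q: "p \<subseteq> q" "pcoeff c k \<notin> q" for q
    using c q bs_ideal_mono[OF q(1)] unfolding bs_generator_def by blast
  then show ?thesis using c(3) by (intro exI[of _ "pcoeff c k"]) blast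
next
  case False
  let ?r = "Polynomial.degree b" and ?m = "lead_coeff b"
  note pr = prime_ideal_setD[OF p]
  obtain h where h: "h \<notin> p" and sp: "\<And>q c j. prime_ideal_set q \<Longrightarrow> p \<subseteq> q \<Longrightarrow> h \<notin> q \<Longrightarrow>
     c \<in> bs_ideal q \<Longrightarrow> (\<forall>k\<ge>j. pcoeff c k \<in> q) \<Longrightarrow>
     (\<exists>u c'. u \<notin> q \<and> c' \<in> bs_ideal p \<and> (\<forall>k\<ge>j. pcoeff c' k = 0) \<and>
        (\<forall>k. u * pcoeff c k - pcoeff c' k \<in> q))"
    using bs_ideal_specializes[OF p g] by (elim exE conjE) (rule that, auto)
  have low: "pcoeff c k \<in> q" if q: "prime_ideal_set q" "p \<subseteq> q" "h \<notin> q" and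
    c: "c \<in> bs_ideal q" "\<forall>k\<ge>?r. pcoeff c k \<in> q" for q c k
  proof -
    obtain u c' where u: "u \<notin> q" "c' \<in> bs_ideal p" "\<forall>k\<ge>?r. pcoeff c' k = 0"
        "\<forall>k. u * pcoeff c k - pcoeff c' k \<in> q"
      using sp[OF q c] by blast
    have "pcoeff c' k \<in> q" using False u(2,3) pr(1) q(2) by (metis subsetD)
    then have "u * pcoeff c k \<in> q" using prime_ideal_setD(3)[OF q(1) u(4)[rule_format, of k]] by fastforce
    then show ?thesis using prime_ideal_setD(6)[OF q(1) u(1)] by blast
  qed
  then have gen: "bs_generator q b \<longleftrightarrow> (\<exists>u. u \<notin> q \<and> smult u b \<in> bs_ideal q)"
    if "prime_ideal_set q" "p \<subseteq> q" "h \<notin> q" for q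
    using that unfolding bs_generator_def by blast
  consider u where "u \<notin> p" "smult u b \<in> bs_ideal p"
    | c where "\<nexists>u. u \<notin> p \<and> smult u b \<in> bs_ideal p" "c \<in> bs_ideal p"
        "\<forall>k>?r. pcoeff c k \<in> p" "pcoeff c ?r \<notin> p"
    | "\<nexists>u. u \<notin> p \<and> smult u b \<in> bs_ideal p"
        "\<And>c. c \<in> bs_ideal p \<Longrightarrow> \<forall>k>?r. pcoeff c k \<in> p \<Longrightarrow> pcoeff c ?r \<in> p"
    by blast
  then show ?thesis
  proof cases
    case 1
    show ?thesis
    proof (rule exI[of _ "h * u"], intro conjI allI impI)
      show "h * u \<notin> p" by (rule pr(6)[OF h 1(1)])
      fix q assume q: "prime_ideal_set q" "p \<subseteq> q" "h * u \<notin> q"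
      note qr = prime_ideal_setD[OF q(1)]
      have hu: "h \<notin> q" "u \<notin> q" using q(3) qr(4)[of u h] qr(5)[of h u] by auto
      show "bs_generator q b \<longleftrightarrow> bs_generator p b"
        using gen[OF q(1,2) hu(1)] gen[OF p _ h] 1 hu(2) bs_ideal_mono[OF q(2)] by blast
    qed
  next
    case 2
    define a where "a = pcoeff c ?r"
    define d where "d = smult a b - smult ?m c"
    have "\<exists>k. pcoeff d k \<notin> p"
    proof (rule ccontr)
      assume "\<nexists>k. pcoeff d k \<notin> p"
      then have "d \<in> bs_ideal p" by (intro bs_ideal_closed(3)[OF p]) blast
      then have "d + smult ?m c \<in> bs_ideal p" by (rule bs_ideal_closed(1)[OF p _ bs_ideal_closed(2)[OF p 2(2)]])
      then have "smult a b \<in> bs_ideal p" by (simp add: d_def)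
      then show False using 2(1,4) by (auto simp: a_def)
    qed
    then obtain k where k: "pcoeff d k \<notin> p" by blast
    have hi: "pcoeff d j \<in> p" if "j \<ge> ?r" for j
    proof (cases "j = ?r")
      case True then show ?thesis by (simp add: d_def a_def pr(1))
    next
      case F: False
      then have "?m * pcoeff c j \<in> p" using 2(3) that by (intro pr(4)) auto
      then show ?thesis using F that by (simp add: d_def coeff_eq_0 pr(7))
    qed
    show ?thesis
    proof (rule exI[of _ "h * pcoeff d k"], intro conjI allI impI)
      show "h * pcoeff d k \<notin> p" by (rule pr(6)[OF h k])
      fix q assume q: "prime_ideal_set q" "p \<subseteq> q" "h * pcoeff d k \<notin> q"
      note qr = prime_ideal_setD[OF q(1)]
      have hu: "h \<notin> q" "pcoeff d k \<notin> q"
        using q(3) qr(4)[of "pcoeff d k" h] qr(5)[of h "pcoeff d k"] by auto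
      have "smult u b \<notin> bs_ideal q" if u: "u \<notin> q" for u
      proof
        assume ub: "smult u b \<in> bs_ideal q"
        have "c \<in> bs_ideal q" using 2(2) bs_ideal_mono[OF q(2)] by blast
        then have "smult a (smult u b) - smult (u * ?m) c \<in> bs_ideal q"
          by (intro bs_ideal_closed(4,2)[OF q(1)] ub)
        then have ud: "smult u d \<in> bs_ideal q" by (simp add: d_def smult_diff_right mult.commute)
        have "\<forall>j\<ge>?r. pcoeff (smult u d) j \<in> q" using hi q(2) by (auto intro: qr(4))
        from low[OF q(1,2) hu(1) ud this, of k] show False using qr(6)[OF u hu(2)] by simp
      qed
      then show "bs_generator q b \<longleftrightarrow> bs_generator p b"
        using gen[OF q(1,2) hu(1)] gen[OF p _ h] 2(1) by blast
    qed
  next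
    case 3
    show ?thesis
    proof (rule exI[of _ h], intro conjI allI impI h)
      fix q assume q: "prime_ideal_set q" "p \<subseteq> q" "h \<notin> q" "?m \<notin> q"
      note qr = prime_ideal_setD[OF q(1)]
      have "smult u b \<notin> bs_ideal q" if u: "u \<notin> q" for u
      proof
        assume ub: "smult u b \<in> bs_ideal q"
        have "\<forall>k\<ge>Suc ?r. pcoeff (smult u b) k \<in> q" by (auto simp: coeff_eq_0 qr(1))
        then obtain v c where v: "v \<notin> q" "c \<in> bs_ideal p" "\<forall>k\<ge>Suc ?r. pcoeff c k = 0"
            "\<forall>k. v * pcoeff (smult u b) k - pcoeff c k \<in> q"
          using sp[OF q(1-3) ub, of "Suc ?r"] by blast
        have "pcoeff c ?r \<in> p" using 3(2)[OF v(2)] v(3) pr(1) by (simp add: Suc_le_eq)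
        then have "pcoeff c ?r \<in> q" using q(2) by blast
        from qr(3)[OF v(4)[rule_format, of ?r] this] have "v * (u * ?m) \<in> q" by simp
        then show False using qr(6)[OF v(1) qr(6)[OF u q(4)]] by blast
      qed
      then show "bs_generator q b \<longleftrightarrow> bs_generator p b"
        using gen[OF q(1-3)] gen[OF p _ h] 3(1) by blast
    qed
  qed
qed

end

section \<open>Rings given by records as images of rings given by types\<close>

text \<open>
  A homomorphism from a ring given by a type to a ring given by a record. Identities, and through
  surjective homomorphisms also ring laws, are transported along it to the record.
\<close>

definition typed_hom :: "('r::ring_1 \<Rightarrow> 'a) \<Rightarrow> ('a, 'm) ring_scheme \<Rightarrow> bool" where
  "typed_hom \<sigma> R \<longleftrightarrow> range \<sigma> \<subseteq> carrier R \<and> \<sigma> 0 = \<zero>\<^bsub>R\<^esub> \<and> \<sigma> 1 = \<one>\<^bsub>R\<^esub> \<and>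
     (\<forall>a b. \<sigma> (a + b) = \<sigma> a \<oplus>\<^bsub>R\<^esub> \<sigma> b) \<and> (\<forall>a b. \<sigma> (a * b) = \<sigma> a \<otimes>\<^bsub>R\<^esub> \<sigma> b)"

lemma typed_homD:
  assumes "typed_hom \<sigma> R"
  shows "\<sigma> a \<in> carrier R" "\<sigma> 0 = \<zero>\<^bsub>R\<^esub>" "\<sigma> 1 = \<one>\<^bsub>R\<^esub>"
    "\<sigma> (a + b) = \<sigma> a \<oplus>\<^bsub>R\<^esub> \<sigma> b" "\<sigma> (a * b) = \<sigma> a \<otimes>\<^bsub>R\<^esub> \<sigma> b"
  using assms by (auto simp: typed_hom_def)

lemma typed_image_ring:
  fixes \<sigma> :: "'r::ring_1 \<Rightarrow> 'a"
  assumes h: "typed_hom \<sigma> R" and s: "carrier R \<subseteq> range \<sigma>"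
  shows "ring R"
proof -
  note hr = typed_homD[OF h]
  have c: "\<exists>a. x = \<sigma> a" if "x \<in> carrier R" for x using s that by auto
  show ?thesis
  proof (intro ringI abelian_groupI monoidI)
    fix x y z assume xyz: "x \<in> carrier R" "y \<in> carrier R" "z \<in> carrier R"
    obtain a b d where e: "x = \<sigma> a" "y = \<sigma> b" "z = \<sigma> d" using c xyz by metis
    show "x \<oplus>\<^bsub>R\<^esub> y \<oplus>\<^bsub>R\<^esub> z = x \<oplus>\<^bsub>R\<^esub> (y \<oplus>\<^bsub>R\<^esub> z)" "x \<otimes>\<^bsub>R\<^esub> y \<otimes>\<^bsub>R\<^esub> z = x \<otimes>\<^bsub>R\<^esub> (y \<otimes>\<^bsub>R\<^esub> z)"
      "(x \<oplus>\<^bsub>R\<^esub> y) \<otimes>\<^bsub>R\<^esub> z = x \<otimes>\<^bsub>R\<^esub> z \<oplus>\<^bsub>R\<^esub> y \<otimes>\<^bsub>R\<^esub> z" "z \<otimes>\<^bsub>R\<^esub> (x \<oplus>\<^bsub>R\<^esub> y) = z \<otimes>\<^bsub>R\<^esub> x \<oplus>\<^bsub>R\<^esub> z \<otimes>\<^bsub>R\<^esub> y"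
      unfolding e hr(4,5)[symmetric] by (simp_all add: algebra_simps)
  next
    fix x y assume xyz: "x \<in> carrier R" "y \<in> carrier R"
    obtain a b where e: "x = \<sigma> a" "y = \<sigma> b" using c xyz by metis
    show "x \<oplus>\<^bsub>R\<^esub> y \<in> carrier R" "x \<otimes>\<^bsub>R\<^esub> y \<in> carrier R" "x \<oplus>\<^bsub>R\<^esub> y = y \<oplus>\<^bsub>R\<^esub> x"
      unfolding e hr(4,5)[symmetric] by (simp_all add: hr(1) algebra_simps)
  next
    fix x assume x: "x \<in> carrier R"
    obtain a where e: "x = \<sigma> a" using c x by metis
    show "\<zero>\<^bsub>R\<^esub> \<oplus>\<^bsub>R\<^esub> x = x" "\<one>\<^bsub>R\<^esub> \<otimes>\<^bsub>R\<^esub> x = x" "x \<otimes>\<^bsub>R\<^esub> \<one>\<^bsub>R\<^esub> = x"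
      unfolding e hr(2-5)[symmetric] by simp_all
    show "\<exists>y\<in>carrier R. y \<oplus>\<^bsub>R\<^esub> x = \<zero>\<^bsub>R\<^esub>"
      unfolding e by (rule bexI[of _ "\<sigma> (- a)"]) (simp_all add: hr(1) flip: hr(2,4))
  qed (auto simp: hr(1) simp flip: hr(2,3))
qed

lemma typed_image_cring:
  fixes \<sigma> :: "'r::comm_ring_1 \<Rightarrow> 'a"
  assumes h: "typed_hom \<sigma> R" and s: "carrier R \<subseteq> range \<sigma>"
  shows "cring R"
proof -
  interpret ring R by (rule typed_image_ring[OF h s])
  show ?thesis
  proof (unfold_locales)
    fix x y assume "x \<in> carrier R" "y \<in> carrier R"
    then obtain a b where "x = \<sigma> a" "y = \<sigma> b" using s by blast
    then show "x \<otimes>\<^bsub>R\<^esub> y = y \<otimes>\<^bsub>R\<^esub> x" by (simp add: mult.commute flip: typed_homD(5)[OF h])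
  qed
qed

lemma typed_hom_sum:
  assumes "typed_hom \<sigma> R" "ring R" "finite A"
  shows "\<sigma> (sum f A) = (\<Oplus>\<^bsub>R\<^esub>i\<in>A. \<sigma> (f i))"
proof -
  interpret ring R by fact
  show ?thesis
    using assms(3)
    by (induction A rule: finite_induct) (simp_all add: typed_homD[OF assms(1)] Pi_def)
qed

lemma typed_hom_uminus:
  assumes "typed_hom \<sigma> R" "ring R"
  shows "\<sigma> (- a) = \<ominus>\<^bsub>R\<^esub> \<sigma> a" "\<sigma> (a - b) = \<sigma> a \<ominus>\<^bsub>R\<^esub> \<sigma> b"
proof -
  interpret ring R by fact
  note hr = typed_homD[OF assms(1)]
  have n: "\<sigma> (- a) = \<ominus>\<^bsub>R\<^esub> \<sigma> a" for a
    by (rule minus_equality[symmetric]) (simp_all add: hr(1) flip: hr(2,4))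
  show "\<sigma> (- a) = \<ominus>\<^bsub>R\<^esub> \<sigma> a" by (rule n)
  show "\<sigma> (a - b) = \<sigma> a \<ominus>\<^bsub>R\<^esub> \<sigma> b"
    unfolding a_minus_def n[symmetric] hr(4)[symmetric] by simp
qed

lemma typed_hom_of_nat:
  assumes "typed_hom \<sigma> R" "ring R"
  shows "\<sigma> (of_nat k) = [k] \<cdot>\<^bsub>R\<^esub> \<one>\<^bsub>R\<^esub>" "\<sigma> (of_nat k * a) = [k] \<cdot>\<^bsub>R\<^esub> \<sigma> a"
proof -
  interpret ring R by fact
  note hr = typed_homD[OF assms(1)]
  show "\<sigma> (of_nat k) = [k] \<cdot>\<^bsub>R\<^esub> \<one>\<^bsub>R\<^esub>"
    by (induction k) (simp_all add: hr add.nat_pow_Suc2 del: add.nat_pow_Suc)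
  show "\<sigma> (of_nat k * a) = [k] \<cdot>\<^bsub>R\<^esub> \<sigma> a"
    by (induction k) (simp_all add: hr add.nat_pow_Suc2 algebra_simps del: add.nat_pow_Suc)
qed

lemma typed_hom_of_int:
  assumes "typed_hom \<sigma> R" "ring R"
  shows "\<sigma> (of_int k) = [k] \<cdot>\<^bsub>R\<^esub> \<one>\<^bsub>R\<^esub>"
proof (cases k)
  interpret ring R by fact
  case (nonneg j)
  then show ?thesis by (simp add: typed_hom_of_nat[OF assms] add_pow_int_ge)
next
  interpret ring R by fact
  case (neg j)
  then have "\<sigma> (of_int k) = \<ominus>\<^bsub>R\<^esub> \<sigma> (of_nat (Suc j))"
    by (simp add: typed_hom_uminus[OF assms, symmetric])
  also have "\<dots> = [k] \<cdot>\<^bsub>R\<^esub> \<one>\<^bsub>R\<^esub>"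
  proof -
    have "nat (- k) = Suc j" using neg by simp
    then show ?thesis
      unfolding typed_hom_of_nat(1)[OF assms] using neg by (subst add_pow_int_lt) (simp_all only:)
  qed
  finally show ?thesis .
qed

lemma typed_hom_kernel_prime:
  fixes \<sigma> :: "'r::comm_ring_1 \<Rightarrow> 'a"
  assumes h: "typed_hom \<sigma> R" and d: "domain R"
  shows "prime_ideal_set {a. \<sigma> a = \<zero>\<^bsub>R\<^esub>}"
proof -
  interpret domain R by fact
  note hr = typed_homD[OF h]
  show ?thesis by (auto simp: prime_ideal_set_def hr integral_iff)
qed

subsection \<open>A ring that maps onto every commutative ring on a given type\<close>

text \<open>
  The product of all commutative rings on \<open>'a\<close>. The factor \<^typ>\<open>int\<close> is there to have \<open>0 \<noteq> 1\<close>.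
\<close>

typedef (overloaded) ('a, 'm) uring =
  "{z :: int \<times> (('a, 'm) ring_scheme \<Rightarrow> 'a).
     \<forall>R. (cring R \<longrightarrow> snd z R \<in> carrier R) \<and> (\<not> cring R \<longrightarrow> snd z R = undefined)}"
proof (rule exI, rule CollectI, intro allI conjI impI)
  let ?z = "(0 :: int, \<lambda>R :: ('a, 'm) ring_scheme. if cring R then \<zero>\<^bsub>R\<^esub> else undefined)"
  fix R :: "('a, 'm) ring_scheme"
  show "snd ?z R \<in> carrier R" if "cring R"
  proof -
    interpret cring R by fact
    show ?thesis using that by simp
  qed
  show "snd ?z R = undefined" if "\<not> cring R" using that by simp
qed

setup_lifting type_definition_uring

instantiation uring :: (type, type) comm_ring_1
begin

lift_definition zero_uring :: "('a, 'm) uring" is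
  "(0, \<lambda>R. if cring R then \<zero>\<^bsub>R\<^esub> else undefined)"
  by (auto simp: cring_def ring.ring_simprules)

lift_definition one_uring :: "('a, 'm) uring" is
  "(1, \<lambda>R. if cring R then \<one>\<^bsub>R\<^esub> else undefined)"
  by (auto simp: cring_def ring.ring_simprules)

lift_definition plus_uring :: "('a, 'm) uring \<Rightarrow> ('a, 'm) uring \<Rightarrow> ('a, 'm) uring" is
  "\<lambda>(i, f) (j, g). (i + j, \<lambda>R. if cring R then f R \<oplus>\<^bsub>R\<^esub> g R else undefined)"
  by (auto simp: cring_def ring.ring_simprules)

lift_definition times_uring :: "('a, 'm) uring \<Rightarrow> ('a, 'm) uring \<Rightarrow> ('a, 'm) uring" is
  "\<lambda>(i, f) (j, g). (i * j, \<lambda>R. if cring R then f R \<otimes>\<^bsub>R\<^esub> g R else undefined)"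
  by (auto simp: cring_def ring.ring_simprules)

lift_definition uminus_uring :: "('a, 'm) uring \<Rightarrow> ('a, 'm) uring" is
  "\<lambda>(i, f). (- i, \<lambda>R. if cring R then \<ominus>\<^bsub>R\<^esub> f R else undefined)"
  by (auto simp: cring_def ring.ring_simprules)

definition minus_uring :: "('a, 'm) uring \<Rightarrow> ('a, 'm) uring \<Rightarrow> ('a, 'm) uring" where
  "minus_uring a b = a + (- b)"

instance
proof
  fix a b c :: "('a, 'm) uring"
  show "a * b * c = a * (b * c)"
    by transfer (auto simp: fun_eq_iff cring.cring_simprules)
  show "a * b = b * a"
    by transfer (auto simp: fun_eq_iff cring.cring_simprules)
  show "1 * a = a"
    by transfer (auto simp: fun_eq_iff cring_def ring.ring_simprules)
  show "a + b + c = a + (b + c)"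
    by transfer (auto simp: fun_eq_iff cring.cring_simprules)
  show "a + b = b + a"
    by transfer (auto simp: fun_eq_iff cring.cring_simprules)
  show "0 + a = a"
    by transfer (auto simp: fun_eq_iff cring.cring_simprules)
  show "- a + a = 0"
    by transfer (auto simp: fun_eq_iff cring.cring_simprules)
  show "a - b = a + - b" by (rule minus_uring_def)
  show "(a + b) * c = a * c + b * c"
    by transfer (auto simp: fun_eq_iff algebra_simps cring.cring_simprules)
  show "(0 :: ('a, 'm) uring) \<noteq> 1" by transfer auto
qed

end

lift_definition uproj :: "('a, 'm) ring_scheme \<Rightarrow> ('a, 'm) uring \<Rightarrow> 'a" is "\<lambda>R z. snd z R" .

lemma uproj_hom: "cring R \<Longrightarrow> typed_hom (uproj R) R"
  unfolding typed_hom_def by (auto; transfer; auto split: prod.splits)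

text \<open>
  A given element at \<open>R\<close> is completed by \<open>0\<close> at all other rings.
\<close>

lemma uproj_surj:
  assumes "cring R"
  shows "carrier R \<subseteq> range (uproj R)"
proof
  fix x assume x: "x \<in> carrier R"
  define f :: "('a, 'b) ring_scheme \<Rightarrow> 'a"
    where "f R' = (if R' = R then x else if cring R' then \<zero>\<^bsub>R'\<^esub> else undefined)" for R'
  have "(0 :: int, f) \<in> {z. \<forall>R. (cring R \<longrightarrow> snd z R \<in> carrier R) \<and> (\<not> cring R \<longrightarrow> snd z R = undefined)}"
    using x assms by (auto simp: f_def cring_def ring.ring_simprules)
  then have "uproj R (Abs_uring (0, f)) = x"
    by (simp add: uproj.rep_eq Abs_uring_inverse f_def)
  then show "x \<in> range (uproj R)" by (metis rangeI)
qed

subsection \<open>Multivariate polynomial rings\<close>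

lemma finite_submultisets: "finite {u. u \<subseteq># (m :: 'v multiset)}"
proof (induction m)
  case (add v m)
  have "{u. u \<subseteq># add_mset v m} \<subseteq> {u. u \<subseteq># m} \<union> add_mset v ` {u. u \<subseteq># m}"
  proof
    fix u assume u: "u \<in> {u. u \<subseteq># add_mset v m}"
    show "u \<in> {u. u \<subseteq># m} \<union> add_mset v ` {u. u \<subseteq># m}"
    proof (cases "v \<in># u")
      case True
      then obtain u' where "u = add_mset v u'" by (meson mset_add)
      then show ?thesis using u by auto
    next
      case False
      have "count u x \<le> count m x" for x
      proof (cases "x = v")
        case True then show ?thesis using False by (simp add: not_in_iff)
      next
        case ne: False
        have "count u x \<le> count (add_mset v m) x" using u by (intro mset_subset_eq_count) simp
        then show ?thesis using ne by simp
      qed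
      then show ?thesis by (simp add: subseteq_mset_def)
    qed
  qed
  then show ?case using add by (meson finite_UnI finite_imageI finite_subset)
qed simp

lemma lookup_mult_multiset:
  fixes f g :: "'v multiset \<Rightarrow>\<^sub>0 'r::comm_ring_1"
  shows "lookup (f * g) m = (\<Sum>u\<in>{u. u \<subseteq># m}. lookup f u * lookup g (m - u))"
proof (induction f rule: poly_mapping_additive_induct)
  case (single k c)
  have "(\<Sum>u\<in>{u. u \<subseteq># m}. lookup (single k c) u * lookup g (m - u)) =
      (\<Sum>u\<in>{u. u \<subseteq># m}. if u = k then c * lookup g (m - u) else 0)"
    by (intro sum.cong) (auto simp: lookup_single when_def)
  also have "\<dots> = (if k \<in> {u. u \<subseteq># m} then c * lookup g (m - k) else 0)"
    by (rule sum.delta) (rule finite_submultisets)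
  finally show ?case by (simp add: lookup_single_mult)
qed (simp_all add: lookup_add algebra_simps sum.distrib)

context ring
begin

lemma indexed_monomial_in_pset:
  fixes I :: "'c set"
  assumes "k \<in> carrier R" "set_mset m \<subseteq> I"
  shows "(\<lambda>m'. if m' = m then k else \<zero>) \<in> indexed_pset I (carrier R)"
  using assms(2)
proof (induction m)
  case empty
  have "(\<lambda>m' :: 'c multiset. if m' = {#} then k else \<zero>) = indexed_const k" by (auto simp: indexed_const_def)
  then show ?case using indexed_pset.indexed_const[OF assms(1)] by (simp only:)
next
  case (add v m)
  have "(\<lambda>m'. if m' = add_mset v m then k else \<zero>) = indexed_pmult (\<lambda>m'. if m' = m then k else \<zero>) v"
    by (auto simp: indexed_pmult_def fun_eq_iff)
  then show ?case using add by (auto intro: indexed_pset.indexed_pmult)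
qed

lemma indexed_pset_iff:
  fixes I :: "'c set"
  shows "p \<in> indexed_pset I (carrier R) \<longleftrightarrow>
     (\<forall>m. p m \<in> carrier R) \<and> finite {m. p m \<noteq> \<zero>} \<and> (\<forall>m. p m \<noteq> \<zero> \<longrightarrow> set_mset m \<subseteq> I)"
  (is "_ = ?Q p")
proof
  assume "p \<in> indexed_pset I (carrier R)"
  then show "?Q p"
  proof (induction rule: indexed_pset.induct)
    case (indexed_const k)
    have "{m. indexed_const k m \<noteq> \<zero>} \<subseteq> {{#}}" by (auto simp: indexed_const_def)
    then show ?case using indexed_const finite_subset by (fastforce simp: indexed_const_def)
  next
    case (indexed_padd P Q)
    have "{m. indexed_padd P Q m \<noteq> \<zero>} \<subseteq> {m. P m \<noteq> \<zero>} \<union> {m. Q m \<noteq> \<zero>}"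
      by (auto simp: indexed_padd_def)
    then have "finite {m. indexed_padd P Q m \<noteq> \<zero>}"
      using indexed_padd.IH by (meson finite_UnI finite_subset)
    then show ?case using indexed_padd.IH by (force simp: indexed_padd_def)
  next
    case (indexed_pmult P i)
    have "{m. indexed_pmult P i m \<noteq> \<zero>} \<subseteq> add_mset i ` {m. P m \<noteq> \<zero>}"
    proof
      fix m assume "m \<in> {m. indexed_pmult P i m \<noteq> \<zero>}"
      then have "i \<in># m" "P (m - {#i#}) \<noteq> \<zero>" by (auto simp: indexed_pmult_def split: if_splits)
      then show "m \<in> add_mset i ` {m. P m \<noteq> \<zero>}" by (intro image_eqI[of _ _ "m - {#i#}"]) auto
    qed
    then have "finite {m. indexed_pmult P i m \<noteq> \<zero>}"
      using indexed_pmult.IH by (meson finite_imageI finite_subset)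
    moreover have "set_mset m \<subseteq> I" if "indexed_pmult P i m \<noteq> \<zero>" for m
    proof -
      have "i \<in># m" "P (m - {#i#}) \<noteq> \<zero>" using that by (auto simp: indexed_pmult_def split: if_splits)
      then have "set_mset (m - {#i#}) \<subseteq> I" "i \<in># m" using indexed_pmult.IH by blast+
      moreover have "x = i \<or> x \<in># m - {#i#}" if "x \<in># m" for x
        using that by (cases "x = i") (auto simp: in_diff_count)
      ultimately show ?thesis using indexed_pmult.hyps by blast
    qed
    ultimately show ?case using indexed_pmult.IH by (auto simp: indexed_pmult_def)
  qed
next
  assume p: "?Q p"
  have "(\<lambda>m. if m \<in> A then p m else \<zero>) \<in> indexed_pset I (carrier R)"
    if "finite A" "A \<subseteq> {m. p m \<noteq> \<zero>}" for A
    using that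
  proof (induction A rule: finite_induct)
    case empty
    have "(\<lambda>m :: 'c multiset. \<zero>) = indexed_const \<zero>" by (auto simp: indexed_const_def)
    then show ?case using indexed_pset.indexed_const[of \<zero> "carrier R" I] by simp
  next
    case (insert a A)
    have "(\<lambda>m. if m \<in> insert a A then p m else \<zero>) =
        indexed_padd (\<lambda>m'. if m' = a then p a else \<zero>) (\<lambda>m. if m \<in> A then p m else \<zero>)"
      using insert.hyps p by (auto simp: indexed_padd_def fun_eq_iff)
    moreover have "(\<lambda>m'. if m' = a then p a else \<zero>) \<in> indexed_pset I (carrier R)"
      using p insert.prems by (intro indexed_monomial_in_pset) auto
    ultimately show ?case using insert by (auto intro: indexed_pset.indexed_padd)
  qed
  from this[of "{m. p m \<noteq> \<zero>}"] p have "(\<lambda>m. if p m \<noteq> \<zero> then p m else \<zero>) \<in> indexed_pset I (carrier R)"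
    by simp
  moreover have "(\<lambda>m. if p m \<noteq> \<zero> then p m else \<zero>) = p" by auto
  ultimately show "p \<in> indexed_pset I (carrier R)" by simp
qed

end

text \<open>The variables outside \<open>I\<close> are sent to \<open>0\<close>, so that this is defined on all polynomials.\<close>

definition mpoly_map :: "('r \<Rightarrow> 'a) \<Rightarrow> ('a, 'm) ring_scheme \<Rightarrow> 'v set \<Rightarrow>
    ('v multiset \<Rightarrow>\<^sub>0 'r::comm_ring_1) \<Rightarrow> ('v multiset \<Rightarrow> 'a)" where
  "mpoly_map \<sigma> R I f = (\<lambda>m. if set_mset m \<subseteq> I then \<sigma> (lookup f m) else \<zero>\<^bsub>R\<^esub>)"

lemma mpoly_map_hom:
  assumes h: "typed_hom \<sigma> R" and R: "ring R"
  shows "typed_hom (mpoly_map \<sigma> R I) (mpoly_ring R I)"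
proof -
  interpret ring R by fact
  note hr = typed_homD[OF h]
  have "mpoly_map \<sigma> R I f \<in> indexed_pset I (carrier R)" for f
  proof -
    have "{m. mpoly_map \<sigma> R I f m \<noteq> \<zero>\<^bsub>R\<^esub>} \<subseteq> keys f"
      by (auto simp: mpoly_map_def in_keys_iff hr(2))
    then have "finite {m. mpoly_map \<sigma> R I f m \<noteq> \<zero>\<^bsub>R\<^esub>}" by (rule finite_subset) simp
    then show ?thesis unfolding indexed_pset_iff by (auto simp: mpoly_map_def hr(1))
  qed
  moreover have "mpoly_map \<sigma> R I (f * g) m =
      (\<Oplus>\<^bsub>R\<^esub>u\<in>{u. u \<subseteq># m}. mpoly_map \<sigma> R I f u \<otimes>\<^bsub>R\<^esub> mpoly_map \<sigma> R I g (m - u))" for f g m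
  proof (cases "set_mset m \<subseteq> I")
    case True
    have "mpoly_map \<sigma> R I (f * g) m = \<sigma> (\<Sum>u\<in>{u. u \<subseteq># m}. lookup f u * lookup g (m - u))"
      using True by (simp add: mpoly_map_def lookup_mult_multiset)
    also have "\<dots> = (\<Oplus>\<^bsub>R\<^esub>u\<in>{u. u \<subseteq># m}. \<sigma> (lookup f u) \<otimes>\<^bsub>R\<^esub> \<sigma> (lookup g (m - u)))"
      by (simp add: typed_hom_sum[OF h R finite_submultisets] hr)
    also have "\<dots> = (\<Oplus>\<^bsub>R\<^esub>u\<in>{u. u \<subseteq># m}. mpoly_map \<sigma> R I f u \<otimes>\<^bsub>R\<^esub> mpoly_map \<sigma> R I g (m - u))"
    proof (rule finsum_cong')
      fix u assume "u \<in> {u. u \<subseteq># m}"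
      then have "set_mset u \<subseteq> I" "set_mset (m - u) \<subseteq> I"
        using True by (auto dest: mset_subset_eqD in_diffD)
      then show "\<sigma> (lookup f u) \<otimes>\<^bsub>R\<^esub> \<sigma> (lookup g (m - u)) = mpoly_map \<sigma> R I f u \<otimes>\<^bsub>R\<^esub> mpoly_map \<sigma> R I g (m - u)"
        by (simp add: mpoly_map_def)
    qed (auto simp: mpoly_map_def hr(1))
    finally show ?thesis .
  next
    case False
    have "(\<Oplus>\<^bsub>R\<^esub>u\<in>{u. u \<subseteq># m}. mpoly_map \<sigma> R I f u \<otimes>\<^bsub>R\<^esub> mpoly_map \<sigma> R I g (m - u)) =
        (\<Oplus>\<^bsub>R\<^esub>u\<in>{u. u \<subseteq># m}. \<zero>\<^bsub>R\<^esub>)"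
    proof (rule finsum_cong')
      fix u assume u: "u \<in> {u. u \<subseteq># m}"
      then have "m = u + (m - u)" by simp
      then have "\<not> set_mset u \<subseteq> I \<or> \<not> set_mset (m - u) \<subseteq> I"
        using False by (metis Un_least set_mset_union)
      then show "mpoly_map \<sigma> R I f u \<otimes>\<^bsub>R\<^esub> mpoly_map \<sigma> R I g (m - u) = \<zero>\<^bsub>R\<^esub>"
        by (auto simp: mpoly_map_def hr(1))
    qed auto
    then show ?thesis using False by (simp add: mpoly_map_def)
  qed
  moreover have "mpoly_map \<sigma> R I 0 = indexed_const \<zero>\<^bsub>R\<^esub>" "mpoly_map \<sigma> R I 1 = indexed_const \<one>\<^bsub>R\<^esub>"
    by (auto simp: mpoly_map_def indexed_const_def hr(2,3) lookup_one when_def fun_eq_iff)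
  moreover have "mpoly_map \<sigma> R I (f + g) m = mpoly_map \<sigma> R I f m \<oplus>\<^bsub>R\<^esub> mpoly_map \<sigma> R I g m" for f g m
    by (simp add: mpoly_map_def hr(4) lookup_add)
  ultimately show ?thesis
    unfolding typed_hom_def mpoly_ring_def by (simp add: fun_eq_iff image_subset_iff)
qed

lemma mpoly_map_surj:
  assumes h: "typed_hom \<sigma> R" and R: "ring R" and s: "carrier R \<subseteq> range \<sigma>"
    and p: "p \<in> carrier (mpoly_ring R I)"
  obtains f where "p = mpoly_map \<sigma> R I f" "keys f \<subseteq> {m. set_mset m \<subseteq> I}"
proof -
  interpret ring R by fact
  note hr = typed_homD[OF h]
  have pc: "\<forall>m. p m \<in> carrier R" "finite {m. p m \<noteq> \<zero>\<^bsub>R\<^esub>}" "\<forall>m. p m \<noteq> \<zero>\<^bsub>R\<^esub> \<longrightarrow> set_mset m \<subseteq> I"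
    using p by (auto simp: mpoly_ring_def indexed_pset_iff)
  define c where "c m = (SOME a. \<sigma> a = p m)" for m
  have c: "\<sigma> (c m) = p m" for m
  proof -
    have "p m \<in> range \<sigma>" using s pc(1) by blast
    then obtain a where "\<sigma> a = p m" by auto
    then show ?thesis unfolding c_def by (rule someI)
  qed
  define f where "f = (\<Sum>m\<in>{m. p m \<noteq> \<zero>\<^bsub>R\<^esub>}. single m (c m))"
  have l: "lookup f k = (if p k \<noteq> \<zero>\<^bsub>R\<^esub> then c k else 0)" for k
  proof -
    have "lookup f k = (\<Sum>m\<in>{m. p m \<noteq> \<zero>\<^bsub>R\<^esub>}. if m = k then c m else 0)"
      by (simp add: f_def lookup_sum lookup_single when_def)
    also have "\<dots> = (if k \<in> {m. p m \<noteq> \<zero>\<^bsub>R\<^esub>} then c k else 0)" by (rule sum.delta[OF pc(2)])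
    finally show ?thesis by simp
  qed
  have "p = mpoly_map \<sigma> R I f" using pc(3) by (auto simp: mpoly_map_def fun_eq_iff l c hr(2))
  moreover have "keys f \<subseteq> {m. set_mset m \<subseteq> I}" 
  proof
    fix m assume "m \<in> keys f"
    then have "p m \<noteq> \<zero>\<^bsub>R\<^esub>" by (auto simp: in_keys_iff l split: if_splits)
    then show "m \<in> {m. set_mset m \<subseteq> I}" using pc(3) by simp
  qed
  ultimately show thesis by (rule that)
qed

lemma mpoly_cring:
  assumes "cring R"
  shows "cring (mpoly_ring R I)"
proof (rule typed_image_cring)
  have R: "ring R" using assms by (rule cring.axioms)
  show "typed_hom (mpoly_map (uproj R) R I) (mpoly_ring R I)"
    by (rule mpoly_map_hom[OF uproj_hom[OF assms] R])
  show "carrier (mpoly_ring R I) \<subseteq> range (mpoly_map (uproj R) R I)"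
    using mpoly_map_surj[OF uproj_hom[OF assms] R uproj_surj[OF assms]] by blast
qed

lemma lead_monom_mult:
  fixes f g :: "'v::linorder multiset \<Rightarrow>\<^sub>0 'r::comm_ring_1"
  assumes q: "prime_ideal_set q" and f: "lead_monom q f a" and g: "lead_monom q g b"
  shows "lookup (f * g) (a + b) \<notin> q"
proof -
  note qr = prime_ideal_setD[OF q]
  let ?A = "{u. u \<subseteq># a + b}"
  have "(\<Sum>u\<in>?A - {a}. lookup f u * lookup g (a + b - u)) \<in> q"
  proof (rule prime_ideal_set_sum[OF q])
    fix u assume u: "u \<in> ?A - {a}"
    show "lookup f u * lookup g (a + b - u) \<in> q"
    proof (cases "u > a")
      case True
      then show ?thesis using f by (intro qr(5)) (auto simp: lead_monom_def)
    next
      case False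
      then have "u < a" using u by auto
      have "b < a + b - u"
      proof (rule ccontr)
        assume "\<not> b < a + b - u"
        then have "u + (a + b - u) < a + b" using \<open>u < a\<close> by (intro add_less_le_mono) auto
        then show False using u by simp
      qed
      then show ?thesis using g by (intro qr(4)) (auto simp: lead_monom_def)
    qed
  qed
  moreover have "lookup f a * lookup g b \<notin> q" using f g by (intro qr(6)) (auto simp: lead_monom_def)
  moreover have "lookup (f * g) (a + b) =
      lookup f a * lookup g b + (\<Sum>u\<in>?A - {a}. lookup f u * lookup g (a + b - u))"
    unfolding lookup_mult_multiset by (subst sum.remove[of _ a]) (auto simp: finite_submultisets)
  ultimately show ?thesis using qr(8) by fastforce
qed

text \<open>
  The leading coefficients of two polynomials multiply to a coefficient of the product.
\<close>

lemma mpoly_domain: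
  fixes I :: "'v::linorder set"
  assumes R: "domain R"
  shows "domain (mpoly_ring R I)"
proof -
  interpret domain R by fact
  have cr: "cring R" by unfold_locales
  have R': "ring R" by unfold_locales
  note h = uproj_hom[OF cr]
  interpret M: cring "mpoly_ring R I" by (rule mpoly_cring[OF cr])
  note hM = mpoly_map_hom[OF h R', of I]
  have q: "prime_ideal_set {a. uproj R a = \<zero>\<^bsub>R\<^esub>}" (is "prime_ideal_set ?q")
    by (rule typed_hom_kernel_prime[OF h R])
  have nz: "\<exists>a. lead_monom ?q f a" if "keys f \<subseteq> {m. set_mset m \<subseteq> I}"
      "mpoly_map (uproj R) R I f \<noteq> \<zero>\<^bsub>mpoly_ring R I\<^esub>" for f
  proof -
    have "f \<notin> coeffs_in ?q"
      using that(2) by (auto simp: coeffs_in_def mpoly_ring_def indexed_const_def mpoly_map_def fun_eq_iff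
          split: if_splits)
    then show ?thesis using lead_monom_exists[OF q] by blast
  qed
  show ?thesis
  proof (unfold_locales)
    show "\<one>\<^bsub>mpoly_ring R I\<^esub> \<noteq> \<zero>\<^bsub>mpoly_ring R I\<^esub>"
      using one_not_zero by (auto simp: mpoly_ring_def indexed_const_def fun_eq_iff)
  next
    fix x y assume prod: "x \<otimes>\<^bsub>mpoly_ring R I\<^esub> y = \<zero>\<^bsub>mpoly_ring R I\<^esub>"
      and xy: "x \<in> carrier (mpoly_ring R I)" "y \<in> carrier (mpoly_ring R I)"
    obtain f where f: "x = mpoly_map (uproj R) R I f" "keys f \<subseteq> {m. set_mset m \<subseteq> I}"
      by (rule mpoly_map_surj[OF h R' uproj_surj[OF cr] xy(1)])
    obtain g where g: "y = mpoly_map (uproj R) R I g" "keys g \<subseteq> {m. set_mset m \<subseteq> I}"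
      by (rule mpoly_map_surj[OF h R' uproj_surj[OF cr] xy(2)])
    show "x = \<zero>\<^bsub>mpoly_ring R I\<^esub> \<or> y = \<zero>\<^bsub>mpoly_ring R I\<^esub>"
    proof (rule ccontr)
      assume "\<not> ?thesis"
      then have xy: "x \<noteq> \<zero>\<^bsub>mpoly_ring R I\<^esub>" "y \<noteq> \<zero>\<^bsub>mpoly_ring R I\<^esub>" by blast+
      obtain a where a: "lead_monom ?q f a" using nz[OF f(2)] xy(1) f(1) by blast
      obtain b where b: "lead_monom ?q g b" using nz[OF g(2)] xy(2) g(1) by blast
      note ab = a b
      have "lookup (f * g) (a + b) \<notin> ?q" by (rule lead_monom_mult[OF q a b])
      moreover have "a \<in> keys f" "b \<in> keys g"
        using ab typed_homD(2)[OF h] by (auto simp: lead_monom_def in_keys_iff)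
      then have "set_mset (a + b) \<subseteq> I" using f(2) g(2) by auto
      ultimately have "mpoly_map (uproj R) R I (f * g) (a + b) \<noteq> \<zero>\<^bsub>mpoly_ring R I\<^esub> (a + b)"
        by (simp add: mpoly_ring_def indexed_const_def mpoly_map_def)
      then show False using prod by (simp add: f g typed_homD(5)[OF hM])
    qed
  qed
qed

section \<open>Localization of a domain\<close>

text \<open>
  For a multiplicative set without \<open>0\<close> in a domain, two fractions are equal if and only if they agree
  after cross-multiplication, and the unions in the definition of the operations collapse.
\<close>

locale domain_localization = domain R for R (structure) +
  fixes S :: "'a set"
  assumes S_sub: "S \<subseteq> carrier R - {\<zero>}" and one_S: "\<one> \<in> S"
    and mult_S: "\<And>b e. b \<in> S \<Longrightarrow> e \<in> S \<Longrightarrow> b \<otimes> e \<in> S"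
begin

abbreviation fr :: "'a \<Rightarrow> 'a \<Rightarrow> ('a \<times> 'a) set" where "fr \<equiv> fraction R S"
abbreviation Loc :: "('a \<times> 'a) set ring" where "Loc \<equiv> localization R S"

lemma S_carrier: "b \<in> S \<Longrightarrow> b \<in> carrier R" using S_sub by blast
lemma S_nonzero: "b \<in> S \<Longrightarrow> b \<noteq> \<zero>" using S_sub by blast

lemma fr_mem:
  assumes "a \<in> carrier R" "b \<in> S"
  shows "(c, e) \<in> fr a b \<longleftrightarrow> c \<in> carrier R \<and> e \<in> S \<and> a \<otimes> e = c \<otimes> b"
proof -
  have "(\<exists>t\<in>S. t \<otimes> (a \<otimes> e) = t \<otimes> (c \<otimes> b)) \<longleftrightarrow> a \<otimes> e = c \<otimes> b" if "c \<in> carrier R" "e \<in> S"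
  proof
    assume "\<exists>t\<in>S. t \<otimes> (a \<otimes> e) = t \<otimes> (c \<otimes> b)"
    then obtain t where "t \<in> S" "t \<otimes> (a \<otimes> e) = t \<otimes> (c \<otimes> b)" by blast
    then show "a \<otimes> e = c \<otimes> b"
      using that assms S_carrier S_nonzero by (subst (asm) m_lcancel) auto
  next
    assume "a \<otimes> e = c \<otimes> b"
    then show "\<exists>t\<in>S. t \<otimes> (a \<otimes> e) = t \<otimes> (c \<otimes> b)" using one_S by auto
  qed
  then show ?thesis by (auto simp: fraction_def)
qed

lemma fr_eq:
  assumes "a \<in> carrier R" "b \<in> S" "c \<in> carrier R" "e \<in> S"
  shows "fr a b = fr c e \<longleftrightarrow> a \<otimes> e = c \<otimes> b"
proof
  assume "fr a b = fr c e"
  moreover have "(c, e) \<in> fr c e" using fr_mem[OF assms(3,4)] assms by simp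
  ultimately show "a \<otimes> e = c \<otimes> b" using fr_mem[OF assms(1,2)] by blast
next
  have *: "fr x y \<subseteq> fr z w" if h: "x \<otimes> w = z \<otimes> y" "x \<in> carrier R" "y \<in> S" "z \<in> carrier R" "w \<in> S" for x y z w
  proof (rule subrelI)
    fix u v assume "(u, v) \<in> fr x y"
    then have uv: "u \<in> carrier R" "v \<in> S" "x \<otimes> v = u \<otimes> y" using h by (simp_all add: fr_mem)
    note cl = h uv(1,2) S_carrier[OF h(3)] S_carrier[OF h(5)] S_carrier[OF uv(2)]
    have "y \<otimes> (z \<otimes> v) = (z \<otimes> y) \<otimes> v" using cl by (simp add: m_ac)
    also have "\<dots> = (x \<otimes> v) \<otimes> w" unfolding h(1)[symmetric] using cl by (simp add: m_ac)
    also have "\<dots> = y \<otimes> (u \<otimes> w)" unfolding uv(3) using cl by (simp add: m_ac)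
    finally have "z \<otimes> v = u \<otimes> w"
      using cl S_nonzero[OF h(3)] by (subst (asm) m_lcancel) auto
    then show "(u, v) \<in> fr z w" using h uv by (simp add: fr_mem)
  qed
  assume "a \<otimes> e = c \<otimes> b"
  then show "fr a b = fr c e" using *[of a e c b] *[of c b a e] assms by auto
qed

lemma fr_self: "a \<in> carrier R \<Longrightarrow> b \<in> S \<Longrightarrow> (a, b) \<in> fr a b" by (simp add: fr_mem)

lemma Loc_carrier: "x \<in> carrier Loc \<longleftrightarrow> (\<exists>a b. a \<in> carrier R \<and> b \<in> S \<and> x = fr a b)"
  by (auto simp: localization_def)

lemma fr_closed: "a \<in> carrier R \<Longrightarrow> b \<in> S \<Longrightarrow> fr a b \<in> carrier Loc"
  by (auto simp: Loc_carrier)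

lemma union_over_fr:
  assumes "a \<in> carrier R" "b \<in> S"
    "\<And>c e. c \<in> carrier R \<Longrightarrow> e \<in> S \<Longrightarrow> a \<otimes> e = c \<otimes> b \<Longrightarrow> F c e = Y"
  shows "(\<Union>(c, e)\<in>fr a b. F c e) = Y"
proof -
  have "F c e = Y" if "(c, e) \<in> fr a b" for c e using that assms by (auto simp: fr_mem)
  then show ?thesis using fr_self[OF assms(1,2)] by fastforce
qed

lemma exists_typed: "x \<in> carrier R \<Longrightarrow> \<exists>a. x = uproj R a"
  using uproj_surj[OF is_cring] by blast

lemmas typed = typed_homD[OF uproj_hom[OF is_cring]]

lemma fr_mult:
  assumes "a \<in> carrier R" "b \<in> S" "c \<in> carrier R" "e \<in> S"
  shows "fr a b \<otimes>\<^bsub>Loc\<^esub> fr c e = fr (a \<otimes> c) (b \<otimes> e)"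
proof -
  have "fr (a' \<otimes> c') (b' \<otimes> e') = fr (a \<otimes> c) (b \<otimes> e)"
    if h: "a' \<in> carrier R" "b' \<in> S" "a \<otimes> b' = a' \<otimes> b" "c' \<in> carrier R" "e' \<in> S" "c \<otimes> e' = c' \<otimes> e"
    for a' b' c' e'
  proof -
    note cl = S_carrier[OF assms(2)] S_carrier[OF assms(4)] S_carrier[OF h(2)] S_carrier[OF h(5)]
    have "(a' \<otimes> c') \<otimes> (b \<otimes> e) = (a' \<otimes> b) \<otimes> (c' \<otimes> e)" using h assms cl by (simp add: m_ac)
    also have "\<dots> = (a \<otimes> c) \<otimes> (b' \<otimes> e')" unfolding h(3)[symmetric] h(6)[symmetric]
      using h(1,2,4,5) assms cl by (simp add: m_ac)
    finally show ?thesis using h assms by (subst fr_eq) (auto intro: mult_S)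
  qed
  then show ?thesis
    unfolding localization_def monoid.simps
    by (intro union_over_fr assms) auto
qed

lemma fr_add:
  assumes "a \<in> carrier R" "b \<in> S" "c \<in> carrier R" "e \<in> S"
  shows "fr a b \<oplus>\<^bsub>Loc\<^esub> fr c e = fr (a \<otimes> e \<oplus> c \<otimes> b) (b \<otimes> e)"
proof -
  have "fr (a' \<otimes> e' \<oplus> c' \<otimes> b') (b' \<otimes> e') = fr (a \<otimes> e \<oplus> c \<otimes> b) (b \<otimes> e)"
    if h: "a' \<in> carrier R" "b' \<in> S" "a \<otimes> b' = a' \<otimes> b" "c' \<in> carrier R" "e' \<in> S" "c \<otimes> e' = c' \<otimes> e"
    for a' b' c' e'
  proof -
    note cl = S_carrier[OF assms(2)] S_carrier[OF assms(4)] S_carrier[OF h(2)] S_carrier[OF h(5)]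
    have "(a' \<otimes> e' \<oplus> c' \<otimes> b') \<otimes> (b \<otimes> e) = (a' \<otimes> b) \<otimes> (e \<otimes> e') \<oplus> (c' \<otimes> e) \<otimes> (b \<otimes> b')"
      using h assms cl by (simp add: l_distr r_distr m_ac)
    also have "\<dots> = (a \<otimes> e \<oplus> c \<otimes> b) \<otimes> (b' \<otimes> e')" unfolding h(3)[symmetric] h(6)[symmetric]
      using h(1,2,4,5) assms cl by (simp add: l_distr r_distr m_ac)
    finally show ?thesis using h assms cl by (subst fr_eq) (auto intro: mult_S)
  qed
  then show ?thesis
    unfolding localization_def ring.simps
    by (intro union_over_fr assms) auto
qed

lemma one_Loc: "\<one>\<^bsub>Loc\<^esub> = fr \<one> \<one>" and zero_Loc: "\<zero>\<^bsub>Loc\<^esub> = fr \<zero> \<one>"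
  by (simp_all add: localization_def)

lemma Loc_cring: "cring Loc"
proof -
  note one = one_Loc and zero = zero_Loc
  note sc = S_carrier
  show ?thesis
  proof (intro cringI abelian_groupI comm_monoidI)
    fix x y z assume "x \<in> carrier Loc" "y \<in> carrier Loc" "z \<in> carrier Loc"
    then obtain a b c e u v where x: "a \<in> carrier R" "b \<in> S" "x = fr a b"
      and y: "c \<in> carrier R" "e \<in> S" "y = fr c e" and z: "u \<in> carrier R" "v \<in> S" "z = fr u v"
      unfolding Loc_carrier by blast
    note cl = x(1,2) y(1,2) z(1,2) sc[OF x(2)] sc[OF y(2)] sc[OF z(2)] mult_S
    obtain a' b' c' e' u' v' where t: "a = uproj R a'" "b = uproj R b'" "c = uproj R c'"
        "e = uproj R e'" "u = uproj R u'" "v = uproj R v'"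
      using cl exists_typed by metis
    show "x \<oplus>\<^bsub>Loc\<^esub> y \<oplus>\<^bsub>Loc\<^esub> z = x \<oplus>\<^bsub>Loc\<^esub> (y \<oplus>\<^bsub>Loc\<^esub> z)"
      unfolding x y z using cl
      by (simp add: fr_add) (simp add: t algebra_simps flip: typed)
    show "x \<otimes>\<^bsub>Loc\<^esub> y \<otimes>\<^bsub>Loc\<^esub> z = x \<otimes>\<^bsub>Loc\<^esub> (y \<otimes>\<^bsub>Loc\<^esub> z)"
      unfolding x y z using cl by (simp add: fr_mult m_assoc)
    show "(x \<oplus>\<^bsub>Loc\<^esub> y) \<otimes>\<^bsub>Loc\<^esub> z = x \<otimes>\<^bsub>Loc\<^esub> z \<oplus>\<^bsub>Loc\<^esub> y \<otimes>\<^bsub>Loc\<^esub> z"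
      unfolding x y z using cl
      by (simp add: fr_mult fr_add fr_eq) (simp add: t algebra_simps flip: typed)
  next
    fix x y assume "x \<in> carrier Loc" "y \<in> carrier Loc"
    then obtain a b c e where x: "a \<in> carrier R" "b \<in> S" "x = fr a b"
      and y: "c \<in> carrier R" "e \<in> S" "y = fr c e" unfolding Loc_carrier by blast
    note cl = x(1,2) y(1,2) sc[OF x(2)] sc[OF y(2)] mult_S
    show "x \<oplus>\<^bsub>Loc\<^esub> y \<in> carrier Loc" "x \<otimes>\<^bsub>Loc\<^esub> y \<in> carrier Loc"
      unfolding x y using cl by (auto simp: fr_mult fr_add intro!: fr_closed)
    show "x \<oplus>\<^bsub>Loc\<^esub> y = y \<oplus>\<^bsub>Loc\<^esub> x" "x \<otimes>\<^bsub>Loc\<^esub> y = y \<otimes>\<^bsub>Loc\<^esub> x"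
      unfolding x y using cl by (simp_all add: fr_mult fr_add m_comm a_comm)
  next
    fix x assume "x \<in> carrier Loc"
    then obtain a b where x: "a \<in> carrier R" "b \<in> S" "x = fr a b" unfolding Loc_carrier by blast
    note cl = x(1,2) sc[OF x(2)] one_S
    show "\<zero>\<^bsub>Loc\<^esub> \<oplus>\<^bsub>Loc\<^esub> x = x" "\<one>\<^bsub>Loc\<^esub> \<otimes>\<^bsub>Loc\<^esub> x = x"
      unfolding x one zero using cl by (simp_all add: fr_mult fr_add)
    have "fr (\<ominus> a) b \<oplus>\<^bsub>Loc\<^esub> fr a b = fr \<zero> \<one>"
      using cl mult_S by (simp add: fr_add fr_eq l_minus l_neg)
    then show "\<exists>y\<in>carrier Loc. y \<oplus>\<^bsub>Loc\<^esub> x = \<zero>\<^bsub>Loc\<^esub>"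
      unfolding x zero using cl by (intro bexI[of _ "fr (\<ominus> a) b"] fr_closed) auto
  qed (auto simp: one zero one_S intro: fr_closed)
qed

lemma fr_one_hom:
  assumes "typed_hom \<sigma> R"
  shows "typed_hom (\<lambda>a. fr (\<sigma> a) \<one>) Loc"
  using typed_homD[OF assms] one_S
  by (auto simp: typed_hom_def fr_add fr_mult one_Loc zero_Loc intro: fr_closed)

lemma fr_zero_iff:
  assumes "a \<in> carrier R" "b \<in> S"
  shows "fr a b = \<zero>\<^bsub>Loc\<^esub> \<longleftrightarrow> a = \<zero>"
  using assms S_carrier[OF assms(2)] by (simp add: localization_def fr_eq one_S)

end

locale localization_derivation = domain_localization +
  fixes d :: "'a \<Rightarrow> 'a"
  assumes d_closed: "a \<in> carrier R \<Longrightarrow> d a \<in> carrier R"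
    and d_add: "a \<in> carrier R \<Longrightarrow> b \<in> carrier R \<Longrightarrow> d (a \<oplus> b) = d a \<oplus> d b"
    and d_mult: "a \<in> carrier R \<Longrightarrow> b \<in> carrier R \<Longrightarrow> d (a \<otimes> b) = d a \<otimes> b \<oplus> a \<otimes> d b"
begin

abbreviation ld :: "('a \<times> 'a) set \<Rightarrow> ('a \<times> 'a) set" where "ld \<equiv> localized_derivation R S d"

lemma ld_fr:
  assumes "a \<in> carrier R" "b \<in> S"
  shows "ld (fr a b) = fr (b \<otimes> d a \<ominus> a \<otimes> d b) (b \<otimes> b)"
proof -
  have "fr (e \<otimes> d c \<ominus> c \<otimes> d e) (e \<otimes> e) = fr (b \<otimes> d a \<ominus> a \<otimes> d b) (b \<otimes> b)"
    if h: "c \<in> carrier R" "e \<in> S" "a \<otimes> e = c \<otimes> b" for c e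
  proof -
    note cl = assms h(1,2) S_carrier[OF assms(2)] S_carrier[OF h(2)]
    have "d (a \<otimes> e) = d (c \<otimes> b)" using h(3) by simp
    then have 1: "d a \<otimes> e \<oplus> a \<otimes> d e = d c \<otimes> b \<oplus> c \<otimes> d b" using cl by (simp add: d_mult)
    have dcl: "d a \<in> carrier R" "d b \<in> carrier R" "d c \<in> carrier R" "d e \<in> carrier R"
      using cl by (auto intro: d_closed)
    obtain a' b' c' e' da db dc de where t: "a = uproj R a'" "b = uproj R b'" "c = uproj R c'"
        "e = uproj R e'" "d a = uproj R da" "d b = uproj R db" "d c = uproj R dc" "d e = uproj R de"
      using cl dcl exists_typed by metis
    note um = typed_hom_uminus[OF uproj_hom[OF is_cring] ring_axioms, symmetric]
    let ?k = "\<lambda>x. uproj R x = \<zero>"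
    have k1: "?k (a' * e' - c' * b')" and k2: "?k (da * e' + a' * de - (dc * b' + c' * db))"
      using h(3) 1 cl unfolding t(5-8) unfolding t(1-4) by (simp_all add: typed um typed_hom_uminus[OF uproj_hom[OF is_cring] ring_axioms] a_minus_def r_neg)
    have "(e' * dc - c' * de) * (b' * b') - (b' * da - a' * db) * (e' * e') =
        - (b' * e') * (da * e' + a' * de - (dc * b' + c' * db)) + (a' * e' - c' * b') * (b' * de + e' * db)"
      by (simp add: algebra_simps)
    then have "?k ((e' * dc - c' * de) * (b' * b') - (b' * da - a' * db) * (e' * e'))"
      using k1 k2 by (simp only: typed) (simp add: typed(1))
    then have "(e \<otimes> d c \<ominus> c \<otimes> d e) \<otimes> (b \<otimes> b) \<ominus> (b \<otimes> d a \<ominus> a \<otimes> d b) \<otimes> (e \<otimes> e) = \<zero>"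
      unfolding t(5-8) unfolding t(1-4) by (simp only: typed typed_hom_uminus[OF uproj_hom[OF is_cring] ring_axioms])
    then have "(e \<otimes> d c \<ominus> c \<otimes> d e) \<otimes> (b \<otimes> b) = (b \<otimes> d a \<ominus> a \<otimes> d b) \<otimes> (e \<otimes> e)"
      using cl dcl by (subst (asm) r_right_minus_eq) auto
    then show ?thesis using cl dcl by (subst fr_eq) (auto intro: mult_S)
  qed
  then show ?thesis unfolding localized_derivation_def by (intro union_over_fr assms) auto
qed

lemma ld_add:
  assumes "x \<in> carrier Loc" "y \<in> carrier Loc"
  shows "ld (x \<oplus>\<^bsub>Loc\<^esub> y) = ld x \<oplus>\<^bsub>Loc\<^esub> ld y"
proof -
  obtain a b c e where x: "a \<in> carrier R" "b \<in> S" "x = fr a b"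
      and y: "c \<in> carrier R" "e \<in> S" "y = fr c e" using assms unfolding Loc_carrier by blast
  note cl = x(1,2) y(1,2) S_carrier[OF x(2)] S_carrier[OF y(2)] mult_S
  have dcl: "d a \<in> carrier R" "d b \<in> carrier R" "d c \<in> carrier R" "d e \<in> carrier R"
      using cl by (auto intro: d_closed)
  obtain a' b' c' e' da db dc de where t: "a = uproj R a'" "b = uproj R b'" "c = uproj R c'"
        "e = uproj R e'" "d a = uproj R da" "d b = uproj R db" "d c = uproj R dc" "d e = uproj R de"
      using cl dcl exists_typed by metis
  note um = typed_hom_uminus(2)[OF uproj_hom[OF is_cring] ring_axioms, symmetric]
  show ?thesis
    unfolding x y using cl dcl
    by (simp add: fr_add ld_fr d_add d_mult, simp only: t(5-8)) (simp add: t(1-4) um algebra_simps flip: typed)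
qed

lemma ld_mult:
  assumes "x \<in> carrier Loc" "y \<in> carrier Loc"
  shows "ld (x \<otimes>\<^bsub>Loc\<^esub> y) = ld x \<otimes>\<^bsub>Loc\<^esub> y \<oplus>\<^bsub>Loc\<^esub> x \<otimes>\<^bsub>Loc\<^esub> ld y"
proof -
  obtain a b c e where x: "a \<in> carrier R" "b \<in> S" "x = fr a b"
      and y: "c \<in> carrier R" "e \<in> S" "y = fr c e" using assms unfolding Loc_carrier by blast
  note cl = x(1,2) y(1,2) S_carrier[OF x(2)] S_carrier[OF y(2)] mult_S
  have dcl: "d a \<in> carrier R" "d b \<in> carrier R" "d c \<in> carrier R" "d e \<in> carrier R"
      using cl by (auto intro: d_closed)
  obtain a' b' c' e' da db dc de where t: "a = uproj R a'" "b = uproj R b'" "c = uproj R c'"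
        "e = uproj R e'" "d a = uproj R da" "d b = uproj R db" "d c = uproj R dc" "d e = uproj R de"
      using cl dcl exists_typed by metis
  note um = typed_hom_uminus(2)[OF uproj_hom[OF is_cring] ring_axioms, symmetric]
  show ?thesis
    unfolding x y using cl dcl
    by (simp add: fr_add fr_mult ld_fr d_add d_mult fr_eq, simp only: t(5-8))
      (simp add: t(1-4) um algebra_simps flip: typed)
qed

lemma d_one: "d \<one> = \<zero>"
proof -
  have c: "d \<one> \<in> carrier R" by (rule d_closed) simp
  have "d (\<one> \<otimes> \<one>) = d \<one> \<otimes> \<one> \<oplus> \<one> \<otimes> d \<one>" by (rule d_mult) simp_all
  then have "d \<one> = d \<one> \<oplus> d \<one>" using c by simp
  then show ?thesis using add.r_cancel_one'[OF c c] by simp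
qed

lemma ld_fr_one: "a \<in> carrier R \<Longrightarrow> ld (fr a \<one>) = fr (d a) \<one>"
  by (simp add: ld_fr one_S d_one d_closed a_minus_def)

end

section \<open>Homomorphisms out of polynomial rings\<close>

text \<open>
  The homomorphism from the polynomial ring that extends \<open>\<kappa>\<close> and sends the variable to \<open>y\<close>.
\<close>

definition poly_ext :: "('s::comm_ring_1 \<Rightarrow> 'b) \<Rightarrow> ('b, 'm) ring_scheme \<Rightarrow> 'b \<Rightarrow> 's poly \<Rightarrow> 'b" where
  "poly_ext \<kappa> B y p = (\<Oplus>\<^bsub>B\<^esub>k\<in>{..Polynomial.degree p}. \<kappa> (pcoeff p k) \<otimes>\<^bsub>B\<^esub> y [^]\<^bsub>B\<^esub> k)"

lemma poly_ext_properties: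
  fixes \<kappa> :: "'s::comm_ring_1 \<Rightarrow> 'b"
  assumes h: "typed_hom \<kappa> B" and B: "cring B" and y: "y \<in> carrier B"
  shows poly_ext_hom: "typed_hom (poly_ext \<kappa> B y) B"
    and poly_ext_pCons: "poly_ext \<kappa> B y (pCons a p) = \<kappa> a \<oplus>\<^bsub>B\<^esub> y \<otimes>\<^bsub>B\<^esub> poly_ext \<kappa> B y p"
    and poly_ext_monom: "poly_ext \<kappa> B y (Polynomial.monom a k) = \<kappa> a \<otimes>\<^bsub>B\<^esub> y [^]\<^bsub>B\<^esub> k"
proof -
  interpret B: cring B by fact
  note hr = typed_homD[OF h]
  let ?e = "poly_ext \<kappa> B y"
  have cl: "\<kappa> a \<otimes>\<^bsub>B\<^esub> y [^]\<^bsub>B\<^esub> k \<in> carrier B" for a and k :: nat using hr(1) y by simp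
  have bound: "?e p = (\<Oplus>\<^bsub>B\<^esub>k\<in>{..N}. \<kappa> (pcoeff p k) \<otimes>\<^bsub>B\<^esub> y [^]\<^bsub>B\<^esub> k)" if "N \<ge> Polynomial.degree p" for p N
    unfolding poly_ext_def
    by (rule B.add.finprod_mono_neutral_cong_left) (use that cl y in \<open>auto simp: coeff_eq_0 hr(2)\<close>)
  have ecl: "?e p \<in> carrier B" for p unfolding poly_ext_def using cl by (intro B.finsum_closed) auto
  have zero: "?e 0 = \<zero>\<^bsub>B\<^esub>" by (simp add: poly_ext_def hr(2))
  have pc: "?e (pCons a p) = \<kappa> a \<oplus>\<^bsub>B\<^esub> y \<otimes>\<^bsub>B\<^esub> ?e p" for a p
  proof -
    have "?e (pCons a p) = (\<Oplus>\<^bsub>B\<^esub>k\<in>{..Suc (Polynomial.degree p)}. \<kappa> (pcoeff (pCons a p) k) \<otimes>\<^bsub>B\<^esub> y [^]\<^bsub>B\<^esub> k)"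
      by (rule bound) (rule degree_pCons_le)
    also have "\<dots> = (\<Oplus>\<^bsub>B\<^esub>k\<in>{..Polynomial.degree p}. \<kappa> (pcoeff p k) \<otimes>\<^bsub>B\<^esub> y [^]\<^bsub>B\<^esub> Suc k) \<oplus>\<^bsub>B\<^esub> \<kappa> a"
      by (subst B.finsum_Suc2) (use cl hr(1) y in \<open>auto simp del: B.nat_pow_Suc\<close>)
    also have "(\<Oplus>\<^bsub>B\<^esub>k\<in>{..Polynomial.degree p}. \<kappa> (pcoeff p k) \<otimes>\<^bsub>B\<^esub> y [^]\<^bsub>B\<^esub> Suc k) =
        (\<Oplus>\<^bsub>B\<^esub>k\<in>{..Polynomial.degree p}. y \<otimes>\<^bsub>B\<^esub> (\<kappa> (pcoeff p k) \<otimes>\<^bsub>B\<^esub> y [^]\<^bsub>B\<^esub> k))"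
      by (rule B.finsum_cong') (use hr(1) y in \<open>auto simp: B.m_ac\<close>)
    also have "\<dots> = y \<otimes>\<^bsub>B\<^esub> ?e p"
      unfolding poly_ext_def by (rule B.finsum_rdistr[symmetric]) (use cl y in auto)
    finally show ?thesis using ecl hr(1) y by (simp add: B.a_comm)
  qed
  have add: "?e (p + q) = ?e p \<oplus>\<^bsub>B\<^esub> ?e q" for p q
  proof (induction p q rule: poly_induct2)
    case (pCons a p b q)
    then show ?case using ecl hr(1) y by (simp add: pc hr(4) B.r_distr B.a_ac)
  qed (simp add: zero)
  have sm: "?e (smult a p) = \<kappa> a \<otimes>\<^bsub>B\<^esub> ?e p" for a p
  proof (induction p)
    case (pCons b p)
    then show ?case using ecl hr(1) y by (simp add: pc hr(5) B.r_distr B.m_ac)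
  qed (simp add: zero hr)
  have mult: "?e (p * q) = ?e p \<otimes>\<^bsub>B\<^esub> ?e q" for p q
  proof (induction p)
    case (pCons b p)
    then show ?case using ecl hr(1) y by (simp add: pc add sm hr(2) B.l_distr B.r_distr B.m_ac)
  qed (simp add: zero ecl)
  have one: "?e 1 = \<one>\<^bsub>B\<^esub>" unfolding one_pCons using y by (simp add: pc zero hr(3))
  show "typed_hom ?e B" using ecl zero one add mult by (auto simp: typed_hom_def)
  show "?e (pCons a p) = \<kappa> a \<oplus>\<^bsub>B\<^esub> y \<otimes>\<^bsub>B\<^esub> ?e p" by (rule pc)
  show "?e (Polynomial.monom a k) = \<kappa> a \<otimes>\<^bsub>B\<^esub> y [^]\<^bsub>B\<^esub> k"
    by (induction k) (use hr y in \<open>auto simp: monom_0 monom_Suc pc zero B.m_ac\<close>)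
qed

text \<open>
  The map induced by \<open>\<omega>\<close> on coefficients, into the univariate polynomials over a record ring.
\<close>

definition up_map :: "('s::comm_ring_1 \<Rightarrow> 'b) \<Rightarrow> 's poly \<Rightarrow> (nat \<Rightarrow> 'b)" where
  "up_map \<omega> p = (\<lambda>j. \<omega> (pcoeff p j))"

lemma up_map_closed:
  assumes "typed_hom \<omega> B"
  shows "up_map \<omega> p \<in> up B"
proof (rule mem_upI)
  show "up_map \<omega> p j \<in> carrier B" for j using typed_homD(1)[OF assms] by (simp add: up_map_def)
  have "bound \<zero>\<^bsub>B\<^esub> (Polynomial.degree p) (up_map \<omega> p)"
    by (auto simp: up_map_def coeff_eq_0 typed_homD(2)[OF assms])
  then show "\<exists>j. bound \<zero>\<^bsub>B\<^esub> j (up_map \<omega> p)" by blast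
qed

lemma up_map_hom:
  fixes \<omega> :: "'s::comm_ring_1 \<Rightarrow> 'b"
  assumes h: "typed_hom \<omega> B" and B: "cring B"
  shows "typed_hom (up_map \<omega>) (UP B)"
proof -
  interpret B: cring B by fact
  note hr = typed_homD[OF h]
  note cl = up_map_closed[OF h]
  have m: "up_map \<omega> (p * q) = (\<lambda>n. \<Oplus>\<^bsub>B\<^esub>i \<in> {..n}. up_map \<omega> p i \<otimes>\<^bsub>B\<^esub> up_map \<omega> q (n - i))" for p q
    unfolding up_map_def coeff_mult by (simp add: typed_hom_sum[OF h B.ring_axioms] hr(5))
  show ?thesis
    unfolding typed_hom_def
  proof (intro conjI allI)
    show "range (up_map \<omega>) \<subseteq> carrier (UP B)" using cl by (auto simp: UP_def)
    show "up_map \<omega> 0 = \<zero>\<^bsub>UP B\<^esub>" by (simp add: UP_def up_map_def hr)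
    show "up_map \<omega> 1 = \<one>\<^bsub>UP B\<^esub>" by (auto simp: UP_def up_map_def hr fun_eq_iff)
    show "up_map \<omega> (p + q) = up_map \<omega> p \<oplus>\<^bsub>UP B\<^esub> up_map \<omega> q" for p q
      using cl by (simp add: UP_def up_map_def hr fun_eq_iff)
    show "up_map \<omega> (p * q) = up_map \<omega> p \<otimes>\<^bsub>UP B\<^esub> up_map \<omega> q" for p q
      unfolding m using cl by (simp add: UP_def)
  qed
qed

lemma up_map_monom:
  assumes "typed_hom \<omega> B"
  shows "monom (UP B) (\<omega> a) k = up_map \<omega> (Polynomial.monom a k)"
  using typed_homD(1,2)[OF assms] by (auto simp: UP_def up_map_def fun_eq_iff)

lemma up_map_surj:
  assumes h: "typed_hom \<omega> B" and s: "carrier B \<subseteq> range \<omega>" and u: "u \<in> carrier (UP B)"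
  obtains p where "u = up_map \<omega> p"
proof -
  have u': "u \<in> up B" using u by (simp add: UP_def)
  then obtain N where N: "\<And>j. N < j \<Longrightarrow> u j = \<zero>\<^bsub>B\<^esub>" by (auto simp: up_def)
  define c where "c j = (SOME a. \<omega> a = u j)" for j
  have c: "\<omega> (c j) = u j" for j
  proof -
    have "u j \<in> range \<omega>" using s mem_upD[OF u'] by blast
    then obtain a where "\<omega> a = u j" by auto
    then show ?thesis unfolding c_def by (rule someI)
  qed
  define p where "p = (\<Sum>j\<le>N. Polynomial.monom (c j) j)"
  have "pcoeff p j = (if j \<le> N then c j else 0)" for j by (simp add: p_def Polynomial.coeff_sum)
  then have "u = up_map \<omega> p"
    using N by (auto simp: up_map_def fun_eq_iff c typed_homD(2)[OF h] not_le)
  then show thesis by (rule that)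
qed

section \<open>Free algebras\<close>

text \<open>
  Words, as a type of class \<^class>\<open>monoid_add\<close>: the finitely supported functions on it are the free
  algebra, with its product.
\<close>

datatype 'l free_monoid = FM (letters: "'l list")

instantiation free_monoid :: (type) monoid_add
begin
definition "0 = FM []"
definition "a + b = FM (letters a @ letters b)"
instance by standard (auto simp: zero_free_monoid_def plus_free_monoid_def)
end

lemma free_monoid_simps [simp]: "letters 0 = []" "letters (a + b) = letters a @ letters b"
  by (simp_all add: zero_free_monoid_def plus_free_monoid_def)

lemma lookup_mult_free:
  fixes f g :: "'l free_monoid \<Rightarrow>\<^sub>0 'r::comm_ring_1"
  shows "lookup (f * g) (FM w) = (\<Sum>i\<le>length w. lookup f (FM (take i w)) * lookup g (FM (drop i w)))"
proof (induction f rule: poly_mapping_additive_induct)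
  case (single a c)
  show ?case
  proof (induction g rule: poly_mapping_additive_induct)
    case (single b d)
    obtain a' b' where ab: "a = FM a'" "b = FM b'" by (cases a, cases b) auto
    let ?t = "if take (length a') w = a' \<and> drop (length a') w = b' then c * d else 0"
    have "(\<Sum>i\<le>length w. lookup (single a c) (FM (take i w)) * lookup (single b d) (FM (drop i w))) =
        (\<Sum>i\<le>length w. if i = length a' then ?t else 0)"
      by (intro sum.cong refl) (auto simp: lookup_single when_def ab)
    also have "\<dots> = (if length a' \<le> length w then ?t else 0)" by simp
    also have "\<dots> = (if a' @ b' = w then c * d else 0)"
      by (auto simp: append_eq_conv_conj)
    also have "\<dots> = lookup (single a c * single b d) (FM w)"
      by (simp add: mult_single lookup_single when_def ab plus_free_monoid_def)
    finally show ?case by simp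
  qed (simp_all add: lookup_add algebra_simps sum.distrib)
qed (simp_all add: lookup_add algebra_simps sum.distrib)

definition free_map :: "('r \<Rightarrow> 'a) \<Rightarrow> ('a, 'm) ring_scheme \<Rightarrow> 'l set \<Rightarrow>
    ('l free_monoid \<Rightarrow>\<^sub>0 'r::comm_ring_1) \<Rightarrow> ('l list \<Rightarrow> 'a)" where
  "free_map \<sigma> R L p = (\<lambda>w. if w \<in> lists L then \<sigma> (lookup p (FM w)) else \<zero>\<^bsub>R\<^esub>)"

lemma free_map_support:
  assumes h: "typed_hom \<sigma> R"
  shows "{w. free_map \<sigma> R L p w \<noteq> \<zero>\<^bsub>R\<^esub>} \<subseteq> letters ` keys p"
proof
  fix w assume "w \<in> {w. free_map \<sigma> R L p w \<noteq> \<zero>\<^bsub>R\<^esub>}"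
  then have "FM w \<in> keys p"
    by (auto simp: free_map_def in_keys_iff typed_homD(2)[OF h] split: if_splits)
  then show "w \<in> letters ` keys p" by (intro image_eqI[of _ _ "FM w"]) auto
qed

lemma free_map_hom:
  assumes h: "typed_hom \<sigma> R" and R: "ring R"
  shows "typed_hom (free_map \<sigma> R L) (free_algebra R L)"
proof -
  interpret ring R by fact
  note hr = typed_homD[OF h]
  have c: "free_map \<sigma> R L p w \<in> carrier R" for p w by (auto simp: free_map_def hr(1))
  have "finite {w. free_map \<sigma> R L p w \<noteq> \<zero>\<^bsub>R\<^esub>}" for p
    using free_map_support[OF h] by (rule finite_subset) simp
  then have 1: "range (free_map \<sigma> R L) \<subseteq> carrier (free_algebra R L)"
    using c by (auto simp: free_algebra_def free_map_def split: if_splits)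
  have 2: "free_map \<sigma> R L (p * q) w =
      (\<Oplus>\<^bsub>R\<^esub>i\<in>{..length w}. free_map \<sigma> R L p (take i w) \<otimes>\<^bsub>R\<^esub> free_map \<sigma> R L q (drop i w))" for p q w
  proof (cases "w \<in> lists L")
    case True
    have "free_map \<sigma> R L (p * q) w =
        (\<Oplus>\<^bsub>R\<^esub>i\<in>{..length w}. \<sigma> (lookup p (FM (take i w))) \<otimes>\<^bsub>R\<^esub> \<sigma> (lookup q (FM (drop i w))))"
      using True by (simp add: free_map_def lookup_mult_free typed_hom_sum[OF h R] hr)
    also have "\<dots> = (\<Oplus>\<^bsub>R\<^esub>i\<in>{..length w}. free_map \<sigma> R L p (take i w) \<otimes>\<^bsub>R\<^esub> free_map \<sigma> R L q (drop i w))"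
    proof (rule finsum_cong')
      fix i
      have "take i w \<in> lists L" "drop i w \<in> lists L"
        using True by (auto simp: in_lists_conv_set dest: in_set_takeD in_set_dropD)
      then show "\<sigma> (lookup p (FM (take i w))) \<otimes>\<^bsub>R\<^esub> \<sigma> (lookup q (FM (drop i w))) =
          free_map \<sigma> R L p (take i w) \<otimes>\<^bsub>R\<^esub> free_map \<sigma> R L q (drop i w)"
        by (simp add: free_map_def)
    qed (auto simp: c)
    finally show ?thesis .
  next
    case False
    have "(\<Oplus>\<^bsub>R\<^esub>i\<in>{..length w}. free_map \<sigma> R L p (take i w) \<otimes>\<^bsub>R\<^esub> free_map \<sigma> R L q (drop i w)) =
        (\<Oplus>\<^bsub>R\<^esub>i\<in>{..length w}. \<zero>\<^bsub>R\<^esub>)"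
    proof (rule finsum_cong')
      fix i
      have "take i w \<notin> lists L \<or> drop i w \<notin> lists L"
        using False by (metis append_in_lists_conv append_take_drop_id)
      then show "free_map \<sigma> R L p (take i w) \<otimes>\<^bsub>R\<^esub> free_map \<sigma> R L q (drop i w) = \<zero>\<^bsub>R\<^esub>"
        using c by (auto simp: free_map_def hr(1))
    qed auto
    then show ?thesis using False by (simp add: free_map_def)
  qed
  have 3: "free_map \<sigma> R L 0 = (\<lambda>_. \<zero>\<^bsub>R\<^esub>)" "free_map \<sigma> R L 1 = (\<lambda>w. if w = [] then \<one>\<^bsub>R\<^esub> else \<zero>\<^bsub>R\<^esub>)"
    by (auto simp: free_map_def hr(2,3) lookup_one when_def zero_free_monoid_def fun_eq_iff)
  have 4: "free_map \<sigma> R L (p + q) w = free_map \<sigma> R L p w \<oplus>\<^bsub>R\<^esub> free_map \<sigma> R L q w" for p q w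
    by (simp add: free_map_def lookup_add hr(4))
  show ?thesis
    unfolding typed_hom_def using 1 2 3 4 by (simp add: free_algebra_def fun_eq_iff)
qed

lemma free_map_surj:
  assumes h: "typed_hom \<sigma> R" and s: "carrier R \<subseteq> range \<sigma>"
    and p: "p \<in> carrier (free_algebra R L)"
  obtains f where "p = free_map \<sigma> R L f" "letters ` keys f \<subseteq> lists L"
proof -
  note hr = typed_homD[OF h]
  have pc: "\<And>w. p w \<in> carrier R" "finite {w. p w \<noteq> \<zero>\<^bsub>R\<^esub>}" "{w. p w \<noteq> \<zero>\<^bsub>R\<^esub>} \<subseteq> lists L"
    using p by (auto simp: free_algebra_def)
  define c where "c w = (SOME a. \<sigma> a = p w)" for w
  have c: "\<sigma> (c w) = p w" for w
  proof -
    have "p w \<in> range \<sigma>" using s pc(1) by blast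
    then obtain a where "\<sigma> a = p w" by auto
    then show ?thesis unfolding c_def by (rule someI)
  qed
  define f where "f = (\<Sum>w\<in>{w. p w \<noteq> \<zero>\<^bsub>R\<^esub>}. single (FM w) (c w))"
  have l: "lookup f (FM v) = (if p v \<noteq> \<zero>\<^bsub>R\<^esub> then c v else 0)" for v
  proof -
    have "lookup f (FM v) = (\<Sum>w\<in>{w. p w \<noteq> \<zero>\<^bsub>R\<^esub>}. if w = v then c w else 0)"
      by (simp add: f_def lookup_sum lookup_single when_def)
    also have "\<dots> = (if v \<in> {w. p w \<noteq> \<zero>\<^bsub>R\<^esub>} then c v else 0)" by (rule sum.delta[OF pc(2)])
    finally show ?thesis by simp
  qed
  have "p = free_map \<sigma> R L f" using pc(3) by (auto simp: free_map_def fun_eq_iff l c hr(2))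
  moreover have "letters ` keys f \<subseteq> lists L"
  proof (rule image_subsetI)
    fix k assume k: "k \<in> keys f"
    obtain w where w: "k = FM w" by (cases k)
    then have "p w \<noteq> \<zero>\<^bsub>R\<^esub>" using k by (auto simp: in_keys_iff l split: if_splits)
    then show "letters k \<in> lists L" using pc(3) w by auto
  qed
  ultimately show thesis by (rule that)
qed

lemma free_algebra_ring:
  assumes "cring R"
  shows "ring (free_algebra R L)"
proof (rule typed_image_ring)
  have R: "ring R" using assms by (rule cring.axioms)
  show "typed_hom (free_map (uproj R) R L) (free_algebra R L)"
    by (rule free_map_hom[OF uproj_hom[OF assms] R])
  show "carrier (free_algebra R L) \<subseteq> range (free_map (uproj R) R L)"
    using free_map_surj[OF uproj_hom[OF assms] uproj_surj[OF assms]] by blast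
qed

lemma free_word_map:
  assumes "typed_hom \<sigma> R" "w \<in> lists L"
  shows "free_word R w = free_map \<sigma> R L (single (FM w) 1)"
  using assms typed_homD(2,3)[OF assms(1)]
  by (auto simp: free_word_def free_map_def lookup_single when_def fun_eq_iff)

section \<open>The Weyl algebra acting on the module generated by \<open>g\<^sup>s\<close>\<close>

subsection \<open>The action before specialization\<close>

text \<open>
  Here \<open>y\<close> stands for \<open>1/g\<close>, so that the elements of \<^typ>\<open>'r mpoly poly\<close> are polynomials in \<open>y\<close>
  and those of \<^typ>\<open>'r mpoly poly poly\<close> are polynomials in \<open>y\<close> and \<open>s\<close>.
\<close>

text \<open>
  The derivation \<open>\<partial>\<^sub>i\<close> of \<open>R[x][1/g]\<close> on polynomials in \<open>y\<close>, with \<open>\<partial>\<^sub>i y = - (\<partial>\<^sub>i g) y\<^sup>2\<close>.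
\<close>

definition ypoly_deriv :: "'r::comm_ring_1 mpoly \<Rightarrow> nat \<Rightarrow> 'r mpoly poly \<Rightarrow> 'r mpoly poly" where
  "ypoly_deriv g i A = map_poly (pderiv_at i) A - smult (pderiv_at i g) (pCons 0 (euler A))"

lemma coeff_ypoly_deriv: "pcoeff (ypoly_deriv g i A) k = pderiv_at i (pcoeff A k) -
    (if k = 0 then 0 else pderiv_at i g * (of_nat (k - 1) * pcoeff A (k - 1)))"
  by (cases k) (simp_all add: ypoly_deriv_def coeff_map_poly)

lemma pderiv_at_of_nat [simp]: "pderiv_at i (of_nat k :: 'v multiset \<Rightarrow>\<^sub>0 'r::comm_ring_1) = 0"
  by (simp flip: single_of_nat)

lemma ypoly_deriv_add: "ypoly_deriv g i (A + B) = ypoly_deriv g i A + ypoly_deriv g i B"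
  by (rule poly_eqI) (simp add: coeff_ypoly_deriv pderiv_at_add algebra_simps)

lemma ypoly_deriv_zero [simp]: "ypoly_deriv g i 0 = 0"
  by (rule poly_eqI) (simp add: coeff_ypoly_deriv)

lemma ypoly_deriv_pCons: "ypoly_deriv g i (pCons a A) =
    [:pderiv_at i a:] + pCons 0 (ypoly_deriv g i A) - smult (pderiv_at i g) (pCons 0 (pCons 0 A))"
proof (rule poly_eqI)
  fix k
  show "pcoeff (ypoly_deriv g i (pCons a A)) k = pcoeff ([:pderiv_at i a:] + pCons 0 (ypoly_deriv g i A)
      - smult (pderiv_at i g) (pCons 0 (pCons 0 A))) k"
    by (auto simp: coeff_ypoly_deriv coeff_pCons algebra_simps split: nat.splits)
qed

lemma ypoly_deriv_smult: "ypoly_deriv g i (smult a A) = smult (pderiv_at i a) A + smult a (ypoly_deriv g i A)"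
  by (rule poly_eqI) (simp add: coeff_ypoly_deriv pderiv_at_mult algebra_simps)

lemma ypoly_deriv_mult: "ypoly_deriv g i (A * B) = ypoly_deriv g i A * B + A * ypoly_deriv g i B"
proof (induction A)
  case (pCons a A)
  have 1: "ypoly_deriv g i (pCons 0 C) = pCons 0 (ypoly_deriv g i C)
      - smult (pderiv_at i g) (pCons 0 (pCons 0 C))" for C
    by (simp add: ypoly_deriv_pCons)
  have 2: "pCons 0 (C + C') = pCons 0 C + pCons 0 C'" for C C' :: "'a mpoly poly" by simp
  show ?case
    unfolding mult_pCons_left ypoly_deriv_add ypoly_deriv_smult 1 pCons.IH ypoly_deriv_pCons 2
    by (simp only: distrib_right left_diff_distrib mult_pCons_left mult_smult_left mult_zero_left
        smult_0_left pderiv_at_zero pCons_0_0 add_0_left add_0_right add_ac diff_add_eq add_diff_eq)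
qed simp

lemma ypoly_deriv_commute:
  "ypoly_deriv g i (ypoly_deriv g j A) = ypoly_deriv g j (ypoly_deriv g i A)"
proof (rule poly_eqI)
  fix k
  show "pcoeff (ypoly_deriv g i (ypoly_deriv g j A)) k = pcoeff (ypoly_deriv g j (ypoly_deriv g i A)) k"
    by (simp add: coeff_ypoly_deriv pderiv_at_diff pderiv_at_mult
        pderiv_at_commute[of i j] algebra_simps)
qed

lemma ypoly_deriv_y: "ypoly_deriv g i (Polynomial.monom a 1) =
    Polynomial.monom (pderiv_at i a) 1 - Polynomial.monom (pderiv_at i g * a) 2"
  by (rule poly_eqI) (auto simp: coeff_ypoly_deriv)

fun letter_op :: "'r::comm_ring_1 mpoly \<Rightarrow> weyl_letter \<Rightarrow> 'r mpoly poly poly \<Rightarrow> 'r mpoly poly poly" where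
  "letter_op g (Var i) U = smult [:single {#i#} 1:] U"
| "letter_op g (Diff i) U = map_poly (ypoly_deriv g i) U + pCons 0 (smult (Polynomial.monom (pderiv_at i g) 1) U)"

abbreviation const3 :: "'r::comm_ring_1 \<Rightarrow> 'r mpoly poly poly" where
  "const3 c \<equiv> [:[:single 0 c:]:]"

lemma coeff_letter_op_Diff: "pcoeff (letter_op g (Diff i) U) k = ypoly_deriv g i (pcoeff U k) +
    (if k = 0 then 0 else Polynomial.monom (pderiv_at i g) 1 * pcoeff U (k - 1))"
  by (cases k) (simp_all add: coeff_map_poly)

lemma letter_op_add: "letter_op g l (U + V) = letter_op g l U + letter_op g l V"
  by (cases l; rule poly_eqI)
    (auto simp: coeff_letter_op_Diff ypoly_deriv_add algebra_simps smult_add_right simp del: letter_op.simps(2))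

lemma letter_op_zero [simp]: "letter_op g l 0 = 0"
  by (cases l; rule poly_eqI) (auto simp: coeff_letter_op_Diff simp del: letter_op.simps(2))

lemma letter_op_const3: "letter_op g l (const3 c * U) = const3 c * letter_op g l U"
  by (cases l; rule poly_eqI)
    (auto simp: coeff_letter_op_Diff ypoly_deriv_smult algebra_simps simp del: letter_op.simps(2))

lemma letter_op_s: "letter_op g l (pCons 0 U) = pCons 0 (letter_op g l U)"
proof (cases l)
  case (Diff i)
  show ?thesis unfolding Diff
    by (rule poly_eqI) (simp add: coeff_letter_op_Diff coeff_pCons split: nat.splits del: letter_op.simps(2))
qed simp

text \<open>
  The relations of the Weyl algebra hold before specialization.
\<close>

lemma letter_op_commutators:
  "letter_op g (Var i) (letter_op g (Var j) U) = letter_op g (Var j) (letter_op g (Var i) U)"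
  "letter_op g (Diff i) (letter_op g (Diff j) U) = letter_op g (Diff j) (letter_op g (Diff i) U)"
  "letter_op g (Diff i) (letter_op g (Var j) U) =
     letter_op g (Var j) (letter_op g (Diff i) U) + (if i = j then U else 0)"
proof -
  show "letter_op g (Var i) (letter_op g (Var j) U) = letter_op g (Var j) (letter_op g (Var i) U)"
    by (simp add: mult.commute)
  show "letter_op g (Diff i) (letter_op g (Diff j) U) = letter_op g (Diff j) (letter_op g (Diff i) U)"
  proof (rule poly_eqI)
    fix k
    have m: "Polynomial.monom (pderiv_at i g) 1 * (Polynomial.monom (pderiv_at j g) 1 * A) =
      Polynomial.monom (pderiv_at j g) 1 * (Polynomial.monom (pderiv_at i g) 1 * A)" for A
      by (simp add: mult.left_commute)
    have d: "ypoly_deriv g i (Polynomial.monom (pderiv_at j g) 1) = ypoly_deriv g j (Polynomial.monom (pderiv_at i g) 1)"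
      unfolding ypoly_deriv_y by (simp add: pderiv_at_commute[of i j] mult.commute)
    show "pcoeff (letter_op g (Diff i) (letter_op g (Diff j) U)) k =
      pcoeff (letter_op g (Diff j) (letter_op g (Diff i) U)) k"
      by (simp add: coeff_letter_op_Diff ypoly_deriv_add ypoly_deriv_mult ypoly_deriv_commute[of g i j] d[unfolded One_nat_def] m
          algebra_simps del: letter_op.simps(2))
  qed
  have v: "pderiv_at i (single {#j#} 1 :: 'a mpoly) = (if i = j then 1 else 0)"
    by (auto simp: pderiv_at_single)
  show "letter_op g (Diff i) (letter_op g (Var j) U) =
     letter_op g (Var j) (letter_op g (Diff i) U) + (if i = j then U else 0)"
    by (rule poly_eqI)
      (auto simp: coeff_letter_op_Diff ypoly_deriv_smult v algebra_simps simp del: letter_op.simps(2))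
qed

definition free_op :: "'r::comm_ring_1 mpoly \<Rightarrow> (weyl_letter free_monoid \<Rightarrow>\<^sub>0 'r) \<Rightarrow>
    'r mpoly poly poly \<Rightarrow> 'r mpoly poly poly" where
  "free_op g p U = (\<Sum>w\<in>keys p. const3 (lookup p w) * foldr (letter_op g) (letters w) U)"

lemma free_op_superset:
  assumes "finite A" "keys p \<subseteq> A"
  shows "free_op g p U = (\<Sum>w\<in>A. const3 (lookup p w) * foldr (letter_op g) (letters w) U)"
  unfolding free_op_def by (rule sum.mono_neutral_left) (use assms in \<open>auto simp: in_keys_iff\<close>)

lemma free_op_single [simp]: "free_op g (single w c) U = const3 c * foldr (letter_op g) (letters w) U"
  by (subst free_op_superset[of "{w}"]) auto

lemma free_op_add: "free_op g (p + q) U = free_op g p U + free_op g q U"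
proof -
  let ?A = "keys p \<union> keys q"
  have "keys (p + q) \<subseteq> ?A" by (rule keys_add)
  moreover have "const3 (c + d) = const3 c + const3 d" for c d :: 'a by (simp add: single_add)
  ultimately show ?thesis
    by (simp only: free_op_superset[of ?A] finite_UnI finite_keys Un_upper1 Un_upper2 lookup_add
        distrib_right sum.distrib)
qed

lemma free_op_zero [simp]: "free_op g 0 U = 0" by (simp add: free_op_def)

lemma foldr_letter_op_linear:
  "foldr (letter_op g) w (U + V) = foldr (letter_op g) w U + foldr (letter_op g) w V"
  "foldr (letter_op g) w (const3 c * U) = const3 c * foldr (letter_op g) w U"
  "foldr (letter_op g) w 0 = 0" "foldr (letter_op g) w (pCons 0 U) = pCons 0 (foldr (letter_op g) w U)"
  by (induction w) (simp_all only: foldr.simps o_apply id_apply letter_op_add letter_op_const3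
      letter_op_zero letter_op_s)

lemma free_op_linear:
  "free_op g p (U + V) = free_op g p U + free_op g p V" "free_op g p 0 = 0"
  by (simp_all only: free_op_def foldr_letter_op_linear distrib_left sum.distrib mult_zero_right sum.neutral_const)

lemma free_op_mult: "free_op g (p * q) U = free_op g p (free_op g q U)"
proof (induction p rule: poly_mapping_additive_induct)
  case (single w c)
  show ?case
  proof (induction q rule: poly_mapping_additive_induct)
    case (single v d)
    have "const3 (c * d) = const3 c * const3 d" by (simp add: mult_single)
    then show ?case
      by (simp only: mult_single free_op_single free_monoid_simps foldr_append foldr_letter_op_linear mult.assoc)
  next
    case (add f g')
    then show ?case by (simp only: distrib_left free_op_add free_op_linear)
  qed (simp only: mult_zero_right free_op_zero free_op_linear)
qed (simp_all only: distrib_right free_op_add mult_zero_left free_op_zero)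

subsection \<open>The action on the module generated by \<open>g\<^sup>s\<close>\<close>

lemma partial_diff_mpoly_map:
  assumes h: "typed_hom \<sigma> K" and K: "ring K" and i: "i \<in> I"
  shows "partial_diff K i (mpoly_map \<sigma> K I f) = mpoly_map \<sigma> K I (pderiv_at i f)"
proof
  interpret ring K by fact
  fix m
  have "[Suc (count m i)] \<cdot>\<^bsub>K\<^esub> \<zero>\<^bsub>K\<^esub> = \<zero>\<^bsub>K\<^esub>" by (rule add.nat_pow_one)
  then show "partial_diff K i (mpoly_map \<sigma> K I f) m = mpoly_map \<sigma> K I (pderiv_at i f) m"
    using i by (simp add: partial_diff_def mpoly_map_def lookup_pderiv_at typed_hom_of_nat(2)[OF h K] del: of_nat_Suc)
qed

lemma mpoly_map_const:
  assumes h: "typed_hom \<sigma> K" and K: "ring K"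
  shows "ring.indexed_const K (\<sigma> c) = mpoly_map \<sigma> K I (single 0 c)"
proof -
  interpret ring K by fact
  show ?thesis
    by (auto simp: indexed_const_def mpoly_map_def lookup_single when_def typed_homD(2)[OF h] fun_eq_iff)
qed

lemma mpoly_map_var:
  assumes h: "typed_hom \<sigma> K" and K: "ring K" and i: "i \<in> I"
  shows "ring.indexed_var K i = mpoly_map \<sigma> K I (single {#i#} 1)"
proof -
  interpret ring K by fact
  have "m - {#i#} = {#} \<longleftrightarrow> m = {#i#}" if "i \<in># m" for m
    using that by (metis add_mset_remove_trivial insert_DiffM)
  then show ?thesis using i
    by (auto simp: indexed_var_def indexed_pmult_def indexed_const_def mpoly_map_def lookup_single when_def
        typed_homD(2,3)[OF h] fun_eq_iff)
qed

text \<open>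
  A polynomial over a field \<open>K\<close>, given as the image under \<open>\<sigma>\<close> of a polynomial \<open>g\<close> over a typed ring. The
  maps \<open>\<kappa>\<close>, \<open>omega\<close> and \<open>Omega\<close> specialize polynomials, polynomials in \<open>y = 1/g\<close>, and polynomials in \<open>y\<close>
  and \<open>s\<close>.
\<close>

locale gs_setting =
  fixes K :: "('a, 'm) ring_scheme" and n :: nat and \<sigma> :: "'r::comm_ring_1 \<Rightarrow> 'a" and g :: "'r mpoly"
  assumes field_K: "field K" and hom: "typed_hom \<sigma> K"
    and g_nonzero: "mpoly_map \<sigma> K {..<n} g \<noteq> \<zero>\<^bsub>poly_ring K n\<^esub>"
begin

abbreviation "\<kappa> \<equiv> mpoly_map \<sigma> K {..<n}"
abbreviation "P \<equiv> poly_ring K n"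
abbreviation "S \<equiv> powers P (\<kappa> g)"
abbreviation "B \<equiv> inverted_ring K n (\<kappa> g)"
abbreviation "N \<equiv> gs_module K n (\<kappa> g)"

lemma domain_K: "domain K" and cring_K: "cring K" and ring_K: "ring K"
  using field_K by (auto simp: field_def domain_def cring_def)

lemma domain_P: "domain P" by (rule mpoly_domain[OF domain_K])
lemma cring_P: "cring P" using domain_P by (simp add: domain_def)

lemma kappa_hom: "typed_hom \<kappa> P" by (rule mpoly_map_hom[OF hom ring_K])

lemmas kappa = typed_homD[OF kappa_hom]

sublocale loc: domain_localization P S
proof -
  interpret domain P by (rule domain_P)
  have c: "\<kappa> g \<in> carrier P" by (rule kappa)
  have nz: "\<kappa> g [^]\<^bsub>P\<^esub> (e::nat) \<noteq> \<zero>\<^bsub>P\<^esub>" for e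
    by (induction e) (use c g_nonzero in \<open>auto simp: integral_iff\<close>)
  show "domain_localization P S"
  proof
    show "S \<subseteq> carrier P - {\<zero>\<^bsub>P\<^esub>}" using c nz by (auto simp: powers_def)
    show "\<one>\<^bsub>P\<^esub> \<in> S" unfolding powers_def by (rule range_eqI[of _ _ "0::nat"]) simp
    fix b e assume "b \<in> S" "e \<in> S"
    then obtain i j :: nat where "b = \<kappa> g [^]\<^bsub>P\<^esub> i" "e = \<kappa> g [^]\<^bsub>P\<^esub> j" by (auto simp: powers_def)
    then have "b \<otimes>\<^bsub>P\<^esub> e = \<kappa> g [^]\<^bsub>P\<^esub> (i + j)" using c by (simp add: nat_pow_mult)
    then show "b \<otimes>\<^bsub>P\<^esub> e \<in> S" unfolding powers_def by (rule range_eqI)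
  qed
qed

lemma B_eq: "B = loc.Loc" by (simp add: inverted_ring_def)
lemma frac_eq: "inverted_frac K n (\<kappa> g) = loc.fr" by (simp add: inverted_frac_def)
lemma poly_eq: "inverted_poly K n (\<kappa> g) = (\<lambda>h. loc.fr h \<one>\<^bsub>P\<^esub>)"
  by (simp add: inverted_poly_def inverted_frac_def fun_eq_iff)

lemma cring_B: "cring B" unfolding B_eq by (rule loc.Loc_cring)

lemma cring_N: "cring N"
proof -
  interpret UP_cring B N by (simp add: UP_cring_def cring_B)
  show ?thesis by (rule UP_cring)
qed

lemma g_in_S: "\<kappa> g \<in> S"
  unfolding powers_def by (rule range_eqI[of _ _ 1]) (simp add: cring.cring_simprules[OF cring_P] kappa)

definition omega :: "'r mpoly poly \<Rightarrow> 'a inverted_poly" where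
  "omega = poly_ext (\<lambda>a. loc.fr (\<kappa> a) \<one>\<^bsub>P\<^esub>) B (loc.fr \<one>\<^bsub>P\<^esub> (\<kappa> g))"

lemma y_closed: "loc.fr \<one>\<^bsub>P\<^esub> (\<kappa> g) \<in> carrier B"
  unfolding B_eq by (rule loc.fr_closed) (simp_all add: g_in_S)

lemma fr_one: "typed_hom (\<lambda>a. loc.fr (\<kappa> a) \<one>\<^bsub>P\<^esub>) B"
  unfolding B_eq by (rule loc.fr_one_hom[OF kappa_hom])

lemma omega_hom: "typed_hom omega B"
  unfolding omega_def by (rule poly_ext_hom[OF fr_one cring_B y_closed])

lemmas omega = typed_homD[OF omega_hom]

lemma omega_pCons: "omega (pCons a A) =
    loc.fr (\<kappa> a) \<one>\<^bsub>P\<^esub> \<oplus>\<^bsub>B\<^esub> loc.fr \<one>\<^bsub>P\<^esub> (\<kappa> g) \<otimes>\<^bsub>B\<^esub> omega A"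
  unfolding omega_def by (rule poly_ext_pCons[OF fr_one cring_B y_closed])

lemma y_power: "loc.fr \<one>\<^bsub>P\<^esub> (\<kappa> g) [^]\<^bsub>B\<^esub> (k::nat) = loc.fr \<one>\<^bsub>P\<^esub> (\<kappa> g [^]\<^bsub>P\<^esub> k) \<and> \<kappa> g [^]\<^bsub>P\<^esub> k \<in> S"
proof (induction k)
  case 0
  then show ?case by (simp add: B_eq loc.one_Loc loc.one_S)
next
  case (Suc k)
  then show ?case by (simp add: B_eq loc.fr_mult loc.mult_S g_in_S)
qed

lemma omega_monom: "omega (Polynomial.monom a k) = loc.fr (\<kappa> a) (\<kappa> g [^]\<^bsub>P\<^esub> k)"
proof -
  interpret P: domain P by (rule domain_P)
  have "omega (Polynomial.monom a k) = loc.fr (\<kappa> a) \<one>\<^bsub>P\<^esub> \<otimes>\<^bsub>B\<^esub> loc.fr \<one>\<^bsub>P\<^esub> (\<kappa> g) [^]\<^bsub>B\<^esub> k"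
    unfolding omega_def by (rule poly_ext_monom[OF fr_one cring_B y_closed])
  also have "\<dots> = loc.fr (\<kappa> a) (\<kappa> g [^]\<^bsub>P\<^esub> k)"
    using y_power[of k] loc.S_carrier[of "\<kappa> g [^]\<^bsub>P\<^esub> k"] by (simp add: B_eq loc.fr_mult loc.one_S kappa)
  finally show ?thesis .
qed

lemma omega_const: "omega [:a:] = loc.fr (\<kappa> a) \<one>\<^bsub>P\<^esub>"
  using omega_monom[of a 0] by (simp add: monom_0)

lemma omega_y: "omega (Polynomial.monom a 1) = loc.fr (\<kappa> a) (\<kappa> g)"
proof -
  interpret P: domain P by (rule domain_P)
  show ?thesis using omega_monom[of a 1] by (simp add: kappa)
qed

lemma omega_y_g: "omega (Polynomial.monom g 1) = \<one>\<^bsub>B\<^esub>"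
  unfolding omega_y by (simp add: B_eq loc.one_Loc loc.fr_eq g_in_S loc.one_S kappa cring.cring_simprules[OF cring_P])

definition Omega :: "'r mpoly poly poly \<Rightarrow> nat \<Rightarrow> 'a inverted_poly" where
  "Omega = up_map omega"

lemma Omega_hom: "typed_hom Omega N"
  unfolding Omega_def by (rule up_map_hom[OF omega_hom cring_B])

lemmas Omega = typed_homD[OF Omega_hom]

lemma gs_monom_eq: "gs_monom K n (\<kappa> g) (\<kappa> a) j = Omega (Polynomial.monom [:a:] j)"
  unfolding gs_monom_def poly_eq omega_const[symmetric] Omega_def by (rule up_map_monom[OF omega_hom])

lemma gs_monom_const: "gs_monom K n (\<kappa> g) (ring.indexed_const K (\<sigma> c)) 0 = Omega (const3 c)"
  using gs_monom_eq[of "single 0 c" 0] mpoly_map_const[OF hom ring_K, of c "{..<n}"] by (simp add: monom_0)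

lemma gs_monom_one: "gs_monom K n (\<kappa> g) \<one>\<^bsub>P\<^esub> j = Omega (Polynomial.monom 1 j)"
  using gs_monom_eq[of 1 j] by (simp add: kappa(3) one_pCons)

lemma exists_lift: "a \<in> carrier P \<Longrightarrow> \<exists>f. a = mpoly_map (uproj K) K {..<n} f"
  using mpoly_map_surj[OF uproj_hom[OF cring_K] ring_K uproj_surj[OF cring_K]] by metis

lemma derivation:
  assumes i: "i < n"
  shows "localization_derivation P S (partial_diff K i)"
proof -
  interpret P: domain P by (rule domain_P)
  have i': "i \<in> {..<n}" using i by simp
  note hu = uproj_hom[OF cring_K]
  note pd = partial_diff_mpoly_map[OF hu ring_K i']
  note hm = typed_homD[OF mpoly_map_hom[OF hu ring_K]]
  have closed: "partial_diff K i a \<in> carrier P" if ac: "a \<in> carrier P" for a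
  proof -
    obtain f where a: "a = mpoly_map (uproj K) K {..<n} f" using exists_lift[OF ac] by (elim exE)
    show ?thesis unfolding a pd by (rule hm(1))
  qed
  have add: "partial_diff K i (a \<oplus>\<^bsub>P\<^esub> b) = partial_diff K i a \<oplus>\<^bsub>P\<^esub> partial_diff K i b"
    and mult: "partial_diff K i (a \<otimes>\<^bsub>P\<^esub> b) = partial_diff K i a \<otimes>\<^bsub>P\<^esub> b \<oplus>\<^bsub>P\<^esub> a \<otimes>\<^bsub>P\<^esub> partial_diff K i b"
    if ab: "a \<in> carrier P" "b \<in> carrier P" for a b
  proof -
    obtain f where a: "a = mpoly_map (uproj K) K {..<n} f" using exists_lift[OF ab(1)] by (elim exE)
    obtain f' where b: "b = mpoly_map (uproj K) K {..<n} f'" using exists_lift[OF ab(2)] by (elim exE)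
    show "partial_diff K i (a \<oplus>\<^bsub>P\<^esub> b) = partial_diff K i a \<oplus>\<^bsub>P\<^esub> partial_diff K i b"
      unfolding a b hm(4)[symmetric] pd by (simp only: pderiv_at_add)
    show "partial_diff K i (a \<otimes>\<^bsub>P\<^esub> b) = partial_diff K i a \<otimes>\<^bsub>P\<^esub> b \<oplus>\<^bsub>P\<^esub> a \<otimes>\<^bsub>P\<^esub> partial_diff K i b"
      unfolding a b hm(5)[symmetric] pd hm(4)[symmetric] by (simp only: pderiv_at_mult)
  qed
  show ?thesis by unfold_locales (fact closed add mult)+
qed

lemma localized_derivation_omega:
  assumes i: "i < n"
  shows "localized_derivation P S (partial_diff K i) (omega A) = omega (ypoly_deriv g i A)"
proof -
  interpret D: localization_derivation P S "partial_diff K i" by (rule derivation[OF i])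
  interpret B: cring B by (rule cring_B)
  have i': "i \<in> {..<n}" using i by simp
  note pd = partial_diff_mpoly_map[OF hom ring_K i']
  let ?y = "loc.fr \<one>\<^bsub>P\<^esub> (\<kappa> g)"
  have y: "?y = omega (Polynomial.monom 1 1)" unfolding omega_y kappa(3) ..
  have dy: "D.ld ?y = omega (- Polynomial.monom (pderiv_at i g) 2)"
  proof -
    have 2: "\<kappa> g [^]\<^bsub>P\<^esub> (2::nat) = \<kappa> g \<otimes>\<^bsub>P\<^esub> \<kappa> g"
      by (simp add: numeral_2_eq_2 kappa)
    have "D.ld ?y = loc.fr (\<kappa> (- pderiv_at i g)) (\<kappa> g \<otimes>\<^bsub>P\<^esub> \<kappa> g)"
      by (simp add: D.ld_fr g_in_S D.d_one pd kappa a_minus_def typed_hom_uminus[OF kappa_hom cring.axioms(1)[OF cring_P]])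
    also have "\<dots> = omega (Polynomial.monom (- pderiv_at i g) 2)" unfolding omega_monom 2 ..
    finally show ?thesis by (simp add: minus_monom)
  qed
  show ?thesis
  proof (induction A)
    case 0
    have "D.ld (omega 0) = D.ld (loc.fr (\<kappa> 0) \<one>\<^bsub>P\<^esub>)" using omega_const[of 0] by simp
    also have "\<dots> = loc.fr (\<kappa> (pderiv_at i 0)) \<one>\<^bsub>P\<^esub>" by (simp only: D.ld_fr_one kappa(1) pd)
    also have "\<dots> = omega (ypoly_deriv g i 0)" using omega_const[of 0] by simp
    finally show ?case .
  next
    case (pCons a A)
    have "D.ld (omega (pCons a A)) = D.ld (omega [:a:] \<oplus>\<^bsub>B\<^esub> ?y \<otimes>\<^bsub>B\<^esub> omega A)"
      by (simp only: omega_pCons[of a A] omega_const)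
    also have "\<dots> = D.ld (omega [:a:]) \<oplus>\<^bsub>B\<^esub> (D.ld ?y \<otimes>\<^bsub>B\<^esub> omega A \<oplus>\<^bsub>B\<^esub> ?y \<otimes>\<^bsub>B\<^esub> D.ld (omega A))"
      using omega(1) y_closed unfolding B_eq
      by (simp add: D.ld_add D.ld_mult cring.cring_simprules(5)[OF loc.Loc_cring])
    also have "D.ld (omega [:a:]) = omega [:pderiv_at i a:]"
      unfolding omega_const by (simp add: D.ld_fr_one kappa pd)
    also have "omega [:pderiv_at i a:] \<oplus>\<^bsub>B\<^esub> (D.ld ?y \<otimes>\<^bsub>B\<^esub> omega A \<oplus>\<^bsub>B\<^esub> ?y \<otimes>\<^bsub>B\<^esub> D.ld (omega A)) =
        omega ([:pderiv_at i a:] + (- Polynomial.monom (pderiv_at i g) 2 * A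
          + Polynomial.monom 1 1 * ypoly_deriv g i A))"
      unfolding pCons.IH dy unfolding y omega(4,5)[symmetric] ..
    also have "[:pderiv_at i a:] + (- Polynomial.monom (pderiv_at i g) 2 * A
          + Polynomial.monom 1 1 * ypoly_deriv g i A) = ypoly_deriv g i (pCons a A)"
      by (simp add: ypoly_deriv_pCons monom_altdef numeral_2_eq_2)
    finally show ?case .
  qed
qed

lemma letter_act_Omega:
  assumes l: "l \<in> weyl_letters n"
  shows "letter_act K n (\<kappa> g) l (Omega U) = Omega (letter_op g l U)"
proof (cases l)
  case (Var i)
  then have i: "i \<in> {..<n}" using l by (auto simp: weyl_letters_def)
  show ?thesis
    unfolding Var letter_act.simps letter_op.simps mpoly_map_var[OF hom ring_K i] gs_monom_eq Omega(5)[symmetric]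
    by (simp add: monom_0)
next
  case (Diff i)
  then have i: "i < n" using l by (auto simp: weyl_letters_def)
  then have i': "i \<in> {..<n}" by simp
  have 1: "(\<lambda>j. localized_derivation P S (partial_diff K i) (Omega U j)) = Omega (map_poly (ypoly_deriv g i) U)"
    by (simp add: Omega_def up_map_def localized_derivation_omega[OF i] coeff_map_poly)
  have 2: "monom N (inverted_frac K n (\<kappa> g) (partial_diff K i (\<kappa> g)) (\<kappa> g)) 1 =
      Omega (Polynomial.monom (Polynomial.monom (pderiv_at i g) 1) 1)"
    unfolding frac_eq partial_diff_mpoly_map[OF hom ring_K i'] omega_y[symmetric] Omega_def
    by (rule up_map_monom[OF omega_hom])
  have 3: "Polynomial.monom (Polynomial.monom (pderiv_at i g) 1) 1 * U = pCons 0 (smult (Polynomial.monom (pderiv_at i g) 1) U)"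
    by (simp add: monom_Suc monom_0)
  show ?thesis
    unfolding Diff letter_act.simps letter_op.simps 1 2 Omega(4,5)[symmetric] 3 ..
qed

lemma foldr_letter_act_Omega:
  assumes "w \<in> lists (weyl_letters n)"
  shows "foldr (letter_act K n (\<kappa> g)) w (Omega U) = Omega (foldr (letter_op g) w U)"
  using assms by (induction w) (simp_all add: letter_act_Omega del: letter_op.simps letter_act.simps)

lemma free_act_Omega:
  assumes p: "letters ` keys p \<subseteq> lists (weyl_letters n)"
  shows "free_act K n (\<kappa> g) (free_map \<sigma> K (weyl_letters n) p) (Omega U) = Omega (free_op g p U)"
proof -
  interpret N: cring N by (rule cring_N)
  let ?F = "\<lambda>w. Omega (const3 (lookup p (FM w)) * foldr (letter_op g) w U)"
  have trm: "gs_monom K n (\<kappa> g) (ring.indexed_const K (free_map \<sigma> K (weyl_letters n) p w)) 0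
      \<otimes>\<^bsub>N\<^esub> foldr (letter_act K n (\<kappa> g)) w (Omega U) = ?F w"
    if "w \<in> lists (weyl_letters n)" for w
    using that by (simp only: free_map_def if_True gs_monom_const foldr_letter_act_Omega Omega(5))
  have inj: "inj_on letters (keys p)" by (auto simp: inj_on_def free_monoid.expand)
  have "free_act K n (\<kappa> g) (free_map \<sigma> K (weyl_letters n) p) (Omega U) = (\<Oplus>\<^bsub>N\<^esub>w\<in>letters ` keys p. ?F w)"
    unfolding free_act_def
  proof (rule N.add.finprod_mono_neutral_cong_left)
    show "{w. free_map \<sigma> K (weyl_letters n) p w \<noteq> \<zero>\<^bsub>K\<^esub>} \<subseteq> letters ` keys p" by (rule free_map_support[OF hom])
    show "?F w = \<zero>\<^bsub>N\<^esub>" if w: "w \<in> letters ` keys p - {w. free_map \<sigma> K (weyl_letters n) p w \<noteq> \<zero>\<^bsub>K\<^esub>}" for w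
    proof -
      have wl: "w \<in> lists (weyl_letters n)" using w p by blast
      have z: "\<sigma> (lookup p (FM w)) = \<sigma> 0"
        using w wl by (simp add: free_map_def typed_homD(2)[OF hom])
      have "Omega (const3 (lookup p (FM w))) = Omega (const3 0)"
        unfolding gs_monom_const[symmetric] z ..
      then show ?thesis unfolding Omega(5) by (simp add: Omega(1,2))
    qed
    show "gs_monom K n (\<kappa> g) (ring.indexed_const K (free_map \<sigma> K (weyl_letters n) p w)) 0
      \<otimes>\<^bsub>N\<^esub> foldr (letter_act K n (\<kappa> g)) w (Omega U) = ?F w"
      if "w \<in> {w. free_map \<sigma> K (weyl_letters n) p w \<noteq> \<zero>\<^bsub>K\<^esub>}" for w
      by (rule trm) (use that in \<open>auto simp: free_map_def split: if_splits\<close>)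
  qed (simp_all add: Omega(1))
  also have "\<dots> = (\<Oplus>\<^bsub>N\<^esub>k\<in>keys p. ?F (letters k))"
    by (rule N.add.finprod_reindex[OF _ inj]) (simp add: Omega(1))
  also have "\<dots> = Omega (free_op g p U)"
    unfolding free_op_def typed_hom_sum[OF Omega_hom N.ring_axioms finite_keys] by simp
  finally show ?thesis .
qed

end

subsection \<open>The Weyl algebra acts\<close>

lemma free_op_diff: "free_op g (p - q) U = free_op g p U - free_op g q U"
  using free_op_add[of g "p - q" q U] by simp

lemma letters_keys_add:
  assumes "letters ` keys p \<subseteq> lists L" "letters ` keys q \<subseteq> lists L"
  shows "letters ` keys (p + q) \<subseteq> lists L"
  using assms keys_add[of p q] by blast

lemma letters_keys_uminus:
  fixes p :: "'l free_monoid \<Rightarrow>\<^sub>0 'r::comm_ring_1"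
  assumes "letters ` keys p \<subseteq> lists L"
  shows "letters ` keys (- p) \<subseteq> lists L"
  using assms by (auto simp: in_keys_iff image_subset_iff)

lemma letters_keys_diff:
  fixes p :: "'l free_monoid \<Rightarrow>\<^sub>0 'r::comm_ring_1"
  assumes "letters ` keys p \<subseteq> lists L" "letters ` keys q \<subseteq> lists L"
  shows "letters ` keys (p - q) \<subseteq> lists L"
  using letters_keys_add[OF assms(1) letters_keys_uminus[OF assms(2)]] by simp

lemma letters_keys_mult:
  fixes p :: "'l free_monoid \<Rightarrow>\<^sub>0 'r::comm_ring_1"
  assumes "letters ` keys p \<subseteq> lists L" "letters ` keys q \<subseteq> lists L"
  shows "letters ` keys (p * q) \<subseteq> lists L"
proof (rule image_subsetI)
  fix k assume "k \<in> keys (p * q)"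
  then obtain a b where "k = a + b" "a \<in> keys p" "b \<in> keys q" using keys_mult[of p q] by blast
  then show "letters k \<in> lists L" using assms by (auto simp: image_subset_iff)
qed

lemma letters_keys_single:
  "letters w \<in> lists L \<Longrightarrow> letters ` keys (single w c) \<subseteq> lists L"
  by auto

text \<open>
  With \<open>\<sigma>\<close> surjective, every element of the free algebra and of the module has a typed lift.
\<close>

locale gs_surj = gs_setting K n \<sigma> g
  for K :: "('a, 'm) ring_scheme" and n :: nat and \<sigma> :: "'r::comm_ring_1 \<Rightarrow> 'a" and g :: "'r mpoly" +
  assumes surj: "carrier K \<subseteq> range \<sigma>"
begin

abbreviation "L \<equiv> weyl_letters n"
abbreviation "F \<equiv> free_algebra K L"
abbreviation "fm \<equiv> free_map \<sigma> K L"
abbreviation "J \<equiv> Idl\<^bsub>F\<^esub> (weyl_relations K n)"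
abbreviation "W \<equiv> weyl_algebra K n"
abbreviation "fac \<equiv> free_act K n (\<kappa> g)"

lemma W_eq: "W = F Quot J" by (simp add: weyl_algebra_def Let_def)

lemma omega_surj: "carrier B \<subseteq> range omega"
proof
  fix x assume "x \<in> carrier B"
  then obtain a b where ab: "a \<in> carrier P" "b \<in> S" "x = loc.fr a b"
    unfolding B_eq loc.Loc_carrier by blast
  obtain f where f: "a = \<kappa> f" using mpoly_map_surj[OF hom ring_K surj ab(1)] by metis
  obtain e :: nat where e: "b = \<kappa> g [^]\<^bsub>P\<^esub> e" using ab(2) by (auto simp: powers_def)
  show "x \<in> range omega" unfolding ab(3) f e omega_monom[symmetric] by (rule rangeI)
qed

lemma Omega_surj: "u \<in> carrier N \<Longrightarrow> \<exists>U. u = Omega U"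
  using up_map_surj[OF omega_hom omega_surj] unfolding Omega_def by metis

lemma fm_hom: "typed_hom fm F" by (rule free_map_hom[OF hom ring_K])

lemmas fm = typed_homD[OF fm_hom]

lemma ring_F: "ring F" by (rule free_algebra_ring[OF cring_K])

lemma fm_surj: "x \<in> carrier F \<Longrightarrow> \<exists>p. x = fm p \<and> letters ` keys p \<subseteq> lists L"
  using free_map_surj[OF hom surj] by metis

lemma weyl_relation_lift:
  assumes "r \<in> weyl_relations K n"
  shows "\<exists>p. r = fm p \<and> letters ` keys p \<subseteq> lists L \<and> (\<forall>U. free_op g p U = 0)"
proof -
  note d = typed_hom_uminus(2)[OF fm_hom ring_F, symmetric]
  let ?s = "\<lambda>w. single (FM w) (1::'r)"
  have V: "Var i \<in> L" and D: "Diff i \<in> L" if "i < n" for i using that by (auto simp: weyl_letters_def)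
  have w: "free_word K [a, b] = fm (?s [a, b])" if "a \<in> L" "b \<in> L" for a b
    using that by (intro free_word_map[OF hom]) auto
  have k: "letters ` keys (?s [a, b]) \<subseteq> lists L" if "a \<in> L" "b \<in> L" for a b
    using that by (intro letters_keys_single) auto
  have op: "free_op g (?s [a, b]) U = letter_op g a (letter_op g b U)" for a b U
    by (simp flip: one_pCons)
  from assms consider
      i j where "i < n" "j < n" "r = free_word K [Var i, Var j] \<ominus>\<^bsub>F\<^esub> free_word K [Var j, Var i]"
    | i j where "i < n" "j < n" "r = free_word K [Diff i, Diff j] \<ominus>\<^bsub>F\<^esub> free_word K [Diff j, Diff i]"
    | i j where "i < n" "j < n" "r = (free_word K [Diff i, Var j] \<ominus>\<^bsub>F\<^esub> free_word K [Var j, Diff i])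
        \<ominus>\<^bsub>F\<^esub> (if i = j then \<one>\<^bsub>F\<^esub> else \<zero>\<^bsub>F\<^esub>)"
    unfolding weyl_relations_def Let_def by blast
  then show ?thesis
  proof cases
    case 1
    have "r = fm (?s [Var i, Var j] - ?s [Var j, Var i])" using 1 V by (simp only: w d)
    moreover have "letters ` keys (?s [Var i, Var j] - ?s [Var j, Var i]) \<subseteq> lists L"
      using 1 V by (intro letters_keys_diff k)
    moreover have "free_op g (?s [Var i, Var j] - ?s [Var j, Var i]) U = 0" for U
      unfolding free_op_diff op letter_op_commutators(1)[of g i j] by simp
    ultimately show ?thesis by blast
  next
    case 2
    have "r = fm (?s [Diff i, Diff j] - ?s [Diff j, Diff i])" using 2 D by (simp only: w d)
    moreover have "letters ` keys (?s [Diff i, Diff j] - ?s [Diff j, Diff i]) \<subseteq> lists L"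
      using 2 D by (intro letters_keys_diff k)
    moreover have "free_op g (?s [Diff i, Diff j] - ?s [Diff j, Diff i]) U = 0" for U
      unfolding free_op_diff op letter_op_commutators(2)[of g i j] by simp
    ultimately show ?thesis by blast
  next
    case 3
    let ?e = "if i = j then 1 else (0 :: weyl_letter free_monoid \<Rightarrow>\<^sub>0 'r)"
    have e: "(if i = j then \<one>\<^bsub>F\<^esub> else \<zero>\<^bsub>F\<^esub>) = fm ?e" by (simp add: fm)
    have "r = fm (?s [Diff i, Var j] - ?s [Var j, Diff i] - ?e)" using 3 D V by (simp only: w d e)
    moreover have "letters ` keys (?s [Diff i, Var j] - ?s [Var j, Diff i] - ?e) \<subseteq> lists L"
      using 3 D V by (intro letters_keys_diff k) auto
    moreover have "free_op g (?s [Diff i, Var j] - ?s [Var j, Diff i] - ?e) U = 0" for U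
    proof -
      have "free_op g (single 0 1) U = U" unfolding free_op_single by (simp flip: one_pCons)
      then have "free_op g 1 U = U" by simp
      then show ?thesis unfolding free_op_diff op letter_op_commutators(3)[of g i j] by simp
    qed
    ultimately show ?thesis by blast
  qed
qed

lemma weyl_relations_carrier: "weyl_relations K n \<subseteq> carrier F"
  using weyl_relation_lift fm(1) by fastforce

lemma ideal_J: "ideal J F"
  by (rule ring.genideal_ideal[OF ring_F weyl_relations_carrier])

text \<open>
  A two-sided ideal that contains the relations of the Weyl algebra. Hence it contains the ideal
  generated by them, and all representatives of a residue class act in the same way.
\<close>

definition annihilator :: "(weyl_letter list \<Rightarrow> 'a) set" where
  "annihilator = {x \<in> carrier F. \<forall>u \<in> carrier N. fac x u = \<zero>\<^bsub>N\<^esub>}"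

lemma annihilator_iff:
  assumes "letters ` keys p \<subseteq> lists L"
  shows "fm p \<in> annihilator \<longleftrightarrow> (\<forall>U. Omega (free_op g p U) = \<zero>\<^bsub>N\<^esub>)"
proof
  assume a: "fm p \<in> annihilator"
  show "\<forall>U. Omega (free_op g p U) = \<zero>\<^bsub>N\<^esub>"
  proof
    fix U
    have "fac (fm p) (Omega U) = \<zero>\<^bsub>N\<^esub>" using a Omega(1) by (simp add: annihilator_def)
    then show "Omega (free_op g p U) = \<zero>\<^bsub>N\<^esub>" by (simp only: free_act_Omega[OF assms])
  qed
next
  assume a: "\<forall>U. Omega (free_op g p U) = \<zero>\<^bsub>N\<^esub>"
  have "fac (fm p) u = \<zero>\<^bsub>N\<^esub>" if u: "u \<in> carrier N" for u
  proof -
    obtain U where "u = Omega U" using Omega_surj[OF u] by blast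
    then show ?thesis using a by (simp only: free_act_Omega[OF assms])
  qed
  then show "fm p \<in> annihilator" by (simp add: annihilator_def fm(1))
qed

lemma ideal_annihilator: "ideal annihilator F"
proof (rule idealI[OF ring_F])
  interpret N: cring N by (rule cring_N)
  interpret F: ring F by (rule ring_F)
  have lift: "\<exists>p. x = fm p \<and> letters ` keys p \<subseteq> lists L" if "x \<in> annihilator" for x
    using that fm_surj by (simp add: annihilator_def)
  show "subgroup annihilator (add_monoid F)"
  proof
    show "annihilator \<subseteq> carrier (add_monoid F)" by (auto simp: annihilator_def)
    have "fm 0 \<in> annihilator" by (subst annihilator_iff) (simp_all add: Omega)
    then show "\<one>\<^bsub>add_monoid F\<^esub> \<in> annihilator" by (simp add: fm)
    fix x assume x: "x \<in> annihilator"
    then obtain p where p: "x = fm p" "letters ` keys p \<subseteq> lists L" using lift by blast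
    have px: "\<forall>U. Omega (free_op g p U) = \<zero>\<^bsub>N\<^esub>" using x annihilator_iff[OF p(2)] p(1) by simp
    have "inv\<^bsub>add_monoid F\<^esub> x = \<ominus>\<^bsub>F\<^esub> x" by (simp add: a_inv_def)
    also have "\<dots> = fm (0 - p)" unfolding p(1) by (simp add: typed_hom_uminus[OF fm_hom ring_F])
    also have "fm (0 - p) \<in> annihilator"
    proof (subst annihilator_iff)
      show "letters ` keys (0 - p) \<subseteq> lists L" using letters_keys_uminus[OF p(2)] by simp
      show "\<forall>U. Omega (free_op g (0 - p) U) = \<zero>\<^bsub>N\<^esub>"
        unfolding free_op_diff typed_hom_uminus[OF Omega_hom N.ring_axioms]
        using px by (simp add: Omega(2))
    qed
    finally show "inv\<^bsub>add_monoid F\<^esub> x \<in> annihilator" .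
    fix y assume y: "y \<in> annihilator"
    then obtain q where q: "y = fm q" "letters ` keys q \<subseteq> lists L" using lift by blast
    have qx: "\<forall>U. Omega (free_op g q U) = \<zero>\<^bsub>N\<^esub>" using y annihilator_iff[OF q(2)] q(1) by simp
    have "fm (p + q) \<in> annihilator"
    proof (subst annihilator_iff)
      show "letters ` keys (p + q) \<subseteq> lists L" by (rule letters_keys_add[OF p(2) q(2)])
      show "\<forall>U. Omega (free_op g (p + q) U) = \<zero>\<^bsub>N\<^esub>" using px qx by (simp add: free_op_add Omega(4))
    qed
    then show "x \<otimes>\<^bsub>add_monoid F\<^esub> y \<in> annihilator" by (simp add: fm p(1) q(1))
  qed
  fix a x assume a: "a \<in> annihilator" and x: "x \<in> carrier F"
  obtain p where p: "a = fm p" "letters ` keys p \<subseteq> lists L" using lift[OF a] by blast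
  obtain q where q: "x = fm q" "letters ` keys q \<subseteq> lists L" using fm_surj[OF x] by blast
  have pa: "\<forall>U. Omega (free_op g p U) = \<zero>\<^bsub>N\<^esub>" using a annihilator_iff[OF p(2)] p(1) by simp
  have "fm (q * p) \<in> annihilator"
  proof (subst annihilator_iff)
    show "letters ` keys (q * p) \<subseteq> lists L" by (rule letters_keys_mult[OF q(2) p(2)])
    show "\<forall>U. Omega (free_op g (q * p) U) = \<zero>\<^bsub>N\<^esub>"
    proof
      fix U
      have "Omega (free_op g (q * p) U) = fac (fm q) (Omega (free_op g p U))"
        by (simp only: free_op_mult free_act_Omega[OF q(2)])
      also have "\<dots> = fac (fm q) (Omega 0)" using pa by (simp add: Omega(2))
      also have "\<dots> = Omega (free_op g q 0)" by (rule free_act_Omega[OF q(2)])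
      also have "\<dots> = \<zero>\<^bsub>N\<^esub>" unfolding free_op_linear by (rule Omega(2))
      finally show "Omega (free_op g (q * p) U) = \<zero>\<^bsub>N\<^esub>" .
    qed
  qed
  then show "x \<otimes>\<^bsub>F\<^esub> a \<in> annihilator" by (simp add: fm p(1) q(1))
  have "fm (p * q) \<in> annihilator"
  proof (subst annihilator_iff)
    show "letters ` keys (p * q) \<subseteq> lists L" by (rule letters_keys_mult[OF p(2) q(2)])
    show "\<forall>U. Omega (free_op g (p * q) U) = \<zero>\<^bsub>N\<^esub>" using pa by (simp add: free_op_mult)
  qed
  then show "a \<otimes>\<^bsub>F\<^esub> x \<in> annihilator" by (simp add: fm p(1) q(1))
qed

lemma J_annihilates: "J \<subseteq> annihilator"
proof (rule ring.genideal_minimal[OF ring_F ideal_annihilator], rule subsetI)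
  fix r assume "r \<in> weyl_relations K n"
  then obtain p where p: "r = fm p" "letters ` keys p \<subseteq> lists L" "\<forall>U. free_op g p U = 0"
    using weyl_relation_lift by blast
  show "r \<in> annihilator" unfolding p(1) annihilator_iff[OF p(2)] using p(3) by (simp add: Omega(2))
qed

lemma weyl_act_coset:
  assumes p: "letters ` keys p \<subseteq> lists L"
  shows "weyl_act K n (\<kappa> g) (J +>\<^bsub>F\<^esub> fm p) (Omega U) = Omega (free_op g p U)"
proof -
  interpret N: cring N by (rule cring_N)
  interpret F: ring F by (rule ring_F)
  interpret J: ideal J F by (rule ideal_J)
  have act: "fac (h \<oplus>\<^bsub>F\<^esub> fm p) (Omega U) = Omega (free_op g p U)" if h: "h \<in> J" for h
  proof -
    have "h \<in> annihilator" using h J_annihilates by blast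
    then obtain q where q: "h = fm q" "letters ` keys q \<subseteq> lists L"
      using fm_surj by (auto simp: annihilator_def)
    have "Omega (free_op g q U) = \<zero>\<^bsub>N\<^esub>" using \<open>h \<in> annihilator\<close> annihilator_iff[OF q(2)] q(1) by simp
    then show ?thesis
      unfolding q(1) fm(4)[symmetric] free_act_Omega[OF letters_keys_add[OF q(2) p]] free_op_add Omega(4)
      by (simp add: Omega(1))
  qed
  have "(\<lambda>p. fac p (Omega U)) ` (J +>\<^bsub>F\<^esub> fm p) = (\<lambda>p'. Omega (free_op g p U)) ` (J +>\<^bsub>F\<^esub> fm p)"
  proof (rule image_cong[OF refl])
    fix x assume "x \<in> J +>\<^bsub>F\<^esub> fm p"
    then obtain h where "h \<in> J" "x = h \<oplus>\<^bsub>F\<^esub> fm p" unfolding a_r_coset_def' by blast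
    then show "fac x (Omega U) = Omega (free_op g p U)" using act by simp
  qed
  moreover have "J +>\<^bsub>F\<^esub> fm p \<noteq> {}"
    unfolding a_r_coset_def' using J.zero_closed by blast
  ultimately have "(\<lambda>p. fac p (Omega U)) ` (J +>\<^bsub>F\<^esub> fm p) = {Omega (free_op g p U)}"
    by (simp only: image_constant_conv if_False)
  then show ?thesis unfolding weyl_act_def by simp
qed

lemma ring_W: "ring W"
  unfolding W_eq by (rule ideal.quotient_is_ring[OF ideal_J])

lemma carrier_W: "x \<in> carrier W \<Longrightarrow> \<exists>p. x = J +>\<^bsub>F\<^esub> fm p \<and> letters ` keys p \<subseteq> lists L"
  unfolding W_eq FactRing_def A_RCOSETS_def' using fm_surj by auto

lemma coset_carrier: "J +>\<^bsub>F\<^esub> fm p \<in> carrier W"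
  unfolding W_eq FactRing_def A_RCOSETS_def' using fm(1) by auto

abbreviation "G \<equiv> gs_monom K n (\<kappa> g) (\<kappa> g) 0"
abbreviation "G' \<equiv> [:[:g:]:]"

lemma G_eq: "G = Omega G'"
  using gs_monom_eq[of g 0] by (simp add: monom_0)

text \<open>
  The module \<open>A\<^sub>n(K)[s] g\<^sup>s\<^sup>+\<^sup>1\<close> in terms of words, without the quotient that defines the Weyl algebra.
\<close>

lemma weyl_s_act_images:
  "(\<lambda>Q. weyl_s_act K n (\<kappa> g) Q G) ` carrier (UP W) =
     {Omega (\<Sum>j\<le>M. Polynomial.monom 1 j * free_op g (p j) G') | M p. \<forall>j. letters ` keys (p j) \<subseteq> lists L}"
  (is "?A = ?C")
proof
  interpret N: cring N by (rule cring_N)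
  interpret W: UP_ring W "UP W" by (simp add: UP_ring_def ring_W)
  have act: "gs_monom K n (\<kappa> g) \<one>\<^bsub>P\<^esub> j \<otimes>\<^bsub>N\<^esub> weyl_act K n (\<kappa> g) (J +>\<^bsub>F\<^esub> fm p) G =
      Omega (Polynomial.monom 1 j * free_op g p G')" if "letters ` keys p \<subseteq> lists L" for j p
    unfolding G_eq weyl_act_coset[OF that] gs_monom_one Omega(5) ..
  show "?A \<subseteq> ?C"
  proof (rule image_subsetI)
    fix Q assume Q: "Q \<in> carrier (UP W)"
    have "\<forall>j. \<exists>p. coeff (UP W) Q j = J +>\<^bsub>F\<^esub> fm p \<and> letters ` keys p \<subseteq> lists L"
      using W.coeff_closed[OF Q] carrier_W by blast
    then obtain p where p: "\<And>j. coeff (UP W) Q j = J +>\<^bsub>F\<^esub> fm (p j)" "\<And>j. letters ` keys (p j) \<subseteq> lists L"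
      by metis
    have "weyl_s_act K n (\<kappa> g) Q G = Omega (\<Sum>j\<le>deg W Q. Polynomial.monom 1 j * free_op g (p j) G')"
      unfolding weyl_s_act_def typed_hom_sum[OF Omega_hom N.ring_axioms finite_atMost]
      by (rule N.finsum_cong') (simp_all add: p act Omega(1))
    then show "weyl_s_act K n (\<kappa> g) Q G \<in> ?C" using p(2) by blast
  qed
  show "?C \<subseteq> ?A"
  proof
    fix x assume "x \<in> ?C"
    then obtain M p where x: "x = Omega (\<Sum>j\<le>M. Polynomial.monom 1 j * free_op g (p j) G')"
      and p: "\<And>j. letters ` keys (p j) \<subseteq> lists L" by blast
    define p' where "p' j = (if j \<le> M then p j else 0)" for j
    have p': "letters ` keys (p' j) \<subseteq> lists L" for j using p by (simp add: p'_def)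
    define Q where "Q j = J +>\<^bsub>F\<^esub> fm (p' j)" for j
    have zero: "\<zero>\<^bsub>W\<^esub> = J +>\<^bsub>F\<^esub> fm 0"
    proof -
      interpret F: ring F by (rule ring_F)
      interpret J: ideal J F by (rule ideal_J)
      show ?thesis unfolding W_eq FactRing_def fm(2) by (simp add: F.a_coset_add_zero J.a_subset)
    qed
    have Qup: "Q \<in> up W"
    proof (rule mem_upI)
      show "Q j \<in> carrier W" for j unfolding Q_def by (rule coset_carrier)
      have "bound \<zero>\<^bsub>W\<^esub> M Q" by (auto simp: Q_def p'_def zero)
      then show "\<exists>k. bound \<zero>\<^bsub>W\<^esub> k Q" by (rule exI)
    qed
    have Q: "Q \<in> carrier (UP W)" and cQ: "coeff (UP W) Q j = Q j" for j
      unfolding UP_def by (simp_all add: Qup)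
    let ?T = "\<lambda>j. Polynomial.monom 1 j * free_op g (p' j) G'"
    have big: "Omega (?T j) = \<zero>\<^bsub>N\<^esub>" if "deg W Q < j" for j
    proof -
      have "Q j = J +>\<^bsub>F\<^esub> fm 0" using W.deg_aboveD[OF that Q] by (simp add: cQ zero)
      then have "weyl_act K n (\<kappa> g) (J +>\<^bsub>F\<^esub> fm (p' j)) (Omega G') = weyl_act K n (\<kappa> g) (J +>\<^bsub>F\<^esub> fm 0) (Omega G')"
        by (simp add: Q_def)
      then have "Omega (free_op g (p' j) G') = \<zero>\<^bsub>N\<^esub>"
        using weyl_act_coset[OF p'[of j], of G'] weyl_act_coset[of 0 G'] by (simp add: Omega(2))
      then show ?thesis unfolding Omega(5) by (simp add: Omega(1))
    qed
    have "weyl_s_act K n (\<kappa> g) Q G = (\<Oplus>\<^bsub>N\<^esub>j\<in>{..deg W Q}. Omega (?T j))"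
      unfolding weyl_s_act_def by (rule N.finsum_cong') (simp_all add: cQ Q_def act p' Omega(1))
    also have "\<dots> = (\<Oplus>\<^bsub>N\<^esub>j\<in>{..max M (deg W Q)}. Omega (?T j))"
      by (rule N.add.finprod_mono_neutral_cong_left) (auto simp: Omega(1) big)
    also have "\<dots> = Omega (\<Sum>j\<le>max M (deg W Q). ?T j)"
      by (rule typed_hom_sum[OF Omega_hom N.ring_axioms finite_atMost, symmetric])
    also have "(\<Sum>j\<le>max M (deg W Q). ?T j) = (\<Sum>j\<le>M. ?T j)"
    proof (rule sum.mono_neutral_right)
      show "\<forall>j\<in>{..max M (deg W Q)} - {..M}. ?T j = 0" by (simp add: p'_def)
    qed simp_all
    also have "\<dots> = (\<Sum>j\<le>M. Polynomial.monom 1 j * free_op g (p j) G')"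
      by (rule sum.cong) (simp_all add: p'_def)
    finally have "x = weyl_s_act K n (\<kappa> g) Q G" unfolding x by (rule sym)
    then show "x \<in> ?A" using Q by (rule image_eqI)
  qed
qed

end

subsection \<open>The submodule generated by \<open>g\<^sup>s\<^sup>+\<^sup>1\<close>\<close>

lemma free_op_one: "free_op g 1 U = U"
proof -
  have "free_op g (single 0 1) U = U" unfolding free_op_single by (simp flip: one_pCons)
  then show ?thesis by simp
qed

definition gs_scale ::
    "('a, 'm) ring_scheme \<Rightarrow> nat \<Rightarrow> (nat multiset \<Rightarrow> 'a) \<Rightarrow> 'a \<Rightarrow> (nat \<Rightarrow> 'a inverted_poly) \<Rightarrow> (nat \<Rightarrow> 'a inverted_poly)" where
  "gs_scale K n h k x = gs_monom K n h (ring.indexed_const K k) 0 \<otimes>\<^bsub>gs_module K n h\<^esub> x"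

definition s_times ::
    "('a, 'm) ring_scheme \<Rightarrow> nat \<Rightarrow> (nat multiset \<Rightarrow> 'a) \<Rightarrow> (nat \<Rightarrow> 'a inverted_poly) \<Rightarrow> (nat \<Rightarrow> 'a inverted_poly)" where
  "s_times K n h x = gs_monom K n h \<one>\<^bsub>poly_ring K n\<^esub> 1 \<otimes>\<^bsub>gs_module K n h\<^esub> x"

text \<open>
  The submodules over \<open>A\<^sub>n(K)[s]\<close> that contain \<open>g\<^sup>s\<^sup>+\<^sup>1\<close>, described by the generators of the Weyl algebra.
  The module \<open>A\<^sub>n(K)[s] g\<^sup>s\<^sup>+\<^sup>1\<close> is the smallest one. This characterization mentions neither \<open>\<sigma>\<close> nor lifts, so it can be
  proved for a surjective \<open>\<sigma>\<close> and used for any other.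
\<close>

definition gs_closed ::
    "('a, 'm) ring_scheme \<Rightarrow> nat \<Rightarrow> (nat multiset \<Rightarrow> 'a) \<Rightarrow> (nat \<Rightarrow> 'a inverted_poly) set \<Rightarrow> bool" where
  "gs_closed K n h Z \<longleftrightarrow> Z \<subseteq> carrier (gs_module K n h) \<and> \<zero>\<^bsub>gs_module K n h\<^esub> \<in> Z \<and>
     gs_monom K n h h 0 \<in> Z \<and> (\<forall>x\<in>Z. \<forall>y\<in>Z. x \<oplus>\<^bsub>gs_module K n h\<^esub> y \<in> Z) \<and>
     (\<forall>k\<in>carrier K. \<forall>x\<in>Z. gs_scale K n h k x \<in> Z) \<and>
     (\<forall>l\<in>weyl_letters n. \<forall>x\<in>Z. letter_act K n h l x \<in> Z) \<and>
     (\<forall>x\<in>Z. s_times K n h x \<in> Z)"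

definition gs_submodule ::
    "('a, 'm) ring_scheme \<Rightarrow> nat \<Rightarrow> (nat multiset \<Rightarrow> 'a) \<Rightarrow> (nat \<Rightarrow> 'a inverted_poly) set" where
  "gs_submodule K n h = (\<lambda>Q. weyl_s_act K n h Q (gs_monom K n h h 0)) ` carrier (UP (weyl_algebra K n))"

context gs_setting
begin

lemma gs_scale_Omega: "gs_scale K n (\<kappa> g) (\<sigma> c) (Omega U) = Omega (const3 c * U)"
  unfolding gs_scale_def gs_monom_const Omega(5) ..

lemma s_times_Omega: "s_times K n (\<kappa> g) (Omega U) = Omega (pCons 0 U)"
  unfolding s_times_def gs_monom_one Omega(5)[symmetric] by (simp add: monom_Suc monom_0)

end

context gs_surj
begin

lemma gs_scale_laws:
  assumes k: "k \<in> carrier K" "k' \<in> carrier K" and x: "x \<in> carrier N" "y \<in> carrier N"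
  shows "gs_scale K n (\<kappa> g) k x \<in> carrier N"
    "gs_scale K n (\<kappa> g) k (gs_scale K n (\<kappa> g) k' x) = gs_scale K n (\<kappa> g) (k \<otimes>\<^bsub>K\<^esub> k') x"
    "gs_scale K n (\<kappa> g) \<one>\<^bsub>K\<^esub> x = x"
    "gs_scale K n (\<kappa> g) k (x \<oplus>\<^bsub>N\<^esub> y) = gs_scale K n (\<kappa> g) k x \<oplus>\<^bsub>N\<^esub> gs_scale K n (\<kappa> g) k y"
    "l \<in> L \<Longrightarrow> letter_act K n (\<kappa> g) l (gs_scale K n (\<kappa> g) k x) = gs_scale K n (\<kappa> g) k (letter_act K n (\<kappa> g) l x)"
    "s_times K n (\<kappa> g) (gs_scale K n (\<kappa> g) k x) = gs_scale K n (\<kappa> g) k (s_times K n (\<kappa> g) x)"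
    "l \<in> L \<Longrightarrow> letter_act K n (\<kappa> g) l x \<in> carrier N" "s_times K n (\<kappa> g) x \<in> carrier N"
proof -
  obtain a where a: "k = \<sigma> a" using k(1) surj by blast
  obtain b where b: "k' = \<sigma> b" using k(2) surj by blast
  obtain U where U: "x = Omega U" using Omega_surj[OF x(1)] by blast
  obtain V where V: "y = Omega V" using Omega_surj[OF x(2)] by blast
  note hs = typed_homD(3,5)[OF hom, symmetric]
  show "gs_scale K n (\<kappa> g) k x \<in> carrier N" unfolding a U gs_scale_Omega by (rule Omega)
  show "gs_scale K n (\<kappa> g) k (gs_scale K n (\<kappa> g) k' x) = gs_scale K n (\<kappa> g) (k \<otimes>\<^bsub>K\<^esub> k') x"
    unfolding a b U hs(2) gs_scale_Omega by (simp add: mult_single)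
  show "gs_scale K n (\<kappa> g) \<one>\<^bsub>K\<^esub> x = x"
    unfolding U hs(1) gs_scale_Omega by (simp flip: one_pCons)
  show "gs_scale K n (\<kappa> g) k (x \<oplus>\<^bsub>N\<^esub> y) = gs_scale K n (\<kappa> g) k x \<oplus>\<^bsub>N\<^esub> gs_scale K n (\<kappa> g) k y"
    unfolding a U V Omega(4)[symmetric] gs_scale_Omega by (simp add: smult_add_right)
  show "letter_act K n (\<kappa> g) l (gs_scale K n (\<kappa> g) k x) = gs_scale K n (\<kappa> g) k (letter_act K n (\<kappa> g) l x)"
    if "l \<in> L" unfolding a U gs_scale_Omega letter_act_Omega[OF that] letter_op_const3 ..
  show "s_times K n (\<kappa> g) (gs_scale K n (\<kappa> g) k x) = gs_scale K n (\<kappa> g) k (s_times K n (\<kappa> g) x)"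
    unfolding a U gs_scale_Omega s_times_Omega by simp
  show "letter_act K n (\<kappa> g) l x \<in> carrier N" if "l \<in> L"
    unfolding U letter_act_Omega[OF that] by (rule Omega)
  show "s_times K n (\<kappa> g) x \<in> carrier N" unfolding U s_times_Omega by (rule Omega)
qed

abbreviation "comb M p \<equiv> (\<Sum>j\<le>M. Polynomial.monom 1 j * free_op g (p j) G')"

lemma gs_submodule_eq:
  "gs_submodule K n (\<kappa> g) = {Omega (comb M p) | M p. \<forall>j. letters ` keys (p j) \<subseteq> lists L}"
  unfolding gs_submodule_def by (rule weyl_s_act_images)

lemma gs_submoduleI: "(\<And>j. letters ` keys (p j) \<subseteq> lists L) \<Longrightarrow> Omega (comb M p) \<in> gs_submodule K n (\<kappa> g)"
  unfolding gs_submodule_eq by blast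

lemma comb_mono:
  assumes "M \<le> M'" "\<And>j. j > M \<Longrightarrow> p j = 0"
  shows "comb M p = comb M' p"
  by (rule sum.mono_neutral_left) (use assms in \<open>simp_all add: subset_iff\<close>)

lemma gs_submodule_closed: "gs_closed K n (\<kappa> g) (gs_submodule K n (\<kappa> g))"
proof -
  interpret N: cring N by (rule cring_N)
  let ?Z = "gs_submodule K n (\<kappa> g)"
  have elim: "\<exists>M p. x = Omega (comb M p) \<and> (\<forall>j. letters ` keys (p j) \<subseteq> lists L) \<and> (\<forall>j>M. p j = 0)" if xZ: "x \<in> ?Z" for x
  proof -
    obtain M p where x: "x = Omega (comb M p)" "\<forall>j. letters ` keys (p j) \<subseteq> lists L"
      using xZ unfolding gs_submodule_eq by blast
    let ?p = "\<lambda>j. if j \<le> M then p j else 0"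
    have "comb M p = comb M ?p" by (rule sum.cong) simp_all
    then show ?thesis using x by (intro exI[of _ M] exI[of _ ?p]) simp
  qed
  show ?thesis
    unfolding gs_closed_def
  proof (intro conjI ballI)
    show "?Z \<subseteq> carrier N" unfolding gs_submodule_eq using Omega(1) by blast
    have "Omega (comb 0 (\<lambda>_. 0)) \<in> ?Z" by (rule gs_submoduleI) simp
    then show "\<zero>\<^bsub>N\<^esub> \<in> ?Z" by (simp add: Omega(2))
    have "Omega (comb 0 (\<lambda>_. single 0 1)) \<in> ?Z" by (rule gs_submoduleI) simp
    moreover have "comb 0 (\<lambda>_. single 0 1) = G'"
      unfolding atMost_0 sum.insert_remove[OF finite.emptyI] by (simp add: free_op_one monom_0 flip: one_pCons)
    ultimately show "G \<in> ?Z" by (simp only: G_eq)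
  next
    fix x y assume xy: "x \<in> ?Z" "y \<in> ?Z"
    obtain M p where x: "x = Omega (comb M p)" "\<forall>j. letters ` keys (p j) \<subseteq> lists L" "\<forall>j>M. p j = 0"
      using elim[OF xy(1)] by (elim exE conjE)
    obtain M' p' where y: "y = Omega (comb M' p')" "\<forall>j. letters ` keys (p' j) \<subseteq> lists L" "\<forall>j>M'. p' j = 0"
      using elim[OF xy(2)] by (elim exE conjE)
    let ?M = "max M M'"
    have "Omega (comb ?M (\<lambda>j. p j + p' j)) \<in> ?Z"
      by (rule gs_submoduleI) (rule letters_keys_add[OF x(2)[rule_format] y(2)[rule_format]])
    moreover have "comb ?M (\<lambda>j. p j + p' j) = comb M p + comb M' p'"
      using comb_mono[of M ?M p] comb_mono[of M' ?M p'] x(3) y(3)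
      by (simp add: free_op_add distrib_left sum.distrib)
    ultimately show "x \<oplus>\<^bsub>N\<^esub> y \<in> ?Z" unfolding x(1) y(1) Omega(4)[symmetric] by simp
  next
    fix k x assume k: "k \<in> carrier K" and xX: "x \<in> ?Z"
    obtain M p where x: "x = Omega (comb M p)" "\<forall>j. letters ` keys (p j) \<subseteq> lists L"
      using elim[OF xX] by (elim exE conjE)
    obtain c where c: "k = \<sigma> c" using k surj by blast
    have "Omega (comb M (\<lambda>j. single 0 c * p j)) \<in> ?Z"
      by (rule gs_submoduleI, rule letters_keys_mult) (use x(2) in auto)
    moreover have "comb M (\<lambda>j. single 0 c * p j) = const3 c * comb M p"
      by (simp only: free_op_mult free_op_single free_monoid_simps foldr.simps id_apply sum_distrib_left mult.left_commute)
    ultimately show "gs_scale K n (\<kappa> g) k x \<in> ?Z" unfolding x(1) c gs_scale_Omega by (simp only:)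
  next
    fix l x assume l: "l \<in> L" and xX: "x \<in> ?Z"
    obtain M p where x: "x = Omega (comb M p)" "\<forall>j. letters ` keys (p j) \<subseteq> lists L"
      using elim[OF xX] by (elim exE conjE)
    have "Omega (comb M (\<lambda>j. single (FM [l]) 1 * p j)) \<in> ?Z"
      by (rule gs_submoduleI, rule letters_keys_mult) (use x(2) l in auto)
    moreover have "comb M (\<lambda>j. single (FM [l]) 1 * p j) = letter_op g l (comb M p)"
    proof -
      have 1: "letter_op g l (sum f A) = (\<Sum>j\<in>A. letter_op g l (f j))" for f :: "nat \<Rightarrow> _" and A
        by (induction A rule: infinite_finite_induct) (simp_all del: letter_op.simps add: letter_op_add)
      have 2: "letter_op g l (Polynomial.monom 1 j * U) = Polynomial.monom 1 j * letter_op g l U" for j U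
        by (induction j arbitrary: U) (simp_all del: letter_op.simps add: monom_0 monom_Suc letter_op_s flip: one_pCons)
      have 3: "free_op g (single (FM [l]) 1 * q) U = letter_op g l (free_op g q U)" for q U
        unfolding free_op_mult free_op_single by (simp del: letter_op.simps flip: one_pCons)
      show ?thesis unfolding 1 2 3 ..
    qed
    ultimately show "letter_act K n (\<kappa> g) l x \<in> ?Z" unfolding x(1) letter_act_Omega[OF l] by (simp only:)
  next
    fix x assume xX: "x \<in> ?Z"
    obtain M p where x: "x = Omega (comb M p)" "\<forall>j. letters ` keys (p j) \<subseteq> lists L"
      using elim[OF xX] by (elim exE conjE)
    let ?p = "\<lambda>j. case j of 0 \<Rightarrow> 0 | Suc j \<Rightarrow> p j"
    have "Omega (comb (Suc M) ?p) \<in> ?Z"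
      by (rule gs_submoduleI) (use x(2) in \<open>simp split: nat.split\<close>)
    moreover have "comb (Suc M) ?p = pCons 0 (comb M p)"
    proof -
      have "comb (Suc M) ?p = (\<Sum>j\<le>M. pCons 0 (Polynomial.monom 1 j * free_op g (p j) G'))"
        unfolding sum.atMost_Suc_shift by (simp add: monom_Suc)
      also have "\<dots> = pCons 0 (comb M p)"
        by (induction M) simp_all
      finally show ?thesis .
    qed
    ultimately show "s_times K n (\<kappa> g) x \<in> ?Z" unfolding x(1) s_times_Omega by (simp only:)
  qed
qed

lemma gs_submodule_least:
  assumes Z: "gs_closed K n (\<kappa> g) Z"
  shows "gs_submodule K n (\<kappa> g) \<subseteq> Z"
proof -
  interpret N: cring N by (rule cring_N)
  have zero: "Omega 0 \<in> Z" and G: "Omega G' \<in> Z"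
    and add: "\<And>U V. Omega U \<in> Z \<Longrightarrow> Omega V \<in> Z \<Longrightarrow> Omega (U + V) \<in> Z"
    and sc: "\<And>c U. Omega U \<in> Z \<Longrightarrow> Omega (const3 c * U) \<in> Z"
    and le: "\<And>l U. l \<in> L \<Longrightarrow> Omega U \<in> Z \<Longrightarrow> Omega (letter_op g l U) \<in> Z"
    and s: "\<And>U. Omega U \<in> Z \<Longrightarrow> Omega (pCons 0 U) \<in> Z"
    using Z typed_homD(1)[OF hom]
    unfolding gs_closed_def Omega(2,4) G_eq gs_scale_Omega[symmetric] s_times_Omega[symmetric]
    by (simp_all add: letter_act_Omega[symmetric] del: letter_op.simps letter_act.simps)
  have sum: "Omega (sum f A) \<in> Z" if "\<And>i. i \<in> A \<Longrightarrow> Omega (f i) \<in> Z" for f and A :: "'z set"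
    using that by (induction A rule: infinite_finite_induct) (auto intro: zero add)
  have w: "Omega (foldr (letter_op g) w G') \<in> Z" if "w \<in> lists L" for w
    using that by (induction w) (auto intro: G le simp del: letter_op.simps)
  have m: "Omega (Polynomial.monom 1 j * U) \<in> Z" if "Omega U \<in> Z" for j U
    by (induction j) (use that s in \<open>simp_all add: monom_0 monom_Suc flip: one_pCons\<close>)
  show ?thesis
  proof
    fix x assume "x \<in> gs_submodule K n (\<kappa> g)"
    then obtain M p where x: "x = Omega (comb M p)" and p: "\<forall>j. letters ` keys (p j) \<subseteq> lists L"
      unfolding gs_submodule_eq by blast
    show "x \<in> Z"
      unfolding x free_op_def
    proof (rule sum, rule m, rule sum, rule sc, rule w)
      fix j k assume "k \<in> keys (p j)"
      then show "letters k \<in> lists L" using p by (simp add: image_subset_iff)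
    qed
  qed
qed

end

subsection \<open>Comparison with the module generated by the delta function\<close>

text \<open>
  The polynomial \<open>(-1)\<^sup>k s (s - 1) \<dots> (s - k + 1)\<close> in \<open>s\<close>.
\<close>

fun falling :: "nat \<Rightarrow> 'r::comm_ring_1 poly" where
  "falling 0 = 1"
| "falling (Suc k) = [:of_nat k, - 1:] * falling k"

lemma falling_coeff:
  "k < j \<Longrightarrow> pcoeff (falling k :: 'r::comm_ring_1 poly) j = 0"
  "pcoeff (falling k :: 'r poly) k = (- 1) ^ k"
proof (induction k arbitrary: j)
  case (Suc k)
  { case 1 then show ?case using Suc.IH(1) by (cases j) auto }
  { case 2 show ?case using Suc.IH by simp }
qed auto

lemma falling_coeff_int: "\<exists>c::int. pcoeff (falling k :: 'r::comm_ring_1 poly) j = of_int c"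
proof (induction k arbitrary: j)
  case 0
  show ?case by (cases j) (auto intro: exI[of _ 1] exI[of _ 0])
next
  case (Suc k)
  obtain a where a: "pcoeff (falling k :: 'r poly) j = of_int a" using Suc by blast
  obtain b where b: "pcoeff (falling k :: 'r poly) (j - 1) = of_int b" using Suc by blast
  show ?case
    by (cases j; rule exI[of _ "int k * a - (if j = 0 then 0 else b)"]) (use a b in auto)
qed

lemma ypoly_deriv_of_int: "ypoly_deriv g i (of_int c) = 0"
proof -
  have 0: "pderiv_at i (of_int c :: 'a mpoly) = 0" by (simp flip: single_of_int)
  have 1: "(of_int c :: 'a mpoly poly) = [:of_int c:]" by (rule of_int_poly)
  show ?thesis unfolding 1 by (rule poly_eqI) (simp add: coeff_ypoly_deriv coeff_pCons 0 split: nat.splits)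
qed

text \<open>
  Reduces an identity of additive maps to monomials.
\<close>

lemma poly_additive_eqI:
  assumes "\<And>p q. \<phi> (p + q) = \<phi> p + \<phi> q" "\<And>p q. \<psi> (p + q) = \<psi> p + \<psi> q"
    "\<And>a k. \<phi> (Polynomial.monom a k) = \<psi> (Polynomial.monom a k)"
  shows "\<phi> (p :: 'b::comm_ring_1 poly) = (\<psi> p :: 'c::ab_group_add)"
proof -
  have z: "\<phi> 0 = 0" "\<psi> 0 = 0" using assms(1)[of 0 0] assms(2)[of 0 0] by simp_all
  have "\<phi> (\<Sum>k\<in>A. Polynomial.monom (pcoeff p k) k) = \<psi> (\<Sum>k\<in>A. Polynomial.monom (pcoeff p k) k)" for A
    by (induction A rule: infinite_finite_induct) (simp_all add: z assms)
  from this[of "{..Polynomial.degree p}"] show ?thesis by (simp add: poly_as_sum_of_monoms)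
qed

text \<open>\<open>\<tau>\<^sup>k\<close> acts on \<open>g\<^sup>s\<close> as \<open>(-1)\<^sup>k s (s - 1) \<dots> (s - k + 1) g\<^sup>-\<^sup>k\<close>.\<close>

definition theta :: "'r::comm_ring_1 mpoly poly \<Rightarrow> 'r mpoly poly poly" where
  "theta z = (\<Sum>k\<le>Polynomial.degree z. smult (Polynomial.monom (pcoeff z k) k) (falling k))"

lemma theta_superset:
  "Polynomial.degree z \<le> M \<Longrightarrow> theta z = (\<Sum>k\<le>M. smult (Polynomial.monom (pcoeff z k) k) (falling k))"
  unfolding theta_def by (rule sum.mono_neutral_left) (auto simp: coeff_eq_0)

lemma theta_add: "theta (y + z) = theta y + theta z"
proof -
  let ?M = "max (Polynomial.degree y) (Polynomial.degree z)"
  have "Polynomial.degree (y + z) \<le> ?M" by (rule degree_add_le_max)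
  then show ?thesis
    by (simp add: theta_superset[of _ ?M] sum.distrib smult_add_left flip: add_monom)
qed

lemma theta_zero [simp]: "theta 0 = 0" by (simp add: theta_def)

lemma theta_monom: "theta (Polynomial.monom a k) = smult (Polynomial.monom a k) (falling k)"
proof -
  have "theta (Polynomial.monom a k) =
      (\<Sum>j\<le>k. smult (Polynomial.monom (pcoeff (Polynomial.monom a k) j) j) (falling j))"
    by (rule theta_superset) (rule degree_monom_le)
  also have "\<dots> = (\<Sum>j\<le>k. if j = k then smult (Polynomial.monom a k) (falling k) else 0)"
    by (rule sum.cong) simp_all
  finally show ?thesis by simp
qed

lemma theta_smult: "theta (smult a z) = [:[:a:]:] * theta z"
  by (rule poly_additive_eqI[of "\<lambda>z. theta (smult a z)" "\<lambda>z. [:[:a:]:] * theta z"])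
    (simp_all add: theta_add smult_add_right theta_monom smult_monom)

lemma theta_var_op: "theta (var_op i z) = letter_op g (Var i) (theta z)"
  by (simp add: var_op_def theta_smult)

lemma theta_diff_op:
  fixes g :: "'r::comm_ring_1 mpoly"
  shows "theta (diff_op g i z) = letter_op g (Diff i) (theta z)"
proof (rule poly_additive_eqI[of "\<lambda>z. theta (diff_op g i z)" "\<lambda>z. letter_op g (Diff i) (theta z)"])
  show "theta (diff_op g i (p + q)) = theta (diff_op g i p) + theta (diff_op g i q)" for p q
    by (simp add: ops_add theta_add)
  show "letter_op g (Diff i) (theta (p + q)) = letter_op g (Diff i) (theta p) + letter_op g (Diff i) (theta q)" for p q
    by (simp only: theta_add letter_op_add)
  fix a :: "'r mpoly" and k :: nat
  let ?A = "Polynomial.monom a k" and ?d = "pderiv_at i"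
  have 1: "diff_op g i ?A = Polynomial.monom (?d a) k + Polynomial.monom (- (?d g * a)) (Suc k)"
    by (rule poly_eqI) (auto simp: coeff_diff_op)
  have 2: "ypoly_deriv g i ?A = Polynomial.monom (?d a) k + smult (- of_nat k) (Polynomial.monom (?d g * a) (Suc k))"
    by (rule poly_eqI) (auto simp: coeff_ypoly_deriv)
  have 3: "map_poly (ypoly_deriv g i) (smult A (falling k)) = smult (ypoly_deriv g i A) (falling k)" for A
  proof (rule poly_eqI)
    fix j
    obtain c :: int where c: "pcoeff (falling k :: 'r mpoly poly poly) j = of_int c" using falling_coeff_int by blast
    show "pcoeff (map_poly (ypoly_deriv g i) (smult A (falling k))) j = pcoeff (smult (ypoly_deriv g i A) (falling k)) j"
      by (simp add: coeff_map_poly c ypoly_deriv_mult ypoly_deriv_of_int)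
  qed
  have 4: "Polynomial.monom (?d g) 1 * ?A = Polynomial.monom (?d g * a) (Suc k)" by (simp add: mult_monom)
  have 5: "smult (Polynomial.monom (- (?d g * a)) (Suc k)) (falling (Suc k)) =
      smult (smult (- of_nat k) (Polynomial.monom (?d g * a) (Suc k))) (falling k)
      + pCons 0 (smult (Polynomial.monom (?d g * a) (Suc k)) (falling k))"
  proof -
    let ?m = "Polynomial.monom (?d g * a) (Suc k)"
    have "Polynomial.monom (- (?d g * a)) (Suc k) = - ?m" by (simp add: minus_monom)
    then have "smult (Polynomial.monom (- (?d g * a)) (Suc k)) (falling (Suc k)) =
      smult (- ?m * of_nat k) (falling k) + pCons 0 (smult ?m (falling k))"
      by (simp add: mult.commute smult_add_right)
    also have "- ?m * of_nat k = smult (- of_nat k) ?m"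
      by (simp add: of_nat_poly mult.commute[of _ "[:_:]"])
    finally show ?thesis .
  qed
  show "theta (diff_op g i ?A) = letter_op g (Diff i) (theta ?A)"
    unfolding 1 theta_add theta_monom letter_op.simps 3 2 smult_add_left 5 smult_smult 4 by (simp add: add_ac)
qed

lemma theta_euler_monom:
  fixes a :: "'r::comm_ring_1 mpoly"
  shows "theta (euler (Polynomial.monom a k)) = smult (of_nat k) (theta (Polynomial.monom a k))"
proof -
  have 1: "euler (Polynomial.monom a k) = Polynomial.monom (of_nat k * a) k"
    by (rule poly_eqI) simp
  have 2: "Polynomial.monom (of_nat k * a) k = of_nat k * Polynomial.monom a k"
    by (simp add: of_nat_poly smult_monom)
  show ?thesis unfolding 1 theta_monom by (simp add: 2)
qed

lemma euler_add: "euler (y + z) = euler y + euler z"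
  by (rule poly_eqI) (simp add: algebra_simps)

text \<open>
  Before specialization \<open>theta\<close> is compatible with \<open>s\<close> only up to a multiple of \<open>1 - g y\<close>.
\<close>

lemma theta_s_op:
  fixes g :: "'r::comm_ring_1 mpoly"
  shows "pCons 0 (theta z) - theta (s_op g z) =
    [:1 - Polynomial.monom g 1:] * (pCons 0 (theta z) - theta (euler z))"
proof (rule poly_additive_eqI[of "\<lambda>z. pCons 0 (theta z) - theta (s_op g z)"
      "\<lambda>z. [:1 - Polynomial.monom g 1:] * (pCons 0 (theta z) - theta (euler z))"])
  have pc: "pCons 0 (p + q) = pCons 0 p + pCons 0 q" for p q :: "'r mpoly poly poly" by simp
  show "pCons 0 (theta (p + q)) - theta (s_op g (p + q)) =
      pCons 0 (theta p) - theta (s_op g p) + (pCons 0 (theta q) - theta (s_op g q))" for p q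
    by (simp only: ops_add theta_add pc add_diff_add)
  show "[:1 - Polynomial.monom g 1:] * (pCons 0 (theta (p + q)) - theta (euler (p + q))) =
      [:1 - Polynomial.monom g 1:] * (pCons 0 (theta p) - theta (euler p)) +
      [:1 - Polynomial.monom g 1:] * (pCons 0 (theta q) - theta (euler q))" for p q
    by (simp only: euler_add theta_add pc add_diff_add flip: distrib_left)
  fix a :: "'r mpoly" and k :: nat
  let ?A = "Polynomial.monom a k" and ?Y = "Polynomial.monom g 1"
  let ?M = "theta ?A"
  have 1: "s_op g ?A = euler ?A + Polynomial.monom (- (g * a)) (Suc k)"
    by (rule poly_eqI) (auto simp: coeff_s_op)
  have 2: "Polynomial.monom (- (g * a)) (Suc k) = - (?Y * ?A)"
    by (simp add: mult_monom minus_monom)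
  have "theta (Polynomial.monom (- (g * a)) (Suc k)) = smult (- (?Y * ?A)) (falling (Suc k))"
    unfolding theta_monom by (simp only: 2)
  also have "\<dots> = [:?Y:] * (pCons 0 ?M - smult (of_nat k) ?M)"
    by (simp add: theta_monom smult_add_right smult_diff_right algebra_simps)
  finally have 3: "theta (Polynomial.monom (- (g * a)) (Suc k)) = [:?Y:] * (pCons 0 ?M - theta (euler ?A))"
    by (simp only: theta_euler_monom)
  have 4: "[:1 - ?Y:] = 1 - [:?Y:]" by (simp add: one_pCons)
  show "pCons 0 ?M - theta (s_op g ?A) = [:1 - ?Y:] * (pCons 0 ?M - theta (euler ?A))"
    unfolding 1 theta_add 3 4 left_diff_distrib by (simp only: mult_1_left diff_diff_add[symmetric])
qed

context gs_setting
begin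

sublocale delta: delta_module n g .

abbreviation "q \<equiv> {a. \<sigma> a = \<zero>\<^bsub>K\<^esub>}"

lemma prime_q: "prime_ideal_set q" by (rule typed_hom_kernel_prime[OF hom domain_K])

lemma kerM_iff: "f \<in> delta.kerM q \<longleftrightarrow> \<kappa> f = \<zero>\<^bsub>P\<^esub>"
proof -
  interpret ring K by (rule ring_K)
  show ?thesis
    by (auto simp: delta.kerM_def mpoly_map_def mpoly_ring_def indexed_const_def fun_eq_iff)
qed

definition Psi :: "'r mpoly poly \<Rightarrow> nat \<Rightarrow> 'a inverted_poly" where
  "Psi z = Omega (theta z)"

lemma Psi_closed: "Psi z \<in> carrier N" by (simp add: Psi_def Omega(1))

lemma Psi_add: "Psi (y + z) = Psi y \<oplus>\<^bsub>N\<^esub> Psi z" by (simp add: Psi_def theta_add Omega(4))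

lemma Psi_zero: "Psi 0 = \<zero>\<^bsub>N\<^esub>" by (simp add: Psi_def Omega(2))

lemma Psi_cmult: "Psi (cmult c z) = gs_scale K n (\<kappa> g) (\<sigma> c) (Psi z)"
  by (simp only: Psi_def theta_smult gs_scale_Omega)

lemma Psi_var_op: "i < n \<Longrightarrow> Psi (var_op i z) = letter_act K n (\<kappa> g) (Var i) (Psi z)"
  unfolding Psi_def theta_var_op[where g = g] by (rule letter_act_Omega[symmetric]) (simp add: weyl_letters_def)

lemma Psi_diff_op: "i < n \<Longrightarrow> Psi (diff_op g i z) = letter_act K n (\<kappa> g) (Diff i) (Psi z)"
  unfolding Psi_def theta_diff_op by (rule letter_act_Omega[symmetric]) (simp add: weyl_letters_def)

lemma Omega_const_zero: "omega A = \<zero>\<^bsub>B\<^esub> \<Longrightarrow> Omega ([:A:] * U) = \<zero>\<^bsub>N\<^esub>"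
proof -
  interpret N: cring N by (rule cring_N)
  assume z: "omega A = \<zero>\<^bsub>B\<^esub>"
  have "omega (pcoeff [:A:] j) = omega (pcoeff 0 j)" for j
    by (cases j) (simp_all add: z omega(2))
  then have "Omega [:A:] = Omega 0" unfolding Omega_def up_map_def by simp
  then show ?thesis unfolding Omega(5) by (simp add: Omega(1,2))
qed

lemma Psi_s_op: "Psi (s_op g z) = s_times K n (\<kappa> g) (Psi z)"
proof -
  interpret N: cring N by (rule cring_N)
  interpret B: cring B by (rule cring_B)
  have "omega (1 - Polynomial.monom g 1) = \<zero>\<^bsub>B\<^esub>"
    unfolding typed_hom_uminus(2)[OF omega_hom B.ring_axioms] omega_y_g omega(3)
    by (simp add: a_minus_def B.r_neg)
  then have "Omega (pCons 0 (theta z) - theta (s_op g z)) = \<zero>\<^bsub>N\<^esub>"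
    unfolding theta_s_op by (rule Omega_const_zero)
  then have "Omega (theta (s_op g z)) = Omega (pCons 0 (theta z))"
    unfolding typed_hom_uminus(2)[OF Omega_hom N.ring_axioms]
    by (subst (asm) N.r_right_minus_eq) (simp_all add: Omega(1))
  then show ?thesis unfolding Psi_def s_times_Omega .
qed

lemma Psi_g: "Psi [:g:] = gs_monom K n (\<kappa> g) (\<kappa> g) 0"
  using theta_monom[of g 0] by (simp add: Psi_def gs_monom_eq monom_0)

text \<open>
  The polynomials \<open>falling k\<close> have degree \<open>k\<close> and leading coefficient \<open>\<plusminus> 1\<close> in \<open>s\<close>. So the coefficients of
  \<open>z\<close> can be recovered from \<open>theta z\<close> from the top downwards.
\<close>

lemma Psi_kernel: "Psi z = \<zero>\<^bsub>N\<^esub> \<longleftrightarrow> z \<in> delta.kerN q"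
proof -
  interpret N: cring N by (rule cring_N)
  interpret B: cring B by (rule cring_B)
  interpret PP: domain P by (rule domain_P)
  have w: "omega (Polynomial.monom a k) = \<zero>\<^bsub>B\<^esub> \<longleftrightarrow> \<kappa> a = \<zero>\<^bsub>P\<^esub>" for a k
    unfolding omega_monom unfolding B_eq
    by (rule loc.fr_zero_iff) (simp_all add: kappa(1) y_power)
  have t: "Psi z = (\<Oplus>\<^bsub>N\<^esub>k\<in>{..Polynomial.degree z}. Omega ([:Polynomial.monom (pcoeff z k) k:] * falling k))"
    unfolding Psi_def theta_def typed_hom_sum[OF Omega_hom N.ring_axioms finite_atMost] by simp
  show ?thesis
  proof
    assume "z \<in> delta.kerN q"
    then have "\<kappa> (pcoeff z k) = \<zero>\<^bsub>P\<^esub>" for k by (simp add: delta.kerN_def kerM_iff)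
    then have "Omega ([:Polynomial.monom (pcoeff z k) k:] * falling k) = \<zero>\<^bsub>N\<^esub>" for k
      by (intro Omega_const_zero) (simp add: w)
    then show "Psi z = \<zero>\<^bsub>N\<^esub>" unfolding t by simp
  next
    assume z: "Psi z = \<zero>\<^bsub>N\<^esub>"
    show "z \<in> delta.kerN q"
    proof (rule ccontr)
      define I where "I = {k. \<kappa> (pcoeff z k) \<noteq> \<zero>\<^bsub>P\<^esub>}"
      assume "z \<notin> delta.kerN q"
      then have ne: "I \<noteq> {}" by (auto simp: delta.kerN_def kerM_iff I_def)
      have sub: "I \<subseteq> {..Polynomial.degree z}"
      proof
        fix k assume "k \<in> I"
        then show "k \<in> {..Polynomial.degree z}"
          by (cases "k \<le> Polynomial.degree z") (auto simp: I_def coeff_eq_0 kappa(2))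
      qed
      then have fin: "finite I" by (rule finite_subset) simp
      \<comment> \<open>The highest power of \<open>\<tau>\<close> with a coefficient that survives. It alone contributes to the coefficient of \<open>s\<^sup>i\<close>.\<close>
      define i where "i = Max I"
      have i: "\<kappa> (pcoeff z i) \<noteq> \<zero>\<^bsub>P\<^esub>" using Max_in[OF fin ne] by (simp add: I_def i_def)
      have big: "\<kappa> (pcoeff z k) = \<zero>\<^bsub>P\<^esub>" if "k > i" for k
        using Max_ge[OF fin, of k] that by (auto simp: I_def i_def)
      have id: "i \<le> Polynomial.degree z" using Max_in[OF fin ne] sub by (auto simp: i_def)
      let ?m = "\<lambda>k. Polynomial.monom (pcoeff z k) k"
      have "omega (pcoeff (theta z) i) = (\<Oplus>\<^bsub>B\<^esub>k\<in>{..Polynomial.degree z}. omega (?m k * pcoeff (falling k) i))"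
        unfolding theta_def by (simp add: Polynomial.coeff_sum typed_hom_sum[OF omega_hom B.ring_axioms finite_atMost])
      also have "\<dots> = (\<Oplus>\<^bsub>B\<^esub>k\<in>{..Polynomial.degree z}. if i = k then omega (?m i * (- 1) ^ i) else \<zero>\<^bsub>B\<^esub>)"
      proof (rule B.finsum_cong')
        fix k assume "k \<in> {..Polynomial.degree z}"
        show "omega (?m k * pcoeff (falling k) i) = (if i = k then omega (?m i * (- 1) ^ i) else \<zero>\<^bsub>B\<^esub>)"
        proof (cases k i rule: linorder_cases)
          case less
          then show ?thesis by (simp add: falling_coeff(1) omega(2))
        next
          case equal
          then show ?thesis by (simp add: falling_coeff(2))
        next
          case greater
          then have "omega (?m k) = \<zero>\<^bsub>B\<^esub>" by (simp add: w big)
          then show ?thesis using greater unfolding omega(5) by (simp add: omega(1))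
        qed
      qed (simp_all add: omega(1) Pi_def)
      also have "\<dots> = omega (?m i * (- 1) ^ i)"
        using id by (intro B.add.finprod_singleton) (simp_all add: omega(1))
      finally have "omega (?m i * (- 1) ^ i) = omega (pcoeff (theta z) i)" by simp
      also have "\<dots> = Psi z i" by (simp add: Psi_def Omega_def up_map_def)
      also have "\<dots> = \<zero>\<^bsub>B\<^esub>" unfolding z by (simp add: UP_def)
      finally have "omega (?m i * (- 1) ^ i) \<otimes>\<^bsub>B\<^esub> omega ((- 1) ^ i) = \<zero>\<^bsub>B\<^esub>" by (simp add: omega(1))
      then have "omega (?m i * ((- 1) ^ i * (- 1) ^ i)) = \<zero>\<^bsub>B\<^esub>" by (simp only: omega(5)[symmetric] mult.assoc)
      then have "omega (?m i) = \<zero>\<^bsub>B\<^esub>" by (simp flip: power_add power_mult_distrib)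
      then show False using i by (simp add: w)
    qed
  qed
qed

lemma Psi_eq_iff: "Psi y = Psi z \<longleftrightarrow> y - z \<in> delta.kerN q"
proof -
  interpret N: cring N by (rule cring_N)
  have "Psi y = Psi (y - z) \<oplus>\<^bsub>N\<^esub> Psi z" by (simp flip: Psi_add)
  then show ?thesis
    unfolding Psi_kernel[symmetric] using N.add.r_cancel_one[OF Psi_closed Psi_closed, of z "y - z"]
    by (metis N.add.r_cancel_one' N.l_zero Psi_closed)
qed

text \<open>
  The same polynomial over \<open>K\<close> as the image of one over the ring \<open>uring\<close>, along a surjective map.
\<close>

lemma surjective_setting:
  obtains g' :: "('a, 'm) uring mpoly" where "gs_surj K n (uproj K) g'" "mpoly_map (uproj K) K {..<n} g' = \<kappa> g"
proof -
  obtain g' :: "('a, 'm) uring mpoly" where g': "\<kappa> g = mpoly_map (uproj K) K {..<n} g'"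
    using exists_lift[OF kappa(1)[of g]] by (elim exE)
  have "gs_surj K n (uproj K) g'"
    by (intro gs_surj.intro gs_setting.intro gs_surj_axioms.intro)
      (use field_K uproj_hom[OF cring_K] uproj_surj[OF cring_K] g_nonzero g' in simp_all)
  then show thesis using that g' by simp
qed

lemma scale_laws:
  assumes k: "k \<in> carrier K" "k' \<in> carrier K" and x: "x \<in> carrier N" "y \<in> carrier N"
  shows "gs_scale K n (\<kappa> g) k x \<in> carrier N"
    "gs_scale K n (\<kappa> g) k (gs_scale K n (\<kappa> g) k' x) = gs_scale K n (\<kappa> g) (k \<otimes>\<^bsub>K\<^esub> k') x"
    "gs_scale K n (\<kappa> g) \<one>\<^bsub>K\<^esub> x = x"
    "gs_scale K n (\<kappa> g) k (x \<oplus>\<^bsub>N\<^esub> y) = gs_scale K n (\<kappa> g) k x \<oplus>\<^bsub>N\<^esub> gs_scale K n (\<kappa> g) k y"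
    "l \<in> weyl_letters n \<Longrightarrow> letter_act K n (\<kappa> g) l (gs_scale K n (\<kappa> g) k x) = gs_scale K n (\<kappa> g) k (letter_act K n (\<kappa> g) l x)"
    "s_times K n (\<kappa> g) (gs_scale K n (\<kappa> g) k x) = gs_scale K n (\<kappa> g) k (s_times K n (\<kappa> g) x)"
    "l \<in> weyl_letters n \<Longrightarrow> letter_act K n (\<kappa> g) l x \<in> carrier N" "s_times K n (\<kappa> g) x \<in> carrier N"
proof -
  obtain g' :: "('a, 'm) uring mpoly" where s: "gs_surj K n (uproj K) g'"
    and e: "mpoly_map (uproj K) K {..<n} g' = \<kappa> g" by (rule surjective_setting)
  note laws = gs_surj.gs_scale_laws[OF s, unfolded e, OF k x]
  show "gs_scale K n (\<kappa> g) k x \<in> carrier N"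
    "gs_scale K n (\<kappa> g) k (gs_scale K n (\<kappa> g) k' x) = gs_scale K n (\<kappa> g) (k \<otimes>\<^bsub>K\<^esub> k') x"
    "gs_scale K n (\<kappa> g) \<one>\<^bsub>K\<^esub> x = x"
    "gs_scale K n (\<kappa> g) k (x \<oplus>\<^bsub>N\<^esub> y) = gs_scale K n (\<kappa> g) k x \<oplus>\<^bsub>N\<^esub> gs_scale K n (\<kappa> g) k y"
    "l \<in> weyl_letters n \<Longrightarrow> letter_act K n (\<kappa> g) l (gs_scale K n (\<kappa> g) k x) = gs_scale K n (\<kappa> g) k (letter_act K n (\<kappa> g) l x)"
    "s_times K n (\<kappa> g) (gs_scale K n (\<kappa> g) k x) = gs_scale K n (\<kappa> g) k (s_times K n (\<kappa> g) x)"
    "l \<in> weyl_letters n \<Longrightarrow> letter_act K n (\<kappa> g) l x \<in> carrier N" "s_times K n (\<kappa> g) x \<in> carrier N"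
    by (fact laws)+
qed

lemma submodule_closed: "gs_closed K n (\<kappa> g) (gs_submodule K n (\<kappa> g))"
  and submodule_least: "gs_closed K n (\<kappa> g) Z \<Longrightarrow> gs_submodule K n (\<kappa> g) \<subseteq> Z"
proof -
  obtain g' :: "('a, 'm) uring mpoly" where s: "gs_surj K n (uproj K) g'"
    and e: "mpoly_map (uproj K) K {..<n} g' = \<kappa> g" by (rule surjective_setting)
  show "gs_closed K n (\<kappa> g) (gs_submodule K n (\<kappa> g))" by (rule gs_surj.gs_submodule_closed[OF s, unfolded e])
  show "gs_submodule K n (\<kappa> g) \<subseteq> Z" if "gs_closed K n (\<kappa> g) Z"
    by (rule gs_surj.gs_submodule_least[OF s, unfolded e, OF that])
qed

lemma gen_op_cases:
  assumes "v \<le> 2 * n"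
  obtains "v = 0" "delta.gen_op v = s_op g"
  | i where "i < n" "v = 2 * i + 1" "delta.gen_op v = var_op i"
  | i where "i < n" "v = 2 * i + 2" "delta.gen_op v = diff_op g i"
proof (cases "v = 0")
  case True
  then show thesis by (intro that(1)) (simp_all add: delta.gen_op_def fun_eq_iff)
next
  case nz: False
  show thesis
  proof (cases "even v")
    case True
    then obtain j where "v = 2 * j" by (elim evenE)
    then show thesis using nz assms
      by (intro that(3)[of "j - 1"]) (auto simp: delta.gen_op_def fun_eq_iff)
  next
    case False
    then obtain j where "v = 2 * j + 1" by (elim oddE)
    then show thesis using nz assms
      by (intro that(2)[of j]) (auto simp: delta.gen_op_def fun_eq_iff)
  qed
qed

lemma Psi_dmod: "y \<in> delta.dmod \<Longrightarrow> Psi y \<in> gs_submodule K n (\<kappa> g)"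
proof (induction rule: delta.dmod.induct)
  note c = submodule_closed[unfolded gs_closed_def]
  case base
  then show ?case unfolding Psi_g using c by blast
next
  note c = submodule_closed[unfolded gs_closed_def]
  case (add y z)
  then show ?case unfolding Psi_add using c by blast
next
  note c = submodule_closed[unfolded gs_closed_def]
  case (cmult y a)
  have "\<sigma> a \<in> carrier K" by (rule typed_homD(1)[OF hom])
  then show ?case unfolding Psi_cmult using c cmult by blast
next
  note c = submodule_closed[unfolded gs_closed_def]
  case (gen y v)
  from gen(2) show ?case
  proof (cases rule: gen_op_cases)
    case 1
    show ?thesis unfolding 1(2) Psi_s_op using c gen(3) by blast
  next
    case (2 i)
    have "Var i \<in> weyl_letters n" using 2 by (simp add: weyl_letters_def)
    then show ?thesis unfolding 2(3) Psi_var_op[OF 2(1)] using c gen(3) by blast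
  next
    case (3 i)
    have "Diff i \<in> weyl_letters n" using 3 by (simp add: weyl_letters_def)
    then show ?thesis unfolding 3(3) Psi_diff_op[OF 3(1)] using c gen(3) by blast
  qed
qed

end

subsection \<open>The Bernstein ideal over a field with a given ring of numerators\<close>

definition const_in_s ::
    "('a, 'm) ring_scheme \<Rightarrow> nat \<Rightarrow> (nat multiset \<Rightarrow> 'a) \<Rightarrow> (nat \<Rightarrow> 'a) \<Rightarrow> (nat \<Rightarrow> 'a inverted_poly)" where
  "const_in_s K n h b = (\<lambda>j. inverted_poly K n h (ring.indexed_const K (coeff (UP K) b j)))"

lemma bernstein_ideal_eq:
  "bernstein_ideal K n h = {b \<in> carrier (UP K). const_in_s K n h b \<in> gs_submodule K n h}"
  unfolding bernstein_ideal_def gs_submodule_def const_in_s_def by (auto simp: image_iff)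

lemma coeff_up_map: "typed_hom \<sigma> K \<Longrightarrow> coeff (UP K) (up_map \<sigma> c) j = \<sigma> (pcoeff c j)"
  using up_map_closed[of \<sigma> K c] by (simp add: UP_def up_map_def)

lemma up_map_carrier: "typed_hom \<sigma> K \<Longrightarrow> up_map \<sigma> c \<in> carrier (UP K)"
  using up_map_closed[of \<sigma> K c] by (simp add: UP_def)

lemma up_map_smult:
  assumes "typed_hom \<sigma> K"
  shows "up_map \<sigma> (smult a c) = \<sigma> a \<odot>\<^bsub>UP K\<^esub> up_map \<sigma> c"
  using up_map_closed[OF assms, of c] typed_homD(1,5)[OF assms]
  by (simp add: UP_def up_map_def fun_eq_iff)

context gs_setting
begin

lemma const_in_s_up_map:
  "const_in_s K n (\<kappa> g) (up_map \<sigma> c) = Omega (map_poly (\<lambda>a. [:single 0 a:]) c)"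
proof
  fix j
  have "const_in_s K n (\<kappa> g) (up_map \<sigma> c) j = omega [:single 0 (pcoeff c j):]"
    unfolding const_in_s_def coeff_up_map[OF hom]
      mpoly_map_const[OF hom ring_K, where I = "{..<n}"] poly_eq omega_const ..
  then show "const_in_s K n (\<kappa> g) (up_map \<sigma> c) j = Omega (map_poly (\<lambda>a. [:single 0 a:]) c) j"
    by (simp add: Omega_def up_map_def coeff_map_poly)
qed

lemma Psi_ev_spoly: "Psi (delta.ev 1 (delta.spoly c)) = const_in_s K n (\<kappa> g) (up_map \<sigma> c)"
proof -
  have 1: "Psi ((s_op g ^^ k) 1) = Omega (Polynomial.monom 1 k)" for k
  proof (induction k)
    case 0
    have "theta (1 :: 'r mpoly poly) = 1" using theta_monom[of "1::'r mpoly" 0] by (simp add: monom_0 flip: one_pCons)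
    then show ?case by (simp add: Psi_def monom_0 flip: one_pCons)
  next
    case (Suc k)
    then show ?case by (simp add: Psi_s_op s_times_Omega monom_Suc)
  qed
  have 2: "Psi (\<Sum>k\<in>A. cmult (pcoeff c k) ((s_op g ^^ k) 1)) =
      Omega (\<Sum>k\<in>A. const3 (pcoeff c k) * Polynomial.monom 1 k)" if "finite A" for A
    using that
    by (induction A rule: finite_induct)
      (simp_all only: sum.empty sum.insert Psi_zero Omega(2,4) Psi_add Psi_cmult 1 gs_scale_Omega not_False_eq_True)
  have "(\<Sum>k\<le>Polynomial.degree c. const3 (pcoeff c k) * Polynomial.monom 1 k) = map_poly (\<lambda>a. [:single 0 a:]) c"
    by (rule poly_eqI) (simp add: Polynomial.coeff_sum smult_monom coeff_map_poly coeff_eq_0)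
  then show ?thesis
    unfolding delta.ev_spoly const_in_s_up_map 2[OF finite_atMost] by (simp only:)
qed

lemma const_in_s_laws:
  assumes b: "b \<in> carrier (UP K)" and k: "k \<in> carrier K"
  shows "const_in_s K n (\<kappa> g) b \<in> carrier N"
    "gs_scale K n (\<kappa> g) k (const_in_s K n (\<kappa> g) b) = const_in_s K n (\<kappa> g) (k \<odot>\<^bsub>UP K\<^esub> b)"
proof -
  obtain g' :: "('a, 'm) uring mpoly" where s: "gs_surj K n (uproj K) g'"
    and e: "mpoly_map (uproj K) K {..<n} g' = \<kappa> g" by (rule surjective_setting)
  interpret s: gs_surj K n "uproj K" g' by (rule s)
  obtain c where c: "b = up_map (uproj K) c" by (rule up_map_surj[OF s.hom s.surj b])
  obtain a where a: "k = uproj K a" using k s.surj by blast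
  show "const_in_s K n (\<kappa> g) b \<in> carrier N"
    unfolding e[symmetric] c s.const_in_s_up_map by (rule s.Omega)
  have m: "map_poly (\<lambda>a. [:single 0 a:]) (smult a c) = const3 a * map_poly (\<lambda>a. [:single 0 a:]) c"
    by (rule poly_eqI) (simp add: coeff_map_poly mult_single mult.commute)
  show "gs_scale K n (\<kappa> g) k (const_in_s K n (\<kappa> g) b) = const_in_s K n (\<kappa> g) (k \<odot>\<^bsub>UP K\<^esub> b)"
    unfolding e[symmetric] a c up_map_smult[OF s.hom, symmetric] s.const_in_s_up_map s.gs_scale_Omega m ..
qed

end

text \<open>
  Every element of \<open>K\<close> is a fraction of elements in the image of \<open>\<sigma>\<close>, so that denominators can be
  cleared.
\<close>

locale gs_fractions = gs_setting K n \<sigma> g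
  for K :: "('a, 'm) ring_scheme" and n :: nat and \<sigma> :: "'r::comm_ring_1 \<Rightarrow> 'a" and g :: "'r mpoly" +
  assumes fractions: "k \<in> carrier K \<Longrightarrow> \<exists>u v. \<sigma> v \<noteq> \<zero>\<^bsub>K\<^esub> \<and> k \<otimes>\<^bsub>K\<^esub> \<sigma> v = \<sigma> u"
begin

abbreviation "sc \<equiv> gs_scale K n (\<kappa> g)"

lemmas sg = typed_homD[OF hom]

lemma sigma_nonzero_mult: "\<sigma> u \<noteq> \<zero>\<^bsub>K\<^esub> \<Longrightarrow> \<sigma> v \<noteq> \<zero>\<^bsub>K\<^esub> \<Longrightarrow> \<sigma> (u * v) \<noteq> \<zero>\<^bsub>K\<^esub>"
  using prime_ideal_setD(6)[OF prime_q] by simp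

lemma sc_sigma: "x \<in> carrier N \<Longrightarrow> sc (\<sigma> u) (sc (\<sigma> v) x) = sc (\<sigma> (u * v)) x"
  unfolding sg(5) by (rule scale_laws(2)[OF sg(1) sg(1) _ ]) simp_all

text \<open>
  The elements of which a nonzero multiple comes from \<open>D[s] g \<delta>\<close>. They form a submodule that contains
  \<open>g\<^sup>s\<^sup>+\<^sup>1\<close>, hence all of \<open>A\<^sub>n(K)[s] g\<^sup>s\<^sup>+\<^sup>1\<close>.
\<close>

definition fraction_module :: "(nat \<Rightarrow> 'a inverted_poly) set" where
  "fraction_module = {x \<in> carrier N. \<exists>v y. \<sigma> v \<noteq> \<zero>\<^bsub>K\<^esub> \<and> y \<in> delta.dmod \<and> sc (\<sigma> v) x = Psi y}"

lemma fraction_moduleI: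
  "x \<in> carrier N \<Longrightarrow> \<sigma> v \<noteq> \<zero>\<^bsub>K\<^esub> \<Longrightarrow> y \<in> delta.dmod \<Longrightarrow> sc (\<sigma> v) x = Psi y \<Longrightarrow> x \<in> fraction_module"
  unfolding fraction_module_def by blast

lemma fraction_moduleE:
  assumes "x \<in> fraction_module"
  obtains v y where "x \<in> carrier N" "\<sigma> v \<noteq> \<zero>\<^bsub>K\<^esub>" "y \<in> delta.dmod" "sc (\<sigma> v) x = Psi y"
  using assms unfolding fraction_module_def by blast

lemma fraction_module_closed: "gs_closed K n (\<kappa> g) fraction_module"
proof -
  interpret N: cring N by (rule cring_N)
  interpret K: field K by (rule field_K)
  have one: "\<sigma> 1 \<noteq> \<zero>\<^bsub>K\<^esub>" unfolding sg(3) by (rule K.one_not_zero)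
  have sc1: "sc (\<sigma> 1) x = x" if "x \<in> carrier N" for x
    unfolding sg(3) by (rule scale_laws(3)[OF sg(1) sg(1) that that])
  note la = scale_laws[OF sg(1) sg(1)]
  show ?thesis
    unfolding gs_closed_def
  proof (intro conjI ballI)
    show "fraction_module \<subseteq> carrier N" by (auto simp: fraction_module_def)
    show "\<zero>\<^bsub>N\<^esub> \<in> fraction_module"
      by (rule fraction_moduleI[OF _ one delta.dmod_zero]) (simp_all add: sc1 Psi_zero)
    have G: "gs_monom K n (\<kappa> g) (\<kappa> g) 0 \<in> carrier N" unfolding gs_monom_eq by (rule Omega)
    show "gs_monom K n (\<kappa> g) (\<kappa> g) 0 \<in> fraction_module"
      by (rule fraction_moduleI[OF G one delta.dmod.base]) (simp add: sc1 G Psi_g)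
  next
    fix x x' assume "x \<in> fraction_module" "x' \<in> fraction_module"
    then obtain v y v' y' where x: "x \<in> carrier N" "\<sigma> v \<noteq> \<zero>\<^bsub>K\<^esub>" "y \<in> delta.dmod" "sc (\<sigma> v) x = Psi y"
      and x': "x' \<in> carrier N" "\<sigma> v' \<noteq> \<zero>\<^bsub>K\<^esub>" "y' \<in> delta.dmod" "sc (\<sigma> v') x' = Psi y'"
      by (elim fraction_moduleE)
    have "sc (\<sigma> (v * v')) (x \<oplus>\<^bsub>N\<^esub> x') = sc (\<sigma> (v * v')) x \<oplus>\<^bsub>N\<^esub> sc (\<sigma> (v * v')) x'"
      by (rule la(4)[OF x(1) x'(1)])
    also have "sc (\<sigma> (v * v')) x = sc (\<sigma> v') (Psi y)"
      unfolding x(4)[symmetric] sc_sigma[OF x(1)] by (simp only: mult.commute)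
    also have "sc (\<sigma> (v * v')) x' = sc (\<sigma> v) (Psi y')"
      unfolding x'(4)[symmetric] sc_sigma[OF x'(1)] ..
    also have "sc (\<sigma> v') (Psi y) \<oplus>\<^bsub>N\<^esub> sc (\<sigma> v) (Psi y') = Psi (cmult v' y + cmult v y')"
      by (simp only: Psi_add Psi_cmult)
    finally show "x \<oplus>\<^bsub>N\<^esub> x' \<in> fraction_module"
      by (rule fraction_moduleI[OF N.a_closed[OF x(1) x'(1)] sigma_nonzero_mult[OF x(2) x'(2)]
            delta.dmod.add[OF delta.dmod.cmult[OF x(3)] delta.dmod.cmult[OF x'(3)]]])
  next
    fix k x assume k: "k \<in> carrier K" and "x \<in> fraction_module"
    then obtain v y where x: "x \<in> carrier N" "\<sigma> v \<noteq> \<zero>\<^bsub>K\<^esub>" "y \<in> delta.dmod" "sc (\<sigma> v) x = Psi y"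
      by (elim fraction_moduleE)
    obtain u w where uw: "\<sigma> w \<noteq> \<zero>\<^bsub>K\<^esub>" "k \<otimes>\<^bsub>K\<^esub> \<sigma> w = \<sigma> u" using fractions[OF k] by (elim exE conjE)
    have "sc (\<sigma> (v * w)) (sc k x) = sc (\<sigma> (v * w) \<otimes>\<^bsub>K\<^esub> k) x"
      by (rule scale_laws(2)[OF sg(1) k x(1) x(1)])
    also have "\<sigma> (v * w) \<otimes>\<^bsub>K\<^esub> k = \<sigma> (u * v)"
      unfolding sg(5) uw(2)[symmetric] using sg(1) k by (simp add: K.m_ac)
    also have "sc (\<sigma> (u * v)) x = Psi (cmult u y)"
      unfolding sc_sigma[OF x(1), symmetric] x(4) Psi_cmult ..
    finally show "sc k x \<in> fraction_module"
      by (rule fraction_moduleI[OF scale_laws(1)[OF k k x(1) x(1)] sigma_nonzero_mult[OF x(2) uw(1)] delta.dmod.cmult[OF x(3)]])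
  next
    fix l x assume l: "l \<in> weyl_letters n" and "x \<in> fraction_module"
    then obtain v y where x: "x \<in> carrier N" "\<sigma> v \<noteq> \<zero>\<^bsub>K\<^esub>" "y \<in> delta.dmod" "sc (\<sigma> v) x = Psi y"
      by (elim fraction_moduleE)
    obtain y' where y': "y' \<in> delta.dmod" "letter_act K n (\<kappa> g) l (Psi y) = Psi y'"
    proof (cases l)
      case (Var i)
      then have i: "i < n" using l by (auto simp: weyl_letters_def)
      have "delta.gen_op (2 * i + 1) y \<in> delta.dmod" by (rule delta.dmod.gen[OF x(3)]) (use i in simp)
      also have "delta.gen_op (2 * i + 1) y = var_op i y" using i by (simp add: delta.gen_op_def)
      finally show thesis using that Psi_var_op[OF i, of y] unfolding Var by metis
    next
      case (Diff i)
      then have i: "i < n" using l by (auto simp: weyl_letters_def)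
      have ne: "2 * i + 2 \<noteq> 2 * n + 1" by presburger
      have "delta.gen_op (2 * i + 2) y \<in> delta.dmod" by (rule delta.dmod.gen[OF x(3)]) (use i in simp)
      also have "delta.gen_op (2 * i + 2) y = diff_op g i y" using ne by (simp add: delta.gen_op_def)
      finally show thesis using that Psi_diff_op[OF i, of y] unfolding Diff by metis
    qed
    have "sc (\<sigma> v) (letter_act K n (\<kappa> g) l x) = Psi y'"
      unfolding la(5)[OF x(1) x(1) l, symmetric] x(4) by (rule y'(2))
    then show "letter_act K n (\<kappa> g) l x \<in> fraction_module"
      by (rule fraction_moduleI[OF la(7)[OF x(1) x(1) l] x(2) y'(1)])
  next
    fix x assume "x \<in> fraction_module"
    then obtain v y where x: "x \<in> carrier N" "\<sigma> v \<noteq> \<zero>\<^bsub>K\<^esub>" "y \<in> delta.dmod" "sc (\<sigma> v) x = Psi y"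
      by (elim fraction_moduleE)
    have "delta.gen_op 0 y \<in> delta.dmod" by (rule delta.dmod.gen[OF x(3)]) simp
    then have y: "s_op g y \<in> delta.dmod" by (simp add: delta.gen_op_def)
    have "sc (\<sigma> v) (s_times K n (\<kappa> g) x) = Psi (s_op g y)"
      unfolding la(6)[OF x(1) x(1), symmetric] x(4) Psi_s_op ..
    then show "s_times K n (\<kappa> g) x \<in> fraction_module"
      by (rule fraction_moduleI[OF la(8)[OF x(1) x(1)] x(2) y])
  qed
qed

text \<open>
  By \<open>Psi_eq_iff\<close> the comparison map is injective modulo \<open>q\<close>. So \<open>b(s) g\<^sup>s\<close> has a multiple that is
  the image of an element of \<open>D[s] g \<delta>\<close> if and only if a multiple of \<open>c(s) \<delta>\<close> is congruent modulo \<open>q\<close> to such an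
  element.
\<close>

lemma bernstein_ideal_iff:
  assumes b: "b \<in> carrier (UP K)" and u: "\<sigma> u \<noteq> \<zero>\<^bsub>K\<^esub>" and c: "\<sigma> u \<odot>\<^bsub>UP K\<^esub> b = up_map \<sigma> c"
  shows "b \<in> bernstein_ideal K n (\<kappa> g) \<longleftrightarrow> (\<exists>v. \<sigma> v \<noteq> \<zero>\<^bsub>K\<^esub> \<and> smult v c \<in> delta.bs_ideal q)"
proof -
  interpret K: field K by (rule field_K)
  let ?b = "const_in_s K n (\<kappa> g) b"
  have bN: "?b \<in> carrier N" by (rule const_in_s_laws(1)[OF b sg(1)])
  have cb: "Psi (delta.ev 1 (delta.spoly (smult v c))) = sc (\<sigma> (v * u)) ?b" for v
  proof -
    have "Psi (delta.ev 1 (delta.spoly (smult v c))) = sc (\<sigma> v) (Psi (delta.ev 1 (delta.spoly c)))"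
      by (simp only: delta.spoly_smult delta.ev_scal Psi_cmult)
    also have "\<dots> = sc (\<sigma> v) (sc (\<sigma> u) ?b)"
      unfolding Psi_ev_spoly c[symmetric] const_in_s_laws(2)[OF b sg(1)] ..
    also have "\<dots> = sc (\<sigma> (v * u)) ?b" by (rule sc_sigma[OF bN])
    finally show ?thesis .
  qed
  have "?b \<in> gs_submodule K n (\<kappa> g) \<longleftrightarrow> (\<exists>v. \<sigma> v \<noteq> \<zero>\<^bsub>K\<^esub> \<and> smult v c \<in> delta.bs_ideal q)"
  proof
    assume "?b \<in> gs_submodule K n (\<kappa> g)"
    then have "?b \<in> fraction_module" using submodule_least[OF fraction_module_closed] by blast
    then obtain v y where v: "\<sigma> v \<noteq> \<zero>\<^bsub>K\<^esub>" "y \<in> delta.dmod" "sc (\<sigma> v) ?b = Psi y"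
      by (elim fraction_moduleE)
    have "Psi (delta.ev 1 (delta.spoly (smult v c))) = Psi (cmult u y)"
      unfolding cb Psi_cmult v(3)[symmetric] sc_sigma[OF bN] by (simp only: mult.commute)
    then have "smult v c \<in> delta.bs_ideal q"
      unfolding Psi_eq_iff delta.bs_ideal_def using delta.dmod.cmult[OF v(2)] by blast
    then show "\<exists>v. \<sigma> v \<noteq> \<zero>\<^bsub>K\<^esub> \<and> smult v c \<in> delta.bs_ideal q" using v(1) by blast
  next
    assume "\<exists>v. \<sigma> v \<noteq> \<zero>\<^bsub>K\<^esub> \<and> smult v c \<in> delta.bs_ideal q"
    then obtain v where v: "\<sigma> v \<noteq> \<zero>\<^bsub>K\<^esub>" "smult v c \<in> delta.bs_ideal q" by (elim exE conjE)
    then obtain y where y: "y \<in> delta.dmod" "delta.ev 1 (delta.spoly (smult v c)) - y \<in> delta.kerN q"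
      unfolding delta.bs_ideal_def by blast
    have "sc (\<sigma> (v * u)) ?b = Psi y" using y(2) unfolding Psi_eq_iff[symmetric] cb .
    then have S: "sc (\<sigma> (v * u)) ?b \<in> gs_submodule K n (\<kappa> g)" using Psi_dmod[OF y(1)] by (simp only:)
    let ?k = "inv\<^bsub>K\<^esub> (\<sigma> (v * u))"
    have un: "\<sigma> (v * u) \<in> Units K" using sigma_nonzero_mult[OF v(1) u] sg(1) by (simp add: K.field_Units)
    have k: "?k \<in> carrier K" using un by (rule K.Units_inv_closed)
    have "sc ?k (sc (\<sigma> (v * u)) ?b) = sc (?k \<otimes>\<^bsub>K\<^esub> \<sigma> (v * u)) ?b"
      by (rule scale_laws(2)[OF k sg(1) bN bN])
    also have "?k \<otimes>\<^bsub>K\<^esub> \<sigma> (v * u) = \<one>\<^bsub>K\<^esub>" using un by (rule K.Units_l_inv)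
    also have "sc \<one>\<^bsub>K\<^esub> ?b = ?b" by (rule scale_laws(3)[OF k k bN bN])
    finally have "?b = sc ?k (sc (\<sigma> (v * u)) ?b)" by (rule sym)
    moreover have "sc ?k (sc (\<sigma> (v * u)) ?b) \<in> gs_submodule K n (\<kappa> g)"
      using submodule_closed k S unfolding gs_closed_def by blast
    ultimately show "?b \<in> gs_submodule K n (\<kappa> g)" by (simp only:)
  qed
  then show ?thesis using b by (simp add: bernstein_ideal_eq)
qed

lemma common_denominator:
  assumes b: "b \<in> carrier (UP K)"
  obtains u c where "\<sigma> u \<noteq> \<zero>\<^bsub>K\<^esub>" "\<sigma> u \<odot>\<^bsub>UP K\<^esub> b = up_map \<sigma> c"
proof -
  interpret K: field K by (rule field_K)
  have bu: "b \<in> up K" using b by (simp add: UP_def)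
  have bc: "b j \<in> carrier K" for j by (rule mem_upD[OF bu])
  obtain M where M: "\<And>j. M < j \<Longrightarrow> b j = \<zero>\<^bsub>K\<^esub>" using bu by (auto simp: up_def)
  have "\<exists>u c. \<sigma> u \<noteq> \<zero>\<^bsub>K\<^esub> \<and> (\<forall>j<J. \<sigma> u \<otimes>\<^bsub>K\<^esub> b j = \<sigma> (c j))" for J
  proof (induction J)
    case 0
    show ?case by (rule exI[of _ 1]) (simp add: sg(3))
  next
    case (Suc J)
    then obtain u c where uc: "\<sigma> u \<noteq> \<zero>\<^bsub>K\<^esub>" "\<forall>j<J. \<sigma> u \<otimes>\<^bsub>K\<^esub> b j = \<sigma> (c j)" by (elim exE conjE)
    obtain a w where aw: "\<sigma> w \<noteq> \<zero>\<^bsub>K\<^esub>" "b J \<otimes>\<^bsub>K\<^esub> \<sigma> w = \<sigma> a" using fractions[OF bc[of J]] by (elim exE conjE)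
    let ?c = "\<lambda>j. if j = J then u * a else w * c j"
    have "\<sigma> (u * w) \<otimes>\<^bsub>K\<^esub> b j = \<sigma> (?c j)" if "j < Suc J" for j
    proof (cases "j = J")
      case True
      have "\<sigma> (u * w) \<otimes>\<^bsub>K\<^esub> b J = \<sigma> u \<otimes>\<^bsub>K\<^esub> (b J \<otimes>\<^bsub>K\<^esub> \<sigma> w)"
        unfolding sg(5) using sg(1) bc by (simp add: K.m_ac)
      then show ?thesis using True by (simp add: aw sg(5))
    next
      case False
      have "\<sigma> (u * w) \<otimes>\<^bsub>K\<^esub> b j = \<sigma> w \<otimes>\<^bsub>K\<^esub> (\<sigma> u \<otimes>\<^bsub>K\<^esub> b j)"
        unfolding sg(5) using sg(1) bc by (simp add: K.m_ac)
      then show ?thesis using False uc(2) that by (simp add: sg(5))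
    qed
    then show ?case using sigma_nonzero_mult[OF uc(1) aw(1)] by (intro exI[of _ "u * w"] exI[of _ ?c]) simp
  qed
  from this[of "Suc M"]
  obtain u c where uc: "\<sigma> u \<noteq> \<zero>\<^bsub>K\<^esub>" "\<forall>j<Suc M. \<sigma> u \<otimes>\<^bsub>K\<^esub> b j = \<sigma> (c j)" by (elim exE conjE)
  define p where "p = (\<Sum>j\<le>M. Polynomial.monom (c j) j)"
  have "pcoeff p j = (if j \<le> M then c j else 0)" for j by (simp add: p_def Polynomial.coeff_sum)
  then have "\<sigma> u \<odot>\<^bsub>UP K\<^esub> b = up_map \<sigma> p"
    using bu uc(2) M sg(1) by (auto simp: UP_def up_map_def fun_eq_iff sg(2) less_Suc_eq_le not_le)
  then show thesis using that uc(1) by blast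
qed

end

subsection \<open>Rational polynomials\<close>

text \<open>
  Determines the image of a rational number in \<open>K\<close> by any of its representations as a fraction.
\<close>

lemma rat_embed_clear:
  assumes h: "typed_hom \<sigma> K" and K: "field K" and ch: "char_zero K"
    and e: "of_int m * r = of_int z"
  shows "rat_embed K r \<in> carrier K" "\<sigma> (of_int m) \<otimes>\<^bsub>K\<^esub> rat_embed K r = \<sigma> (of_int z)"
proof -
  interpret K: field K by fact
  note hr = typed_homD[OF h] and oi = typed_hom_of_int[OF h K.ring_axioms, symmetric]
  obtain p q where pq: "quotient_of r = (p, q)" by (cases "quotient_of r")
  have q: "q > 0" using quotient_of_denom_pos[OF pq] .
  have r: "r = of_int p / of_int q" using quotient_of_div[OF pq] .
  have "of_int (m * p) = (of_int (z * q) :: rat)" using e q by (simp add: r field_simps)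
  then have mp: "m * p = z * q" by (simp only: of_int_eq_iff)
  have "\<sigma> (of_int q) = \<sigma> (of_nat (nat q))" using q by simp
  also have "\<dots> = [nat q] \<cdot>\<^bsub>K\<^esub> \<one>\<^bsub>K\<^esub>" by (rule typed_hom_of_nat(1)[OF h K.ring_axioms])
  also have "\<dots> \<noteq> \<zero>\<^bsub>K\<^esub>" using ch q by (simp add: char_zero_def)
  finally have un: "\<sigma> (of_int q) \<in> Units K" using hr(1) by (simp add: K.field_Units)
  have ev: "rat_embed K r = \<sigma> (of_int p) \<otimes>\<^bsub>K\<^esub> inv\<^bsub>K\<^esub> \<sigma> (of_int q)"
    by (simp add: rat_embed_def pq oi)
  show "rat_embed K r \<in> carrier K" unfolding ev using hr(1) un by simp
  have "\<sigma> (of_int m) \<otimes>\<^bsub>K\<^esub> rat_embed K r = \<sigma> (of_int (m * p)) \<otimes>\<^bsub>K\<^esub> inv\<^bsub>K\<^esub> \<sigma> (of_int q)"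
    unfolding ev using hr(1) un by (simp add: hr(5) K.m_assoc)
  also have "\<dots> = \<sigma> (of_int z) \<otimes>\<^bsub>K\<^esub> (\<sigma> (of_int q) \<otimes>\<^bsub>K\<^esub> inv\<^bsub>K\<^esub> \<sigma> (of_int q))"
    unfolding mp using hr(1) un by (simp add: hr(5) K.m_assoc)
  also have "\<dots> = \<sigma> (of_int z)" using hr(1) un by simp
  finally show "\<sigma> (of_int m) \<otimes>\<^bsub>K\<^esub> rat_embed K r = \<sigma> (of_int z)" .
qed

lemma sigma_of_int_nonzero:
  assumes h: "typed_hom \<sigma> K" and K: "field K" and ch: "char_zero K" and m: "m \<noteq> 0"
  shows "\<sigma> (of_int m) \<noteq> \<zero>\<^bsub>K\<^esub>"
proof -
  interpret K: field K by fact
  have pos: "\<sigma> (of_nat k) \<noteq> \<zero>\<^bsub>K\<^esub>" if "k > 0" for k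
    unfolding typed_hom_of_nat(1)[OF h K.ring_axioms] using ch that by (simp add: char_zero_def)
  show ?thesis
  proof (cases "m > 0")
    case True
    then show ?thesis using pos[of "nat m"] by simp
  next
    case False
    then have "\<sigma> (of_int m) = \<ominus>\<^bsub>K\<^esub> \<sigma> (of_nat (nat (- m)))"
      by (simp add: typed_hom_uminus[OF h K.ring_axioms, symmetric])
    moreover have "\<sigma> (of_nat (nat (- m))) \<noteq> \<zero>\<^bsub>K\<^esub>" using False m by (intro pos) simp
    ultimately show ?thesis using typed_homD(1)[OF h]
      by (metis K.add.inv_eq_1_iff)
  qed
qed

lemma rat_embed_eq_zero_one:
  assumes K: "field K" and ch: "char_zero K"
  shows "rat_embed K r \<in> carrier K" "rat_embed K r = \<zero>\<^bsub>K\<^esub> \<longleftrightarrow> r = 0" "rat_embed K r = \<one>\<^bsub>K\<^esub> \<longleftrightarrow> r = 1"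
proof -
  interpret K: field K by fact
  have h: "typed_hom (uproj K) K" by (rule uproj_hom[OF K.is_cring])
  note hr = typed_homD[OF h]
  obtain p q where pq: "quotient_of r = (p, q)" by (cases "quotient_of r")
  have q: "q > 0" using quotient_of_denom_pos[OF pq] .
  have r: "r = of_int p / of_int q" using quotient_of_div[OF pq] .
  have "of_int q * r = of_int p" using q by (simp add: r)
  note cl = rat_embed_clear[OF h K ch this]
  show c: "rat_embed K r \<in> carrier K" by (rule cl)
  have qn: "uproj K (of_int q) \<noteq> \<zero>\<^bsub>K\<^esub>" by (rule sigma_of_int_nonzero[OF h K ch]) (use q in simp)
  have "rat_embed K r = \<zero>\<^bsub>K\<^esub> \<longleftrightarrow> uproj K (of_int p) = \<zero>\<^bsub>K\<^esub>"
    unfolding cl(2)[symmetric] using c hr(1) qn by (simp add: K.integral_iff)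
  also have "\<dots> \<longleftrightarrow> p = 0" using sigma_of_int_nonzero[OF h K ch, of p] by (auto simp: hr(2))
  also have "\<dots> \<longleftrightarrow> r = 0" using q by (simp add: r)
  finally show "rat_embed K r = \<zero>\<^bsub>K\<^esub> \<longleftrightarrow> r = 0" .
  have "rat_embed K r = \<one>\<^bsub>K\<^esub> \<longleftrightarrow> uproj K (of_int q) \<otimes>\<^bsub>K\<^esub> rat_embed K r = uproj K (of_int q) \<otimes>\<^bsub>K\<^esub> \<one>\<^bsub>K\<^esub>"
    using c hr(1) qn by (subst K.m_lcancel) simp_all
  also have "\<dots> \<longleftrightarrow> uproj K (of_int p) = uproj K (of_int q)" unfolding cl(2) using hr(1) by simp
  also have "\<dots> \<longleftrightarrow> uproj K (of_int (p - q)) = \<zero>\<^bsub>K\<^esub>"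
    unfolding of_int_diff typed_hom_uminus(2)[OF h K.ring_axioms] using hr(1) by (simp add: K.r_right_minus_eq)
  also have "\<dots> \<longleftrightarrow> p = q" using sigma_of_int_nonzero[OF h K ch, of "p - q"] by (auto simp: hr(2))
  also have "\<dots> \<longleftrightarrow> r = 1" using q by (auto simp add: r)
  finally show "rat_embed K r = \<one>\<^bsub>K\<^esub> \<longleftrightarrow> r = 1" .
qed

lemma rat_poly_common_denominator:
  "\<exists>m z. m \<noteq> 0 \<and> (\<forall>j. of_int m * pcoeff (b :: rat poly) j = of_int (z j))"
proof (induction b)
  case 0
  show ?case by (rule exI[of _ 1], rule exI[of _ "\<lambda>_. 0"]) simp
next
  case (pCons a b)
  then obtain m z where mz: "m \<noteq> 0" "\<forall>j. of_int m * pcoeff b j = of_int (z j)" by (elim exE conjE)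
  obtain p q where pq: "quotient_of a = (p, q)" by (cases "quotient_of a")
  have q: "q > 0" using quotient_of_denom_pos[OF pq] .
  have a: "a = of_int p / of_int q" using quotient_of_div[OF pq] .
  have "of_int (m * q) * pcoeff (pCons a b) j = of_int (case j of 0 \<Rightarrow> m * p | Suc k \<Rightarrow> q * z k)" for j
  proof (cases j)
    case 0
    then show ?thesis using q by (simp add: a)
  next
    case (Suc k)
    have "of_int (m * q) * pcoeff b k = of_int q * (of_int m * pcoeff b k)" by (simp add: mult_ac)
    then show ?thesis using Suc mz(2) by simp
  qed
  then show ?case using mz(1) q by (intro exI[of _ "m * q"] exI[of _ "\<lambda>j. case j of 0 \<Rightarrow> m * p | Suc k \<Rightarrow> q * z k"]) simp
qed

lemma rat_poly_embed_carrier: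
  assumes "field K" "char_zero K"
  shows "rat_poly_embed K b \<in> up K"
proof (rule mem_upI)
  show "rat_poly_embed K b j \<in> carrier K" for j
    unfolding rat_poly_embed_def by (rule rat_embed_eq_zero_one(1)[OF assms])
  have "bound \<zero>\<^bsub>K\<^esub> (Polynomial.degree b) (rat_poly_embed K b)"
    by (auto simp: rat_poly_embed_def rat_embed_eq_zero_one(2)[OF assms] coeff_eq_0)
  then show "\<exists>j. bound \<zero>\<^bsub>K\<^esub> j (rat_poly_embed K b)" by (rule exI)
qed

lemma rat_poly_embed_UP:
  assumes "field K" "char_zero K"
  shows "rat_poly_embed K b \<in> carrier (UP K)"
    "coeff (UP K) (rat_poly_embed K b) j = rat_embed K (pcoeff b j)"
  using rat_poly_embed_carrier[OF assms, of b] by (simp_all add: UP_def rat_poly_embed_def)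

lemma bernstein_sato_monic:
  assumes K: "field K" and ch: "char_zero K" and bs: "is_bernstein_sato K n h (rat_poly_embed K b)"
  shows "lead_coeff b = 1"
proof -
  interpret K: field K by fact
  interpret U: UP_domain K "UP K" by (simp add: UP_domain_def K.domain_axioms)
  let ?\<beta> = "rat_poly_embed K b"
  let ?e = "deg K ?\<beta>"
  note car = rat_poly_embed_UP(1)[OF K ch, of b] and co = rat_poly_embed_UP(2)[OF K ch, of b]
  have "rat_embed K (pcoeff b ?e) = \<one>\<^bsub>K\<^esub>" using bs by (simp add: is_bernstein_sato_def co)
  then have 1: "pcoeff b ?e = 1" by (simp add: rat_embed_eq_zero_one[OF K ch])
  then have le: "?e \<le> Polynomial.degree b" by (intro le_degree) simp
  have "\<not> ?e < Polynomial.degree b"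
  proof
    assume "?e < Polynomial.degree b"
    from U.deg_aboveD[OF this car] have "lead_coeff b = 0" by (simp add: co rat_embed_eq_zero_one[OF K ch])
    then show False using 1 by simp
  qed
  then show ?thesis using 1 le by simp
qed

context gs_fractions
begin

abbreviation "BI \<equiv> bernstein_ideal K n (\<kappa> g)"

lemma bernstein_idealI:
  "b \<in> carrier (UP K) \<Longrightarrow> \<sigma> u \<noteq> \<zero>\<^bsub>K\<^esub> \<Longrightarrow> \<sigma> u \<odot>\<^bsub>UP K\<^esub> b = up_map \<sigma> c \<Longrightarrow> \<sigma> v \<noteq> \<zero>\<^bsub>K\<^esub> \<Longrightarrow>
    smult v c \<in> delta.bs_ideal q \<Longrightarrow> b \<in> BI"
  using bernstein_ideal_iff by blast

lemma bernstein_idealE: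
  assumes "b \<in> BI"
  obtains u c v where "b \<in> carrier (UP K)" "\<sigma> u \<noteq> \<zero>\<^bsub>K\<^esub>" "\<sigma> u \<odot>\<^bsub>UP K\<^esub> b = up_map \<sigma> c"
    "\<sigma> v \<noteq> \<zero>\<^bsub>K\<^esub>" "smult v c \<in> delta.bs_ideal q"
proof -
  have b: "b \<in> carrier (UP K)" using assms by (simp add: bernstein_ideal_def)
  obtain u c where uc: "\<sigma> u \<noteq> \<zero>\<^bsub>K\<^esub>" "\<sigma> u \<odot>\<^bsub>UP K\<^esub> b = up_map \<sigma> c" by (rule common_denominator[OF b])
  have "\<exists>v. \<sigma> v \<noteq> \<zero>\<^bsub>K\<^esub> \<and> smult v c \<in> delta.bs_ideal q" using bernstein_ideal_iff[OF b uc] assms by (simp only:)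
  then obtain v where "\<sigma> v \<noteq> \<zero>\<^bsub>K\<^esub>" "smult v c \<in> delta.bs_ideal q" by (elim exE conjE)
  then show thesis using that b uc by (simp only:)
qed

lemma bernstein_ideal_mult:
  assumes x: "x \<in> BI" and d: "d \<in> carrier (UP K)"
  shows "d \<otimes>\<^bsub>UP K\<^esub> x \<in> BI"
proof -
  interpret K: field K by (rule field_K)
  interpret U: UP_domain K "UP K" by (simp add: UP_domain_def K.domain_axioms)
  obtain u c v where uc: "x \<in> carrier (UP K)" "\<sigma> u \<noteq> \<zero>\<^bsub>K\<^esub>" "\<sigma> u \<odot>\<^bsub>UP K\<^esub> x = up_map \<sigma> c"
    "\<sigma> v \<noteq> \<zero>\<^bsub>K\<^esub>" "smult v c \<in> delta.bs_ideal q" by (rule bernstein_idealE[OF x])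
  obtain u' c' where uc': "\<sigma> u' \<noteq> \<zero>\<^bsub>K\<^esub>" "\<sigma> u' \<odot>\<^bsub>UP K\<^esub> d = up_map \<sigma> c'" by (rule common_denominator[OF d])
  note cl = d uc(1) sg(1)
  show ?thesis
  proof (rule bernstein_idealI[OF _ sigma_nonzero_mult[OF uc'(1) uc(2)] _ uc(4)])
    show "d \<otimes>\<^bsub>UP K\<^esub> x \<in> carrier (UP K)" using cl by simp
    have "\<sigma> (u' * u) \<odot>\<^bsub>UP K\<^esub> (d \<otimes>\<^bsub>UP K\<^esub> x) = (\<sigma> u' \<odot>\<^bsub>UP K\<^esub> d) \<otimes>\<^bsub>UP K\<^esub> (\<sigma> u \<odot>\<^bsub>UP K\<^esub> x)"
      using cl by (simp add: sg(5) U.smult_l_minus U.UP_smult_assoc1 U.UP_smult_assoc2 U.smult_assoc2 U.m_comm[of d])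
    also have "\<dots> = up_map \<sigma> (c' * c)"
      unfolding uc(3) uc'(2) by (rule typed_homD(5)[OF up_map_hom[OF hom cring_K], symmetric])
    finally show "\<sigma> (u' * u) \<odot>\<^bsub>UP K\<^esub> (d \<otimes>\<^bsub>UP K\<^esub> x) = up_map \<sigma> (c' * c)" .
    show "smult v (c' * c) \<in> delta.bs_ideal q"
      using delta.bs_ideal_closed(6)[OF prime_q uc(5), of c'] by (simp add: mult_smult_right)
  qed
qed

lemma bernstein_ideal_add:
  assumes x: "x \<in> BI" and y: "y \<in> BI"
  shows "x \<oplus>\<^bsub>UP K\<^esub> y \<in> BI"
proof -
  interpret K: field K by (rule field_K)
  interpret U: UP_domain K "UP K" by (simp add: UP_domain_def K.domain_axioms)
  obtain u c v where uc: "x \<in> carrier (UP K)" "\<sigma> u \<noteq> \<zero>\<^bsub>K\<^esub>" "\<sigma> u \<odot>\<^bsub>UP K\<^esub> x = up_map \<sigma> c"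
    "\<sigma> v \<noteq> \<zero>\<^bsub>K\<^esub>" "smult v c \<in> delta.bs_ideal q" by (rule bernstein_idealE[OF x])
  obtain u' c' v' where uc': "y \<in> carrier (UP K)" "\<sigma> u' \<noteq> \<zero>\<^bsub>K\<^esub>" "\<sigma> u' \<odot>\<^bsub>UP K\<^esub> y = up_map \<sigma> c'"
    "\<sigma> v' \<noteq> \<zero>\<^bsub>K\<^esub>" "smult v' c' \<in> delta.bs_ideal q" by (rule bernstein_idealE[OF y])
  note cl = uc(1) uc'(1) sg(1)
  note um = up_map_smult[OF hom]
  show ?thesis
  proof (rule bernstein_idealI[OF _ sigma_nonzero_mult[OF uc(2) uc'(2)] _ sigma_nonzero_mult[OF uc(4) uc'(4)]])
    show "x \<oplus>\<^bsub>UP K\<^esub> y \<in> carrier (UP K)" using cl by simp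
    have "\<sigma> (u * u') \<odot>\<^bsub>UP K\<^esub> (x \<oplus>\<^bsub>UP K\<^esub> y) = \<sigma> (u * u') \<odot>\<^bsub>UP K\<^esub> x \<oplus>\<^bsub>UP K\<^esub> \<sigma> (u * u') \<odot>\<^bsub>UP K\<^esub> y"
      using cl by (simp add: U.UP_smult_r_distr)
    also have "\<sigma> (u * u') \<odot>\<^bsub>UP K\<^esub> x = \<sigma> u' \<odot>\<^bsub>UP K\<^esub> (\<sigma> u \<odot>\<^bsub>UP K\<^esub> x)"
      using cl by (simp add: sg(5) K.m_comm U.UP_smult_assoc1)
    also have "\<sigma> (u * u') \<odot>\<^bsub>UP K\<^esub> y = \<sigma> u \<odot>\<^bsub>UP K\<^esub> (\<sigma> u' \<odot>\<^bsub>UP K\<^esub> y)"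
      using cl by (simp add: sg(5) U.UP_smult_assoc1)
    also have "\<sigma> u' \<odot>\<^bsub>UP K\<^esub> (\<sigma> u \<odot>\<^bsub>UP K\<^esub> x) \<oplus>\<^bsub>UP K\<^esub> \<sigma> u \<odot>\<^bsub>UP K\<^esub> (\<sigma> u' \<odot>\<^bsub>UP K\<^esub> y) =
        up_map \<sigma> (smult u' c + smult u c')"
      unfolding uc(3) uc'(3) um[symmetric] by (rule typed_homD(4)[OF up_map_hom[OF hom cring_K], symmetric])
    finally show "\<sigma> (u * u') \<odot>\<^bsub>UP K\<^esub> (x \<oplus>\<^bsub>UP K\<^esub> y) = up_map \<sigma> (smult u' c + smult u c')" .
    have "smult (v' * u') (smult v c) + smult (v * u) (smult v' c') \<in> delta.bs_ideal q"
      by (rule delta.bs_ideal_closed(1)[OF prime_q delta.bs_ideal_closed(2)[OF prime_q uc(5)]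
            delta.bs_ideal_closed(2)[OF prime_q uc'(5)]])
    then show "smult (v * v') (smult u' c + smult u c') \<in> delta.bs_ideal q"
      by (simp add: smult_add_right mult_ac)
  qed
qed

text \<open>
  Over the field \<open>K\<close>, the monic \<open>b\<close> generates the Bernstein ideal if and only if it is a member and no
  nonzero member has smaller degree. The polynomial \<open>b'\<close> is \<open>b\<close> with its denominators cleared by \<open>m\<close>.
\<close>

theorem is_bernstein_sato_iff:
  assumes ch: "char_zero K" and monic: "lead_coeff (b :: rat poly) = 1" and m: "m \<noteq> 0"
    and z: "\<And>j. of_int m * pcoeff b j = of_int (z j)" and b': "\<And>j. pcoeff b' j = of_int (z j)"
  shows "is_bernstein_sato K n (\<kappa> g) (rat_poly_embed K b) \<longleftrightarrow> delta.bs_generator q b'"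
proof -
  interpret K: field K by (rule field_K)
  interpret U: UP_domain K "UP K" by (simp add: UP_domain_def K.domain_axioms)
  let ?\<beta> = "rat_poly_embed K b" and ?r = "Polynomial.degree b"
  note car = rat_poly_embed_UP(1)[OF field_K ch, of b] and co = rat_poly_embed_UP(2)[OF field_K ch, of b]
  note re = rat_embed_eq_zero_one[OF field_K ch]
  have degb: "deg K ?\<beta> = ?r"
  proof (rule antisym)
    show "deg K ?\<beta> \<le> ?r" by (rule U.deg_aboveI) (simp_all add: co re coeff_eq_0 car)
    show "?r \<le> deg K ?\<beta>" by (rule U.deg_belowI) (simp_all add: co re monic car)
  qed
  have lead: "coeff (UP K) ?\<beta> (deg K ?\<beta>) = \<one>\<^bsub>K\<^esub>" unfolding degb co monic by (simp add: re)
  have bnz: "?\<beta> \<noteq> \<zero>\<^bsub>UP K\<^esub>" using lead by (metis K.one_not_zero U.coeff_zero)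
  have mn: "\<sigma> (of_int m) \<noteq> \<zero>\<^bsub>K\<^esub>" by (rule sigma_of_int_nonzero[OF hom field_K ch m])
  have mb: "\<sigma> (of_int m) \<odot>\<^bsub>UP K\<^esub> ?\<beta> = up_map \<sigma> b'"
  proof (rule U.up_eqI)
    fix j
    have "of_int m * pcoeff b j = of_int (z j)" by (rule z)
    from rat_embed_clear(2)[OF hom field_K ch this]
    show "coeff (UP K) (\<sigma> (of_int m) \<odot>\<^bsub>UP K\<^esub> ?\<beta>) j = coeff (UP K) (up_map \<sigma> b') j"
      by (simp add: car sg(1) co coeff_up_map[OF hom] b')
  qed (simp_all add: car sg(1) up_map_carrier[OF hom])
  have zr: "z ?r = m" using z[of ?r] monic by simp
  have zbig: "z j = 0" if "j > ?r" for j using z[of j] that by (simp add: coeff_eq_0)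
  have degb': "Polynomial.degree b' = ?r"
  proof (rule antisym)
    show "Polynomial.degree b' \<le> ?r" by (rule degree_le) (simp add: b' zbig)
    have "(of_int m :: 'r) \<noteq> 0" using mn sg(2) by auto
    then show "?r \<le> Polynomial.degree b'" by (intro le_degree) (simp add: b' zr)
  qed
  have bBI: "?\<beta> \<in> BI \<longleftrightarrow> (\<exists>v. \<sigma> v \<noteq> \<zero>\<^bsub>K\<^esub> \<and> smult v b' \<in> delta.bs_ideal q)"
    by (rule bernstein_ideal_iff[OF car mn mb])
  show ?thesis
  proof
    assume bs: "is_bernstein_sato K n (\<kappa> g) ?\<beta>"
    then have BI: "BI = PIdl\<^bsub>UP K\<^esub> ?\<beta>" by (simp add: is_bernstein_sato_def)
    have "?\<beta> \<in> BI" unfolding BI by (rule U.cgenideal_self[OF car])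
    then have 1: "\<exists>v. v \<notin> q \<and> smult v b' \<in> delta.bs_ideal q" unfolding bBI by simp
    have 2: "pcoeff c k \<in> q" if c: "c \<in> delta.bs_ideal q" "\<forall>k\<ge>?r. pcoeff c k \<in> q" for c k
    proof -
      let ?c = "up_map \<sigma> c"
      have cc: "?c \<in> carrier (UP K)" by (rule up_map_carrier[OF hom])
      have one: "\<sigma> 1 \<noteq> \<zero>\<^bsub>K\<^esub>" by (simp add: sg(3))
      have "\<sigma> 1 \<odot>\<^bsub>UP K\<^esub> ?c = ?c" unfolding up_map_smult[OF hom, symmetric] by simp
      then have "?c \<in> BI" by (rule bernstein_idealI[OF cc one _ one]) (simp add: c(1))
      then obtain d where d: "d \<in> carrier (UP K)" "?c = d \<otimes>\<^bsub>UP K\<^esub> ?\<beta>" unfolding BI cgenideal_def by blast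
      have "?c = \<zero>\<^bsub>UP K\<^esub>"
      proof (rule ccontr)
        assume nz: "?c \<noteq> \<zero>\<^bsub>UP K\<^esub>"
        then have dnz: "d \<noteq> \<zero>\<^bsub>UP K\<^esub>" using d car by auto
        have "deg K ?c = deg K d + ?r" unfolding d(2) using U.deg_mult[OF dnz bnz d(1) car] degb by simp
        then have "\<sigma> (pcoeff c (deg K ?c)) = \<zero>\<^bsub>K\<^esub>" using c(2) by simp
        then show False using U.lcoeff_nonzero[OF nz cc] by (simp add: coeff_up_map[OF hom])
      qed
      then have "coeff (UP K) ?c k = \<zero>\<^bsub>K\<^esub>" by simp
      then show ?thesis by (simp add: coeff_up_map[OF hom])
    qed
    show "delta.bs_generator q b'" unfolding delta.bs_generator_def degb' using 1 2 by blast
  next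
    assume gen: "delta.bs_generator q b'"
    then have bB: "?\<beta> \<in> BI" unfolding bBI delta.bs_generator_def by simp
    have "BI = PIdl\<^bsub>UP K\<^esub> ?\<beta>"
    proof (rule equalityI; rule subsetI)
      fix x assume "x \<in> PIdl\<^bsub>UP K\<^esub> ?\<beta>"
      then obtain d where "d \<in> carrier (UP K)" "x = d \<otimes>\<^bsub>UP K\<^esub> ?\<beta>" unfolding cgenideal_def by blast
      then show "x \<in> BI" using bernstein_ideal_mult[OF bB] by simp
    next
      fix x assume x: "x \<in> BI"
      have xc: "x \<in> carrier (UP K)" using x by (simp add: bernstein_ideal_def)
      \<comment> \<open>Division with remainder by \<open>b\<close>: the remainder is in the ideal and of smaller degree.\<close>
      obtain d r k where dr: "d \<in> carrier (UP K)" "r \<in> carrier (UP K)"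
        "coeff (UP K) ?\<beta> (deg K ?\<beta>) [^]\<^bsub>K\<^esub> (k::nat) \<odot>\<^bsub>UP K\<^esub> x = ?\<beta> \<otimes>\<^bsub>UP K\<^esub> d \<oplus>\<^bsub>UP K\<^esub> r"
        "r = \<zero>\<^bsub>UP K\<^esub> \<or> deg K r < deg K ?\<beta>"
        using U.long_div_theorem[OF car xc bnz] by (elim exE conjE)
      have eq: "x = ?\<beta> \<otimes>\<^bsub>UP K\<^esub> d \<oplus>\<^bsub>UP K\<^esub> r" using dr(3) xc unfolding lead by simp
      have "r = x \<oplus>\<^bsub>UP K\<^esub> (\<ominus>\<^bsub>UP K\<^esub> d) \<otimes>\<^bsub>UP K\<^esub> ?\<beta>"
        unfolding eq using dr(1,2) car by (simp add: U.P.l_minus U.P.m_comm[of d] U.P.a_ac U.P.r_neg2 U.P.r_neg)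
      then have rB: "r \<in> BI" using bernstein_ideal_add[OF x bernstein_ideal_mult[OF bB, of "\<ominus>\<^bsub>UP K\<^esub> d"]] dr(1) by simp
      have "r = \<zero>\<^bsub>UP K\<^esub>"
      proof (rule ccontr)
        assume nz: "r \<noteq> \<zero>\<^bsub>UP K\<^esub>"
        then have small: "deg K r < ?r" using dr(4) degb by simp
        obtain u c v where uc: "\<sigma> u \<noteq> \<zero>\<^bsub>K\<^esub>" "\<sigma> u \<odot>\<^bsub>UP K\<^esub> r = up_map \<sigma> c"
          "\<sigma> v \<noteq> \<zero>\<^bsub>K\<^esub>" "smult v c \<in> delta.bs_ideal q" by (rule bernstein_idealE[OF rB])
        have cj: "\<sigma> (pcoeff c j) = \<sigma> u \<otimes>\<^bsub>K\<^esub> coeff (UP K) r j" for j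
          using arg_cong[OF uc(2), of "\<lambda>p. coeff (UP K) p j"] dr(2) sg(1) by (simp add: coeff_up_map[OF hom])
        have "pcoeff (smult v c) j \<in> q" if "j \<ge> ?r" for j
        proof -
          have "coeff (UP K) r j = \<zero>\<^bsub>K\<^esub>" by (rule U.deg_aboveD[OF _ dr(2)]) (use small that in simp)
          then show ?thesis using sg(1) by (simp add: sg(5) cj)
        qed
        then have all: "\<forall>j. pcoeff (smult v c) j \<in> q"
          using gen uc(4) unfolding delta.bs_generator_def degb' by blast
        have "coeff (UP K) r j = \<zero>\<^bsub>K\<^esub>" for j
        proof -
          have "\<sigma> v \<otimes>\<^bsub>K\<^esub> (\<sigma> u \<otimes>\<^bsub>K\<^esub> coeff (UP K) r j) = \<zero>\<^bsub>K\<^esub>"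
            using all[rule_format, of j] by (simp add: sg(5) cj)
          then show ?thesis using uc(1,3) sg(1) U.coeff_closed[OF dr(2)] by (simp add: K.integral_iff)
        qed
        then have "r = \<zero>\<^bsub>UP K\<^esub>" by (intro U.up_eqI) (simp_all add: dr(2))
        then show False using nz by contradiction
      qed
      then have "x = d \<otimes>\<^bsub>UP K\<^esub> ?\<beta>" using eq dr(1) car by (simp add: U.P.m_comm)
      then show "x \<in> PIdl\<^bsub>UP K\<^esub> ?\<beta>" unfolding cgenideal_def using dr(1) by blast
    qed
    then show "is_bernstein_sato K n (\<kappa> g) ?\<beta>" unfolding is_bernstein_sato_def using car lead by simp
  qed
qed

end

section \<open>The points of the projective space of polynomials\<close>

lemma finite_exponents: "finite (exponents n d)"
proof (induction d)
  case 0
  have "exponents n 0 \<subseteq> {{#}}" by (auto simp: exponents_def)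
  then show ?case by (rule finite_subset) simp
next
  case (Suc d)
  have "exponents n (Suc d) \<subseteq> insert {#} (\<Union>i\<in>{..<n}. add_mset i ` exponents n d)"
  proof
    fix a assume a: "a \<in> exponents n (Suc d)"
    show "a \<in> insert {#} (\<Union>i\<in>{..<n}. add_mset i ` exponents n d)"
    proof (cases a)
      case (add i b)
      then show ?thesis using a by (auto simp: exponents_def)
    qed simp
  qed
  then show ?case by (rule finite_subset) (use Suc in simp)
qed

text \<open>
  The elements of \<open>C\<close> are handled in two ways: as images under \<open>km\<close> of typed polynomials in the
  coordinates, when monomials matter, and as images under \<open>num\<close> of elements of a typed ring, which
  serves as the coefficient ring \<open>R\<close> of the elimination.
\<close>

locale projective_setting =
  fixes k :: "('a, 'm) ring_scheme" and n d :: nat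
  assumes field_k: "field k" and char_k: "char_zero k"
begin

abbreviation "C \<equiv> coeff_ring k n d"
abbreviation "E \<equiv> exponents n d"
abbreviation "km \<equiv> mpoly_map (uproj k) k E"

lemma domain_k: "domain k" and cring_k: "cring k" and ring_k: "ring k"
  using field_k by (auto simp: field_def domain_def cring_def)

lemma cring_C: "cring C" unfolding coeff_ring_def by (rule mpoly_cring[OF cring_k])

lemma uk: "typed_hom (uproj k) k" by (rule uproj_hom[OF cring_k])

lemma km_hom: "typed_hom km C"
  unfolding coeff_ring_def by (rule mpoly_map_hom[OF uk ring_k])

lemmas km = typed_homD[OF km_hom]

lemma km_surj: "p \<in> carrier C \<Longrightarrow> \<exists>f. p = km f \<and> keys f \<subseteq> {m. set_mset m \<subseteq> E}"
  unfolding coeff_ring_def using mpoly_map_surj[OF uk ring_k uproj_surj[OF cring_k]] by metis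

lemma km_zero_iff: "km f = \<zero>\<^bsub>C\<^esub> \<longleftrightarrow> (\<forall>m. set_mset m \<subseteq> E \<longrightarrow> uproj k (lookup f m) = \<zero>\<^bsub>k\<^esub>)"
proof -
  interpret ring k by (rule ring_k)
  show ?thesis by (auto simp: coeff_ring_def mpoly_ring_def indexed_const_def mpoly_map_def fun_eq_iff)
qed

text \<open>
  Nonzero constants are units of \<open>C\<close>.
\<close>

lemma km_const_unit:
  assumes "uproj k c \<noteq> \<zero>\<^bsub>k\<^esub>"
  obtains c' where "km (single 0 c * single 0 c') = \<one>\<^bsub>C\<^esub>"
proof -
  interpret k: field k by (rule field_k)
  note hu = typed_homD[OF uk]
  have un: "uproj k c \<in> Units k" using assms hu(1) by (simp add: k.field_Units)
  obtain c' where c': "uproj k c' = inv\<^bsub>k\<^esub> uproj k c"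
    using uproj_surj[OF cring_k] k.Units_inv_closed[OF un] by (metis imageE subsetD)
  have "uproj k (c * c') = uproj k 1" unfolding hu(5) c' hu(3) using un by simp
  then have "km (single 0 (c * c')) = km 1"
    by (auto simp: mpoly_map_def fun_eq_iff lookup_single lookup_one when_def)
  then show thesis using that[of c'] by (simp add: mult_single km(3))
qed

lemma var_eq: "a \<in> E \<Longrightarrow> ring.indexed_var k a = km (single {#a#} 1)"
  by (rule mpoly_map_var[OF uk ring_k])

lemma vars_carrier: "ring.indexed_var k ` E \<subseteq> carrier C"
  using var_eq km(1) by fastforce

lemma no_constant_term:
  assumes J: "ideal J C" and v: "ring.indexed_var k ` E \<subseteq> J"
    and f: "keys f \<subseteq> {m. set_mset m \<subseteq> E}" "lookup f {#} = 0"
  shows "km f \<in> J"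
proof -
  interpret J: ideal J C by (rule J)
  have "km (\<Sum>m\<in>A. single m (lookup f m)) \<in> J" if "finite A" "A \<subseteq> keys f" for A
    using that
  proof (induction A rule: finite_induct)
    case empty
    show ?case by (simp add: km(2))
  next
    case (insert m A)
    have m: "set_mset m \<subseteq> E" "m \<noteq> {#}" using insert.prems f by (auto simp: in_keys_iff)
    then obtain a m' where am: "m = add_mset a m'" by (cases m) auto
    have a: "a \<in> E" using m am by simp
    have "km (single {#a#} 1) \<in> J" using v a var_eq by auto
    then have "km (single m' (lookup f m)) \<otimes>\<^bsub>C\<^esub> km (single {#a#} 1) \<in> J"
      by (rule J.I_l_closed) (rule km(1))
    then have "km (single m (lookup f m)) \<in> J" unfolding km(5)[symmetric] by (simp add: mult_single am)
    then show ?case using insert by (simp add: km(4) J.a_closed)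
  qed
  from this[of "keys f"] show ?thesis by (simp flip: poly_mapping_sum_single)
qed

text \<open>
  Modulo the coordinates an element of \<open>C\<close> is a constant, and a nonzero constant is a unit.
\<close>

lemma irrelevant_unique:
  assumes P: "ideal P C" and ne: "P \<noteq> carrier C" and v: "ring.indexed_var k ` E \<subseteq> P"
  shows "P = irrelevant_ideal k E"
proof -
  interpret C: cring C by (rule cring_C)
  interpret P: ideal P C by (rule P)
  have irr: "irrelevant_ideal k E = Idl\<^bsub>C\<^esub> (ring.indexed_var k ` E)"
    by (simp add: irrelevant_ideal_def coeff_ring_def)
  have I: "ideal (irrelevant_ideal k E) C" unfolding irr by (rule C.genideal_ideal[OF vars_carrier])
  have vI: "ring.indexed_var k ` E \<subseteq> irrelevant_ideal k E" unfolding irr by (rule C.genideal_self[OF vars_carrier])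
  show ?thesis
  proof (rule equalityI)
    show "irrelevant_ideal k E \<subseteq> P" unfolding irr by (rule C.genideal_minimal[OF P v])
    show "P \<subseteq> irrelevant_ideal k E"
    proof
      fix p assume p: "p \<in> P"
      have pc: "p \<in> carrier C" using p P.a_subset by blast
      obtain f where f: "p = km f" "keys f \<subseteq> {m. set_mset m \<subseteq> E}" using km_surj[OF pc] by (elim exE conjE)
      define c where "c = lookup f {#}"
      let ?f = "f - single 0 c"
      have kf: "keys ?f \<subseteq> {m. set_mset m \<subseteq> E}"
        using f(2) by (auto simp: in_keys_iff lookup_minus lookup_single when_def split: if_splits)
      have z: "lookup ?f {#} = 0" by (simp add: lookup_minus c_def)
      have "km ?f \<in> P" by (rule no_constant_term[OF P v kf z])
      then have "p \<oplus>\<^bsub>C\<^esub> (\<ominus>\<^bsub>C\<^esub> km ?f) \<in> P" by (intro P.a_closed p P.a_inv_closed)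
      also have "p \<oplus>\<^bsub>C\<^esub> (\<ominus>\<^bsub>C\<^esub> km ?f) = km (single 0 c)"
        unfolding f(1) typed_hom_uminus(1)[OF km_hom C.ring_axioms, symmetric] km(4)[symmetric] by simp
      finally have cP: "km (single 0 c) \<in> P" .
      have "uproj k c = \<zero>\<^bsub>k\<^esub>"
      proof (rule ccontr)
        assume "uproj k c \<noteq> \<zero>\<^bsub>k\<^esub>"
        then obtain c' where c': "km (single 0 c * single 0 c') = \<one>\<^bsub>C\<^esub>" by (rule km_const_unit)
        have "km (single 0 c) \<otimes>\<^bsub>C\<^esub> km (single 0 c') \<in> P" by (rule P.I_r_closed[OF cP km(1)])
        then have "\<one>\<^bsub>C\<^esub> \<in> P" unfolding km(5)[symmetric] c' .
        then show False using P.one_imp_carrier ne by simp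
      qed
      then have "km (single 0 c) = \<zero>\<^bsub>C\<^esub>"
        unfolding km_zero_iff using typed_homD(2)[OF uk] by (simp add: lookup_single when_def)
      moreover have "km f = km ?f \<oplus>\<^bsub>C\<^esub> km (single 0 c)" unfolding km(4)[symmetric] by simp
      ultimately have "km f = km ?f" using km(1)[of ?f] by simp
      then show "p \<in> irrelevant_ideal k E"
        unfolding f(1) using no_constant_term[OF I vI kf z] by simp
    qed
  qed
qed

lemma proj_spaceD:
  assumes "P \<in> proj_space k n d"
  shows "primeideal P C" "homogeneous_ideal k E P" "P \<noteq> irrelevant_ideal k E"
  using assms by (simp_all add: proj_space_def)

definition num :: "(nat multiset multiset \<Rightarrow> 'a, unit) uring \<Rightarrow> (nat multiset multiset \<Rightarrow> 'a)" where
  "num = uproj C"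

lemma num_hom: "typed_hom num C" unfolding num_def by (rule uproj_hom[OF cring_C])

lemmas num = typed_homD[OF num_hom]

lemma num_surj: "c \<in> carrier C \<Longrightarrow> \<exists>r. num r = c"
  unfolding num_def by (drule subsetD[OF uproj_surj[OF cring_C]], elim imageE, intro exI, rule sym)

text \<open>
  The homomorphism to the residue field at \<open>P\<close>, on the typed ring that maps onto \<open>C\<close>.
\<close>

definition res :: "(nat multiset multiset \<Rightarrow> 'a) set \<Rightarrow> (nat multiset multiset \<Rightarrow> 'a, unit) uring \<Rightarrow>
    ((nat multiset multiset \<Rightarrow> 'a) set \<times> (nat multiset multiset \<Rightarrow> 'a) set) set" where
  "res P r = residue_map k n d P (num r)"

text \<open>
  The generic polynomial \<open>f\<close>, with its coefficients lifted to the typed ring.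
\<close>

definition generic_lift :: "(nat multiset multiset \<Rightarrow> 'a, unit) uring mpoly" where
  "generic_lift = (\<Sum>a\<in>E. single a (SOME r. num r = generic_poly k n d a))"

lemma generic_closed: "generic_poly k n d a \<in> carrier C"
  using cring.cring_simprules(2)[OF cring_C] var_eq[of a] km(1) by (simp add: generic_poly_def)

lemma num_generic_lift: "num (lookup generic_lift a) = generic_poly k n d a"
proof -
  have l: "lookup generic_lift a = (if a \<in> E then SOME r. num r = generic_poly k n d a else 0)"
  proof -
    have "lookup generic_lift a = (\<Sum>b\<in>E. if b = a then SOME r. num r = generic_poly k n d b else 0)"
      by (simp add: generic_lift_def lookup_sum lookup_single when_def)
    also have "\<dots> = (if a \<in> E then SOME r. num r = generic_poly k n d a else 0)"
      by (rule sum.delta[OF finite_exponents])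
    finally show ?thesis .
  qed
  show ?thesis
  proof (cases "a \<in> E")
    case True
    have "num (SOME r. num r = generic_poly k n d a) = generic_poly k n d a"
      by (rule someI_ex[OF num_surj[OF generic_closed]])
    then show ?thesis using True l by simp
  next
    case False
    then show ?thesis by (simp add: l num(2) generic_poly_def)
  qed
qed

lemma keys_generic_lift: "keys generic_lift \<subseteq> {a. set_mset a \<subseteq> {..<n}}"
proof
  fix a assume "a \<in> keys generic_lift"
  then have "a \<in> E"
    unfolding in_keys_iff generic_lift_def lookup_sum lookup_single when_def
    by (rule contrapos_np) (rule sum.neutral, auto)
  then show "a \<in> {a. set_mset a \<subseteq> {..<n}}" by (simp add: exponents_def)
qed

context
  fixes P assumes P: "P \<in> proj_space k n d"
begin

lemma prime_P: "primeideal P C" using proj_spaceD(1)[OF P] .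

lemma ideal_P: "ideal P C" using prime_P by (rule primeideal.axioms)

lemma one_notin: "\<one>\<^bsub>C\<^esub> \<notin> P"
  using ideal.one_imp_carrier[OF ideal_P] primeideal.I_notcarr[OF prime_P] by blast

abbreviation "Q \<equiv> C Quot P"
abbreviation "K \<equiv> residue_field k n d P"

lemma domain_Q: "domain Q" by (rule primeideal.quotient_is_domain[OF prime_P])

lemma coset_hom: "typed_hom (\<lambda>r. P +>\<^bsub>C\<^esub> num r) Q"
proof -
  have h: "(+>\<^bsub>C\<^esub>) P \<in> ring_hom C Q" by (rule ideal.rcos_ring_hom[OF ideal_P])
  interpret C: cring C by (rule cring_C)
  interpret Q: domain Q by (rule domain_Q)
  interpret hm: ring_hom_ring C Q "(+>\<^bsub>C\<^esub>) P" by (rule ideal.rcos_ring_hom_ring[OF ideal_P])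
  show ?thesis
    unfolding typed_hom_def
    using hm.hom_closed hm.hom_add hm.hom_mult hm.hom_zero hm.hom_one num
    by (auto simp: image_subset_iff)
qed

lemma coset_zero_iff: "c \<in> carrier C \<Longrightarrow> P +>\<^bsub>C\<^esub> c = \<zero>\<^bsub>Q\<^esub> \<longleftrightarrow> c \<in> P"
proof -
  assume c: "c \<in> carrier C"
  interpret C: cring C by (rule cring_C)
  interpret P: ideal P C by (rule ideal_P)
  have z: "\<zero>\<^bsub>Q\<^esub> = P" by (simp add: FactRing_def)
  show ?thesis unfolding z
  proof
    assume "P +>\<^bsub>C\<^esub> c = P"
    then show "c \<in> P" using P.a_rcos_self[OF c] by simp
  next
    assume "c \<in> P"
    then show "P +>\<^bsub>C\<^esub> c = P" by (rule P.a_rcos_const)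
  qed
qed

lemma Q_loc: "domain_localization Q (carrier Q - {\<zero>\<^bsub>Q\<^esub>})"
proof -
  interpret Q: domain Q by (rule domain_Q)
  show ?thesis by unfold_locales (auto simp: Q.integral_iff)
qed

lemma K_eq: "K = localization Q (carrier Q - {\<zero>\<^bsub>Q\<^esub>})"
  by (simp add: residue_field_def fraction_field_def)

lemma res_eq: "res P r = fraction Q (carrier Q - {\<zero>\<^bsub>Q\<^esub>}) (P +>\<^bsub>C\<^esub> num r) \<one>\<^bsub>Q\<^esub>"
  by (simp add: res_def residue_map_def Let_def)

lemma res_hom: "typed_hom (res P) K"
  unfolding K_eq res_eq[abs_def] by (rule domain_localization.fr_one_hom[OF Q_loc coset_hom])

lemma res_zero_iff: "res P r = \<zero>\<^bsub>K\<^esub> \<longleftrightarrow> num r \<in> P"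
proof -
  interpret L: domain_localization Q "carrier Q - {\<zero>\<^bsub>Q\<^esub>}" by (rule Q_loc)
  have "res P r = \<zero>\<^bsub>K\<^esub> \<longleftrightarrow> P +>\<^bsub>C\<^esub> num r = \<zero>\<^bsub>Q\<^esub>"
    unfolding K_eq res_eq by (rule L.fr_zero_iff[OF typed_homD(1)[OF coset_hom] L.one_S])
  then show ?thesis using coset_zero_iff[OF num(1)] by simp
qed

lemma res_field: "field K"
proof -
  interpret L: domain_localization Q "carrier Q - {\<zero>\<^bsub>Q\<^esub>}" by (rule Q_loc)
  interpret K: cring K unfolding K_eq by (rule L.Loc_cring)
  have 1: "\<one>\<^bsub>K\<^esub> \<noteq> \<zero>\<^bsub>K\<^esub>"
    unfolding typed_homD(3)[OF res_hom, symmetric] res_zero_iff num(3) by (rule one_notin)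
  have inv: "\<exists>y\<in>carrier K. y \<otimes>\<^bsub>K\<^esub> x = \<one>\<^bsub>K\<^esub>" if xK: "x \<in> carrier K" and nz: "x \<noteq> \<zero>\<^bsub>K\<^esub>" for x
  proof -
    obtain a b where ab: "a \<in> carrier Q" "b \<in> carrier Q - {\<zero>\<^bsub>Q\<^esub>}" "x = L.fr a b"
      using xK unfolding K_eq L.Loc_carrier by (elim exE conjE)
    have a: "a \<in> carrier Q - {\<zero>\<^bsub>Q\<^esub>}" using nz ab L.fr_zero_iff[OF ab(1,2)] unfolding K_eq by simp
    have "L.fr b a \<otimes>\<^bsub>K\<^esub> x = L.fr (b \<otimes>\<^bsub>Q\<^esub> a) (a \<otimes>\<^bsub>Q\<^esub> b)"
      unfolding K_eq ab(3) using ab(1,2) a by (intro L.fr_mult) simp_all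
    also have "\<dots> = \<one>\<^bsub>K\<^esub>"
      unfolding K_eq L.one_Loc
      by (subst L.fr_eq) (use ab a L.mult_S[OF a ab(2)] L.one_S in \<open>auto simp: L.m_comm\<close>)
    finally have e: "L.fr b a \<otimes>\<^bsub>K\<^esub> x = \<one>\<^bsub>K\<^esub>" .
    have "L.fr b a \<in> carrier K" unfolding K_eq by (rule L.fr_closed) (use ab(2) a in simp_all)
    with e show ?thesis by (rule rev_bexI[rotated])
  qed
  show ?thesis
  proof (rule K.cring_fieldI, rule equalityI)
    show "Units K \<subseteq> carrier K - {\<zero>\<^bsub>K\<^esub>}"
    proof
      fix x assume x: "x \<in> Units K"
      have "x \<noteq> \<zero>\<^bsub>K\<^esub>"
      proof
        assume "x = \<zero>\<^bsub>K\<^esub>"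
        then have "\<one>\<^bsub>K\<^esub> = \<zero>\<^bsub>K\<^esub>"
          using K.Units_l_inv[OF x] K.r_null[OF K.Units_inv_closed[OF x]] by simp
        then show False using 1 by contradiction
      qed
      then show "x \<in> carrier K - {\<zero>\<^bsub>K\<^esub>}" using K.Units_closed[OF x] by simp
    qed
    show "carrier K - {\<zero>\<^bsub>K\<^esub>} \<subseteq> Units K"
    proof
      fix x assume "x \<in> carrier K - {\<zero>\<^bsub>K\<^esub>}"
      then have x: "x \<in> carrier K" "x \<noteq> \<zero>\<^bsub>K\<^esub>" by simp_all
      obtain y where y: "y \<in> carrier K" "y \<otimes>\<^bsub>K\<^esub> x = \<one>\<^bsub>K\<^esub>" using inv[OF x] by (elim bexE)
      have yx: "x \<otimes>\<^bsub>K\<^esub> y = \<one>\<^bsub>K\<^esub>" unfolding K.m_comm[OF x(1) y(1)] by (rule y(2))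
      show "x \<in> Units K" unfolding Units_def
        by (intro CollectI conjI x(1) bexI[of _ y] y yx)
    qed
  qed
qed

lemma res_fractions:
  assumes x: "x \<in> carrier K"
  shows "\<exists>u v. res P v \<noteq> \<zero>\<^bsub>K\<^esub> \<and> x \<otimes>\<^bsub>K\<^esub> res P v = res P u"
proof -
  interpret L: domain_localization Q "carrier Q - {\<zero>\<^bsub>Q\<^esub>}" by (rule Q_loc)
  obtain a b where ab: "a \<in> carrier Q" "b \<in> carrier Q - {\<zero>\<^bsub>Q\<^esub>}" "x = L.fr a b"
    using x unfolding K_eq L.Loc_carrier by (elim exE conjE)
  have lift: "\<exists>r. c = P +>\<^bsub>C\<^esub> num r" if "c \<in> carrier Q" for c
  proof -
    have "c \<in> (\<Union>x\<in>carrier C. {P +>\<^bsub>C\<^esub> x})" using that by (simp add: FactRing_def A_RCOSETS_def')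
    then show ?thesis using num_surj by fastforce
  qed
  obtain u where u: "a = P +>\<^bsub>C\<^esub> num u" using lift[OF ab(1)] by (elim exE)
  obtain v where v: "b = P +>\<^bsub>C\<^esub> num v" using lift[of b] ab(2) by auto
  have "res P v \<noteq> \<zero>\<^bsub>K\<^esub>" using ab(2) coset_zero_iff[OF num(1)] unfolding res_zero_iff v by simp
  moreover have "x \<otimes>\<^bsub>K\<^esub> res P v = res P u"
  proof -
    have "x \<otimes>\<^bsub>K\<^esub> res P v = L.fr (a \<otimes>\<^bsub>Q\<^esub> b) (b \<otimes>\<^bsub>Q\<^esub> \<one>\<^bsub>Q\<^esub>)"
      unfolding K_eq ab(3) res_eq v[symmetric] by (rule L.fr_mult) (use ab L.one_S in auto)
    also have "\<dots> = L.fr a \<one>\<^bsub>Q\<^esub>"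
      by (subst L.fr_eq) (use ab L.one_S L.mult_S in auto)
    finally show ?thesis unfolding res_eq u .
  qed
  ultimately show ?thesis by blast
qed

lemma res_char: "char_zero K"
  unfolding char_zero_def
proof (intro allI impI)
  fix m :: nat assume m: "m > 0"
  interpret K: field K by (rule res_field)
  interpret P: ideal P C by (rule ideal_P)
  have "uproj k (of_nat m) \<noteq> \<zero>\<^bsub>k\<^esub>"
    unfolding typed_hom_of_nat(1)[OF uk ring_k] using char_k m by (simp add: char_zero_def)
  then obtain c' where c': "km (single 0 (of_nat m) * single 0 c') = \<one>\<^bsub>C\<^esub>" by (rule km_const_unit)
  have "num (of_nat m) = [m] \<cdot>\<^bsub>C\<^esub> \<one>\<^bsub>C\<^esub>" by (rule typed_hom_of_nat(1)[OF num_hom cring.axioms(1)[OF cring_C]])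
  also have "\<dots> = km (of_nat m)" by (rule typed_hom_of_nat(1)[OF km_hom cring.axioms(1)[OF cring_C], symmetric])
  also have "(of_nat m :: (nat multiset multiset \<Rightarrow>\<^sub>0 ('a, 'm) uring)) = single 0 (of_nat m)" by (rule single_of_nat[symmetric])
  finally have e: "num (of_nat m) = km (single 0 (of_nat m))" .
  have "num (of_nat m) \<notin> P"
  proof
    assume "num (of_nat m) \<in> P"
    then have "km (single 0 (of_nat m)) \<otimes>\<^bsub>C\<^esub> km (single 0 c') \<in> P" unfolding e by (rule P.I_r_closed[OF _ km(1)])
    then show False using one_notin unfolding km(5)[symmetric] c' by contradiction
  qed
  then show "[m] \<cdot>\<^bsub>K\<^esub> \<one>\<^bsub>K\<^esub> \<noteq> \<zero>\<^bsub>K\<^esub>"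
    unfolding typed_hom_of_nat(1)[OF res_hom K.ring_axioms, symmetric] res_zero_iff .
qed

lemma generic_lift_map:
  "mpoly_map (res P) K {..<n} generic_lift = (\<lambda>a. residue_map k n d P (generic_poly k n d a))"
proof
  fix a
  show "mpoly_map (res P) K {..<n} generic_lift a = residue_map k n d P (generic_poly k n d a)"
  proof (cases "set_mset a \<subseteq> {..<n}")
    case True
    then show ?thesis by (simp add: mpoly_map_def res_def num_generic_lift)
  next
    case False
    then have "generic_poly k n d a = num 0" by (auto simp: generic_poly_def exponents_def num(2))
    then have "residue_map k n d P (generic_poly k n d a) = res P 0" by (simp add: res_def)
    then show ?thesis using False by (simp add: mpoly_map_def typed_homD(2)[OF res_hom])
  qed
qed

text \<open>
  At a point some coordinate is nonzero, as otherwise the point would be the irrelevant ideal.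
\<close>

lemma generic_lift_nonzero: "mpoly_map (res P) K {..<n} generic_lift \<noteq> \<zero>\<^bsub>poly_ring K n\<^esub>"
proof
  assume z: "mpoly_map (res P) K {..<n} generic_lift = \<zero>\<^bsub>poly_ring K n\<^esub>"
  interpret K: field K by (rule res_field)
  have "ring.indexed_var k ` E \<subseteq> P"
  proof (rule image_subsetI)
    fix a assume a: "a \<in> E"
    then have "res P (lookup generic_lift a) = mpoly_map (res P) K {..<n} generic_lift a"
      by (simp add: mpoly_map_def exponents_def)
    also have "\<dots> = \<zero>\<^bsub>K\<^esub>" unfolding z by (simp add: mpoly_ring_def K.indexed_const_def)
    finally have "generic_poly k n d a \<in> P" unfolding res_zero_iff num_generic_lift .
    then show "ring.indexed_var k a \<in> P" using a by (simp add: generic_poly_def)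
  qed
  then have "P = irrelevant_ideal k E"
    by (rule irrelevant_unique[OF ideal_P primeideal.I_notcarr[OF prime_P, symmetric]])
  then show False using proj_spaceD(3)[OF P] by contradiction
qed

text \<open>
  This makes the comparison with the module of the delta function available at every point. The
  polynomial \<open>generic_lift\<close> is the same at all of them, and only the map \<open>res P\<close> to the residue field
  varies.
\<close>

lemma point_setting: "gs_fractions K n (res P) generic_lift"
  by (intro gs_fractions.intro gs_setting.intro gs_fractions_axioms.intro res_field res_hom
      generic_lift_nonzero res_fractions)

end

section \<open>The strata are constructible\<close>

abbreviation "S b \<equiv> bernstein_sato_stratum k n d b"

text \<open>
  At each point \<open>Y\<close> the stratum is described by \<open>bs_generator\<close> at the prime ideal \<open>q Y\<close> of the
  elements that vanish at \<open>Y\<close>, with \<open>g\<close> and \<open>b'\<close> independent of \<open>Y\<close>. Here \<open>b'\<close> is \<open>b\<close> multiplied by a common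
  denominator \<open>m\<close> of its coefficients. Its leading coefficient \<open>m\<close> vanishes at no point, because all
  residue fields have characteristic \<open>0\<close>.
\<close>

lemma stratum_generically_constant:
  assumes P: "P \<in> proj_space k n d" and monic: "lead_coeff (b :: rat poly) = 1"
  shows "\<exists>h\<in>carrier C. h \<notin> P \<and> (\<forall>Q\<in>proj_space k n d. P \<subseteq> Q \<longrightarrow> h \<notin> Q \<longrightarrow> (Q \<in> S b \<longleftrightarrow> P \<in> S b))"
proof -
  obtain m z where m: "m \<noteq> 0" and z: "\<forall>j. of_int m * pcoeff b j = of_int (z j)"
    using rat_poly_common_denominator[of b] by (elim exE conjE)
  note z = z[rule_format]
  define b' :: "(nat multiset multiset \<Rightarrow> 'a, unit) uring poly"
    where "b' = (\<Sum>j\<le>Polynomial.degree b. Polynomial.monom (of_int (z j)) j)"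
  have z0: "z j = 0" if "j > Polynomial.degree b" for j
    using z[of j] coeff_eq_0[OF that] by simp
  have zd: "z (Polynomial.degree b) = m" using z[of "Polynomial.degree b"] monic by simp
  have b': "pcoeff b' j = of_int (z j)" for j
    by (cases "j \<le> Polynomial.degree b") (simp_all add: b'_def coeff_sum z0)
  define q where "q Y = {r. res Y r = \<zero>\<^bsub>residue_field k n d Y\<^esub>}" for Y
  have q: "q Y = {r. num r \<in> Y}" if "Y \<in> proj_space k n d" for Y
    using res_zero_iff[OF that] by (simp add: q_def)
  have prime: "prime_ideal_set (q Y)" if "Y \<in> proj_space k n d" for Y
    unfolding q_def by (rule typed_hom_kernel_prime[OF res_hom[OF that] field.axioms(1)[OF res_field[OF that]]])
  have mq: "of_int m \<notin> q Y" if "Y \<in> proj_space k n d" for Y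
    unfolding q_def using sigma_of_int_nonzero[OF res_hom[OF that] res_field[OF that] res_char[OF that] m] by simp
  have "pcoeff b' (Polynomial.degree b) \<noteq> 0"
    using mq[OF P] prime_ideal_setD(1)[OF prime[OF P]] unfolding b' zd by metis
  then have "Polynomial.degree b \<le> Polynomial.degree b'" by (rule le_degree)
  moreover have "Polynomial.degree b' \<le> Polynomial.degree b"
    by (rule degree_le) (simp add: b' z0)
  ultimately have deg: "Polynomial.degree b' = Polynomial.degree b" by (rule antisym[rotated])
  have lead: "lead_coeff b' = of_int m" unfolding deg b' zd ..
  have stratum: "Y \<in> S b \<longleftrightarrow> delta_module.bs_generator n generic_lift (q Y) b'" if Y: "Y \<in> proj_space k n d" for Y
  proof -
    interpret Y: gs_fractions "residue_field k n d Y" n "res Y" generic_lift by (rule point_setting[OF Y])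
    have "Y \<in> S b \<longleftrightarrow> is_bernstein_sato (residue_field k n d Y) n
        (mpoly_map (res Y) (residue_field k n d Y) {..<n} generic_lift) (rat_poly_embed (residue_field k n d Y) b)"
      unfolding bernstein_sato_stratum_def generic_lift_map[OF Y] using Y by simp
    also have "\<dots> \<longleftrightarrow> delta_module.bs_generator n generic_lift (q Y) b'"
      unfolding q_def by (rule Y.is_bernstein_sato_iff[OF res_char[OF Y] monic m z b'])
    finally show ?thesis .
  qed
  obtain h where h: "h \<notin> q P" "\<forall>q'. prime_ideal_set q' \<longrightarrow> q P \<subseteq> q' \<longrightarrow> h \<notin> q' \<longrightarrow> lead_coeff b' \<notin> q' \<longrightarrow>
     (delta_module.bs_generator n generic_lift q' b' \<longleftrightarrow> delta_module.bs_generator n generic_lift (q P) b')"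
    using delta_module.bs_generator_generically_constant[OF prime[OF P] keys_generic_lift, of b'] by (elim exE conjE)
  show ?thesis
  proof (intro bexI[of _ "num h"] conjI ballI impI)
    show "num h \<in> carrier C" by (rule num(1))
    show "num h \<notin> P" using h(1) unfolding q[OF P] by simp
    fix Q assume Q: "Q \<in> proj_space k n d" "P \<subseteq> Q" "num h \<notin> Q"
    show "Q \<in> S b \<longleftrightarrow> P \<in> S b"
      unfolding stratum[OF Q(1)] stratum[OF P]
    proof (rule h(2)[rule_format])
      show "prime_ideal_set (q Q)" by (rule prime[OF Q(1)])
      show "q P \<subseteq> q Q" unfolding q[OF Q(1)] q[OF P] using Q(2) by (rule Collect_mono[OF impI, OF subsetD])
      show "h \<notin> q Q" using Q(3) unfolding q[OF Q(1)] by simp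
      show "lead_coeff b' \<notin> q Q" unfolding lead by (rule mq[OF Q(1)])
    qed
  qed
qed

lemma stratum_monic:
  assumes "P \<in> S b" shows "lead_coeff b = 1"
proof -
  have P: "P \<in> proj_space k n d" and bs: "is_bernstein_sato (residue_field k n d P) n
      (\<lambda>\<alpha>. residue_map k n d P (generic_poly k n d \<alpha>)) (rat_poly_embed (residue_field k n d P) b)"
    using assms by (simp_all add: bernstein_sato_stratum_def)
  show ?thesis by (rule bernstein_sato_monic[OF res_field[OF P] res_char[OF P] bs])
qed

end

subsection \<open>Homogeneous components\<close>

lift_definition component :: "nat \<Rightarrow> ('v multiset \<Rightarrow>\<^sub>0 'r::zero) \<Rightarrow> ('v multiset \<Rightarrow>\<^sub>0 'r)"
  is "\<lambda>e f m. if size m = e then f m else 0"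
  subgoal for e f by (rule finite_subset[of _ "{m. f m \<noteq> 0}"]) auto
  done

lemma component_zero_above: "e > (\<Sum>m\<in>keys f. size m) \<Longrightarrow> component e f = 0"
proof (rule poly_mapping_eqI)
  fix m assume e: "e > (\<Sum>m\<in>keys f. size m)"
  have "size m \<le> (\<Sum>m\<in>keys f. size m)" if "m \<in> keys f" by (rule member_le_sum[OF that]) auto
  then show "lookup (component e f) m = lookup 0 m" using e
    by (cases "m \<in> keys f") (auto simp: component.rep_eq in_keys_iff)
qed

lemma sum_components: "(\<Sum>e\<le>(\<Sum>m\<in>keys f. size m). component e f) = f"
proof (rule poly_mapping_eqI)
  fix m
  have "size m \<le> (\<Sum>m\<in>keys f. size m)" if "m \<in> keys f" by (rule member_le_sum[OF that]) auto
  then show "lookup (\<Sum>e\<le>(\<Sum>m\<in>keys f. size m). component e f) m = lookup f m"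
    by (cases "m \<in> keys f") (auto simp: lookup_sum component.rep_eq in_keys_iff)
qed

lemma component_add: "component e (f + g) = component e f + component e g"
  for f g :: "'v multiset \<Rightarrow>\<^sub>0 'r::comm_ring_1"
  by (rule poly_mapping_eqI) (simp add: component.rep_eq lookup_add)

lemma component_component: "component i (component j f) = (if i = j then component j f else 0)"
  by (rule poly_mapping_eqI) (simp add: component.rep_eq)

lemma component_mult:
  fixes f g :: "'v multiset \<Rightarrow>\<^sub>0 'r::comm_ring_1"
  shows "component e (f * g) = (\<Sum>i\<le>e. component i f * component (e - i) g)"
proof (rule poly_mapping_eqI)
  fix m :: "'v multiset"
  let ?A = "{u. u \<subseteq># m}"
  have "lookup (\<Sum>i\<le>e. component i f * component (e - i) g) m =
      (\<Sum>i\<le>e. \<Sum>u\<in>?A. lookup (component i f) u * lookup (component (e - i) g) (m - u))"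
    by (simp add: lookup_sum lookup_mult_multiset)
  also have "\<dots> = (\<Sum>u\<in>?A. \<Sum>i\<le>e. lookup (component i f) u * lookup (component (e - i) g) (m - u))"
    by (rule sum.swap)
  also have "\<dots> = (\<Sum>u\<in>?A. if size m = e then lookup f u * lookup g (m - u) else 0)"
  proof (rule sum.cong[OF refl])
    fix u assume "u \<in> ?A"
    then have u: "u \<subseteq># m" by simp
    have le: "size u \<le> size m" using u by (rule size_mset_mono)
    have "(\<Sum>i\<le>e. lookup (component i f) u * lookup (component (e - i) g) (m - u)) =
        (\<Sum>i\<le>e. if i = size u then lookup f u * (if size m - size u = e - size u then lookup g (m - u) else 0) else 0)"
      by (intro sum.cong) (auto simp: component.rep_eq size_Diff_submset[OF u])
    also have "\<dots> = (if size m = e then lookup f u * lookup g (m - u) else 0)"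
      using le by (simp add: sum.delta) (auto simp: not_le)
    finally show "(\<Sum>i\<le>e. lookup (component i f) u * lookup (component (e - i) g) (m - u)) =
        (if size m = e then lookup f u * lookup g (m - u) else 0)" .
  qed
  also have "\<dots> = lookup (component e (f * g)) m"
    by (simp add: component.rep_eq lookup_mult_multiset)
  finally show "lookup (component e (f * g)) m = lookup (\<Sum>i\<le>e. component i f * component (e - i) g) m" ..
qed

context projective_setting
begin

lemma homogeneous_part_km: "homogeneous_part k e (km f) = km (component e f)"
  using typed_homD(2)[OF uk] by (auto simp: homogeneous_part_def mpoly_map_def component.rep_eq fun_eq_iff)

lemma km_lift:
  assumes "c \<in> carrier C"
  obtains f where "c = km f"
  using km_surj[OF assms] by (elim exE conjE)

lemma ideal_sum: 
  assumes J: "ideal J C" and f: "\<And>i. i \<in> A \<Longrightarrow> km (f i) \<in> J"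
  shows "km (\<Sum>i\<in>A. f i) \<in> J"
proof -
  interpret J: ideal J C by (rule J)
  show ?thesis
    using f by (induction A rule: infinite_finite_induct) (simp_all add: km(2,4) J.a_closed)
qed

lemma ideal_mult:
  assumes J: "ideal J C" and f: "km f \<in> J"
  shows "km (f * g) \<in> J" "km (g * f) \<in> J"
  unfolding km(5) by (rule ideal.I_r_closed[OF J f km(1)], rule ideal.I_l_closed[OF J f km(1)])

lemma ideal_diff:
  assumes J: "ideal J C" and f: "km f \<in> J" "km g \<in> J"
  shows "km (f - g) \<in> J"
proof -
  have "km (f + (- 1) * g) \<in> J"
    unfolding km(4) by (rule additive_subgroup.a_closed[OF ideal.axioms(1)[OF J] f(1) ideal_mult(2)[OF J f(2)]])
  then show ?thesis by simp
qed

abbreviation "homogeneous \<equiv> homogeneous_ideal k E"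

lemma homogeneousD:
  assumes "homogeneous J"
  shows "ideal J C" "km f \<in> J \<Longrightarrow> km (component e f) \<in> J"
proof -
  note h = assms[unfolded homogeneous_ideal_def, folded coeff_ring_def]
  show "ideal J C" using h by (rule conjunct1)
  show "km (component e f) \<in> J" if "km f \<in> J"
    unfolding homogeneous_part_km[symmetric] using conjunct2[OF h] that by blast
qed

lemma homogeneousI:
  assumes J: "ideal J C" and h: "\<And>f e. km f \<in> J \<Longrightarrow> km (component e f) \<in> J"
  shows "homogeneous J"
  unfolding homogeneous_ideal_def coeff_ring_def[symmetric]
proof (intro conjI J ballI allI)
  fix p e assume p: "p \<in> J"
  have "p \<in> carrier C" by (rule subsetD[OF additive_subgroup.a_subset[OF ideal.axioms(1)[OF J]] p])
  then obtain f where f: "p = km f" by (rule km_lift)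
  show "homogeneous_part k e p \<in> J"
    unfolding f homogeneous_part_km by (rule h) (use p f in simp)
qed

text \<open>
  The highest homogeneous component outside \<open>J\<close> is singled out, for use in products.
\<close>

lemma component_notin:
  assumes J: "ideal J C" and f: "km f \<notin> J"
  shows "\<exists>i. km (component i f) \<notin> J \<and> (\<forall>j>i. km (component j f) \<in> J)"
proof -
  interpret J: ideal J C by (rule J)
  define A where "A = {i. km (component i f) \<notin> J}"
  have "i \<le> (\<Sum>m\<in>keys f. size m)" if "i \<in> A" for i
  proof (rule ccontr)
    assume "\<not> ?thesis"
    then have "component i f = 0" by (intro component_zero_above) simp
    then show False using that J.zero_closed by (simp add: A_def km(2))
  qed
  then have fin: "finite A" by (intro finite_subset[of A "{..(\<Sum>m\<in>keys f. size m)}"]) auto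
  have "A \<noteq> {}"
  proof
    assume "A = {}"
    then have c: "km (component i f) \<in> J" for i unfolding A_def by blast
    have "km (\<Sum>i\<le>(\<Sum>m\<in>keys f. size m). component i f) \<in> J" by (rule ideal_sum[OF J c])
    then show False using f unfolding sum_components by contradiction
  qed
  then have in_A: "Max A \<in> A" by (rule Max_in[OF fin])
  have above: "km (component j f) \<in> J" if "j > Max A" for j
  proof (rule ccontr)
    assume "km (component j f) \<notin> J"
    then have "j \<in> A" unfolding A_def by (rule CollectI)
    from Max_ge[OF fin this] that show False by simp
  qed
  show ?thesis
    by (intro exI[of _ "Max A"] conjI allI impI above) (use in_A in \<open>simp_all only: A_def mem_Collect_eq not_False_eq_True\<close>)
qed

text \<open>
  For a homogeneous ideal it suffices to test primality on homogeneous elements. Let \<open>i\<close> and \<open>j\<close> be the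
  degrees of the highest components of two factors outside \<open>J\<close>. Then all summands of the
  component of degree \<open>i + j\<close> of the product are in \<open>J\<close> except one.
\<close>

lemma homogeneous_primeideal:
  assumes J: "homogeneous J" and ne: "J \<noteq> carrier C"
    and pr: "\<And>f g i j. km (component i f * component j g) \<in> J \<Longrightarrow>
      km (component i f) \<in> J \<or> km (component j g) \<in> J"
  shows "primeideal J C"
proof (rule primeidealI[OF homogeneousD(1)[OF J] cring_C ne[symmetric]])
  note id = homogeneousD(1)[OF J]
  have *: "km f \<in> J \<or> km g \<in> J" if fg: "km (f * g) \<in> J" for f g
  proof (rule ccontr)
    assume "\<not> ?thesis"
    then have nf: "km f \<notin> J" and ng: "km g \<notin> J" by simp_all
    obtain i where i: "km (component i f) \<notin> J" "\<forall>j>i. km (component j f) \<in> J"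
      using component_notin[OF id nf] by (elim exE conjE)
    obtain j where j: "km (component j g) \<notin> J" "\<forall>i>j. km (component i g) \<in> J"
      using component_notin[OF id ng] by (elim exE conjE)
    let ?rest = "\<Sum>l\<in>{..i + j} - {i}. component l f * component (i + j - l) g"
    have "component (i + j) (f * g) = component i f * component j g + ?rest"
      unfolding component_mult by (subst sum.remove[of _ i]) simp_all
    then have e: "component i f * component j g = component (i + j) (f * g) - ?rest" by simp
    have "km ?rest \<in> J"
    proof (rule ideal_sum[OF id])
      fix l assume "l \<in> {..i + j} - {i}"
      then have "l > i \<or> i + j - l > j" by auto
      then show "km (component l f * component (i + j - l) g) \<in> J"
        using i(2) j(2) ideal_mult[OF id] by metis
    qed
    then have "km (component i f * component j g) \<in> J"
      unfolding e by (rule ideal_diff[OF id homogeneousD(2)[OF J fg]])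
    from pr[OF this] show False using i(1) j(1) by simp
  qed
  fix a b assume ab: "a \<in> carrier C" "b \<in> carrier C" "a \<otimes>\<^bsub>C\<^esub> b \<in> J"
  obtain f where f: "a = km f" using ab(1) by (rule km_lift)
  obtain g where g: "b = km g" using ab(2) by (rule km_lift)
  show "a \<in> J \<or> b \<in> J" using *[of f g] ab(3) unfolding f g km(5) by blast
qed

definition adjoin :: "(nat multiset multiset \<Rightarrow> 'a) set \<Rightarrow> (nat multiset multiset \<Rightarrow> 'a) \<Rightarrow> (nat multiset multiset \<Rightarrow> 'a) set" where
  "adjoin J a = J <+>\<^bsub>C\<^esub> PIdl\<^bsub>C\<^esub> a"

lemma mem_adjoin:
  assumes J: "ideal J C"
  shows "x \<in> adjoin J (km a) \<longleftrightarrow> (\<exists>f c. x = km (f + c * a) \<and> km f \<in> J)"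
proof
  assume "x \<in> adjoin J (km a)"
  then obtain y z where yz: "y \<in> J" "z \<in> PIdl\<^bsub>C\<^esub> (km a)" "x = y \<oplus>\<^bsub>C\<^esub> z"
    unfolding adjoin_def set_add_def' by (elim UN_E singletonE)
  obtain c' where c': "c' \<in> carrier C" "z = c' \<otimes>\<^bsub>C\<^esub> km a" using yz(2) unfolding cgenideal_def by (elim CollectE exE conjE)
  obtain c where c: "c' = km c" using c'(1) by (rule km_lift)
  have "y \<in> carrier C" by (rule subsetD[OF additive_subgroup.a_subset[OF ideal.axioms(1)[OF J]] yz(1)])
  then obtain f where f: "y = km f" by (rule km_lift)
  show "\<exists>f c. x = km (f + c * a) \<and> km f \<in> J"
    using yz(1,3) by (intro exI[of _ f] exI[of _ c]) (simp add: km(4,5) c' c f)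
next
  assume "\<exists>f c. x = km (f + c * a) \<and> km f \<in> J"
  then obtain f c where f: "x = km f \<oplus>\<^bsub>C\<^esub> (km c \<otimes>\<^bsub>C\<^esub> km a)" "km f \<in> J" unfolding km(4,5) by (elim exE conjE)
  have ca: "km c \<otimes>\<^bsub>C\<^esub> km a \<in> PIdl\<^bsub>C\<^esub> (km a)" unfolding cgenideal_def by (rule CollectI, rule exI[of _ "km c"], rule conjI[OF refl km(1)])
  show "x \<in> adjoin J (km a)"
    unfolding adjoin_def set_add_def' f(1) by (rule UN_I[OF f(2) UN_I[OF ca singletonI]])
qed

lemma adjoin_ideal: "ideal J C \<Longrightarrow> ideal (adjoin J (km a)) C"
  unfolding adjoin_def
  by (rule ring.add_ideals[OF cring.axioms(1)[OF cring_C] _ cring.cgenideal_ideal[OF cring_C km(1)]])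

lemma adjoin_homogeneous:
  assumes J: "homogeneous J"
  shows "homogeneous (adjoin J (km (component i a)))"
proof (rule homogeneousI[OF adjoin_ideal[OF homogeneousD(1)[OF J]]])
  note id = homogeneousD(1)[OF J]
  fix f e assume "km f \<in> adjoin J (km (component i a))"
  then obtain f' c where f: "km f = km (f' + c * component i a)" "km f' \<in> J"
    unfolding mem_adjoin[OF id] by (elim exE conjE)
  have "component e (c * component i a) = (\<Sum>j\<le>e. component j c * (if e - j = i then component i a else 0))"
    unfolding component_mult component_component ..
  also have "\<dots> = (\<Sum>j\<le>e. if e - j = i then component j c else 0) * component i a"
    unfolding sum_distrib_right by (rule sum.cong) simp_all
  finally have "component e (f' + c * component i a) =
      component e f' + (\<Sum>j\<le>e. if e - j = i then component j c else 0) * component i a"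
    by (simp add: component_add)
  moreover have "km (component e f) = km (component e (f' + c * component i a))"
    unfolding homogeneous_part_km[symmetric] f(1) ..
  ultimately have e: "km (component e f) =
      km (component e f' + (\<Sum>j\<le>e. if e - j = i then component j c else 0) * component i a)" by simp
  show "km (component e f) \<in> adjoin J (km (component i a))"
    unfolding mem_adjoin[OF id] by (intro exI conjI, rule e, rule homogeneousD(2)[OF J f(2)])
qed

lemma adjoin_subset_iff:
  assumes J: "ideal J C" and P: "ideal P C"
  shows "adjoin J (km a) \<subseteq> P \<longleftrightarrow> J \<subseteq> P \<and> km a \<in> P"
proof (intro iffI conjI subsetI)
  interpret J: ideal J C by (rule J)
  assume s: "adjoin J (km a) \<subseteq> P"
  have 0: "km 0 \<in> J" unfolding km(2) by (rule additive_subgroup.zero_closed[OF ideal.axioms(1)[OF J]])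
  have "km (0 + 1 * a) \<in> adjoin J (km a)"
    unfolding mem_adjoin[OF J] by (rule exI, rule exI, rule conjI[OF refl 0])
  then have "km a \<in> adjoin J (km a)" by simp
  then show "km a \<in> P" by (rule subsetD[OF s])
  fix x assume x: "x \<in> J"
  have "x \<in> carrier C" by (rule subsetD[OF J.a_subset x])
  then obtain f where f: "x = km f" by (rule km_lift)
  have "km (f + 0 * a) \<in> adjoin J (km a)"
    unfolding mem_adjoin[OF J] by (rule exI, rule exI, rule conjI[OF refl]) (use x f in simp)
  then have "x \<in> adjoin J (km a)" unfolding f by simp
  then show "x \<in> P" by (rule subsetD[OF s])
next
  fix x assume JP: "J \<subseteq> P \<and> km a \<in> P" and x: "x \<in> adjoin J (km a)"
  interpret P: ideal P C by (rule P)
  obtain f c where f: "x = km (f + c * a)" "km f \<in> J" using x unfolding mem_adjoin[OF J] by (elim exE conjE)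
  show "x \<in> P" unfolding f(1) km(4) by (intro additive_subgroup.a_closed[OF ideal.axioms(1)[OF P]] ideal_mult(2)[OF P] subsetD[OF conjunct1[OF JP] f(2)] conjunct2[OF JP])
qed

subsection \<open>Ascending chains of ideals\<close>

abbreviation "z \<equiv> {r. uproj k r = \<zero>\<^bsub>k\<^esub>}"

lemma prime_z: "prime_ideal_set z" by (rule typed_hom_kernel_prime[OF uk domain_k])

definition lead_monoms :: "(nat multiset multiset \<Rightarrow> 'a) set \<Rightarrow> nat multiset multiset set" where
  "lead_monoms J = {m. \<exists>f. keys f \<subseteq> {m. set_mset m \<subseteq> E} \<and> km f \<in> J \<and> lead_monom z f m}"

lemma lead_monoms_vars: "m \<in> lead_monoms J \<Longrightarrow> set_mset m \<subseteq> E"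
proof -
  assume "m \<in> lead_monoms J"
  then obtain f where f: "keys f \<subseteq> {m. set_mset m \<subseteq> E}" "lead_monom z f m" unfolding lead_monoms_def by (elim CollectE exE conjE)
  have "lookup f m \<noteq> 0" using f(2) prime_ideal_setD(1)[OF prime_z] unfolding lead_monom_def by metis
  then have "m \<in> keys f" by (simp add: in_keys_iff)
  then show ?thesis using f(1) by blast
qed

text \<open>
  Multiplication by a monomial shifts the leading monomial.
\<close>

lemma lead_monoms_upward:
  assumes J: "ideal J C" and m: "m \<in> lead_monoms J" and a: "set_mset a \<subseteq> E"
  shows "a + m \<in> lead_monoms J"
proof -
  obtain f where f: "keys f \<subseteq> {m. set_mset m \<subseteq> E}" "km f \<in> J" "lead_monom z f m"
    using m unfolding lead_monoms_def by (elim CollectE exE conjE)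
  let ?f = "single a 1 * f"
  have "keys ?f \<subseteq> {m. set_mset m \<subseteq> E}"
  proof
    fix k' assume "k' \<in> keys ?f"
    then have k': "a \<subseteq># k'" "k' - a \<in> keys f" by (simp_all add: in_keys_iff lookup_single_mult split: if_splits)
    then have "k' = a + (k' - a)" by (simp add: subset_mset.add_diff_inverse)
    moreover have "set_mset (k' - a) \<subseteq> E" using k'(2) f(1) by blast
    ultimately have "set_mset k' \<subseteq> E" using a by (metis Un_least set_mset_union)
    then show "k' \<in> {m. set_mset m \<subseteq> E}" by simp
  qed
  moreover have "km ?f \<in> J" by (rule ideal_mult(2)[OF J f(2)])
  moreover have "lead_monom z ?f (a + m)"
    unfolding lead_monom_def
  proof (intro conjI allI impI)
    show "lookup ?f (a + m) \<notin> z" using f(3) by (simp add: lookup_single_mult lead_monom_def)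
    fix m' assume m': "m' > a + m"
    show "lookup ?f m' \<in> z"
    proof (cases "a \<subseteq># m'")
      case True
      then have "m' = a + (m' - a)" by (simp add: subset_mset.add_diff_inverse)
      then have "m' - a > m" using m' by (metis add_less_cancel_left)
      then show ?thesis using f(3) True by (simp add: lookup_single_mult lead_monom_def)
    next
      case False
      then show ?thesis using prime_ideal_setD(1)[OF prime_z] by (simp add: lookup_single_mult)
    qed
  qed
  ultimately show ?thesis unfolding lead_monoms_def by (intro CollectI exI conjI)
qed

lemma field_inverse:
  assumes "r \<notin> z"
  obtains r' where "1 - r' * r \<in> z"
proof -
  interpret k: field k by (rule field_k)
  note hu = typed_homD[OF uk]
  have un: "uproj k r \<in> Units k" using assms hu(1) by (simp add: k.field_Units)
  obtain r' where r': "inv\<^bsub>k\<^esub> uproj k r = uproj k r'"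
    using subsetD[OF uproj_surj[OF cring_k] k.Units_inv_closed[OF un]] by (elim imageE)
  have "uproj k (1 - r' * r) = \<one>\<^bsub>k\<^esub> \<ominus>\<^bsub>k\<^esub> inv\<^bsub>k\<^esub> uproj k r \<otimes>\<^bsub>k\<^esub> uproj k r"
    unfolding typed_hom_uminus[OF uk ring_k] hu(3,5) r' ..
  also have "\<dots> = \<zero>\<^bsub>k\<^esub>" unfolding k.Units_l_inv[OF un] by (rule k.r_right_minus_eq[THEN iffD2]) simp_all
  finally show thesis by (intro that[of r']) simp
qed

text \<open>
  Induction on the leading monomial of an element of the larger ideal, which can be cancelled by a
  multiple of an element of the smaller ideal, as \<open>k\<close> is a field.
\<close>

lemma ideal_eq_lead_monoms:
  assumes J: "ideal J C" "ideal J' C" and sub: "J \<subseteq> J'" and lead: "lead_monoms J' \<subseteq> lead_monoms J"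
  shows "J' \<subseteq> J"
proof
  note pz = prime_ideal_setD[OF prime_z]
  interpret J: ideal J C by (rule J(1))
  have zero: "km f \<in> J" if "f \<in> coeffs_in z" for f
  proof -
    have "km f = \<zero>\<^bsub>C\<^esub>" using that unfolding km_zero_iff coeffs_in_def by simp
    then show ?thesis using additive_subgroup.zero_closed[OF ideal.axioms(1)[OF J(1)]] by simp
  qed
  have main: "km f \<in> J" if "keys f \<subseteq> {m. set_mset m \<subseteq> E}" "km f \<in> J'" "lead_monom z f m" for f m
    using that
  proof (induction m arbitrary: f rule: less_induct)
    case (less m)
    have "m \<in> lead_monoms J'" using less.prems unfolding lead_monoms_def by (intro CollectI exI conjI)
    then have "m \<in> lead_monoms J" by (rule subsetD[OF lead])
    then obtain g where g: "keys g \<subseteq> {m. set_mset m \<subseteq> E}" "km g \<in> J" "lead_monom z g m"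
      unfolding lead_monoms_def by (elim CollectE exE conjE)
    obtain c where c: "1 - c * lookup g m \<in> z" by (rule field_inverse[OF conjunct1[OF g(3)[unfolded lead_monom_def]]])
    let ?a = "single 0 (lookup f m * c) * g"
    let ?f = "f - ?a"
    have look: "lookup ?f m' = lookup f m' - lookup f m * c * lookup g m'" for m'
      by (simp add: lookup_minus lookup_single_mult)
    have aJ: "km ?a \<in> J" by (rule ideal_mult(2)[OF J(1) g(2)])
    have fJ': "km ?f \<in> J'" by (rule ideal_diff[OF J(2) less.prems(2) subsetD[OF sub aJ]])
    have keys: "keys ?f \<subseteq> {m. set_mset m \<subseteq> E}"
    proof
      fix m' assume "m' \<in> keys ?f"
      then have "lookup f m' \<noteq> 0 \<or> lookup g m' \<noteq> 0" unfolding in_keys_iff look by fastforce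
      then have "m' \<in> keys f \<or> m' \<in> keys g" by (simp add: in_keys_iff)
      then show "m' \<in> {m. set_mset m \<subseteq> E}" using less.prems(1) g(1) by blast
    qed
    have small: "lookup ?f m' \<in> z" if "\<not> m' < m" for m'
    proof (cases "m' = m")
      case True
      have "lookup ?f m = lookup f m * (1 - c * lookup g m)" unfolding look by (simp add: algebra_simps)
      then show ?thesis unfolding True using pz(4)[OF c, of "lookup f m"] by simp
    next
      case False
      then have "m' > m" using \<open>\<not> m' < m\<close> linorder_less_linear[of m' m] by blast
      then have "lookup f m' \<in> z" "lookup g m' \<in> z" using less.prems(3) g(3) unfolding lead_monom_def by blast+
      then show ?thesis unfolding look by (intro pz(8) pz(4))
    qed
    have "km ?f \<in> J"
    proof (cases "?f \<in> coeffs_in z")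
      case False
      then obtain m' where m': "lead_monom z ?f m'" by (rule lead_monom_exists[OF prime_z])
      have "m' < m" using small[of m'] m' unfolding lead_monom_def by blast
      then show ?thesis by (rule less.IH[OF _ keys fJ' m'])
    qed (rule zero)
    then have "km (?f + ?a) \<in> J" unfolding km(4) by (rule additive_subgroup.a_closed[OF ideal.axioms(1)[OF J(1)] _ aJ])
    then show ?case by simp
  qed
  fix x assume x: "x \<in> J'"
  have "x \<in> carrier C" by (rule subsetD[OF additive_subgroup.a_subset[OF ideal.axioms(1)[OF J(2)]] x])
  from km_surj[OF this] obtain f where f: "x = km f" "keys f \<subseteq> {m. set_mset m \<subseteq> E}" by (elim exE conjE)
  show "x \<in> J"
  proof (cases "f \<in> coeffs_in z")
    case False
    then obtain m where "lead_monom z f m" by (rule lead_monom_exists[OF prime_z])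
    from main[OF f(2) _ this] x show ?thesis unfolding f(1) by simp
  qed (unfold f(1), rule zero)
qed

text \<open>
  The ring \<open>C\<close> is noetherian. The leading monomials of an ascending chain of ideals are generated by
  finitely many of them. These occur at a finite stage, from which on the chain is constant.
\<close>

lemma ascending_ideals_wf: "wf {(J', J). ideal J C \<and> ideal J' C \<and> J \<subset> J'}"
  unfolding wf_iff_no_infinite_down_chain
proof
  assume "\<exists>f. \<forall>i. (f (Suc i), f i) \<in> {(J', J). ideal J C \<and> ideal J' C \<and> J \<subset> J'}"
  then obtain J where "\<forall>i. (J (Suc i), J i) \<in> {(J', J). ideal J C \<and> ideal J' C \<and> J \<subset> J'}" by (rule exE)
  then have J: "ideal (J i) C" "J i \<subset> J (Suc i)" for i by simp_all
  have mono: "J i \<subseteq> J j" if "i \<le> j" for i j by (rule lift_Suc_mono_le[OF _ that]) (use J(2) in auto)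
  have lmono: "lead_monoms (J i) \<subseteq> lead_monoms (J j)" if "i \<le> j" for i j
    unfolding lead_monoms_def using mono[OF that] by blast
  have "\<And>m. m \<in> (\<Union>i. lead_monoms (J i)) \<Longrightarrow> set_mset m \<subseteq> E" using lead_monoms_vars by blast
  from dickson[OF finite_exponents this]
  obtain B where B: "finite B" "B \<subseteq> (\<Union>i. lead_monoms (J i))"
      "\<And>a. a \<in> (\<Union>i. lead_monoms (J i)) \<Longrightarrow> \<exists>b\<in>B. b \<subseteq># a" by metis
  have "\<exists>N. B \<subseteq> lead_monoms (J N)"
    using B(1,2)
  proof (induction B rule: finite_induct)
    case (insert b B)
    then obtain N where N: "B \<subseteq> lead_monoms (J N)" by auto
    obtain M where M: "b \<in> lead_monoms (J M)" using insert.prems by auto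
    show ?case
      using N M lmono[of N "max N M"] lmono[of M "max N M"] by (intro exI[of _ "max N M"]) auto
  qed simp
  then obtain N where N: "B \<subseteq> lead_monoms (J N)" by (rule exE)
  have "lead_monoms (J (Suc N)) \<subseteq> lead_monoms (J N)"
  proof
    fix a assume a: "a \<in> lead_monoms (J (Suc N))"
    then have "a \<in> (\<Union>i. lead_monoms (J i))" by (rule UN_I[OF UNIV_I])
    then obtain b where b: "b \<in> B" "b \<subseteq># a" using B(3) by blast
    have "set_mset (a - b) \<subseteq> E" using lead_monoms_vars[OF a] by (meson in_diffD subset_iff)
    from lead_monoms_upward[OF J(1) subsetD[OF N b(1)] this] b(2)
    show "a \<in> lead_monoms (J N)" by simp
  qed
  from ideal_eq_lead_monoms[OF J(1) J(1) mono this] have "J (Suc N) \<subseteq> J N" by simp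
  then show False using J(2)[of N] by simp
qed

subsection \<open>Noetherian induction\<close>

abbreviation "constructible \<equiv> zariski_constructible k n d"

abbreviation "V J \<equiv> {P \<in> proj_space k n d. J \<subseteq> P}"

lemma constructible_empty: "constructible {}"
  unfolding zariski_constructible_def by (rule exI[of _ "{}"]) simp

lemma constructible_diff:
  assumes "homogeneous J" "homogeneous J'"
  shows "constructible (V J - V J')"
  unfolding zariski_constructible_def zariski_closed_def
proof (intro exI[of _ "{V J - V J'}"] conjI ballI)
  fix L assume L: "L \<in> {V J - V J'}"
  show "\<exists>Z Z'. (\<exists>J. homogeneous J \<and> Z = V J) \<and> (\<exists>J. homogeneous J \<and> Z' = V J) \<and> L = Z - Z'"
    by (intro exI[of _ "V J"] exI[of _ "V J'"] conjI exI[of _ J] exI[of _ J'] assms refl singletonD[OF L])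
qed simp_all

lemma constructible_union:
  assumes "constructible T" "constructible T'"
  shows "constructible (T \<union> T')"
proof -
  obtain \<L> where L: "finite \<L>" "T = \<Union>\<L>"
      "\<forall>L\<in>\<L>. \<exists>Z Z'. zariski_closed k n d Z \<and> zariski_closed k n d Z' \<and> L = Z - Z'"
    using assms(1) unfolding zariski_constructible_def by (elim exE conjE)
  obtain \<L>' where L': "finite \<L>'" "T' = \<Union>\<L>'"
      "\<forall>L\<in>\<L>'. \<exists>Z Z'. zariski_closed k n d Z \<and> zariski_closed k n d Z' \<and> L = Z - Z'"
    using assms(2) unfolding zariski_constructible_def by (elim exE conjE)
  show ?thesis
    unfolding zariski_constructible_def
  proof (intro exI[of _ "\<L> \<union> \<L>'"] conjI)
    show "\<forall>L\<in>\<L> \<union> \<L>'. \<exists>Z Z'. zariski_closed k n d Z \<and> zariski_closed k n d Z' \<and> L = Z - Z'"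
      by (rule ball_Un[THEN iffD2, OF conjI[OF L(3) L'(3)]])
    show "finite (\<L> \<union> \<L>')" by (rule finite_UnI[OF L(1) L'(1)])
    show "T \<union> T' = \<Union>(\<L> \<union> \<L>')" unfolding Union_Un_distrib L(2) L'(2) ..
  qed
qed

lemma V_emptyI: "(\<And>P. P \<in> proj_space k n d \<Longrightarrow> J \<subseteq> P \<Longrightarrow> False) \<Longrightarrow> V J = {}"
  by blast

lemma V_improper: "V (carrier C) = {}"
proof (rule V_emptyI)
  fix P assume P: "P \<in> proj_space k n d" and s: "carrier C \<subseteq> P"
  have "carrier C = P"
    by (rule equalityI[OF s additive_subgroup.a_subset[OF ideal.axioms(1)[OF ideal_P[OF P]]]])
  then show False by (rule notE[OF primeideal.I_notcarr[OF prime_P[OF P]]])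
qed

lemma V_irrelevant: "V (irrelevant_ideal k E) = {}"
proof (rule V_emptyI)
    fix P assume P: "P \<in> proj_space k n d" and s: "irrelevant_ideal k E \<subseteq> P"
    have "ring.indexed_var k ` E \<subseteq> irrelevant_ideal k E"
      unfolding irrelevant_ideal_def coeff_ring_def[symmetric]
      by (rule ring.genideal_self[OF cring.axioms(1)[OF cring_C] vars_carrier])
    then have "ring.indexed_var k ` E \<subseteq> P" using s by (rule subset_trans)
    then have "P = irrelevant_ideal k E"
      by (rule irrelevant_unique[OF ideal_P[OF P] primeideal.I_notcarr[OF prime_P[OF P], symmetric]])
    then show False by (rule notE[OF proj_spaceD(3)[OF P]])
qed

lemma V_adjoin:
  assumes J: "ideal J C"
  shows "V (adjoin J (km a)) = {P \<in> V J. km a \<in> P}"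
proof (rule equalityI; rule subsetI)
  fix P assume "P \<in> V (adjoin J (km a))"
  then have P: "P \<in> proj_space k n d" and s: "adjoin J (km a) \<subseteq> P" by simp_all
  show "P \<in> {P \<in> V J. km a \<in> P}" using s P unfolding adjoin_subset_iff[OF J ideal_P[OF P]] by simp
next
  fix P assume "P \<in> {P \<in> V J. km a \<in> P}"
  then have P: "P \<in> proj_space k n d" and s: "J \<subseteq> P \<and> km a \<in> P" by simp_all
  show "P \<in> V (adjoin J (km a))"
    using s P unfolding mem_Collect_eq adjoin_subset_iff[OF J ideal_P[OF P]] by simp
qed

lemma adjoin_strict:
  assumes J: "ideal J C" and a: "km a \<notin> J"
  shows "J \<subset> adjoin J (km a)"
proof -
  have "J \<subseteq> adjoin J (km a) \<and> km a \<in> adjoin J (km a)"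
    using adjoin_subset_iff[OF J adjoin_ideal[OF J], of a a] by simp
  then show ?thesis using a by (elim conjE) (rule psubsetI, assumption, rule notI, simp)
qed

text \<open>
  If \<open>V J\<close> is neither empty nor reducible, then \<open>J\<close> is itself its generic point. By generic constancy
  the stratum contains or misses the part of \<open>V J\<close> where some \<open>h \<notin> J\<close> does not vanish, and a
  homogeneous component of \<open>h\<close> outside \<open>J\<close> takes the place of \<open>h\<close>.
\<close>

lemma stratum_closed_inter:
  assumes "homogeneous J"
  shows "constructible (S b \<inter> V J)"
  using assms
proof (induction J rule: wf_induct_rule[OF ascending_ideals_wf])
  case (1 J)
  note J = "1.prems"
  note id = homogeneousD(1)[OF J]
  have IH: "constructible (S b \<inter> V (adjoin J (km (component i a))))" if "km (component i a) \<notin> J" for i a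
  proof (rule "1.IH")
    show "(adjoin J (km (component i a)), J) \<in> {(J', J). ideal J C \<and> ideal J' C \<and> J \<subset> J'}"
      using id adjoin_ideal[OF id] adjoin_strict[OF id that] by simp
    show "homogeneous (adjoin J (km (component i a)))" by (rule adjoin_homogeneous[OF J])
  qed
  \<comment> \<open>Only the last two cases have points, and a homogeneous ideal that is not a point fails to be prime on homogeneous elements.\<close>
  consider (improper) "J = carrier C" | (irrelevant) "J = irrelevant_ideal k E"
    | (reducible) f g i j where "km (component i f * component j g) \<in> J" "km (component i f) \<notin> J" "km (component j g) \<notin> J"
    | (point) "J \<in> proj_space k n d"
  proof -
    have "J \<in> proj_space k n d" if "J \<noteq> carrier C" "J \<noteq> irrelevant_ideal k E"
      "\<And>f g i j. km (component i f * component j g) \<in> J \<Longrightarrow> km (component i f) \<in> J \<or> km (component j g) \<in> J"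
      unfolding proj_space_def
      by (rule CollectI, intro conjI, rule homogeneous_primeideal[OF J that(1)], erule that(3), rule J, rule that(2))
    then show thesis using that by metis
  qed
  then show ?case
  proof cases
    case improper
    show ?thesis unfolding improper V_improper using constructible_empty by simp
  next
    case irrelevant
    show ?thesis unfolding irrelevant V_irrelevant using constructible_empty by simp
  next
    case reducible
    have "P \<in> V J \<longleftrightarrow> P \<in> V (adjoin J (km (component i f))) \<union> V (adjoin J (km (component j g)))" for P
    proof (cases "P \<in> V J")
      case True
      then have P: "P \<in> proj_space k n d" and JP: "J \<subseteq> P" by simp_all
      have "km (component i f) \<otimes>\<^bsub>C\<^esub> km (component j g) \<in> P"
        unfolding km(5)[symmetric] by (rule subsetD[OF JP reducible(1)])
      from primeideal.I_prime[OF prime_P[OF P] km(1) km(1) this] True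
      show ?thesis unfolding V_adjoin[OF id] by simp
    next
      case False
      then show ?thesis unfolding V_adjoin[OF id] Un_iff mem_Collect_eq by blast
    qed
    then have V: "V J = V (adjoin J (km (component i f))) \<union> V (adjoin J (km (component j g)))" by (rule Set.set_eqI)
    show ?thesis unfolding V Int_Un_distrib by (rule constructible_union[OF IH[OF reducible(2)] IH[OF reducible(3)]])
  next
    case point
    show ?thesis
    proof (cases "lead_coeff b = 1")
      case False
      then have "S b = {}" using stratum_monic[of _ b] by (intro equals0I) simp
      then show ?thesis using constructible_empty by simp
    next
      case True
      obtain h where h: "h \<in> carrier C" "h \<notin> J"
          "\<forall>Q\<in>proj_space k n d. J \<subseteq> Q \<longrightarrow> h \<notin> Q \<longrightarrow> (Q \<in> S b \<longleftrightarrow> J \<in> S b)"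
        using stratum_generically_constant[OF point True] by (elim bexE conjE)
      obtain f where f: "h = km f" using h(1) by (rule km_lift)
      obtain e where e: "km (component e f) \<notin> J"
        using component_notin[OF id h(2)[unfolded f]] by (elim exE conjE)
      let ?J' = "adjoin J (km (component e f))"
      have generic: "Q \<in> S b \<longleftrightarrow> J \<in> S b" if Q: "Q \<in> V J - V ?J'" for Q
      proof -
        have Q': "Q \<in> proj_space k n d" "J \<subseteq> Q" "km (component e f) \<notin> Q"
          using Q unfolding V_adjoin[OF id] by simp_all
        have "h \<notin> Q" using Q'(3) homogeneousD(2)[OF proj_spaceD(2)[OF Q'(1)], of f e] unfolding f by (rule contrapos_nn)
        then show ?thesis by (rule h(3)[rule_format, OF Q'(1,2)])
      qed
      have sub: "V ?J' \<subseteq> V J" unfolding V_adjoin[OF id] by (rule Collect_restrict)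
      show ?thesis
      proof (cases "J \<in> S b")
        case True
        have "S b \<inter> V J = (S b \<inter> V ?J') \<union> (V J - V ?J')"
        proof (rule Set.set_eqI)
          fix Q
          show "Q \<in> S b \<inter> V J \<longleftrightarrow> Q \<in> (S b \<inter> V ?J') \<union> (V J - V ?J')"
            using generic[of Q] True subsetD[OF sub, of Q] unfolding Int_iff Un_iff Diff_iff by argo
        qed
        then show ?thesis
          using constructible_union[OF IH[OF e] constructible_diff[OF J adjoin_homogeneous[OF J]]] by simp
      next
        case False
        have "S b \<inter> V J = S b \<inter> V ?J'"
        proof (rule Set.set_eqI)
          fix Q
          show "Q \<in> S b \<inter> V J \<longleftrightarrow> Q \<in> S b \<inter> V ?J'"
            using generic[of Q] False subsetD[OF sub, of Q] unfolding Int_iff Un_iff Diff_iff by argo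
        qed
        then show ?thesis using IH[OF e] by simp
      qed
    qed
  qed
qed

theorem stratum_constructible: "constructible (S b)"
proof -
  interpret C: cring C by (rule cring_C)
  have "homogeneous {\<zero>\<^bsub>C\<^esub>}"
  proof (rule homogeneousI[OF C.zeroideal])
    fix f e assume "km f \<in> {\<zero>\<^bsub>C\<^esub>}"
    then have "km f = \<zero>\<^bsub>C\<^esub>" by (rule singletonD)
    then have "km (component e f) = \<zero>\<^bsub>C\<^esub>"
      unfolding km_zero_iff using typed_homD(2)[OF uk] by (simp add: component.rep_eq)
    then show "km (component e f) \<in> {\<zero>\<^bsub>C\<^esub>}" by simp
  qed
  from stratum_closed_inter[OF this, of b] have "constructible (S b \<inter> V {\<zero>\<^bsub>C\<^esub>})" .
  moreover have "S b \<subseteq> V {\<zero>\<^bsub>C\<^esub>}"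
  proof
    fix P assume "P \<in> S b"
    then have P: "P \<in> proj_space k n d" by (simp add: bernstein_sato_stratum_def)
    have "\<zero>\<^bsub>C\<^esub> \<in> P" by (rule additive_subgroup.zero_closed[OF ideal.axioms(1)[OF ideal_P[OF P]]])
    then show "P \<in> V {\<zero>\<^bsub>C\<^esub>}" using P by simp
  qed
  ultimately show ?thesis by (simp add: Int_absorb2)
qed

end

theorem theorem6p4:
  fixes k :: "('a, 'm) ring_scheme" and n d :: nat and b :: "rat poly"
  assumes "n > 0" and "d > 0"
    and "field k" and "char_zero k"
    and "b \<in> bernstein_sato_set TYPE('c) n d"
  shows "zariski_constructible k n d (bernstein_sato_stratum k n d b)"
  by (rule projective_setting.stratum_constructible[OF projective_setting.intro[OF assms(3,4)]])

end
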